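(* Let a locally compact group $G$ act properly on the right of a locally compact Hausdorff space $X$, and let $\gamma$ be the action of $G$ on $C_0(X)$ given by $\gamma_t(f)(x)=f(x\cdot t)$. For any object $(A,\alpha,\phi)$ in the comma category $(C_0(X),\gamma)\downarrow\mathcal A(G)$, the action $\alpha$ is proper, in the sense of Rieffel, with respect to $A_0=C_c(X)AC_c(X)$; the generalized fixed-point algebra $A^\alpha$ is $\mathrm{Fix}(A,\alpha,\phi)$, and the right inner product on $A_0$ is given by $$\langle a,b\rangle_R=E(a^*b)\qquad(a,b\in A_0).$$
   Context: A morphism from $A$ to $B$ in the category $\mathcal C$ of $C^*$-algebras is a nondegenerate homomorphism $\phi:A\to M(B)$ ($\phi(A)B$ dense in $B$), extended to a unital homomorphism $M(A)\to M(B)$. Category $\mathcal A(G)$: objects are pairs $(A,\alpha)$ with $\alpha$ a continuous action of $G$ on the $C^*$-algebra $A$; morphisms are $\mathcal C$-morphisms intertwining the actions. An object $(A,\alpha,\phi)$ of the comma category $(C_0(X),\gamma)\downarrow\mathcal A(G)$ is an object $(A,\alpha)$ of $\mathcal A(G)$ with a morphism $\phi:(C_0(X),\gamma)\to(A,\alpha)$ in $\mathcal A(G)$. Averaging: $\mathfrak p$ is the set of $a\in M(A)^+$ for which there is $E(a)\in M(A)^+$ with $\omega(E(a))=\int_G\omega(\alpha_s(a))\,ds$ for every positive functional $\omega$ on $A$ ($ds$ left Haar measure). Put $\mathfrak n=\{a\in M(A):a^*a\in\mathfrak p\}$ and $\mathfrak m=\operatorname{span}\mathfrak n^*\mathfrak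 n$; it is known that $\mathfrak m$ is a $*$-subalgebra, $\mathfrak m=\operatorname{span}\mathfrak p$, and $E$ extends to a positive linear map $E:\mathfrak m\to M(A)$ with $\omega(E(a))=\int_G\omega(\alpha_s(a))\,ds$ for all $\omega\in A^*$. Writing $fag$ for $\phi(f)a\phi(g)$, $A_0=C_c(X)AC_c(X)=\operatorname{span}\{fag:f,g\in C_c(X),a\in A\}$. It is known that $A_0\subset\mathfrak m$. $\mathrm{Fix}(A,\alpha,\phi)$ is the norm closure of $E(A_0)$ in $M(A)$ (a $C^*$-subalgebra of $M(A)$). Rieffel properness: $\alpha$ is proper with respect to a dense $\alpha$-invariant $*$-subalgebra $A_0$ of $A$ if (1) for all $a,b\in A_0$ the functions $s\mapsto a\alpha_s(b^* )$ and $s\mapsto a\alpha_s(b^* )\Delta(s)^{-1/2}$ are in $L^1(G,A)$ ($\Delta$ the modular function), and (2) for all $a,b\in A_0$ there is an element $\langle a,b\rangle_R$ of $M(A)$, which is $\alpha$-invariant and multiplies $A_0$ into itself, such that $c\langle a,b\rangle_R=\int_G c\,\alpha_s(a^*b)\,ds$ for all $c\in A_0$. The generalized fixed-point algebra is $A^\alpha=\overline{\operatorname{span}}\{\langle a,b\rangle_R:a,b\in A_0\}\subset M(A)$. *)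

theory Defs
  imports "HOL-Analysis.Analysis" "HOL-Library.Nonpos_Ints"
begin

section \<open>C*-algebras\<close>

text \<open>Not necessarily unital, not necessarily separable, possibly zero.\<close>

class cstar_algebra = real_normed_algebra + banach +
  fixes scaleC :: "complex \<Rightarrow> 'a \<Rightarrow> 'a"  (infixr \<open>*\<^sub>C\<close> 75)
    and star :: "'a \<Rightarrow> 'a"
  assumes scaleC_add_right: "c *\<^sub>C (a + b) = c *\<^sub>C a + c *\<^sub>C b"
    and scaleC_add_left: "(c + d) *\<^sub>C a = c *\<^sub>C a + d *\<^sub>C a"
    and scaleC_scaleC: "c *\<^sub>C d *\<^sub>C a = (c * d) *\<^sub>C a"
    and scaleR_scaleC: "r *\<^sub>R a = complex_of_real r *\<^sub>C a"
    and mult_scaleC_left: "(c *\<^sub>C a) * b = c *\<^sub>C (a * b)"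
    and mult_scaleC_right: "a * (c *\<^sub>C b) = c *\<^sub>C (a * b)"
    and norm_scaleC: "norm (c *\<^sub>C a) = cmod c * norm a"
    and star_star: "star (star a) = a"
    and star_add: "star (a + b) = star a + star b"
    and star_scaleC: "star (c *\<^sub>C a) = cnj c *\<^sub>C star a"
    and star_mult: "star (a * b) = star b * star a"
    and cstar_identity: "norm (star a * a) = (norm a)\<^sup>2"

lemma scaleC_one: "1 *\<^sub>C (a::'a::cstar_algebra) = a"
  using scaleR_scaleC[of 1 a] by simp

lemma star_scaleR: "star (r *\<^sub>R (a::'a::cstar_algebra)) = r *\<^sub>R star a"
  by (simp add: scaleR_scaleC star_scaleC)

lemma star_zero: "star (0::'a::cstar_algebra) = 0"
  using star_scaleR[of 0 "0::'a"] by simp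

lemma star_minus: "star (- (a::'a::cstar_algebra)) = - star a"
  using star_scaleR[of "-1" a] by simp

lemma star_diff: "star (a - (b::'a::cstar_algebra)) = star a - star b"
  using star_add[of a "- b"] by (simp add: star_minus)

lemma norm_le_norm_star: "norm a \<le> norm (star (a::'a::cstar_algebra))"
proof (cases "norm a = 0")
  case False
  have "norm a * norm a \<le> norm (star a) * norm a"
    using norm_mult_ineq[of "star a" a] by (simp add: cstar_identity power2_eq_square)
  then show ?thesis
    using False by (metis mult_right_le_imp_le norm_ge_zero order_le_less)
qed simp

lemma norm_star: "norm (star a) = norm (a::'a::cstar_algebra)"
  using norm_le_norm_star[of a] norm_le_norm_star[of "star a"] by (simp add: star_star)

lemma bounded_linear_scaleC: "bounded_linear (\<lambda>a. c *\<^sub>C (a :: 'a::cstar_algebra))"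
  by (rule bounded_linear_intro[where K = "cmod c"])
     (simp_all add: scaleC_add_right scaleR_scaleC scaleC_scaleC norm_scaleC mult.commute)

lemma bounded_linear_star: "bounded_linear (star :: 'a::cstar_algebra \<Rightarrow> 'a)"
  by (rule bounded_linear_intro[where K = 1]) (simp_all add: star_add star_scaleR norm_star)

interpretation complex_vs: vector_space "scaleC :: complex \<Rightarrow> 'a \<Rightarrow> 'a::cstar_algebra"
  by standard (simp_all add: scaleC_add_right scaleC_add_left scaleC_scaleC scaleC_one)

abbreviation cspan :: "'a::cstar_algebra set \<Rightarrow> 'a set" where
  "cspan \<equiv> module.span scaleC"

definition positive :: "'a::cstar_algebra \<Rightarrow> bool" where
  "positive a \<longleftrightarrow> (\<exists>x. a = star x * x)"

definition star_hom :: "('a::cstar_algebra \<Rightarrow> 'b::cstar_algebra) \<Rightarrow> bool" where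
  "star_hom \<phi> \<longleftrightarrow> Vector_Spaces.linear scaleC scaleC \<phi> \<and>
     (\<forall>a b. \<phi> (a * b) = \<phi> a * \<phi> b) \<and> (\<forall>a. \<phi> (star a) = star (\<phi> a))"

definition star_subalgebra :: "'a::cstar_algebra set \<Rightarrow> bool" where
  "star_subalgebra S \<longleftrightarrow> module.subspace scaleC S \<and>
     (\<forall>a\<in>S. \<forall>b\<in>S. a * b \<in> S) \<and> (\<forall>a\<in>S. star a \<in> S)"

definition dual :: "('a::cstar_algebra \<Rightarrow> complex) set" where
  "dual = {\<omega>. Vector_Spaces.linear scaleC (*) \<omega> \<and> bounded_linear \<omega>}"

definition positive_functional :: "('a::cstar_algebra \<Rightarrow> complex) \<Rightarrow> bool" where
  "positive_functional \<omega> \<longleftrightarrow> \<omega> \<in> dual \<and> (\<forall>a. \<omega> (star a * a) \<in> \<real>\<^sub>\<ge>\<^sub>0)"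

section \<open>The multiplier algebra\<close>

text \<open>\<open>M(A)\<close> is realised as the algebra of double centralizers: pairs \<open>(L, R)\<close> of bounded linear
  maps with \<open>L (a b) = L a b\<close>, \<open>R (a b) = a R b\<close> and \<open>a L b = R a b\<close>, so that \<open>L a\<close> is the product
  \<open>m a\<close> and \<open>R a\<close> is the product \<open>a m\<close>.\<close>

typedef (overloaded) 'a multiplier =
  "{(L :: 'a::cstar_algebra \<Rightarrow>\<^sub>L 'a, R :: 'a \<Rightarrow>\<^sub>L 'a).
     (\<forall>c a. L (c *\<^sub>C a) = c *\<^sub>C L a) \<and> (\<forall>c a. R (c *\<^sub>C a) = c *\<^sub>C R a) \<and>
     (\<forall>a b. L (a * b) = L a * b) \<and> (\<forall>a b. R (a * b) = a * R b) \<and>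
     (\<forall>a b. a * L b = R a * b)}"
  by (rule exI[where x = "(0, 0)"]) (simp add: complex_vs.scale_zero_right)

setup_lifting type_definition_multiplier

lift_definition lmult :: "'a::cstar_algebra multiplier \<Rightarrow> 'a \<Rightarrow> 'a"  (infixl \<open>\<rhd>\<close> 72)
  is "\<lambda>(L, R). blinfun_apply L" .

lift_definition rmult :: "'a::cstar_algebra \<Rightarrow> 'a multiplier \<Rightarrow> 'a"  (infixl \<open>\<lhd>\<close> 72)
  is "\<lambda>a (L, R). blinfun_apply R a" .

lemma bounded_linear_lmult: "bounded_linear ((\<rhd>) m)"
  by transfer (auto simp: blinfun.bounded_linear_right)

lemma bounded_linear_rmult: "bounded_linear (\<lambda>a. a \<lhd> m)"
  by transfer (auto simp: blinfun.bounded_linear_right)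

lemma lmult_scaleC: "m \<rhd> (c *\<^sub>C a) = c *\<^sub>C (m \<rhd> a)"
  by transfer auto

lemma rmult_scaleC: "(c *\<^sub>C a) \<lhd> m = c *\<^sub>C (a \<lhd> m)"
  by transfer auto

lemma lmult_mult: "m \<rhd> (a * b) = (m \<rhd> a) * b"
  by transfer auto

lemma rmult_mult: "(a * b) \<lhd> m = a * (b \<lhd> m)"
  by transfer auto

lemma mult_lmult: "a * (m \<rhd> b) = (a \<lhd> m) * b"
  by transfer auto

lemma cstar_right_cancel:
  fixes x y :: "'a::cstar_algebra"
  assumes "\<And>b. x * b = y * b"
  shows "x = y"
proof -
  have "star (star (x - y)) * star (x - y) = 0"
    using assms[of "star (x - y)"] by (simp add: star_star left_diff_distrib)
  then have "norm (star (x - y)) = 0"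
    using cstar_identity[of "star (x - y)"] by simp
  then show ?thesis
    by (simp add: norm_star)
qed

lemma multiplier_eqI_both:
  assumes "\<And>a. m \<rhd> a = n \<rhd> a" "\<And>a. a \<lhd> m = a \<lhd> n"
  shows "m = n"
  using assms by transfer (auto intro!: blinfun_eqI)

lemma multiplier_eqI:
  assumes "\<And>a. m \<rhd> a = n \<rhd> a"
  shows "m = n"
proof (rule multiplier_eqI_both[OF assms])
  fix a
  show "a \<lhd> m = a \<lhd> n"
    by (rule cstar_right_cancel) (simp add: mult_lmult[symmetric] assms)
qed

text \<open>\<open>mk_multiplier L R\<close> is meaningful only if \<open>(L, R)\<close> is a double centralizer.\<close>

definition mk_multiplier :: "('a::cstar_algebra \<Rightarrow> 'a) \<Rightarrow> ('a \<Rightarrow> 'a) \<Rightarrow> 'a multiplier" where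
  "mk_multiplier L R = Abs_multiplier (Blinfun L, Blinfun R)"

lemma
  assumes "bounded_linear L" "bounded_linear R"
    and "\<And>c a. L (c *\<^sub>C a) = c *\<^sub>C L a" "\<And>c a. R (c *\<^sub>C a) = c *\<^sub>C R a"
    and "\<And>a b. L (a * b) = L a * b" "\<And>a b. R (a * b) = a * R b" "\<And>a b. a * L b = R a * b"
  shows lmult_mk_multiplier: "mk_multiplier L R \<rhd> a = L a"
    and rmult_mk_multiplier: "a \<lhd> mk_multiplier L R = R a"
  using assms
  by (simp_all add: mk_multiplier_def lmult_def rmult_def Abs_multiplier_inverse
      bounded_linear_Blinfun_apply)

lemmas lmult_linear_simps =
  linear_add[OF bounded_linear.linear[OF bounded_linear_lmult]] linear_diff[OF bounded_linear.linear[OF bounded_linear_lmult]]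
  linear_neg[OF bounded_linear.linear[OF bounded_linear_lmult]] linear_scale[OF bounded_linear.linear[OF bounded_linear_lmult]]
  linear_0[OF bounded_linear.linear[OF bounded_linear_lmult]] lmult_scaleC

lemmas rmult_linear_simps =
  linear_add[OF bounded_linear.linear[OF bounded_linear_rmult]] linear_diff[OF bounded_linear.linear[OF bounded_linear_rmult]]
  linear_neg[OF bounded_linear.linear[OF bounded_linear_rmult]] linear_scale[OF bounded_linear.linear[OF bounded_linear_rmult]]
  linear_0[OF bounded_linear.linear[OF bounded_linear_rmult]] rmult_scaleC

lemmas multiplier_bounded =
  bounded_linear_lmult bounded_linear_rmult
  bounded_linear_add bounded_linear_sub bounded_linear_minus bounded_linear_scaleR_right
  bounded_linear_const_mult bounded_linear_mult_const bounded_linear_zero bounded_linear_ident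
  bounded_linear_compose[OF bounded_linear_lmult bounded_linear_lmult]
  bounded_linear_compose[OF bounded_linear_rmult bounded_linear_rmult]
  bounded_linear_compose[OF bounded_linear_scaleC bounded_linear_lmult]
  bounded_linear_compose[OF bounded_linear_scaleC bounded_linear_rmult]
  bounded_linear_compose[OF bounded_linear_star
    bounded_linear_compose[OF bounded_linear_lmult bounded_linear_star]]
  bounded_linear_compose[OF bounded_linear_star
    bounded_linear_compose[OF bounded_linear_rmult bounded_linear_star]]
  bounded_linear_compose[OF bounded_linear_scaleR_right bounded_linear_lmult]
  bounded_linear_compose[OF bounded_linear_scaleR_right bounded_linear_rmult]

lemmas multiplier_alg =
  lmult_linear_simps rmult_linear_simps lmult_mult rmult_mult mult_lmult
  scaleC_add_right complex_vs.scale_right_diff_distrib complex_vs.scale_minus_right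
  complex_vs.scale_zero_right mult_scaleC_left mult_scaleC_right
  complex_vs.scale_left_commute scaleR_scaleC

instantiation multiplier :: (cstar_algebra) real_normed_algebra
begin

definition "0 = mk_multiplier (\<lambda>a::'a. 0) (\<lambda>a. 0)"
definition "m + n = mk_multiplier (\<lambda>a::'a. m \<rhd> a + n \<rhd> a) (\<lambda>a. a \<lhd> m + a \<lhd> n)"
definition "m - n = mk_multiplier (\<lambda>a::'a. m \<rhd> a - n \<rhd> a) (\<lambda>a. a \<lhd> m - a \<lhd> n)"
definition "- m = mk_multiplier (\<lambda>a::'a. - (m \<rhd> a)) (\<lambda>a. - (a \<lhd> m))"
definition "r *\<^sub>R m = mk_multiplier (\<lambda>a::'a. r *\<^sub>R (m \<rhd> a)) (\<lambda>a. r *\<^sub>R (a \<lhd> m))"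
definition "m * n = mk_multiplier (\<lambda>a::'a. m \<rhd> (n \<rhd> a)) (\<lambda>a. (a \<lhd> m) \<lhd> n)"
definition "norm m = onorm (\<lambda>a::'a. m \<rhd> a)"
definition "sgn m = scaleR (inverse (norm m)) (m :: 'a multiplier)"
definition "dist m n = norm (m - n :: 'a multiplier)"
definition [code del]:
  "(uniformity :: ('a multiplier \<times> 'a multiplier) filter) =
     (INF e\<in>{0<..}. principal {(x, y). dist x y < e})"
definition [code del]:
  "open (U :: 'a multiplier set) \<longleftrightarrow>
     (\<forall>x\<in>U. \<forall>\<^sub>F (x', y) in uniformity. x' = x \<longrightarrow> y \<in> U)"

lemma act_zero [simp]: "(0 :: 'a multiplier) \<rhd> a = 0" "a \<lhd> (0 :: 'a multiplier) = 0"
  by (simp_all add: zero_multiplier_def lmult_mk_multiplier rmult_mk_multiplier multiplier_bounded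
      multiplier_alg)

lemma act_add [simp]: "(m + n) \<rhd> a = m \<rhd> a + n \<rhd> (a::'a)" "a \<lhd> (m + n) = a \<lhd> m + a \<lhd> n"
  by (simp_all add: plus_multiplier_def lmult_mk_multiplier rmult_mk_multiplier multiplier_bounded
      multiplier_alg algebra_simps)

lemma act_diff [simp]: "(m - n) \<rhd> a = m \<rhd> a - n \<rhd> (a::'a)" "a \<lhd> (m - n) = a \<lhd> m - a \<lhd> n"
  by (simp_all add: minus_multiplier_def lmult_mk_multiplier rmult_mk_multiplier multiplier_bounded
      multiplier_alg algebra_simps)

lemma act_minus [simp]: "(- m) \<rhd> a = - (m \<rhd> (a::'a))" "a \<lhd> (- m) = - (a \<lhd> m)"
  by (simp_all add: uminus_multiplier_def lmult_mk_multiplier rmult_mk_multiplier multiplier_bounded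
      multiplier_alg)

lemma act_scaleR [simp]: "(r *\<^sub>R m) \<rhd> a = r *\<^sub>R (m \<rhd> (a::'a))" "a \<lhd> (r *\<^sub>R m) = r *\<^sub>R (a \<lhd> m)"
  using multiplier_bounded
  by (simp_all add: scaleR_multiplier_def lmult_mk_multiplier rmult_mk_multiplier multiplier_bounded
      multiplier_alg)

lemma act_times [simp]: "(m * n) \<rhd> a = m \<rhd> (n \<rhd> (a::'a))" "a \<lhd> (m * n) = (a \<lhd> m) \<lhd> n"
  by (simp_all add: times_multiplier_def lmult_mk_multiplier rmult_mk_multiplier multiplier_bounded
      multiplier_alg)

lemma norm_lmult: "norm (m \<rhd> a) \<le> norm m * norm (a::'a)"
  unfolding norm_multiplier_def by (rule onorm[OF bounded_linear_lmult])

lemma norm_multiplier_bound: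
  "0 \<le> K \<Longrightarrow> (\<And>a. norm (m \<rhd> a) \<le> K * norm a) \<Longrightarrow> norm (m :: 'a multiplier) \<le> K"
  unfolding norm_multiplier_def by (rule onorm_bound)

lemma norm_multiplier_ge_0: "0 \<le> norm (m :: 'a multiplier)"
  unfolding norm_multiplier_def by (rule onorm_pos_le[OF bounded_linear_lmult])

lemma norm_multiplier_mult: "norm (m * n) \<le> norm m * norm (n :: 'a multiplier)"
proof (rule norm_multiplier_bound)
  fix a
  have "norm (m \<rhd> (n \<rhd> a)) \<le> norm m * (norm n * norm a)"
    by (meson norm_lmult mult_left_mono norm_multiplier_ge_0 order_trans)
  then show "norm ((m * n) \<rhd> a) \<le> norm m * norm n * norm a"
    by (simp add: mult.assoc)
qed (simp add: norm_multiplier_ge_0)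

instance
proof
  fix m n p :: "'a multiplier" and r s :: real
  show "norm (m + n) \<le> norm m + norm n"
  proof (rule norm_multiplier_bound)
    show "norm ((m + n) \<rhd> a) \<le> (norm m + norm n) * norm a" for a
      using norm_triangle_ineq[of "m \<rhd> a" "n \<rhd> a"] norm_lmult[of m a] norm_lmult[of n a]
      by (simp add: distrib_right)
  qed (simp add: norm_multiplier_ge_0)
  show "norm (r *\<^sub>R m) = \<bar>r\<bar> * norm m"
    using onorm_scaleR[OF bounded_linear_lmult[of m], of r] by (simp add: norm_multiplier_def)
  show "norm m = 0 \<longleftrightarrow> m = 0"
  proof
    assume "norm m = 0"
    then show "m = 0"
      using norm_lmult[of m] by (intro multiplier_eqI) simp
  next
    assume "m = 0"
    then show "norm m = 0"
      using norm_multiplier_bound[of 0 m] norm_multiplier_ge_0[of m] by simp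
  qed
  show "norm (m * n) \<le> norm m * norm n"
    by (rule norm_multiplier_mult)
  show "sgn m = inverse (norm m) *\<^sub>R m"
    by (rule sgn_multiplier_def)
  show "dist m n = norm (m - n)"
    by (rule dist_multiplier_def)
qed (rule multiplier_eqI uniformity_multiplier_def open_multiplier_def;
     simp add: algebra_simps multiplier_alg)+

end

instantiation multiplier :: (cstar_algebra) cstar_algebra
begin

definition "c *\<^sub>C m = mk_multiplier (\<lambda>a::'a. c *\<^sub>C (m \<rhd> a)) (\<lambda>a. c *\<^sub>C (a \<lhd> m))"
definition "star m = mk_multiplier (\<lambda>a::'a. star (star a \<lhd> m)) (\<lambda>a. star (m \<rhd> star a))"

lemma act_scaleC [simp]: "(c *\<^sub>C m) \<rhd> a = c *\<^sub>C (m \<rhd> (a::'a))" "a \<lhd> (c *\<^sub>C m) = c *\<^sub>C (a \<lhd> m)"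
  by (simp_all add: scaleC_multiplier_def lmult_mk_multiplier rmult_mk_multiplier multiplier_bounded
      multiplier_alg)

lemma act_star [simp]: "star m \<rhd> a = star (star a \<lhd> m)" "a \<lhd> star m = star (m \<rhd> star (a::'a))"
proof -
  have *: "a * star (star b \<lhd> m) = star (m \<rhd> star a) * b" for a b
    using arg_cong[OF mult_lmult[of "star b" m "star a"], of star] by (simp add: star_mult star_star)
  show "star m \<rhd> a = star (star a \<lhd> m)" "a \<lhd> star m = star (m \<rhd> star a)"
    by (simp_all add: star_multiplier_def lmult_mk_multiplier rmult_mk_multiplier multiplier_bounded
        star_mult star_scaleC star_star lmult_mult rmult_mult lmult_scaleC rmult_scaleC *)
qed

lemma norm_sq_le_multiplier: "(norm m)\<^sup>2 \<le> norm (star m * (m :: 'a multiplier))"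
proof -
  have "norm (m \<rhd> a) \<le> sqrt (norm (star m * m)) * norm a" for a
  proof -
    have "(norm (m \<rhd> a))\<^sup>2 = norm (star (m \<rhd> a) * (m \<rhd> a))"
      by (simp add: cstar_identity)
    also have "\<dots> = norm (star ((star m * m) \<rhd> a) * a)"
      by (simp add: mult_lmult star_star)
    also have "\<dots> \<le> norm ((star m * m) \<rhd> a) * norm a"
      using norm_mult_ineq[of "star ((star m * m) \<rhd> a)" a] by (simp only: norm_star)
    also have "\<dots> \<le> norm (star m * m) * norm a * norm a"
      by (intro mult_right_mono norm_lmult) simp
    also have "\<dots> = (sqrt (norm (star m * m)) * norm a)\<^sup>2"
      by (simp add: power2_eq_square norm_multiplier_ge_0 mult_ac real_sqrt_mult_self)
    finally show ?thesis
      by (rule power2_le_imp_le) (simp add: norm_multiplier_ge_0)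
  qed
  then have "norm m \<le> sqrt (norm (star m * m))"
    by (intro norm_multiplier_bound) (simp_all add: norm_multiplier_ge_0)
  then have "(norm m)\<^sup>2 \<le> (sqrt (norm (star m * m)))\<^sup>2"
    by (intro power_mono) (simp_all add: norm_multiplier_ge_0)
  then show ?thesis
    by (simp add: norm_multiplier_ge_0)
qed

lemma norm_le_star_multiplier: "norm m \<le> norm (star (m :: 'a multiplier))"
proof (cases "norm m = 0")
  case False
  have "norm m * norm m \<le> norm (star m) * norm m"
    using norm_sq_le_multiplier[of m] norm_multiplier_mult[of "star m" m]
    by (simp add: power2_eq_square)
  then show ?thesis
    using False norm_multiplier_ge_0[of m] by simp
qed (simp add: norm_multiplier_ge_0)

lemma star_star_multiplier: "star (star m) = (m :: 'a multiplier)"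
  by (rule multiplier_eqI) (simp add: star_star)

lemma norm_star_multiplier: "norm (star m) = norm (m :: 'a multiplier)"
  using norm_le_star_multiplier[of m] norm_le_star_multiplier[of "star m"]
  by (simp add: star_star_multiplier)

lemma norm_rmult: "norm (a \<lhd> m) \<le> norm m * norm (a::'a)"
proof -
  have "norm (star m \<rhd> star a) \<le> norm (star m) * norm (star a)"
    by (rule norm_lmult)
  then show ?thesis
    by (simp only: norm_star_multiplier norm_star act_star star_star)
qed

lemma multiplier_complete:
  fixes X :: "nat \<Rightarrow> 'a multiplier"
  assumes X: "\<And>e. 0 < e \<Longrightarrow> \<exists>N. \<forall>i\<ge>N. \<forall>j\<ge>N. norm (X i - X j) < e"
  shows "\<exists>m. \<forall>e>0. \<exists>N. \<forall>i\<ge>N. norm (X i - m) < e"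
proof -
  have b: "norm ((X i \<rhd> a) - (X j \<rhd> a)) \<le> norm (X i - X j) * norm a"
    "norm ((a \<lhd> X i) - (a \<lhd> X j)) \<le> norm (X i - X j) * norm a" for i j a
    using norm_lmult[of "X i - X j" a] norm_rmult[of a "X i - X j"] by simp_all
  define L where "L i = Blinfun ((\<rhd>) (X i))" for i
  define R where "R i = Blinfun (\<lambda>a. a \<lhd> X i)" for i
  have LR: "blinfun_apply (L i) a = X i \<rhd> a" "blinfun_apply (R i) a = a \<lhd> X i" for i a
    by (simp_all add: L_def R_def bounded_linear_Blinfun_apply multiplier_bounded)
  have n: "norm (L i - L j) \<le> norm (X i - X j)" "norm (R i - R j) \<le> norm (X i - X j)" for i j
    by (intro norm_blinfun_bound norm_multiplier_ge_0;
        simp add: blinfun.bilinear_simps LR b)+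
  have "Cauchy L" "Cauchy R"
    unfolding Cauchy_iff using X n by (meson order_le_less_trans)+
  then obtain l r where l: "L \<longlonglongrightarrow> l" and r: "R \<longlonglongrightarrow> r"
    by (meson Cauchy_convergent convergentD)
  have l': "(\<lambda>i. X i \<rhd> a) \<longlonglongrightarrow> l a" for a
    using blinfun.tendsto[OF l tendsto_const[of a]] by (simp add: LR)
  have r': "(\<lambda>i. a \<lhd> X i) \<longlonglongrightarrow> r a" for a
    using blinfun.tendsto[OF r tendsto_const[of a]] by (simp add: LR)
  define m where "m = mk_multiplier (blinfun_apply l) (blinfun_apply r)"
  have m: "m \<rhd> a = l a" for a
    unfolding m_def
  proof (rule lmult_mk_multiplier)
    show "l (c *\<^sub>C a) = c *\<^sub>C l a" for c a
      using l'[of "c *\<^sub>C a"] bounded_linear.tendsto[OF bounded_linear_scaleC l'[of a], of c]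
      by (auto simp: lmult_scaleC intro: LIMSEQ_unique)
    show "r (c *\<^sub>C a) = c *\<^sub>C r a" for c a
      using r'[of "c *\<^sub>C a"] bounded_linear.tendsto[OF bounded_linear_scaleC r'[of a], of c]
      by (auto simp: rmult_scaleC intro: LIMSEQ_unique)
    show "l (a * b) = l a * b" for a b
      using l'[of "a * b"] tendsto_mult[OF l'[of a] tendsto_const[of b]]
      by (auto simp: lmult_mult intro: LIMSEQ_unique)
    show "r (a * b) = a * r b" for a b
      using r'[of "a * b"] tendsto_mult[OF tendsto_const[of a] r'[of b]]
      by (auto simp: rmult_mult intro: LIMSEQ_unique)
    show "a * l b = r a * b" for a b
      using tendsto_mult[OF tendsto_const[of a] l'[of b]] tendsto_mult[OF r'[of a] tendsto_const[of b]]
      by (auto simp: mult_lmult intro: LIMSEQ_unique)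
  qed (simp_all add: blinfun.bounded_linear_right)
  have "norm (X i - m) \<le> norm (L i - l)" for i
  proof (rule norm_multiplier_bound)
    show "norm ((X i - m) \<rhd> a) \<le> norm (L i - l) * norm a" for a
      using norm_blinfun[of "L i - l" a] by (simp add: blinfun.bilinear_simps LR m)
  qed simp
  moreover have "\<exists>N. \<forall>i\<ge>N. norm (L i - l) < e" if "0 < e" for e
    using l that by (simp add: LIMSEQ_iff)
  ultimately show ?thesis
    by (meson order_le_less_trans)
qed

instance
proof
  fix m n :: "'a multiplier" and c :: complex and r :: real
  show "norm (c *\<^sub>C m) = cmod c * norm m"
    using onorm_scaleR[OF bounded_linear_lmult[of m], of "cmod c"]
    by (simp add: norm_multiplier_def onorm_def norm_scaleC)
  show "norm (star m * m) = (norm m)\<^sup>2"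
    using norm_sq_le_multiplier[of m] norm_multiplier_mult[of "star m" m]
    by (simp add: norm_star_multiplier power2_eq_square)
  show "star (star m) = m"
    by (rule star_star_multiplier)
next
  fix X :: "nat \<Rightarrow> 'a multiplier"
  assume "Cauchy X"
  then have "\<And>e. 0 < e \<Longrightarrow> \<exists>N. \<forall>i\<ge>N. \<forall>j\<ge>N. norm (X i - X j) < e"
    by (auto simp: Cauchy_def dist_norm)
  from multiplier_complete[OF this] show "convergent X"
    by (auto simp: convergent_def LIMSEQ_def dist_norm)
qed (rule multiplier_eqI;
     simp add: algebra_simps multiplier_alg scaleC_add_left scaleC_scaleC star_add star_scaleC
       star_mult star_star)+

end

instantiation multiplier :: (cstar_algebra) one
begin

definition "1 = mk_multiplier (\<lambda>a::'a. a) (\<lambda>a. a)"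

instance ..

end

lemma act_one [simp]: "(1 :: 'a::cstar_algebra multiplier) \<rhd> a = a" "a \<lhd> 1 = a"
  by (simp_all add: one_multiplier_def lmult_mk_multiplier rmult_mk_multiplier bounded_linear_ident)

instance multiplier :: (cstar_algebra) monoid_mult
  by standard (rule multiplier_eqI; simp)+

definition of_alg :: "'a::cstar_algebra \<Rightarrow> 'a multiplier" where
  "of_alg a = mk_multiplier (\<lambda>b. a * b) (\<lambda>b. b * a)"

lemma act_of_alg [simp]: "of_alg a \<rhd> b = a * b" "b \<lhd> of_alg a = b * a"
  by (simp_all add: of_alg_def lmult_mk_multiplier rmult_mk_multiplier bounded_linear_mult_right
      bounded_linear_mult_left mult_scaleC_left mult_scaleC_right mult.assoc)

text \<open>The strict topology is the initial topology for the maps \<open>m \<mapsto> m a\<close> and \<open>m \<mapsto> a m\<close> into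
  \<open>A\<close> with its norm topology; the type of functions carries the product topology.\<close>

definition strict_topology :: "'a::cstar_algebra multiplier topology" where
  "strict_topology = pullback_topology UNIV (\<lambda>m. ((\<lambda>a. m \<rhd> a), (\<lambda>a. a \<lhd> m))) euclidean"

text \<open>A bounded functional on \<open>A\<close> is tacitly extended to \<open>M(A)\<close>; the extension is the unique
  strictly continuous one.\<close>

definition functional_ext :: "('a::cstar_algebra \<Rightarrow> complex) \<Rightarrow> 'a multiplier \<Rightarrow> complex" where
  "functional_ext \<omega> = (THE \<Omega>. Vector_Spaces.linear scaleC (*) \<Omega> \<and>
     continuous_map strict_topology euclidean \<Omega> \<and> (\<forall>a. \<Omega> (of_alg a) = \<omega> a))"

section \<open>Morphisms and actions\<close>

definition cstar_morphism :: "('a::cstar_algebra \<Rightarrow> 'b::cstar_algebra multiplier) \<Rightarrow> bool" where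
  "cstar_morphism \<phi> \<longleftrightarrow> star_hom \<phi> \<and> closure (cspan {\<phi> a \<rhd> b | a b. True}) = UNIV"

text \<open>The extension of a morphism \<open>A \<rightarrow> M(B)\<close> to a unital homomorphism \<open>M(A) \<rightarrow> M(B)\<close>, unique by
  nondegeneracy.\<close>

definition morphism_ext ::
  "('a::cstar_algebra \<Rightarrow> 'b::cstar_algebra multiplier) \<Rightarrow> 'a multiplier \<Rightarrow> 'b multiplier" where
  "morphism_ext \<phi> = (THE \<Phi>. star_hom \<Phi> \<and> \<Phi> 1 = 1 \<and> (\<forall>a. \<Phi> (of_alg a) = \<phi> a))"

text \<open>Groups are written additively because that is how the library provides topological groups;
  \<^class>\<open>topological_group_add\<close> does not assume commutativity.\<close>

definition continuous_action ::
  "('g::{topological_group_add, t2_space} \<Rightarrow> 'a::cstar_algebra \<Rightarrow> 'a) \<Rightarrow> bool" where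
  "continuous_action \<alpha> \<longleftrightarrow> (\<forall>s. star_hom (\<alpha> s)) \<and> (\<forall>a. \<alpha> 0 a = a) \<and>
     (\<forall>s t a. \<alpha> (s + t) a = \<alpha> s (\<alpha> t a)) \<and> (\<forall>a. continuous_on UNIV (\<lambda>s. \<alpha> s a))"

definition mact :: "('g \<Rightarrow> 'a::cstar_algebra \<Rightarrow> 'a) \<Rightarrow> 'g \<Rightarrow> 'a multiplier \<Rightarrow> 'a multiplier" where
  "mact \<alpha> s = morphism_ext (\<lambda>a. of_alg (\<alpha> s a))"

definition equivariant_morphism ::
  "('g \<Rightarrow> 'b::cstar_algebra \<Rightarrow> 'b) \<Rightarrow> ('g \<Rightarrow> 'a::cstar_algebra \<Rightarrow> 'a) \<Rightarrow> ('b \<Rightarrow> 'a multiplier) \<Rightarrow> bool"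
  where
  "equivariant_morphism \<beta> \<alpha> \<phi> \<longleftrightarrow>
     cstar_morphism \<phi> \<and> (\<forall>s b. mact \<alpha> s (\<phi> b) = \<phi> (\<beta> s b))"

definition comma_object ::
  "('g::{topological_group_add, t2_space} \<Rightarrow> 'b::cstar_algebra \<Rightarrow> 'b) \<Rightarrow>
   ('g \<Rightarrow> 'a::cstar_algebra \<Rightarrow> 'a) \<Rightarrow> ('b \<Rightarrow> 'a multiplier) \<Rightarrow> bool" where
  "comma_object \<beta> \<alpha> \<phi> \<longleftrightarrow> continuous_action \<alpha> \<and> equivariant_morphism \<beta> \<alpha> \<phi>"


section \<open>The C*-algebra of continuous functions vanishing at infinity\<close>

typedef (overloaded) 'x c0 =
  "{f :: 'x::topological_space \<Rightarrow>\<^sub>C complex. \<forall>e>0. compact {x. e \<le> cmod (f x)}}"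
  by (rule exI[where x = 0]) simp

setup_lifting type_definition_c0

lift_definition c0_apply :: "'x::topological_space c0 \<Rightarrow> 'x \<Rightarrow> complex" is apply_bcontfun .

lemma c0_eqI: "(\<And>x. c0_apply f x = c0_apply g x) \<Longrightarrow> f = g"
  by transfer (rule bcontfun_eqI)

lemma continuous_on_c0: "continuous_on S (c0_apply f)"
  by transfer simp

lemma compact_c0: "0 < e \<Longrightarrow> compact {x. e \<le> cmod (c0_apply f x)}"
  by transfer simp

definition mk_c0 :: "('x::topological_space \<Rightarrow> complex) \<Rightarrow> 'x c0" where
  "mk_c0 f = Abs_c0 (Bcontfun f)"

lemma bounded_vanishing:
  assumes "continuous_on UNIV f" "\<And>e. 0 < e \<Longrightarrow> compact {x. e \<le> cmod (f x)}"
  shows "f \<in> bcontfun"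
proof -
  have "bounded (f ` {x. 1 \<le> cmod (f x)})"
    using assms by (intro compact_imp_bounded compact_continuous_image)
      (auto intro: continuous_on_subset)
  then obtain B where B: "\<And>x. 1 \<le> cmod (f x) \<Longrightarrow> cmod (f x) \<le> B"
    by (auto simp: bounded_iff)
  have "cmod (f x) \<le> max 1 B" for x
    using B[of x] by (cases "1 \<le> cmod (f x)") auto
  then show ?thesis
    using assms(1) by (intro bcontfun_normI)
qed

lemma apply_mk_c0:
  assumes "continuous_on UNIV f" "\<And>e. 0 < e \<Longrightarrow> compact {x. e \<le> cmod (f x)}"
  shows "c0_apply (mk_c0 f) x = f x"
  using assms bounded_vanishing[OF assms]
  by (simp add: mk_c0_def c0_apply_def Abs_c0_inverse Bcontfun_inverse)

lemma compact_level_subset: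
  fixes f :: "'x::topological_space \<Rightarrow> complex"
  assumes "continuous_on UNIV f" "compact K" "{x. e \<le> cmod (f x)} \<subseteq> K"
  shows "compact {x. e \<le> cmod (f x)}"
proof -
  have "closed {x. e \<le> cmod (f x)}"
    using assms(1) by (intro closed_Collect_le continuous_intros)
  then show ?thesis
    using compact_Int_closed[OF assms(2)] assms(3) by (metis inf.absorb2)
qed

lemma apply_mk_c0_bound:
  assumes f: "continuous_on UNIV f" and K: "0 < K" "\<And>x. cmod (f x) \<le> K * cmod (c0_apply g x)"
  shows "c0_apply (mk_c0 f) x = f x"
proof (rule apply_mk_c0[OF f])
  fix e :: real
  assume "0 < e"
  show "compact {x. e \<le> cmod (f x)}"
  proof (rule compact_level_subset[OF f])
    show "compact {x. e / K \<le> cmod (c0_apply g x)}"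
      using \<open>0 < e\<close> K(1) by (intro compact_c0) simp
    show "{x. e \<le> cmod (f x)} \<subseteq> {x. e / K \<le> cmod (c0_apply g x)}"
      using K by (auto simp: field_simps intro: order_trans)
  qed
qed

lemma c0_bounded: obtains K where "0 < K" "\<And>x. cmod (c0_apply f x) \<le> K"
proof -
  have "cmod (c0_apply f x) \<le> norm (Rep_c0 f) + 1" for x
    using norm_bounded[of "Rep_c0 f" x] by (simp add: c0_apply.rep_eq)
  then show ?thesis
    using that[of "norm (Rep_c0 f) + 1"] by (simp add: add_nonneg_pos)
qed

instantiation c0 :: (topological_space) real_normed_algebra
begin

definition "0 = mk_c0 (\<lambda>x::'a. 0)"
definition "f + g = mk_c0 (\<lambda>x::'a. c0_apply f x + c0_apply g x)"
definition "f - g = mk_c0 (\<lambda>x::'a. c0_apply f x - c0_apply g x)"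
definition "- f = mk_c0 (\<lambda>x::'a. - c0_apply f x)"
definition "r *\<^sub>R f = mk_c0 (\<lambda>x::'a. r *\<^sub>R c0_apply f x)"
definition "f * g = mk_c0 (\<lambda>x::'a. c0_apply f x * c0_apply g x)"
definition "norm f = (SUP x::'a. cmod (c0_apply f x))"
definition "sgn f = scaleR (inverse (norm f)) (f :: 'a c0)"
definition "dist f g = norm (f - g :: 'a c0)"
definition [code del]:
  "(uniformity :: ('a c0 \<times> 'a c0) filter) = (INF e\<in>{0<..}. principal {(x, y). dist x y < e})"
definition [code del]:
  "open (U :: 'a c0 set) \<longleftrightarrow> (\<forall>x\<in>U. \<forall>\<^sub>F (x', y) in uniformity. x' = x \<longrightarrow> y \<in> U)"

lemma c0_apply_zero [simp]: "c0_apply 0 (x::'a) = 0"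
  unfolding zero_c0_def by (rule apply_mk_c0) auto

lemma c0_apply_add [simp]: "c0_apply (f + g) (x::'a) = c0_apply f x + c0_apply g x"
  unfolding plus_c0_def
proof (rule apply_mk_c0)
  show c: "continuous_on UNIV (\<lambda>x. c0_apply f x + c0_apply g x)"
    by (intro continuous_intros continuous_on_c0)
  fix e :: real
  assume "0 < e"
  show "compact {x. e \<le> cmod (c0_apply f x + c0_apply g x)}"
  proof (rule compact_level_subset[OF c])
    show "compact ({x. e / 2 \<le> cmod (c0_apply f x)} \<union> {x. e / 2 \<le> cmod (c0_apply g x)})"
      using \<open>0 < e\<close> by (intro compact_Un compact_c0) simp_all
    have "e / 2 \<le> cmod a \<or> e / 2 \<le> cmod b" if "e \<le> cmod (a + b)" for a b
      using that norm_triangle_ineq[of a b] by linarith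
    then show "{x. e \<le> cmod (c0_apply f x + c0_apply g x)} \<subseteq>
        {x. e / 2 \<le> cmod (c0_apply f x)} \<union> {x. e / 2 \<le> cmod (c0_apply g x)}"
      by blast
  qed
qed

lemma c0_apply_minus [simp]: "c0_apply (- f) (x::'a) = - c0_apply f x"
  unfolding uminus_c0_def
  by (rule apply_mk_c0_bound[where K = 1 and g = f]) (auto intro!: continuous_intros continuous_on_c0)

lemma c0_apply_diff [simp]: "c0_apply (f - g) (x::'a) = c0_apply f x - c0_apply g x"
proof -
  have "f - g = f + (- g)"
    by (simp add: minus_c0_def plus_c0_def)
  then show ?thesis
    by simp
qed

lemma c0_apply_scaleR [simp]: "c0_apply (r *\<^sub>R f) (x::'a) = r *\<^sub>R c0_apply f x"
  unfolding scaleR_c0_def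
  by (rule apply_mk_c0_bound[where K = "\<bar>r\<bar> + 1" and g = f])
     (auto intro!: continuous_intros continuous_on_c0 mult_right_mono)

lemma c0_apply_times [simp]: "c0_apply (f * g) (x::'a) = c0_apply f x * c0_apply g x"
proof -
  obtain K where "0 < K" "\<And>x. cmod (c0_apply f x) \<le> K"
    using c0_bounded by blast
  then show ?thesis
    unfolding times_c0_def
    by (intro apply_mk_c0_bound[where K = K and g = g])
       (auto intro!: continuous_intros continuous_on_c0 mult_right_mono simp: norm_mult)
qed

lemma norm_c0_apply: "cmod (c0_apply f x) \<le> norm (f :: 'a c0)"
proof -
  obtain K where "\<And>x. cmod (c0_apply f x) \<le> K"
    using c0_bounded by blast
  then show ?thesis
    unfolding norm_c0_def by (intro cSUP_upper) (auto intro!: bdd_aboveI)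
qed

lemma norm_c0_bound: "(\<And>x. cmod (c0_apply f x) \<le> K) \<Longrightarrow> norm (f :: 'a c0) \<le> K"
  unfolding norm_c0_def by (rule cSUP_least) auto

lemma norm_c0_ge_0: "0 \<le> norm (f :: 'a c0)"
  using norm_c0_apply norm_ge_zero by (rule order_trans[rotated])

lemma norm_c0_cmult:
  assumes "\<And>x. cmod (c0_apply g x) = k * cmod (c0_apply f x)" "0 \<le> k"
  shows "norm (g :: 'a c0) = k * norm f"
proof (cases "k = 0")
  case True
  then show ?thesis
    using assms norm_c0_bound[of g 0] norm_c0_ge_0[of g] by simp
next
  case False
  have "norm g \<le> k * norm f"
    using assms norm_c0_apply[of f] by (intro norm_c0_bound) (simp add: mult_left_mono)
  moreover have "norm f \<le> norm g / k"
    using assms False norm_c0_apply[of g] by (intro norm_c0_bound) (simp add: field_simps)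
  ultimately show ?thesis
    using False assms(2) by (simp add: field_simps)
qed

instance
proof
  fix f g h :: "'a c0" and r s :: real
  show "norm (f + g) \<le> norm f + norm g"
    by (rule norm_c0_bound) (auto intro: norm_triangle_mono norm_c0_apply)
  show "norm (r *\<^sub>R f) = \<bar>r\<bar> * norm f"
    by (rule norm_c0_cmult) simp_all
  show "norm f = 0 \<longleftrightarrow> f = 0"
  proof
    assume "norm f = 0"
    then show "f = 0"
      using norm_c0_apply[of f] by (intro c0_eqI) simp
  next
    assume "f = 0"
    then show "norm f = 0"
      using norm_c0_bound[of 0 0] norm_c0_ge_0[of 0] by simp
  qed
  show "norm (f * g) \<le> norm f * norm g"
    by (rule norm_c0_bound) (auto simp: norm_mult intro!: mult_mono norm_c0_apply norm_c0_ge_0)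
  show "sgn f = inverse (norm f) *\<^sub>R f"
    by (rule sgn_c0_def)
  show "dist f g = norm (f - g)"
    by (rule dist_c0_def)
qed (rule c0_eqI uniformity_c0_def open_c0_def; simp add: algebra_simps)+

end

instantiation c0 :: (topological_space) cstar_algebra
begin

definition "c *\<^sub>C f = mk_c0 (\<lambda>x::'a. c * c0_apply f x)"
definition "star f = mk_c0 (\<lambda>x::'a. cnj (c0_apply f x))"

lemma c0_apply_scaleC [simp]: "c0_apply (c *\<^sub>C f) (x::'a) = c * c0_apply f x"
  unfolding scaleC_c0_def
  by (rule apply_mk_c0_bound[where K = "cmod c + 1" and g = f])
     (auto intro!: continuous_intros continuous_on_c0 mult_right_mono simp: norm_mult add_nonneg_pos)

lemma c0_apply_star [simp]: "c0_apply (star f) (x::'a) = cnj (c0_apply f x)"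
  unfolding star_c0_def
  by (rule apply_mk_c0_bound[where K = 1 and g = f]) (auto intro!: continuous_intros continuous_on_c0)

lemma c0_complete:
  fixes X :: "nat \<Rightarrow> 'a c0"
  assumes "Cauchy X"
  shows "convergent X"
proof -
  have *: "dist (c0_apply (X m) x) (c0_apply (X n) x) \<le> dist (X m) (X n)" for m n x
    using norm_c0_apply[of "X m - X n" x] by (simp add: dist_norm)
  have "uniformly_Cauchy_on UNIV (\<lambda>n. c0_apply (X n))"
    using assms * unfolding Cauchy_def uniformly_Cauchy_on_def by (meson order_le_less_trans)
  then obtain l where l: "uniform_limit UNIV (\<lambda>n. c0_apply (X n)) l sequentially"
    by (meson Cauchy_uniformly_convergent uniformly_convergent_on_def)
  have c: "continuous_on UNIV l"
    using l by (rule uniform_limit_theorem[rotated]) (simp_all add: continuous_on_c0)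
  have "c0_apply (mk_c0 l) x = l x" for x
  proof (rule apply_mk_c0[OF c])
    fix e :: real
    assume "0 < e"
    then have "\<forall>\<^sub>F n in sequentially. \<forall>x\<in>UNIV. dist (c0_apply (X n) x) (l x) < e / 2"
      by (intro uniform_limitD[OF l]) simp
    then obtain n where n: "\<And>x. dist (c0_apply (X n) x) (l x) < e / 2"
      by (auto simp: eventually_sequentially)
    show "compact {x. e \<le> cmod (l x)}"
    proof (rule compact_level_subset[OF c])
      show "compact {x. e / 2 \<le> cmod (c0_apply (X n) x)}"
        using \<open>0 < e\<close> by (intro compact_c0) simp
      have "e / 2 \<le> cmod (c0_apply (X n) x)" if "e \<le> cmod (l x)" for x
        using that n[of x] norm_triangle_sub[of "l x" "c0_apply (X n) x"]
        by (simp add: dist_norm norm_minus_commute)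
      then show "{x. e \<le> cmod (l x)} \<subseteq> {x. e / 2 \<le> cmod (c0_apply (X n) x)}"
        by blast
    qed
  qed
  then have L: "c0_apply (mk_c0 l) = l" ..
  have "X \<longlonglongrightarrow> mk_c0 l"
  proof (rule metric_LIMSEQ_I)
    fix e :: real
    assume "0 < e"
    then have "\<forall>\<^sub>F n in sequentially. \<forall>x\<in>UNIV. dist (c0_apply (X n) x) (l x) < e / 2"
      by (intro uniform_limitD[OF l]) simp
    then obtain N where N: "\<And>n x. N \<le> n \<Longrightarrow> dist (c0_apply (X n) x) (l x) < e / 2"
      by (auto simp: eventually_sequentially)
    have "dist (X n) (mk_c0 l) < e" if "N \<le> n" for n
    proof -
      have "norm (X n - mk_c0 l) \<le> e / 2"
        using N[OF that] by (intro norm_c0_bound) (auto simp: L dist_norm intro: less_imp_le)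
      then show ?thesis
        using \<open>0 < e\<close> by (simp add: dist_norm)
    qed
    then show "\<exists>N. \<forall>n\<ge>N. dist (X n) (mk_c0 l) < e"
      by blast
  qed
  then show ?thesis
    by (rule convergentI)
qed

instance
proof
  fix f g :: "'a c0" and c :: complex
  show "norm (c *\<^sub>C f) = cmod c * norm f"
    by (rule norm_c0_cmult) (simp_all add: norm_mult)
  have "cmod (c0_apply f x) \<le> sqrt (norm (star f * f))" for x
    using norm_c0_apply[of "star f * f" x]
    by (intro real_le_rsqrt) (simp add: norm_mult power2_eq_square)
  then have "norm f \<le> sqrt (norm (star f * f))"
    by (rule norm_c0_bound)
  then have "(norm f)\<^sup>2 \<le> (sqrt (norm (star f * f)))\<^sup>2"
    by (intro power_mono) simp_all
  moreover have "norm (star f * f) \<le> (norm f)\<^sup>2"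
    by (rule norm_c0_bound)
       (auto simp: norm_mult power2_eq_square intro!: mult_mono norm_c0_apply)
  ultimately show "norm (star f * f) = (norm f)\<^sup>2"
    by simp
qed (rule c0_complete, assumption | rule c0_eqI, simp add: algebra_simps scaleR_conv_of_real)+

end

definition Cc :: "'x::topological_space c0 set" where
  "Cc = {f. compact (closure {x. c0_apply f x \<noteq> 0})}"

text \<open>On locally compact Hausdorff spaces, properness of \<open>(x, t) \<mapsto> (x, x \<cdot> t)\<close> in the library's sense
  (closed with compact fibres) says that preimages of compact sets are compact.\<close>

definition proper_right_action ::
  "('x::topological_space \<Rightarrow> 'g::{topological_group_add, t2_space} \<Rightarrow> 'x) \<Rightarrow> bool" where
  "proper_right_action act \<longleftrightarrow>
     (\<forall>x. act x 0 = x) \<and> (\<forall>x s t. act (act x s) t = act x (s + t)) \<and>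
     continuous_on UNIV (\<lambda>(x, t). act x t) \<and>
     proper_map euclidean euclidean (\<lambda>(x, t). (x, act x t))"

definition translation ::
  "('x::topological_space \<Rightarrow> 'g \<Rightarrow> 'x) \<Rightarrow> 'g \<Rightarrow> 'x c0 \<Rightarrow> 'x c0" where
  "translation act t f = mk_c0 (\<lambda>x. c0_apply f (act x t))"

lemma c0_apply_translation:
  assumes "proper_right_action act"
  shows "c0_apply (translation act t f) x = c0_apply f (act x t)"
  unfolding translation_def
proof (rule apply_mk_c0)
  have act: "act (act x s) t = act x (s + t)" "act x 0 = x" for x s t
    using assms by (auto simp: proper_right_action_def)
  have "continuous_on UNIV (\<lambda>(x, t). act x t)"
    using assms by (simp add: proper_right_action_def)
  then have c: "continuous_on S (\<lambda>x. act x t)" for S t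
    using continuous_on_compose2[of UNIV "\<lambda>(x, t). act x t" S "\<lambda>x. (x, t)"]
      continuous_on_Pair[OF continuous_on_id continuous_on_const[of S t]]
    by simp
  show "continuous_on UNIV (\<lambda>x. c0_apply f (act x t))"
    by (rule continuous_on_compose2[OF continuous_on_c0 c]) auto
  fix e :: real
  assume "0 < e"
  have "{x. e \<le> cmod (c0_apply f (act x t))} =
      (\<lambda>y. act y (- t)) ` {y. e \<le> cmod (c0_apply f y)}"
  proof (intro equalityI subsetI)
    fix x
    assume "x \<in> {x. e \<le> cmod (c0_apply f (act x t))}"
    then show "x \<in> (\<lambda>y. act y (- t)) ` {y. e \<le> cmod (c0_apply f y)}"
      by (intro image_eqI[where x = "act x t"]) (simp_all add: act)
  qed (auto simp: act)
  then show "compact {x. e \<le> cmod (c0_apply f (act x t))}"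
    using compact_continuous_image[OF c compact_c0[OF \<open>0 < e\<close>]] by simp
qed

section \<open>Haar measure and vector-valued integration\<close>

text \<open>A nonzero left-invariant Radon measure on the Borel sets.\<close>

definition left_haar_measure :: "'g::{topological_group_add, t2_space} measure \<Rightarrow> bool" where
  "left_haar_measure \<mu> \<longleftrightarrow> sets \<mu> = sets borel \<and> emeasure \<mu> UNIV \<noteq> 0 \<and>
     (\<forall>K. compact K \<longrightarrow> emeasure \<mu> K < \<infinity>) \<and>
     (\<forall>B\<in>sets borel. emeasure \<mu> B = (INF U\<in>{U. open U \<and> B \<subseteq> U}. emeasure \<mu> U)) \<and>
     (\<forall>U. open U \<longrightarrow> emeasure \<mu> U = (SUP K\<in>{K. compact K \<and> K \<subseteq> U}. emeasure \<mu> K)) \<and>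
     (\<forall>s. \<forall>B\<in>sets borel. emeasure \<mu> ((\<lambda>t. s + t) ` B) = emeasure \<mu> B)"

text \<open>The convention is \<open>\<mu>(B s) = \<Delta>(s) \<mu>(B)\<close>; this determines \<open>\<Delta>\<close>, since Haar measure takes a finite
  nonzero value on some Borel set.\<close>

definition modular_function ::
  "'g::{topological_group_add, t2_space} measure \<Rightarrow> ('g \<Rightarrow> real) \<Rightarrow> bool" where
  "modular_function \<mu> \<Delta> \<longleftrightarrow> (\<forall>s. 0 < \<Delta> s) \<and>
     (\<forall>s. \<forall>B\<in>sets borel. emeasure \<mu> ((\<lambda>t. t + s) ` B) = ennreal (\<Delta> s) * emeasure \<mu> B)"

text \<open>Bochner integration without the second countability of the codomain that the library's
  \<^const>\<open>has_bochner_integral\<close> imposes; the defining clauses are otherwise the same, and they force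
  the values of \<open>f\<close> to lie in a separable subspace almost everywhere.\<close>

definition has_vector_integral ::
  "'s measure \<Rightarrow> ('s \<Rightarrow> 'a::real_normed_vector) \<Rightarrow> 'a \<Rightarrow> bool" where
  "has_vector_integral \<mu> f v \<longleftrightarrow> f \<in> borel_measurable \<mu> \<and>
     (\<exists>S. (\<forall>i. Bochner_Integration.simple_bochner_integrable \<mu> (S i)) \<and>
          (\<lambda>i. \<integral>\<^sup>+s. norm (f s - S i s) \<partial>\<mu>) \<longlonglongrightarrow> 0 \<and>
          (\<lambda>i. Bochner_Integration.simple_bochner_integral \<mu> (S i)) \<longlonglongrightarrow> v)"

definition L1 :: "'s measure \<Rightarrow> ('s \<Rightarrow> 'a::real_normed_vector) set" where
  "L1 \<mu> = {f. \<exists>v. has_vector_integral \<mu> f v}"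

section \<open>Averaging\<close>

text \<open>The integrands are nonnegative for positive \<open>a\<close>, so integrability only says that the integral is
  finite, as it must be to equal \<open>\<omega>(e)\<close>.\<close>

definition is_average ::
  "'g measure \<Rightarrow> ('g \<Rightarrow> 'a::cstar_algebra \<Rightarrow> 'a) \<Rightarrow> 'a multiplier \<Rightarrow> 'a multiplier \<Rightarrow> bool" where
  "is_average \<mu> \<alpha> a e \<longleftrightarrow> positive e \<and>
     (\<forall>\<omega>. positive_functional \<omega> \<longrightarrow>
        integrable \<mu> (\<lambda>s. functional_ext \<omega> (mact \<alpha> s a)) \<and>
        functional_ext \<omega> e = (LINT s|\<mu>. functional_ext \<omega> (mact \<alpha> s a)))"

definition avg_pos :: "'g measure \<Rightarrow> ('g \<Rightarrow> 'a::cstar_algebra \<Rightarrow> 'a) \<Rightarrow> 'a multiplier set"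
    (\<open>\<pp>\<close>) where
  "\<pp> \<mu> \<alpha> = {a. positive a \<and> (\<exists>e. is_average \<mu> \<alpha> a e)}"

definition avg_sq :: "'g measure \<Rightarrow> ('g \<Rightarrow> 'a::cstar_algebra \<Rightarrow> 'a) \<Rightarrow> 'a multiplier set"
    (\<open>\<nn>\<close>) where
  "\<nn> \<mu> \<alpha> = {a. star a * a \<in> \<pp> \<mu> \<alpha>}"

definition avg_dom :: "'g measure \<Rightarrow> ('g \<Rightarrow> 'a::cstar_algebra \<Rightarrow> 'a) \<Rightarrow> 'a multiplier set"
    (\<open>\<mm>\<close>) where
  "\<mm> \<mu> \<alpha> = cspan {star a * b | a b. a \<in> \<nn> \<mu> \<alpha> \<and> b \<in> \<nn> \<mu> \<alpha>}"

definition average_pos ::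
  "'g measure \<Rightarrow> ('g \<Rightarrow> 'a::cstar_algebra \<Rightarrow> 'a) \<Rightarrow> 'a multiplier \<Rightarrow> 'a multiplier" where
  "average_pos \<mu> \<alpha> a = (THE e. is_average \<mu> \<alpha> a e)"

text \<open>\<open>E\<close> is the linear extension of \<^const>\<open>average_pos\<close> from \<open>\<pp>\<close> to \<open>\<mm> = span \<pp>\<close>, so its value
  at \<open>a\<close> is read off from any expansion of \<open>a\<close> in elements of \<open>\<pp>\<close>.\<close>

definition average ::
  "'g measure \<Rightarrow> ('g \<Rightarrow> 'a::cstar_algebra \<Rightarrow> 'a) \<Rightarrow> 'a multiplier \<Rightarrow> 'a multiplier" where
  "average \<mu> \<alpha> a = (THE e. a \<in> \<mm> \<mu> \<alpha> \<and>
     (\<exists>(n::nat) c p. (\<forall>i<n. p i \<in> \<pp> \<mu> \<alpha>) \<and> a = (\<Sum>i<n. c i *\<^sub>C p i) \<and>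
        e = (\<Sum>i<n. c i *\<^sub>C average_pos \<mu> \<alpha> (p i))))"

text \<open>\<open>corner \<phi>\<close> is \<open>A\<^sub>0 = C\<^sub>c(X) A C\<^sub>c(X)\<close>.\<close>

definition corner :: "('x::topological_space c0 \<Rightarrow> 'a::cstar_algebra multiplier) \<Rightarrow> 'a set" where
  "corner \<phi> = cspan {\<phi> f \<rhd> a \<lhd> \<phi> g | f a g. f \<in> Cc \<and> g \<in> Cc}"

definition Fix ::
  "'g measure \<Rightarrow> ('g \<Rightarrow> 'a::cstar_algebra \<Rightarrow> 'a) \<Rightarrow>
   ('x::topological_space c0 \<Rightarrow> 'a multiplier) \<Rightarrow> 'a multiplier set" where
  "Fix \<mu> \<alpha> \<phi> = closure (average \<mu> \<alpha> ` of_alg ` corner \<phi>)"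

section \<open>Rieffel properness\<close>

text \<open>That \<open>m\<close> multiplies \<open>A\<^sub>0\<close> into itself is read two-sidedly: \<open>m A\<^sub>0\<close> and \<open>A\<^sub>0 m\<close> lie in \<open>A\<^sub>0\<close>.\<close>

definition is_rieffel_inner ::
  "'g measure \<Rightarrow> ('g \<Rightarrow> 'a::cstar_algebra \<Rightarrow> 'a) \<Rightarrow> 'a set \<Rightarrow> 'a \<Rightarrow> 'a \<Rightarrow> 'a multiplier \<Rightarrow> bool" where
  "is_rieffel_inner \<mu> \<alpha> A0 a b m \<longleftrightarrow> (\<forall>s. mact \<alpha> s m = m) \<and>
     (\<forall>c\<in>A0. m \<rhd> c \<in> A0 \<and> c \<lhd> m \<in> A0) \<and>
     (\<forall>c\<in>A0. has_vector_integral \<mu> (\<lambda>s. c * \<alpha> s (star a * b)) (c \<lhd> m))"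

definition rieffel_proper ::
  "'g measure \<Rightarrow> ('g \<Rightarrow> real) \<Rightarrow> ('g \<Rightarrow> 'a::cstar_algebra \<Rightarrow> 'a) \<Rightarrow> 'a set \<Rightarrow> bool" where
  "rieffel_proper \<mu> \<Delta> \<alpha> A0 \<longleftrightarrow>
     star_subalgebra A0 \<and> closure A0 = UNIV \<and> (\<forall>s. \<forall>a\<in>A0. \<alpha> s a \<in> A0) \<and>
     (\<forall>a\<in>A0. \<forall>b\<in>A0. (\<lambda>s. a * \<alpha> s (star b)) \<in> L1 \<mu> \<and>
        (\<lambda>s. (\<Delta> s powr (- 1 / 2)) *\<^sub>R (a * \<alpha> s (star b))) \<in> L1 \<mu>) \<and>
     (\<forall>a\<in>A0. \<forall>b\<in>A0. \<exists>m. is_rieffel_inner \<mu> \<alpha> A0 a b m)"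

definition rieffel_inner ::
  "'g measure \<Rightarrow> ('g \<Rightarrow> 'a::cstar_algebra \<Rightarrow> 'a) \<Rightarrow> 'a set \<Rightarrow> 'a \<Rightarrow> 'a \<Rightarrow> 'a multiplier" where
  "rieffel_inner \<mu> \<alpha> A0 a b = (THE m. is_rieffel_inner \<mu> \<alpha> A0 a b m)"

definition generalized_fixed_point_algebra ::
  "'g measure \<Rightarrow> ('g \<Rightarrow> 'a::cstar_algebra \<Rightarrow> 'a) \<Rightarrow> 'a set \<Rightarrow> 'a multiplier set" where
  "generalized_fixed_point_algebra \<mu> \<alpha> A0 =
     closure (cspan {rieffel_inner \<mu> \<alpha> A0 a b | a b. a \<in> A0 \<and> b \<in> A0})"

end

theory Submission
  imports Defs
begin

text \<open>Because the action on \<open>X\<close> is proper, \<open>s \<mapsto> c \<alpha>\<^sub>s(y)\<close> is compactly supported for \<open>c, y \<in> A\<^sub>0\<close>. If \<open>y\<close> is positive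
  and \<open>g \<in> C\<^sub>c(X)\<close> is real with \<open>g y g = y\<close>, then \<open>\<alpha>\<^sub>s(y) \<le> \<parallel>y\<parallel> \<phi>(\<gamma>\<^sub>s(g\<^sup>2))\<close>, and left invariance bounds the orbit
  integrals of \<open>g\<^sup>2\<close> uniformly over \<open>X\<close>. Hence the strict integral of \<open>\<alpha>\<^sub>s(y)\<close> exists as a positive multiplier of
  norm at most \<open>C\<^sub>g \<parallel>y\<parallel>\<close>. Compressing a positive functional by elements of \<open>A\<^sub>0\<close> and applying Fatou's lemma
  identifies this multiplier with \<open>E(y)\<close>, and a decomposition into four positive parts extends this to \<open>A\<^sub>0\<close>.
  The bound also shows that the elements \<open>E(a\<^sup>* b)\<close> are dense in \<open>E(A\<^sub>0)\<close>.\<close>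

text \<open>The obstacle is boundedness. For each c in A_0 the integral of \<alpha>_s(y) c exists,
  but the support in s depends on c, so the triangle inequality gives no bound by a multiple of the
  norm of c, and a multiplier needs one. Order supplies it: positive Riemann sums lie below a
  multiple of \<phi>(F), and F is estimated in the supremum norm on X, one orbit at a time. The
  constant is the Haar measure of the set of s for which a fixed compact set meets its translate by
  s. It depends on g alone, so E is bounded on all elements with a common local unit, which is
  enough for the density. Fatou's lemma enters because s -> \<omega>(\<alpha>_s(y)) need not have
  compact support: \<omega> carries no cutoff of its own. E and the extension of \<omega> to M(A)
  are definite descriptions, so functionals must extend in a strictly continuous and unique way, and
  the extensions must separate multipliers. The order theory behind this comes from the norm
  identity, without spectra: a selfadjoint h is positive if norm(t 1 - h) <= t for some t, and
  square roots are limits of an iteration.\<close>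

section \<open>Square roots by iteration\<close>

text \<open>The iteration \<open>q \<mapsto> (h + q\<^sup>2) / 2\<close> converges to \<open>1 - sqrt (1 - h)\<close>; it is dominated by the
  scalar iteration with \<open>h = 1\<close>, and it makes sense without a unit.\<close>

primrec sqrt_iter :: "'a::cstar_algebra \<Rightarrow> nat \<Rightarrow> 'a" where
  "sqrt_iter h 0 = 0"
| "sqrt_iter h (Suc n) = (1/2) *\<^sub>R (h + sqrt_iter h n * sqrt_iter h n)"

primrec sqrt_bound :: "nat \<Rightarrow> real" where
  "sqrt_bound 0 = 0"
| "sqrt_bound (Suc n) = (1 + sqrt_bound n * sqrt_bound n) / 2"

lemma sqrt_bound_range: "0 \<le> sqrt_bound n \<and> sqrt_bound n \<le> 1"
  by (induction n) (auto simp: mult_le_one)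

lemma sqrt_bound_mono: "sqrt_bound n \<le> sqrt_bound (Suc n)"
proof -
  have "0 \<le> (1 - sqrt_bound n)\<^sup>2" by simp
  then show ?thesis by (simp add: power2_eq_square algebra_simps)
qed

text \<open>The limit is a fixed point of \<open>(1 + l * l) / 2\<close>, and the fixed point
  equation is \<open>(l - 1) * (l - 1) = 0\<close>.\<close>

lemma sqrt_bound_tendsto: "sqrt_bound \<longlonglongrightarrow> 1"
proof -
  have "incseq sqrt_bound" by (rule incseq_SucI) (rule sqrt_bound_mono)
  moreover have "\<forall>n. sqrt_bound n \<le> 1" using sqrt_bound_range by blast
  ultimately obtain l where l: "sqrt_bound \<longlonglongrightarrow> l" by (rule incseq_convergent)
  have "(\<lambda>n. (1 + sqrt_bound n * sqrt_bound n) / 2) \<longlonglongrightarrow> (1 + l * l) / 2"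
    by (intro tendsto_intros l) simp
  moreover have "(\<lambda>n. sqrt_bound (Suc n)) \<longlonglongrightarrow> l"
    using l by (rule LIMSEQ_Suc)
  ultimately have "l = (1 + l * l) / 2"
    using LIMSEQ_unique[of sqrt_bound] by (simp only: sqrt_bound.simps) (rule LIMSEQ_unique)
  then have "(l - 1) * (l - 1) = 0" by (simp add: algebra_simps)
  then have "l = 1" by simp
  then show ?thesis using l by simp
qed

lemma sqrt_iter_commute: "z * h = h * z \<Longrightarrow> z * sqrt_iter h n = sqrt_iter h n * z"
proof (induction n)
  case (Suc n)
  then have "z * (sqrt_iter h n * sqrt_iter h n) = (sqrt_iter h n * sqrt_iter h n) * z"
    by (metis mult.assoc)
  then show ?case using Suc by (simp add: algebra_simps)
qed simp

lemma sqrt_iter_norm: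
  assumes "norm h \<le> 1" shows "norm (sqrt_iter h n) \<le> sqrt_bound n"
proof (induction n)
  case (Suc n)
  have "norm (h + sqrt_iter h n * sqrt_iter h n) \<le> 1 + sqrt_bound n * sqrt_bound n"
    using assms Suc sqrt_bound_range[of n]
    by (intro norm_triangle_mono order_trans[OF norm_mult_ineq] mult_mono) auto
  then show ?case by simp
qed simp

text \<open>All iterates commute, so a difference of consecutive squares factors into difference
  times sum. The scalar sequence has the same factorization with nonnegative factors, so its
  increments stay majorants at each step.\<close>

lemma sqrt_iter_diff:
  assumes "norm h \<le> 1"
  shows "norm (sqrt_iter h (Suc n) - sqrt_iter h n) \<le> sqrt_bound (Suc n) - sqrt_bound n"
proof (induction n)
  case (Suc n)
  let ?q = "sqrt_iter h" and ?r = sqrt_bound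
  have c: "?q (Suc n) * ?q n = ?q n * ?q (Suc n)"
    by (intro sqrt_iter_commute sym[OF sqrt_iter_commute] refl)
  have "?q (Suc (Suc n)) - ?q (Suc n) = (1/2) *\<^sub>R (?q (Suc n) * ?q (Suc n) - ?q n * ?q n)"
    by (simp only: sqrt_iter.simps(2)[of h "Suc n"] sqrt_iter.simps(2)[of h n]
        scaleR_diff_right[symmetric] add_diff_cancel_left)
  also have "?q (Suc n) * ?q (Suc n) - ?q n * ?q n = (?q (Suc n) - ?q n) * (?q (Suc n) + ?q n)"
    using c by (simp add: algebra_simps del: sqrt_iter.simps)
  finally have "norm (?q (Suc (Suc n)) - ?q (Suc n))
      = norm ((?q (Suc n) - ?q n) * (?q (Suc n) + ?q n)) / 2" by simp
  also have "norm ((?q (Suc n) - ?q n) * (?q (Suc n) + ?q n)) \<le> (?r (Suc n) - ?r n) * (?r (Suc n) + ?r n)"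
    using Suc sqrt_iter_norm[OF assms] sqrt_bound_mono[of n]
    by (intro order_trans[OF norm_mult_ineq] mult_mono order_trans[OF norm_triangle_ineq] add_mono) (simp_all del: sqrt_iter.simps sqrt_bound.simps)
  also have "(?r (Suc n) - ?r n) * (?r (Suc n) + ?r n) / 2
      = (1 + ?r (Suc n) * ?r (Suc n)) / 2 - (1 + ?r n * ?r n) / 2"
    by (simp add: field_simps del: sqrt_bound.simps)
  also have "\<dots> = ?r (Suc (Suc n)) - ?r (Suc n)"
    by (simp only: sqrt_bound.simps(2))
  finally show ?case by simp
qed (use assms in simp)

lemma sqrt_iter_convergent:
  assumes "norm h \<le> 1"
  shows "convergent (sqrt_iter h)"
proof -
  have b: "norm (sqrt_iter h (n + k) - sqrt_iter h n) \<le> sqrt_bound (n + k) - sqrt_bound n" for n k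
  proof (induction k)
    case (Suc k)
    have "norm (sqrt_iter h (Suc (n + k)) - sqrt_iter h n)
        \<le> norm (sqrt_iter h (Suc (n + k)) - sqrt_iter h (n + k)) + norm (sqrt_iter h (n + k) - sqrt_iter h n)"
      by (metis norm_triangle_ineq diff_add_cancel add_diff_eq)
    then show ?case using Suc sqrt_iter_diff[OF assms, of "n + k"] by simp
  qed simp
  have "Cauchy (sqrt_iter h)"
  proof (rule metric_CauchyI)
    fix e :: real assume "0 < e"
    then obtain N where N: "\<And>n. n \<ge> N \<Longrightarrow> \<bar>sqrt_bound n - 1\<bar> < e / 2"
      using LIMSEQ_D[OF sqrt_bound_tendsto, of "e / 2"] by auto
    have *: "dist (sqrt_iter h n) (sqrt_iter h N) < e / 2" if "n \<ge> N" for n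
      using b[of N "n - N"] that N[of N] sqrt_bound_range[of n] by (simp add: dist_norm abs_if split: if_splits)
    show "\<exists>M. \<forall>m\<ge>M. \<forall>n\<ge>M. dist (sqrt_iter h m) (sqrt_iter h n) < e"
      using * dist_triangle_half_l by blast
  qed
  then show ?thesis by (rule Cauchy_convergent)
qed

text \<open>In the unitization the relation for \<open>q\<close> reads (1 - q)^2 = 1 - h, so
  \<open>q\<close> is 1 minus a square root of 1 - h, expressed without a unit. This form survives
  homomorphisms that are not unital.\<close>

lemma quasi_sqrt:
  fixes h :: "'a::cstar_algebra"
  assumes "norm h \<le> 1" "star h = h"
  obtains q where "sqrt_iter h \<longlonglongrightarrow> q" "norm q \<le> 1" "star q = q" "q + q - q * q = h"
    "\<And>z. z * h = h * z \<Longrightarrow> z * q = q * z"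
proof -
  obtain q where q: "sqrt_iter h \<longlonglongrightarrow> q"
    using sqrt_iter_convergent[OF assms(1)] by (auto simp: convergent_def)
  have "norm (sqrt_iter h n) \<le> 1" for n
    using sqrt_iter_norm[OF assms(1), of n] sqrt_bound_range[of n] by linarith
  then have 1: "norm q \<le> 1"
    using q tendsto_norm LIMSEQ_le_const2 by metis
  have "star (sqrt_iter h n) = sqrt_iter h n" for n
    by (induction n) (simp_all add: star_zero star_scaleR star_add star_mult assms)
  then have 2: "star q = q"
    using bounded_linear.tendsto[OF bounded_linear_star q] q LIMSEQ_unique by auto
  have "(\<lambda>n. (1/2) *\<^sub>R (h + sqrt_iter h n * sqrt_iter h n)) \<longlonglongrightarrow> (1/2) *\<^sub>R (h + q * q)"
    by (intro tendsto_intros q)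
  moreover have "(\<lambda>n. sqrt_iter h (Suc n)) \<longlonglongrightarrow> q"
    using q by (rule LIMSEQ_Suc)
  ultimately have "q = (1/2) *\<^sub>R (h + q * q)"
    by (simp add: LIMSEQ_unique)
  then have "q + q = h + q * q"
    using scaleR_half_double[of "h + q * q"] by (metis scaleR_add_right)
  then have 3: "q + q - q * q = h" by simp
  have 4: "z * q = q * z" if "z * h = h * z" for z
  proof -
    have "(\<lambda>n. z * sqrt_iter h n) \<longlonglongrightarrow> z * q" "(\<lambda>n. sqrt_iter h n * z) \<longlonglongrightarrow> q * z"
      by (intro tendsto_intros q)+
    then show ?thesis
      using sqrt_iter_commute[OF that] LIMSEQ_unique by auto
  qed
  show ?thesis using that q 1 2 3 4 by blast
qed

section \<open>Positivity in unital C*-algebras\<close>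

text \<open>The spectrum of a selfadjoint \<open>h\<close> lies in [0, 2t] exactly when the norm
  inequality holds. In this encoding sums and limits are handled by the triangle inequality;
  agreement with \<open>positive\<close> is the outcome of the section.\<close>

definition psd :: "'a::{cstar_algebra, monoid_mult} \<Rightarrow> bool" where
  "psd h \<longleftrightarrow> star h = h \<and> (\<exists>t. norm (t *\<^sub>R 1 - h) \<le> t)"

lemma star_one [simp]: "star (1::'a::{cstar_algebra, monoid_mult}) = 1"
  by (metis mult_1_right mult_1_left star_mult star_star)

text \<open>The algebra may be zero, so the norm of \<open>1\<close> is 0 or 1 and only an
  inequality holds in general.\<close>

lemma norm_one_le: "norm (1::'a::{cstar_algebra, monoid_mult}) \<le> 1"
proof -
  have "(norm (1::'a))\<^sup>2 = norm (1::'a)"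
    using cstar_identity[of "1::'a"] by simp
  then show ?thesis
    by (metis power2_eq_square mult_cancel_left1 mult_cancel_right1 order.refl zero_le_one)
qed

lemma norm_scaleR_one_le: "0 \<le> t \<Longrightarrow> norm (t *\<^sub>R (1::'a::{cstar_algebra, monoid_mult})) \<le> t"
  using norm_one_le[where 'a='a] by (simp add: mult_left_le)

lemma norm_diff_scaleR_one:
  "norm (t *\<^sub>R 1 - h) \<le> t \<Longrightarrow> t \<le> u \<Longrightarrow> norm (u *\<^sub>R 1 - (h::'a::{cstar_algebra, monoid_mult})) \<le> u"
proof -
  assume a: "norm (t *\<^sub>R 1 - h) \<le> t" "t \<le> u"
  have "u *\<^sub>R 1 - h = (u - t) *\<^sub>R 1 + (t *\<^sub>R 1 - h)" by (simp add: algebra_simps)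
  then have "norm (u *\<^sub>R 1 - h) \<le> norm ((u - t) *\<^sub>R (1::'a)) + norm (t *\<^sub>R 1 - h)"
    by (metis norm_triangle_ineq)
  then show ?thesis using a norm_scaleR_one_le[of "u - t", where 'a='a] by linarith
qed

lemma psd_star: "psd h \<Longrightarrow> star h = h"
  by (simp add: psd_def)

lemma psd_nonneg_one: "0 \<le> c \<Longrightarrow> psd (c *\<^sub>R 1)"
  by (auto simp: psd_def star_scaleR intro!: exI[of _ c])

lemma psd_zero [simp]: "psd 0"
  using psd_nonneg_one[of 0] by simp

lemma psd_norm_minus: "star h = h \<Longrightarrow> norm h \<le> c \<Longrightarrow> psd (c *\<^sub>R 1 - h)"
  by (auto simp: psd_def star_scaleR star_diff intro!: exI[of _ c])

lemma psd_add: "psd h \<Longrightarrow> psd k \<Longrightarrow> psd (h + k)"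
proof -
  assume "psd h" "psd k"
  then obtain t u where "norm (t *\<^sub>R 1 - h) \<le> t" "norm (u *\<^sub>R 1 - k) \<le> u" "star (h + k) = h + k"
    by (auto simp: psd_def star_add)
  moreover have "norm ((t + u) *\<^sub>R 1 - (h + k)) \<le> norm (t *\<^sub>R 1 - h) + norm (u *\<^sub>R 1 - k)"
    using norm_triangle_ineq[of "t *\<^sub>R 1 - h" "u *\<^sub>R 1 - k"] by (simp add: algebra_simps)
  ultimately show ?thesis unfolding psd_def by (intro conjI exI[of _ "t + u"]) simp_all
qed

lemma psd_sum: "(\<And>i. i \<in> I \<Longrightarrow> psd (f i)) \<Longrightarrow> psd (\<Sum>i\<in>I. f i)"
  by (induction I rule: infinite_finite_induct) (auto intro: psd_add)

lemma psd_scaleR: "psd h \<Longrightarrow> 0 \<le> c \<Longrightarrow> psd (c *\<^sub>R h)"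
proof -
  assume "psd h" "0 \<le> c"
  then obtain t where "norm (t *\<^sub>R 1 - h) \<le> t" and s: "star h = h" by (auto simp: psd_def)
  then have "norm (c *\<^sub>R (t *\<^sub>R 1 - h)) \<le> c * t" using \<open>0 \<le> c\<close> by (simp add: mult_left_mono)
  then show ?thesis using s unfolding psd_def
    by (intro conjI exI[of _ "c * t"]) (simp_all add: star_scaleR scaleR_diff_right)
qed

text \<open>Since k = 1 - h/t has norm at most 1, it has a quasi-root \<open>q\<close>, and
  \<open>sqrt t *\<^sub>R (1 - q)\<close> squares to \<open>h\<close>. The approximating sequence is
  part of the conclusion so that roots of elements of A can later be located inside A.\<close>

lemma psd_sqrt_limit:
  fixes h :: "'a::{cstar_algebra, monoid_mult}"
  assumes "psd h"
  obtains t s where "0 < t" "star s = s" "psd s" "s * s = h" "\<And>z. z * h = h * z \<Longrightarrow> z * s = s * z"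
    "(\<lambda>n. sqrt t *\<^sub>R (1 - sqrt_iter (1 - (1/t) *\<^sub>R h) n)) \<longlonglongrightarrow> s"
proof -
  obtain t0 where "norm (t0 *\<^sub>R 1 - h) \<le> t0" "star h = h" using assms by (auto simp: psd_def)
  \<comment> \<open>Adding 1 keeps the inequality and makes division by \<open>t\<close> possible
    even if the given witness is 0.\<close>
  moreover define t where "t = t0 + 1"
  ultimately have t: "norm (t *\<^sub>R 1 - h) \<le> t" "0 < t" "star h = h"
    using norm_diff_scaleR_one[of t0 h t] norm_ge_zero[of "t0 *\<^sub>R 1 - h"] by linarith+
  define k where "k = 1 - (1/t) *\<^sub>R h"
  have "k = (1/t) *\<^sub>R (t *\<^sub>R 1 - h)" using t by (simp add: k_def scaleR_diff_right)
  then have "norm k = norm (t *\<^sub>R 1 - h) / t" using t by simp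
  then have "norm k \<le> 1" using t by (simp add: divide_le_eq_1)
  moreover have "star k = k" using t by (simp add: k_def star_diff star_scaleR)
  ultimately obtain q where q: "norm q \<le> 1" "star q = q" "q + q - q * q = k"
    "\<And>z. z * k = k * z \<Longrightarrow> z * q = q * z" and lim: "sqrt_iter k \<longlonglongrightarrow> q"
    using quasi_sqrt by metis
  define s where "s = sqrt t *\<^sub>R (1 - q)"
  have "(1 - q) * (1 - q) = 1 - k" using q(3) by (simp add: algebra_simps)
  also have "\<dots> = (1/t) *\<^sub>R h" by (simp add: k_def)
  finally have 1: "s * s = h" using t by (simp add: s_def)
  have 2: "star s = s" using q(2) by (simp add: s_def star_scaleR star_diff)
  have "norm (sqrt t *\<^sub>R 1 - s) \<le> sqrt t"
    using q(1) t by (simp add: s_def scaleR_diff_right mult_left_le)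
  then have 3: "psd s" using 2 by (auto simp: psd_def)
  have 4: "z * s = s * z" if "z * h = h * z" for z
  proof -
    have "z * k = k * z" using that by (simp add: k_def algebra_simps)
    then show ?thesis using q(4)[of z] by (simp add: s_def algebra_simps)
  qed
  have "(\<lambda>n. sqrt t *\<^sub>R (1 - sqrt_iter k n)) \<longlonglongrightarrow> s"
    unfolding s_def by (intro tendsto_intros lim)
  then show ?thesis using that t(2) 1 2 3 4 unfolding k_def by blast
qed

lemma psd_sqrt:
  fixes h :: "'a::{cstar_algebra, monoid_mult}"
  assumes "psd h"
  obtains s where "star s = s" "psd s" "s * s = h" "\<And>z. z * h = h * z \<Longrightarrow> z * s = s * z"
  using psd_sqrt_limit[OF assms] by metis

text \<open>Because \<open>s\<close> and \<open>r\<close> commute, u = s + i r satisfies u* u = c 1.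
  The selfadjoint part of \<open>u\<close> is \<open>s\<close>, hence its norm is at most sqrt
  c.\<close>

lemma norm_le_of_square_sum:
  fixes s r :: "'a::{cstar_algebra, monoid_mult}"
  assumes "star s = s" "star r = r" "s * r = r * s" "s * s + r * r = c *\<^sub>R 1" "0 \<le> c"
  shows "norm (s * s) \<le> c"
proof -
  define u where "u = s + \<i> *\<^sub>C r"
  have su: "star u = s - \<i> *\<^sub>C r"
    by (simp add: u_def star_add star_scaleC assms complex_vs.scale_minus_left)
  have "star u * u = s * s + r * r"
    unfolding su unfolding u_def
    using assms(3) by (simp add: algebra_simps mult_scaleC_left mult_scaleC_right scaleC_scaleC
        complex_vs.scale_minus_left scaleC_one)
  then have "(norm u)\<^sup>2 = norm (c *\<^sub>R (1::'a))" using assms(4) cstar_identity[of u] by simp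
  then have n: "(norm u)\<^sup>2 \<le> c" using norm_scaleR_one_le[OF assms(5), where 'a='a] by simp
  have "u + star u = s + s" unfolding su by (simp add: u_def)
  then have "norm s = norm ((1/2) *\<^sub>R (u + star u))" by (simp only: scaleR_half_double)
  also have "\<dots> \<le> norm u" using norm_triangle_ineq[of u "star u"] by (simp add: norm_star)
  finally have "(norm s)\<^sup>2 \<le> c" using n by (meson norm_ge_zero order_trans power_mono)
  then show ?thesis using norm_mult_ineq[of s s] by (simp add: power2_eq_square)
qed

text \<open>The roots of \<open>k\<close> and of c 1 - k commute and their squares add up to c 1, so
  the preceding bound applies.\<close>

lemma psd_le_norm:
  fixes k :: "'a::{cstar_algebra, monoid_mult}"
  assumes "psd k" "psd (c *\<^sub>R 1 - k)" "0 \<le> c"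
  shows "norm k \<le> c"
proof -
  obtain s where s: "star s = s" "s * s = k" "\<And>z. z * k = k * z \<Longrightarrow> z * s = s * z"
    using psd_sqrt[OF assms(1)] by metis
  obtain r where r: "star r = r" "r * r = c *\<^sub>R 1 - k" "\<And>z. z * (c *\<^sub>R 1 - k) = (c *\<^sub>R 1 - k) * z \<Longrightarrow> z * r = r * z"
    using psd_sqrt[OF assms(2)] by metis
  have "s * k = k * s" using s(2) by (metis mult.assoc)
  then have "s * r = r * s" by (intro r(3)) (simp add: algebra_simps)
  then show ?thesis using norm_le_of_square_sum[OF s(1) r(1)] s(2) r(2) assms(3) by simp
qed

text \<open>After scaling \<open>s\<close> to norm 1, the quasi-root \<open>q\<close> of its square
  gives (1 - q)^2 + s^2 = 1. The bound for sums of squares then reads norm(1 - s^2) <= 1, so t = 1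
  is a witness.\<close>

lemma psd_square:
  fixes s :: "'a::{cstar_algebra, monoid_mult}"
  assumes "star s = s"
  shows "psd (s * s)"
proof (cases "s = 0")
  case False
  define s' where "s' = (1 / norm s) *\<^sub>R s"
  have n: "norm s' = 1" "star s' = s'" using False assms by (simp_all add: s'_def star_scaleR)
  have "norm (s' * s') \<le> 1" "star (s' * s') = s' * s'"
    using norm_mult_ineq[of s' s'] n by (simp_all add: star_mult)
  then obtain q where q: "star q = q" "q + q - q * q = s' * s'"
     "\<And>z. z * (s' * s') = (s' * s') * z \<Longrightarrow> z * q = q * z"
    using quasi_sqrt by metis
  have c: "s' * (1 - q) = (1 - q) * s'" using q(3)[of s'] by (simp add: algebra_simps)
  have e: "(1 - q) * (1 - q) + s' * s' = 1 *\<^sub>R 1"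
    unfolding q(2)[symmetric] by (simp add: algebra_simps)
  have "norm ((1 - q) * (1 - q)) \<le> 1"
    by (rule norm_le_of_square_sum[OF _ n(2) _ e]) (simp_all add: star_diff q(1) c)
  moreover have "(1 - q) * (1 - q) = 1 - s' * s'" using e by (simp add: eq_diff_eq)
  ultimately have "psd (s' * s')" unfolding psd_def
    using n by (intro conjI exI[of _ 1]) (simp_all add: star_mult)
  then have "psd ((norm s * norm s) *\<^sub>R (s' * s'))" by (intro psd_scaleR) simp_all
  moreover have "(norm s * norm s) *\<^sub>R (s' * s') = s * s" using False by (simp add: s'_def)
  ultimately show ?thesis by simp
qed simp

lemma psd_antisym: "psd h \<Longrightarrow> psd (- h) \<Longrightarrow> h = 0"
  using psd_le_norm[of h 0] by simp

lemma psd_mono_norm: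
  assumes "psd x" "psd (y - x)" shows "norm x \<le> norm y"
proof (rule psd_le_norm[OF assms(1)])
  have "star y = y" using psd_star[OF psd_add[OF assms]] by simp
  then have "psd ((y - x) + (norm y *\<^sub>R 1 - y))" by (intro psd_add psd_norm_minus assms) simp_all
  then show "psd (norm y *\<^sub>R 1 - x)" by simp
qed simp

lemma psd_norm_diff:
  fixes h :: "'a::{cstar_algebra, monoid_mult}"
  assumes "psd h" "norm h \<le> t" shows "norm (t *\<^sub>R 1 - h) \<le> t"
proof (rule psd_le_norm)
  show "psd (t *\<^sub>R 1 - h)" by (intro psd_norm_minus psd_star assms)
  show "0 \<le> t" using assms(2) norm_ge_zero[of h] by linarith
qed (simp add: assms(1))

text \<open>A witness may be any number above the norm, so one bound \<open>B\<close> of the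
  sequence serves every term and the inequality passes to the limit.\<close>

lemma psd_limit:
  fixes f :: "nat \<Rightarrow> 'a::{cstar_algebra, monoid_mult}"
  assumes "\<And>n. psd (f n)" "f \<longlonglongrightarrow> h"
  shows "psd h"
proof -
  obtain B where B: "\<And>n. norm (f n) \<le> B"
    using convergent_imp_bounded[OF assms(2)] by (auto simp: bounded_iff)
  have "(\<lambda>n. norm (B *\<^sub>R 1 - f n)) \<longlonglongrightarrow> norm (B *\<^sub>R 1 - h)"
    by (intro tendsto_intros assms)
  then have "norm (B *\<^sub>R 1 - h) \<le> B"
    by (rule LIMSEQ_le_const2) (use psd_norm_diff[OF assms(1) B] in auto)
  moreover have "star h = h"
    using bounded_linear.tendsto[OF bounded_linear_star assms(2)] assms LIMSEQ_unique
    by (auto simp: psd_star)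
  ultimately show ?thesis by (auto simp: psd_def)
qed

lemma psd_selfadj_conj:
  assumes "psd h" "star k = k" "h * k = k * h" shows "psd (k * h * k)"
proof -
  obtain s where s: "star s = s" "s * s = h" "\<And>z. z * h = h * z \<Longrightarrow> z * s = s * z"
    using psd_sqrt[OF assms(1)] by metis
  have "k * s = s * k" using s(3)[of k] assms(3) by simp
  then have "(s * k) * (s * k) = k * h * k" using s(2) by (metis mult.assoc)
  moreover have "star (s * k) = s * k" using s(1) assms(2) \<open>k * s = s * k\<close> by (simp add: star_mult)
  ultimately show ?thesis using psd_square[of "s * k"] by metis
qed

lemma psd_commuting_mult:
  assumes "psd h" "psd k" "h * k = k * h" shows "psd (h * k)"
proof -
  obtain s where s: "star s = s" "s * s = h" "\<And>z. z * h = h * z \<Longrightarrow> z * s = s * z"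
    using psd_sqrt[OF assms(1)] by metis
  have c: "k * s = s * k" using s(3)[of k] assms(3) by simp
  then have "psd (s * k * s)" by (intro psd_selfadj_conj assms(2) s(1) c)
  then show ?thesis using c s(2) by (metis mult.assoc)
qed

section \<open>Absolute values and positivity of elements x* x\<close>

lemma square_zero: "star h = h \<Longrightarrow> h * h = 0 \<Longrightarrow> h = (0::'a::cstar_algebra)"
  using cstar_identity[of h] by simp

text \<open>Here \<open>s\<close> is the absolute value of \<open>h\<close> and \<open>k\<close> its
  negative part; the third relation expresses that the positive and negative parts are orthogonal.
  At this stage only the cube of \<open>k\<close> is seen to be positive, as
  \<open>k * s * k\<close>.\<close>

lemma half_difference_abs:
  fixes h s :: "'a::{cstar_algebra, monoid_mult}"
  assumes "star h = h" "psd s" "s * s = h * h" "h * s = s * h"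
  defines "k \<equiv> (1/2) *\<^sub>R (s - h)"
  shows "star k = k" "h * k = k * h" "h * k = - (k * k)" "psd (k * k * k)"
proof -
  note c = assms(4) and s = psd_star[OF assms(2)] assms(2,3)
  show k: "star k = k" "h * k = k * h"
    using c s assms by (simp_all add: k_def star_scaleR star_diff algebra_simps)
  have k3: "s * k = k * s" using c by (simp_all add: k_def algebra_simps)
  have 1: "h * k = - (k * s)" using c s(3) by (simp add: k_def algebra_simps)
  have "k * k + k * k = k * (2 *\<^sub>R k)" by (simp add: scaleR_2 algebra_simps)
  also have "2 *\<^sub>R k = s - h" by (simp add: k_def)
  also have "k * (s - h) = k * s + k * s" using 1 k(2) by (simp add: algebra_simps)
  finally have "2 *\<^sub>R (k * k) = 2 *\<^sub>R (k * s)" by (simp add: scaleR_2)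
  then have 2: "k * k = k * s" by simp
  then show "h * k = - (k * k)" using 1 by simp
  have "psd (k * s * k)" by (intro psd_selfadj_conj k(1) k3 assms(2))
  then show "psd (k * k * k)" using 2 by (simp add: mult.assoc)
qed

text \<open>Compressing h^3 by the negative part \<open>k\<close> of \<open>h\<close> gives -k^5. It
  is positive by assumption, and k^5 is positive as well, so both vanish. This forces k = 0, and
  \<open>h\<close> equals its absolute value.\<close>

lemma psd_cube:
  fixes h :: "'a::{cstar_algebra, monoid_mult}"
  assumes "star h = h" "psd (h * h * h)"
  shows "psd h"
proof -
  obtain s where s: "star s = s" "psd s" "s * s = h * h" "\<And>z. z * (h * h) = (h * h) * z \<Longrightarrow> z * s = s * z"
    using psd_sqrt[OF psd_square[OF assms(1)]] by metis
  have c: "h * s = s * h" by (rule s(4)) (simp add: mult.assoc)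
  define k where "k = (1/2) *\<^sub>R (s - h)"
  note k = s(2) k_def half_difference_abs[OF assms(1) s(2,3) c, folded k_def]
  have hk: "h * (k * z) = - (k * (k * z))" for z
    using arg_cong[OF k(5), of "\<lambda>x. x * z"] by (simp add: mult.assoc)
  have kh: "k * (h * z) = h * (k * z)" for z
    using arg_cong[OF k(4), of "\<lambda>x. x * z"] by (simp add: mult.assoc)
  have "k * (h * h * h) * k = - (k * (k * k * k) * k)"
    using k(5) by (simp add: hk mult.assoc)
  moreover have "psd (k * (h * h * h) * k)"
    by (intro psd_selfadj_conj assms k(3)) (simp add: mult.assoc kh k(4))
  moreover have "psd (k * (k * k * k) * k)" by (intro psd_selfadj_conj k(3,6)) (simp add: mult.assoc)
  ultimately have "k * (k * k * k) * k = 0" using psd_antisym[of "k * (k * k * k) * k"] by simp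
  \<comment> \<open>A selfadjoint element with zero square is zero; this is applied to k^3, k^2 and
    k in turn.\<close>
  then have "k * k * k * (k * k * k) = 0" using mult_zero_left[of k] by (simp add: mult.assoc[symmetric])
  then have "k * k * k = 0" by (rule square_zero[rotated]) (simp add: star_mult mult.assoc k(3))
  then have "(k * k) * (k * k) = 0" by (simp add: mult.assoc)
  then have "k * k = 0" by (rule square_zero[rotated]) (simp add: star_mult k(3))
  then have "k = 0" by (rule square_zero[rotated, OF _ k(3)])
  then have "s = h" by (simp add: k(2))
  then show ?thesis using k(1) by simp
qed

lemma psd_abs_parts:
  fixes h s :: "'a::{cstar_algebra, monoid_mult}"
  assumes "star h = h" "psd s" "s * s = h * h" "h * s = s * h"
  shows "psd (s - h)" "psd (s + h)"
proof -
  have *: "psd (s - h)" if "star h = h" "s * s = h * h" "h * s = s * h" for h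
  proof -
    note k = half_difference_abs[OF that(1) assms(2) that(2,3)]
    have "psd (2 *\<^sub>R ((1/2) *\<^sub>R (s - h)))" by (rule psd_scaleR[OF psd_cube[OF k(1,4)]]) simp
    then show ?thesis by simp
  qed
  show "psd (s - h)" using *[of h] assms by simp
  show "psd (s + h)" using *[of "- h"] assms by (simp add: star_minus)
qed

text \<open>This replaces the fact that y* y and y y* have the same nonzero spectrum. Powers of t 1
  + y y* are moved through \<open>y\<close> to powers of t 1 + y* y, whose norm is at most t, so
  they grow at most like n t^n. For selfadjoint k the norm of k^(2^m) is the 2^m-th power of the
  norm of k, and a linear factor cannot make up for an exponential one.\<close>

lemma psd_star_mult_swap:
  fixes y :: "'a::{cstar_algebra, monoid_mult}"
  assumes "psd (- (star y * y))"
  shows "psd (- (y * star y))"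
proof -
  \<comment> \<open>With t at least 1 the powers of t increase, which absorbs a shift of the
    exponent in the growth estimate.\<close>
  define t where "t = max 1 (norm (star y * y))"
  define k where "k = t *\<^sub>R 1 + y * star y"
  have t: "1 \<le> t" "norm (- (star y * y)) \<le> t" by (simp_all add: t_def)
  have nt: "norm (t *\<^sub>R 1 + star y * y) \<le> t" using psd_norm_diff[OF assms t(2)] by simp
  define C where "C = norm y * norm y"
  have kn: "k ^ n * y = y * (t *\<^sub>R 1 + star y * y) ^ n" for n
  proof (induction n)
    case (Suc n)
    have "k ^ Suc n * y = k ^ n * (k * y)" by (simp add: power_Suc2 mult.assoc del: power_Suc)
    also have "k * y = y * (t *\<^sub>R 1 + star y * y)" by (simp add: k_def algebra_simps)
    also have "k ^ n * (y * (t *\<^sub>R 1 + star y * y)) = y * ((t *\<^sub>R 1 + star y * y) ^ n * (t *\<^sub>R 1 + star y * y))"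
      using Suc by (metis mult.assoc)
    finally show ?case by (simp add: power_Suc2 del: power_Suc)
  qed simp
  have pw: "norm (z ^ n) \<le> c ^ n" if "norm z \<le> c" for z :: 'a and c n
  proof (induction n)
    case (Suc n)
    then show ?case using that norm_mult_ineq[of z "z ^ n"]
      by simp (meson mult_mono norm_ge_zero order_trans)
  qed (simp add: norm_one_le)
  have d: "norm (k ^ n * (k - t *\<^sub>R 1)) \<le> C * t ^ n" for n
  proof -
    have "k ^ n * (k - t *\<^sub>R 1) = y * ((t *\<^sub>R 1 + star y * y) ^ n * star y)"
      using kn[of n] by (simp add: k_def mult.assoc[symmetric])
    also have "norm \<dots> \<le> norm y * (t ^ n * norm y)"
      using pw[OF nt, of n]
      by (intro order_trans[OF norm_mult_ineq] mult_left_mono) (auto simp: norm_star intro!: mult_right_mono order_trans[OF norm_mult_ineq])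
    finally show ?thesis by (simp add: C_def mult_ac)
  qed
  \<comment> \<open>Each further factor k = t 1 + (k - t 1) multiplies the bound by t and adds one
    term controlled by the previous estimate, hence the linear factor.\<close>
  have g: "norm (k ^ n) \<le> (1 + n * C) * t ^ n" for n
  proof (induction n)
    case (Suc n)
    have "k ^ Suc n = t *\<^sub>R k ^ n + k ^ n * (k - t *\<^sub>R 1)" by (simp add: power_Suc2 algebra_simps del: power_Suc)
    then have "norm (k ^ Suc n) \<le> t * norm (k ^ n) + C * t ^ n"
      using norm_triangle_ineq[of "t *\<^sub>R k ^ n" "k ^ n * (k - t *\<^sub>R 1)"] d[of n] t by simp
    also have "t * norm (k ^ n) \<le> t * ((1 + n * C) * t ^ n)" using Suc t by (intro mult_left_mono) auto
    also have "C * t ^ n \<le> C * t ^ Suc n" using t by (intro mult_left_mono power_increasing) (auto simp: C_def)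
    finally show ?case by (simp add: algebra_simps)
  qed (simp add: norm_one_le)
  have sk: "star k = k" by (simp add: k_def star_add star_scaleR star_mult star_star)
  have skn: "star (k ^ n) = k ^ n" for n
    by (induction n) (simp_all add: star_mult sk power_commutes)
  have nk: "norm (k ^ (2 ^ m)) = norm k ^ (2 ^ m)" for m
  proof (induction m)
    case (Suc m)
    have "norm (k ^ (2 ^ Suc m)) = norm (star (k ^ (2 ^ m)) * k ^ (2 ^ m))"
      by (simp add: skn power_add[symmetric] mult_2)
    also have "\<dots> = (norm k ^ (2 ^ m))\<^sup>2" by (simp add: cstar_identity Suc)
    finally show ?case by (simp add: power_mult[symmetric] mult.commute)
  qed simp
  have "norm k \<le> t"
  proof (rule ccontr)
    assume "\<not> norm k \<le> t"
    moreover define x where "x = norm k / t - 1"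
    ultimately have x: "norm k = t * (1 + x)" "0 < x"
      using t(1) by (simp_all add: less_divide_eq)
    have "(1 + x) ^ (2 ^ m) \<le> 1 + (2 ^ m) * C" for m
      using g[of "2 ^ m"] t by (simp add: nk x(1) power_mult_distrib mult.commute)
    \<comment> \<open>Bernoulli's inequality is squared to obtain a term quadratic in 2^m, which
      exceeds the linear upper bound for large m.\<close>
    moreover have "1 + 2 ^ Suc m * x + (2 ^ m * x)\<^sup>2 \<le> (1 + x) ^ (2 ^ Suc m)" for m
    proof -
      have "1 + real (2 ^ m) * x \<le> (1 + x) ^ (2 ^ m)" using x by (intro Bernoulli_inequality) simp
      then have "(1 + real (2 ^ m) * x)\<^sup>2 \<le> ((1 + x) ^ (2 ^ m))\<^sup>2" using x by (intro power_mono) simp_all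
      then show ?thesis by (simp only: power_mult[symmetric]) (simp add: power2_eq_square power_mult algebra_simps)
    qed
    ultimately have *: "1 + 2 ^ Suc m * x + (2 ^ m * x)\<^sup>2 \<le> 1 + 2 ^ Suc m * C" for m
      using order_trans[of _ "(1 + x) ^ (2 ^ Suc m)"] by blast
    have "2 ^ m * (x * x) \<le> 2 * C" for m
    proof -
      have "2 ^ m * (2 ^ m * (x * x)) \<le> 2 ^ m * (2 * C)"
      proof -
        have "0 \<le> 2 ^ Suc m * x" using x(2) by simp
        then have "(2 ^ m * x)\<^sup>2 \<le> 2 ^ Suc m * C" using *[of m] by linarith
        then show ?thesis by (simp add: power2_eq_square mult_ac)
      qed
      then show ?thesis by (simp only: mult_le_cancel_left_pos zero_less_power zero_less_numeral)
    qed
    then have "2 ^ m \<le> 2 * C / (x * x)" for m using x by (simp add: field_simps)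
    moreover obtain m where "2 * C / (x * x) < 2 ^ m" using real_arch_pow[of 2 "2 * C / (x * x)"] by auto
    ultimately show False by (meson not_less)
  qed
  then show ?thesis unfolding psd_def k_def
    by (intro conjI exI[of _ t]) (simp_all add: star_minus star_mult star_star)
qed

lemma selfadj_parts:
  fixes x :: "'a::cstar_algebra"
  obtains h k where "star h = h" "star k = k" "x = h + \<i> *\<^sub>C k"
    "star x = h - \<i> *\<^sub>C k" "norm h \<le> norm x" "norm k \<le> norm x"
proof -
  define h where "h = (1/2) *\<^sub>R (x + star x)"
  define k where "k = (1/2) *\<^sub>R ((- \<i>) *\<^sub>C (x - star x))"
  have 1: "star h = h" by (simp add: h_def star_scaleR star_add star_star add.commute)
  have 2: "star k = k" by (simp add: k_def star_scaleR star_scaleC star_diff star_star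
       complex_vs.scale_minus_left complex_vs.scale_right_diff_distrib)
  have *: "\<i> *\<^sub>C k = (1/2) *\<^sub>R (x - star x)"
    by (simp add: k_def scaleR_scaleC scaleC_scaleC)
  have 3: "x = h + \<i> *\<^sub>C k" "star x = h - \<i> *\<^sub>C k"
    unfolding * h_def by (simp_all add: scaleR_add_right[symmetric] scaleR_diff_right[symmetric] scaleR_half_double)
  have 4: "norm h \<le> norm x" using norm_triangle_ineq[of x "star x"] by (simp add: h_def norm_star)
  have 5: "norm k \<le> norm x" using norm_triangle_ineq4[of x "star x"] by (simp add: k_def norm_star norm_scaleC)
  show ?thesis using that 1 2 3 4 5 by blast
qed

text \<open>With \<open>k\<close> the negative part of x* x and y = x k, the product y* y equals
  -k^3. The sum y* y + y y* is twice a sum of selfadjoint squares, and y y* is negative by the swap,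
  so y* y is positive and negative at once. Hence k = 0.\<close>

lemma psd_star_mult_self:
  fixes x :: "'a::{cstar_algebra, monoid_mult}"
  shows "psd (star x * x)"
proof -
  define h where "h = star x * x"
  have sh: "star h = h" by (simp add: h_def star_mult star_star)
  obtain s where s: "star s = s" "psd s" "s * s = h * h" "\<And>z. z * (h * h) = (h * h) * z \<Longrightarrow> z * s = s * z"
    using psd_sqrt[OF psd_square[OF sh]] by metis
  have c: "h * s = s * h" by (rule s(4)) (simp add: mult.assoc)
  define k where "k = (1/2) *\<^sub>R (s - h)"
  note k = half_difference_abs[OF sh s(2,3) c, folded k_def]
  define y where "y = x * k"
  have "star y * y = k * h * k" using k(1) by (simp add: y_def star_mult h_def mult.assoc)
  also have "k * h * k = - (k * k * k)" using k(3) by (simp add: mult.assoc)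
  finally have yy: "star y * y = - (k * k * k)" .
  then have n: "psd (- (star y * y))" using k(4) by simp
  obtain a b where ab: "star a = a" "star b = b" "y = a + \<i> *\<^sub>C b" "star y = a - \<i> *\<^sub>C b"
    using selfadj_parts[of y] by metis
  have "star y * y + y * star y = 2 *\<^sub>R (a * a + b * b)"
    unfolding ab(4) unfolding ab(3)
    by (simp add: algebra_simps mult_scaleC_left mult_scaleC_right scaleC_scaleC
        complex_vs.scale_minus_left scaleC_one scaleR_2)
  moreover have "psd (2 *\<^sub>R (a * a + b * b))" by (intro psd_scaleR psd_add psd_square ab) simp
  ultimately have "psd ((star y * y + y * star y) + - (y * star y))"
    using psd_add[OF _ psd_star_mult_swap[OF n], of "star y * y + y * star y"] by simp
  then have "psd (star y * y)" by simp
  then have "star y * y = 0" using n by (rule psd_antisym)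
  then have "k * k * k = 0" using yy by simp
  then have "(k * k) * (k * k) = 0" by (simp add: mult.assoc)
  then have "k * k = 0" by (rule square_zero[rotated]) (simp add: star_mult k(1))
  then have "k = 0" by (rule square_zero[rotated, OF _ k(1)])
  then have "s = h" by (simp add: k_def)
  then show ?thesis using s(2) by (simp add: h_def)
qed

lemma positive_iff_psd: "positive h \<longleftrightarrow> psd (h::'a::{cstar_algebra, monoid_mult})"
  unfolding positive_def using psd_star_mult_self psd_sqrt by metis

lemma psd_conj: "psd h \<Longrightarrow> psd (star z * h * (z::'a::{cstar_algebra, monoid_mult}))"
  by (metis psd_sqrt psd_star_mult_self star_mult mult.assoc)

lemma norm_conj_mono:
  fixes x y z :: "'a::{cstar_algebra, monoid_mult}"
  assumes "psd x" "psd (y - x)"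
  shows "norm (z * x * star z) \<le> norm (z * y * star z)"
proof (rule psd_mono_norm)
  show "psd (z * x * star z)" using psd_conj[OF assms(1), of "star z"] by (simp add: star_star)
  show "psd (z * y * star z - z * x * star z)"
    using psd_conj[OF assms(2), of "star z"] by (simp add: star_star algebra_simps)
qed

section \<open>Elements of a C*-algebra inside its multiplier algebra\<close>

lemma of_alg_add: "of_alg (a + b) = of_alg a + of_alg b"
  by (rule multiplier_eqI) (simp add: algebra_simps)

lemma of_alg_diff: "of_alg (a - b) = of_alg a - of_alg b"
  by (rule multiplier_eqI) (simp add: algebra_simps)

lemma of_alg_scaleC: "of_alg (c *\<^sub>C a) = c *\<^sub>C of_alg a"
  by (rule multiplier_eqI) (simp add: mult_scaleC_left)

lemma of_alg_scaleR: "of_alg (c *\<^sub>R a) = c *\<^sub>R of_alg a"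
  by (rule multiplier_eqI) simp

lemma of_alg_minus: "of_alg (- a) = - of_alg a"
  by (rule multiplier_eqI) simp

lemma of_alg_zero [simp]: "of_alg 0 = 0"
  by (rule multiplier_eqI) simp

lemma of_alg_mult: "of_alg (a * b) = of_alg a * of_alg b"
  by (rule multiplier_eqI) (simp add: mult.assoc)

lemma of_alg_star: "of_alg (star a) = star (of_alg a)"
  by (rule multiplier_eqI) (simp add: star_mult star_star)

lemma of_alg_sum: "of_alg (\<Sum>i\<in>I. f i) = (\<Sum>i\<in>I. of_alg (f i))"
  by (induction I rule: infinite_finite_induct) (simp_all add: of_alg_add)

lemma of_alg_lmult: "m * of_alg a = of_alg (m \<rhd> a)"
  by (rule multiplier_eqI) (simp add: lmult_mult)

lemma of_alg_rmult: "of_alg a * m = of_alg (a \<lhd> m)"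
  by (rule multiplier_eqI) (simp add: mult_lmult)

lemma norm_of_alg: "norm (of_alg a) = norm (a::'a::cstar_algebra)"
proof (rule antisym)
  show "norm (of_alg a) \<le> norm a"
    by (rule norm_multiplier_bound) (simp_all add: norm_mult_ineq)
  have "norm (star a) * norm (star a) = norm (a * star a)"
    using cstar_identity[of "star a"] by (simp add: star_star power2_eq_square)
  also have "\<dots> \<le> norm (of_alg a) * norm (star a)"
    using norm_lmult[of "of_alg a" "star a"] by simp
  finally show "norm a \<le> norm (of_alg a)"
    by (cases "a = 0") (simp_all add: norm_star)
qed

lemma of_alg_eq_iff [simp]: "of_alg a = of_alg b \<longleftrightarrow> a = b"
proof
  assume "of_alg a = of_alg b"
  then have "norm (of_alg (a - b)) = 0" by (simp add: of_alg_diff)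
  then have "norm (a - b) = 0" by (simp only: norm_of_alg)
  then show "a = b" by simp
qed simp

text \<open>The embedding of A into M(A) is isometric and A is complete, so A is norm closed in
  M(A).\<close>

lemma of_alg_limit:
  fixes m :: "'a::cstar_algebra multiplier"
  assumes "(\<lambda>n. of_alg (f n)) \<longlonglongrightarrow> m"
  obtains a where "m = of_alg a" "f \<longlonglongrightarrow> a"
proof -
  have d: "dist (of_alg x) (of_alg y) = dist x y" for x y :: 'a
    by (simp only: dist_norm of_alg_diff[symmetric] norm_of_alg)
  have "Cauchy (\<lambda>n. of_alg (f n))" using assms by (rule LIMSEQ_imp_Cauchy)
  then have "Cauchy f" unfolding Cauchy_def d .
  then obtain a where a: "f \<longlonglongrightarrow> a" using Cauchy_convergent convergentD by blast
  then have "(\<lambda>n. of_alg (f n)) \<longlonglongrightarrow> of_alg a"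
    by (subst (asm) tendsto_dist_iff, subst tendsto_dist_iff) (simp only: d)
  then have "m = of_alg a" using assms LIMSEQ_unique by blast
  then show ?thesis using that a by blast
qed

text \<open>Each iterate is a scalar plus an element of A, and the scalar is exactly
  \<open>sqrt_bound n\<close>. It tends to 1, so the scalar part of 1 minus the iterate disappears
  in the limit and the root lies in A.\<close>

lemma sqrt_in_algebra:
  fixes h :: "'a::cstar_algebra"
  assumes "psd (of_alg h)"
  obtains x where "star x = x" "x * x = h" "psd (of_alg x)"
    "\<And>z. z * of_alg h = of_alg h * z \<Longrightarrow> z * of_alg x = of_alg x * z"
proof -
  obtain t s where s: "0 < t" "star s = s" "psd s" "s * s = of_alg h"
    "\<And>z. z * of_alg h = of_alg h * z \<Longrightarrow> z * s = s * z"
    "(\<lambda>n. sqrt t *\<^sub>R (1 - sqrt_iter (1 - (1/t) *\<^sub>R of_alg h) n)) \<longlonglongrightarrow> s"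
    by (rule psd_sqrt_limit[OF assms]) blast
  let ?q = "sqrt_iter (1 - (1/t) *\<^sub>R of_alg h)"
  have "\<exists>a. ?q n = sqrt_bound n *\<^sub>R 1 + of_alg a" for n
  proof (induction n)
    case (Suc n)
    then obtain a where a: "?q n = sqrt_bound n *\<^sub>R 1 + of_alg a" by blast
    have "?q n * ?q n = (sqrt_bound n * sqrt_bound n) *\<^sub>R 1 + of_alg ((2 * sqrt_bound n) *\<^sub>R a + a * a)"
      unfolding a by (simp add: of_alg_add of_alg_scaleR of_alg_mult algebra_simps scaleR_2[symmetric])
    then have "?q (Suc n) = (1/2) *\<^sub>R (1 - of_alg ((1/t) *\<^sub>R h) +
        ((sqrt_bound n * sqrt_bound n) *\<^sub>R 1 + of_alg ((2 * sqrt_bound n) *\<^sub>R a + a * a)))"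
      by (simp add: of_alg_scaleR)
    also have "\<dots> = sqrt_bound (Suc n) *\<^sub>R 1 +
        of_alg ((1/2) *\<^sub>R ((2 * sqrt_bound n) *\<^sub>R a + a * a - (1/t) *\<^sub>R h))"
      by (simp only: of_alg_scaleR[of "1/2"] of_alg_diff)
        (simp add: algebra_simps add_divide_distrib)
    finally show ?case by blast
  qed (auto intro: exI[of _ 0])
  then obtain a where a: "\<And>n. ?q n = sqrt_bound n *\<^sub>R 1 + of_alg (a n)" by metis
  have "(\<lambda>n. sqrt t *\<^sub>R (1 - ?q n) - (sqrt t * (1 - sqrt_bound n)) *\<^sub>R 1) \<longlonglongrightarrow> s - (sqrt t * (1 - 1)) *\<^sub>R 1"
    by (intro tendsto_intros s(6) sqrt_bound_tendsto)
  moreover have "sqrt t *\<^sub>R (1 - ?q n) - (sqrt t * (1 - sqrt_bound n)) *\<^sub>R 1 = of_alg (- sqrt t *\<^sub>R a n)" for n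
    unfolding a by (simp add: of_alg_scaleR of_alg_minus algebra_simps)
  ultimately have "(\<lambda>n. of_alg (- sqrt t *\<^sub>R a n)) \<longlonglongrightarrow> s" by simp
  then obtain x where x: "s = of_alg x" by (rule of_alg_limit)
  show ?thesis
    using that[of x] s(2-5) unfolding x by (simp add: of_alg_star[symmetric] of_alg_mult[symmetric])
qed

lemma psd_of_alg_star_mult: "psd (of_alg (star x * x))"
  by (simp add: of_alg_mult of_alg_star psd_star_mult_self)

lemma psd_of_alg_mult_star: "psd (of_alg (x * star x))"
  using psd_of_alg_star_mult[of "star x"] by (simp add: star_star)

text \<open>The parts are (|y| + y)/2 and (|y| - y)/2. The absolute value is computed inside A and
  has the norm of \<open>y\<close>, which bounds both halves.\<close>

lemma selfadj_decomposition:
  fixes y :: "'a::cstar_algebra"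
  assumes "star y = y"
  obtains p q where "y = p - q" "psd (of_alg p)" "psd (of_alg q)" "norm p \<le> norm y" "norm q \<le> norm y"
proof -
  have "psd (of_alg (y * y))" using psd_of_alg_star_mult[of y] assms by simp
  then obtain s where s: "star s = s" "s * s = y * y" "psd (of_alg s)"
    "\<And>z. z * of_alg (y * y) = of_alg (y * y) * z \<Longrightarrow> z * of_alg s = of_alg s * z"
    using sqrt_in_algebra by blast
  have c: "of_alg y * of_alg s = of_alg s * of_alg y"
    by (rule s(4)) (simp add: of_alg_mult mult.assoc)
  have e: "of_alg s * of_alg s = of_alg y * of_alg y" "star (of_alg y) = of_alg y"
    using s(2) assms by (simp_all add: of_alg_mult[symmetric] of_alg_star[symmetric])
  have "(norm s)\<^sup>2 = (norm y)\<^sup>2"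
    using cstar_identity[of s] cstar_identity[of y] s(1,2) assms by simp
  then have n: "norm s = norm y" by simp
  have 1: "psd (of_alg ((1/2) *\<^sub>R (s + y)))" "psd (of_alg ((1/2) *\<^sub>R (s - y)))"
    unfolding of_alg_scaleR of_alg_add of_alg_diff
    by (intro psd_scaleR psd_abs_parts[OF e(2) s(3) e(1) c] divide_nonneg_nonneg; simp)+
  have 2: "y = (1/2) *\<^sub>R (s + y) - (1/2) *\<^sub>R (s - y)"
    using scaleR_half_double[of y] by (simp add: algebra_simps)
  have 3: "norm ((1/2) *\<^sub>R (s + y)) \<le> norm y" "norm ((1/2) *\<^sub>R (s - y)) \<le> norm y"
    using norm_triangle_ineq[of s y] norm_triangle_ineq4[of s y] n by simp_all
  show ?thesis using that[OF 2 1 3] .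
qed

section \<open>Star homomorphisms\<close>

lemma
  assumes "star_hom \<psi>"
  shows star_hom_add: "\<psi> (a + b) = \<psi> a + \<psi> b"
    and star_hom_scaleC: "\<psi> (c *\<^sub>C a) = c *\<^sub>C \<psi> a"
    and star_hom_mult: "\<psi> (a * b) = \<psi> a * \<psi> b"
    and star_hom_star: "\<psi> (star a) = star (\<psi> a)"
  using assms unfolding star_hom_def Vector_Spaces.linear_iff by auto

lemma star_hom_scaleR: "star_hom \<psi> \<Longrightarrow> \<psi> (c *\<^sub>R a) = c *\<^sub>R \<psi> a"
  by (simp add: scaleR_scaleC star_hom_scaleC)

lemma star_hom_zero: "star_hom \<psi> \<Longrightarrow> \<psi> 0 = 0"
  using star_hom_scaleR[of \<psi> 0 0] by simp

lemma star_hom_diff: "star_hom \<psi> \<Longrightarrow> \<psi> (a - b) = \<psi> a - \<psi> b"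
  using star_hom_add[of \<psi> "a - b" b] by simp

lemma star_hom_sum: "star_hom \<psi> \<Longrightarrow> \<psi> (\<Sum>i\<in>I. f i) = (\<Sum>i\<in>I. \<psi> (f i))"
  by (induction I rule: infinite_finite_induct) (simp_all add: star_hom_add star_hom_zero)

lemma star_homI:
  assumes "\<And>a b. \<psi> (a + b) = \<psi> a + \<psi> b" "\<And>c a. \<psi> (c *\<^sub>C a) = c *\<^sub>C \<psi> a"
    "\<And>a b. \<psi> (a * b) = \<psi> a * \<psi> b" "\<And>a. \<psi> (star a) = star (\<psi> a)"
  shows "star_hom \<psi>"
  unfolding star_hom_def Vector_Spaces.linear_iff
  by (intro conjI allI assms complex_vs.vector_space_axioms)

lemma star_hom_of_alg: "star_hom \<psi> \<Longrightarrow> star_hom (\<lambda>a. of_alg (\<psi> a))"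
  by (rule star_homI) (simp_all add: star_hom_add star_hom_scaleC star_hom_mult star_hom_star
    of_alg_add of_alg_scaleC of_alg_mult of_alg_star)

text \<open>For \<open>b\<close> of norm 1, the quasi-root \<open>q\<close> of b* b is carried to
  the codomain, where 1 - \<psi>(b* b) becomes the square of 1 - \<psi>(q). Thus 0 <= \<psi>(b* b)
  <= 1 although \<psi> need not respect units.\<close>

lemma star_hom_norm_le:
  fixes \<psi> :: "'a::cstar_algebra \<Rightarrow> 'b::{cstar_algebra, monoid_mult}"
  assumes "star_hom \<psi>"
  shows "norm (\<psi> a) \<le> norm a"
proof (cases "a = 0")
  case False
  define b where "b = (1 / norm a) *\<^sub>R a"
  have nb: "norm b = 1" using False by (simp add: b_def)
  define h where "h = star b * b"
  have "norm h \<le> 1" "star h = h" using nb by (simp_all add: h_def cstar_identity star_mult star_star)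
  then obtain q where q: "star q = q" "q + q - q * q = h" using quasi_sqrt by metis
  have s: "star (1 - \<psi> q) = 1 - \<psi> q"
    using q(1) by (simp add: star_diff star_hom_star[OF assms, symmetric])
  have "(1 - \<psi> q) * (1 - \<psi> q) = 1 - \<psi> (q + q - q * q)"
    by (simp add: star_hom_add[OF assms] star_hom_diff[OF assms] star_hom_mult[OF assms] algebra_simps)
  then have "psd (1 *\<^sub>R 1 - \<psi> h)" using psd_square[OF s] q(2) by simp
  moreover have "\<psi> h = star (\<psi> b) * \<psi> b" by (simp add: h_def star_hom_mult[OF assms] star_hom_star[OF assms])
  moreover have "psd (star (\<psi> b) * \<psi> b)" by (rule psd_star_mult_self)
  ultimately have "norm (star (\<psi> b) * \<psi> b) \<le> 1" using psd_le_norm[of "\<psi> h" 1] by simp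
  then have "norm (\<psi> b) \<le> 1" by (simp add: cstar_identity power_le_one_iff)
  then show ?thesis using False by (simp add: b_def star_hom_scaleR[OF assms] field_simps)
qed (simp add: star_hom_zero[OF assms])

lemma star_hom_psd:
  fixes \<psi> :: "'a::cstar_algebra \<Rightarrow> 'b::{cstar_algebra, monoid_mult}"
  assumes "star_hom \<psi>" "psd (of_alg h)"
  shows "psd (\<psi> h)"
proof -
  obtain x where "star x = x" "x * x = h" using sqrt_in_algebra[OF assms(2)] by metis
  then show ?thesis using psd_star_mult_self[of "\<psi> x"]
    by (metis star_hom_mult[OF assms(1)] star_hom_star[OF assms(1)])
qed

section \<open>Approximate units\<close>

text \<open>The elements \<open>k ^ i * h\<close> are positive and decrease in i, and their sum up
  to n telescopes to 1 - k^(n+1), which lies below 1. The last one is therefore at most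
  1/(n+1).\<close>

lemma norm_mult_complement_power:
  fixes h :: "'b::{cstar_algebra, monoid_mult}"
  assumes "psd h" "norm h \<le> 1"
  defines "k \<equiv> 1 - h"
  shows "psd (k ^ n)" "norm (k ^ n) \<le> 1" "star (k ^ n) = k ^ n" "norm (k ^ n * h) \<le> 1 / Suc n"
proof -
  have nk: "norm k \<le> 1" using psd_norm_diff[OF assms(1,2)] by (simp add: k_def)
  have sk: "star k = k" using psd_star[OF assms(1)] by (simp add: k_def star_diff)
  have pk: "psd k" using psd_norm_minus[OF psd_star[OF assms(1)] assms(2)] by (simp add: k_def)
  have p: "psd (k ^ n)" for n
  proof (induction n)
    case (Suc n)
    then show ?case using psd_commuting_mult[OF pk Suc] by (simp add: power_commutes)
  qed (use psd_nonneg_one[of 1] in simp)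
  then show "psd (k ^ n)" "star (k ^ n) = k ^ n" by (auto intro: psd_star)
  have n1: "norm (k ^ n) \<le> 1" for n
  proof (induction n)
    case (Suc n)
    then show ?case using nk norm_mult_ineq[of k "k ^ n"] by simp (meson mult_le_one norm_ge_zero order_trans)
  qed (simp add: norm_one_le)
  then show "norm (k ^ n) \<le> 1" .
  have kh: "k * h = h * k" by (simp add: k_def algebra_simps)
  have kn: "k ^ n * h = h * k ^ n" for n
    by (induction n) (simp_all add: mult.assoc, metis kh mult.assoc)
  have ph: "psd (k ^ n * h)" for n by (rule psd_commuting_mult[OF p assms(1) kn])
  have s: "(\<Sum>i<m. k ^ i * h) = 1 - k ^ m" for m
  proof (induction m)
    case (Suc m)
    have "k ^ m * h = k ^ m - k ^ m * k" by (simp add: k_def algebra_simps)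
    then show ?case using Suc by (simp add: power_Suc2 del: power_Suc)
  qed simp
  have d: "psd (k ^ i * h - k ^ (i + j) * h)" for i j
  proof (induction j)
    case (Suc j)
    have "psd (h * (k ^ (i + j) * h))"
      by (rule psd_commuting_mult[OF assms(1) ph]) (metis kn mult.assoc)
    moreover have "h * (k ^ (i + j) * h) = k ^ (i + j) * h - k ^ (i + Suc j) * h"
      unfolding add_Suc_right power_Suc2 by (simp add: k_def kn[unfolded k_def] algebra_simps)
    ultimately show ?case using psd_add[OF Suc] by fastforce
  qed simp
  have "psd ((\<Sum>i<Suc n. k ^ i * h) - (\<Sum>i<Suc n. k ^ n * h))"
    unfolding sum_subtractf[symmetric]
  proof (rule psd_sum)
    fix i assume "i \<in> {..<Suc n}"
    then show "psd (k ^ i * h - k ^ n * h)" using d[of i "n - i"] by simp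
  qed
  then have "psd ((1 - k ^ Suc n) - real (Suc n) *\<^sub>R (k ^ n * h))"
    unfolding s by (simp only: sum_constant_scaleR) simp
  from psd_add[OF this p[of "Suc n"]]
  have "psd (1 *\<^sub>R 1 - real (Suc n) *\<^sub>R (k ^ n * h))" by simp
  moreover have "psd (real (Suc n) *\<^sub>R (k ^ n * h))" by (intro psd_scaleR ph) simp
  ultimately have "norm (real (Suc n) *\<^sub>R (k ^ n * h)) \<le> 1"
    by (intro psd_le_norm) simp_all
  then have "real (Suc n) * norm (k ^ n * h) \<le> 1" by (simp only: norm_scaleR abs_of_nat)
  then show "norm (k ^ n * h) \<le> 1 / Suc n" by (simp add: field_simps)
qed

text \<open>The unit is u = 1 - (1 - h)^n, where h is a normalized sum of the elements a a*. Since a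
  a* lies below c h, the square of the norm of a - u a is at most c times the norm of k^n h k^n,
  which is at most c/(n+1).\<close>

lemma approximate_unit:
  fixes S :: "'a::cstar_algebra set"
  assumes "finite S" "0 < e"
  obtains u where "norm u \<le> 1" "star u = u" "\<And>a. a \<in> S \<Longrightarrow> norm (u * a - a) < e" "\<And>a. a \<in> S \<Longrightarrow> norm (a * u - a) < e"
proof -
  \<comment> \<open>Adding adjoints lets the estimate for a u - a follow from the one for u a* -
    a*.\<close>
  define T where "T = S \<union> star ` S"
  have fT: "finite T" using assms by (simp add: T_def)
  define H where "H = (\<Sum>a\<in>T. a * star a)"
  define c where "c = norm H + 1"
  have c: "0 < c" by (simp add: c_def add_nonneg_pos)
  define h where "h = (1/c) *\<^sub>R of_alg H"
  have ph: "psd h" unfolding h_def H_def of_alg_sum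
    using c by (intro psd_scaleR psd_sum psd_of_alg_mult_star) simp
  have "norm H \<le> c" by (simp add: c_def)
  then have nh: "norm h \<le> 1" using c by (simp add: h_def norm_of_alg)
  define k where "k = 1 - h"
  note kp = norm_mult_complement_power[OF ph nh, folded k_def]
  obtain n where n: "c / e\<^sup>2 < real n" using reals_Archimedean2 by blast
  have "\<exists>u. 1 - k ^ m = of_alg u" for m
  proof (induction m)
    case (Suc m)
    then obtain u where u: "1 - k ^ m = of_alg u" by blast
    have "1 - k ^ Suc m = (1 - k ^ m) + k ^ m * h"
      unfolding power_Suc2 by (simp add: k_def algebra_simps)
    also have "k ^ m * h = of_alg ((1/c) *\<^sub>R (k ^ m \<rhd> H))"
      by (simp add: h_def of_alg_lmult of_alg_scaleR)
    finally show ?case using u by (metis of_alg_add)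
  qed (auto intro: exI[of _ 0])
  then obtain u where u: "1 - k ^ n = of_alg u" by blast
  have su: "star u = u"
    using kp(3)[of n] u by (metis of_alg_eq_iff of_alg_star star_diff star_one)
  have "norm (of_alg u) \<le> 1"
    using psd_norm_diff[OF kp(1,2), of n] u by simp
  then have nu: "norm u \<le> 1" by (simp add: norm_of_alg)
  have T: "norm (u * a - a) < e" if "a \<in> T" for a
  proof -
    have ua: "of_alg (a - u * a) = k ^ n * of_alg a"
      by (simp add: of_alg_diff of_alg_mult u[symmetric] algebra_simps)
    have psa: "psd (of_alg (a * star a))" by (rule psd_of_alg_mult_star)
    have "psd (\<Sum>b\<in>T - {a}. of_alg (b * star b))" by (intro psd_sum psd_of_alg_mult_star)
    then have "psd (of_alg H - of_alg (a * star a))"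
      by (simp add: H_def of_alg_sum sum.remove[OF fT that] of_alg_add)
    from norm_conj_mono[OF psa this, of "k ^ n"]
    have "norm (k ^ n * of_alg (a * star a) * k ^ n) \<le> norm (k ^ n * of_alg H * k ^ n)"
      by (simp add: kp(3))
    also have "k ^ n * of_alg H * k ^ n = c *\<^sub>R (k ^ n * h * k ^ n)" using c by (simp add: h_def)
    also have "norm \<dots> = c * norm (k ^ n * h * k ^ n)" using c by simp
    also have "\<dots> \<le> c * (1 / Suc n * 1)"
      by (rule mult_left_mono[OF order_trans[OF norm_mult_ineq mult_mono[OF kp(4,2)]]]) (use c in simp_all)
    also have "\<dots> < e\<^sup>2"
    proof -
      have "c < real n * e\<^sup>2" using n assms(2) by (simp add: field_simps)
      also have "\<dots> \<le> real (Suc n) * e\<^sup>2" by (intro mult_right_mono) simp_all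
      finally show ?thesis by (simp add: field_simps)
    qed
    finally have "norm (k ^ n * of_alg (a * star a) * k ^ n) < e\<^sup>2" .
    moreover have "k ^ n * of_alg (a * star a) * k ^ n = of_alg (a - u * a) * star (of_alg (a - u * a))"
      unfolding ua star_mult kp(3) of_alg_mult of_alg_star by (simp only: mult.assoc)
    ultimately have "norm (star (star (of_alg (a - u * a))) * star (of_alg (a - u * a))) < e\<^sup>2"
      unfolding star_star by (simp only:)
    then have "(norm (a - u * a))\<^sup>2 < e\<^sup>2"
      by (simp only: cstar_identity norm_star norm_of_alg)
    then have "norm (a - u * a) < e" by (rule power2_less_imp_less) (use assms(2) in simp)
    then show ?thesis by (simp only: norm_minus_commute)
  qed
  have "norm (u * a - a) < e" "norm (a * u - a) < e" if "a \<in> S" for a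
  proof -
    show "norm (u * a - a) < e" using T that by (auto simp: T_def)
    have "star a \<in> T" using that by (simp add: T_def)
    from T[OF this] have "norm (star (u * star a - star a)) < e" by (simp only: norm_star)
    then show "norm (a * u - a) < e" by (simp add: star_diff star_mult star_star su)
  qed
  then show ?thesis using that[of u] nu su by blast
qed

section \<open>Positive functionals separate points\<close>

definition sublinear :: "('b::real_vector \<Rightarrow> real) \<Rightarrow> bool" where
  "sublinear q \<longleftrightarrow> (\<forall>x y. q (x + y) \<le> q x + q y) \<and> (\<forall>c x. 0 < c \<longrightarrow> q (c *\<^sub>R x) \<le> c * q x) \<and> q 0 = 0"

lemma sublinear_scaleR:
  assumes "sublinear q" "0 \<le> c" shows "q (c *\<^sub>R x) = c * q x"
proof (cases "c = 0")
  case False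
  then have c: "0 < c" "0 < 1/c" using assms(2) by simp_all
  then have "q (c *\<^sub>R x) \<le> c * q x" "q ((1/c) *\<^sub>R (c *\<^sub>R x)) \<le> (1/c) * q (c *\<^sub>R x)"
    using assms(1) unfolding sublinear_def by blast+
  then show ?thesis using c by (simp add: field_simps)
qed (use assms in \<open>simp add: sublinear_def\<close>)

lemma sublinear_minus: "sublinear q \<Longrightarrow> - q (- x) \<le> q x"
  unfolding sublinear_def by (metis add.right_inverse add.commute neg_le_iff_le minus_le_iff le_add_same_cancel1 add_le_cancel_left neg_eq_iff_add_eq_0 add_minus_cancel)

text \<open>The standard modification that stays below \<open>q\<close> and drops to -q(y) at -y. A
  minimal sublinear functional is unchanged by it for every \<open>y\<close>, which makes it odd and
  so linear.\<close>

definition sublinear_shift :: "('b::real_vector \<Rightarrow> real) \<Rightarrow> 'b \<Rightarrow> 'b \<Rightarrow> real" where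
  "sublinear_shift q y x = (INF t\<in>{0..}. q (x + t *\<^sub>R y) - t * q y)"

lemma
  assumes q: "sublinear q"
  shows sublinear_sublinear_shift: "sublinear (sublinear_shift q y)"
    and sublinear_shift_le: "sublinear_shift q y x \<le> q x"
    and sublinear_shift_minus: "sublinear_shift q y (- y) \<le> - q y"
proof -
  have tri: "q (x + y) \<le> q x + q y" for x y using q by (simp add: sublinear_def)
  have lb: "- q (- x) \<le> q (x + t *\<^sub>R y) - t * q y" if "0 \<le> t" for x t
    using tri[of "x + t *\<^sub>R y" "- x"] sublinear_scaleR[OF q that, of y] by simp
  have le: "sublinear_shift q y x \<le> q (x + t *\<^sub>R y) - t * q y" if "0 \<le> t" for x t
    unfolding sublinear_shift_def using lb that by (intro cINF_lower bdd_belowI2[where m = "- q (- x)"]) auto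
  have ge: "r \<le> sublinear_shift q y x" if "\<And>t. 0 \<le> t \<Longrightarrow> r \<le> q (x + t *\<^sub>R y) - t * q y" for r x
    unfolding sublinear_shift_def using that by (intro cINF_greatest) auto
  show le0: "sublinear_shift q y x \<le> q x" for x using le[of 0 x] by simp
  show "sublinear_shift q y (- y) \<le> - q y" using le[of 1 "- y"] q by (simp add: sublinear_def)
  have "sublinear_shift q y (x1 + x2) \<le> sublinear_shift q y x1 + sublinear_shift q y x2" for x1 x2
  proof -
    have *: "sublinear_shift q y (x1 + x2) \<le> (q (x1 + t *\<^sub>R y) - t * q y) + (q (x2 + u *\<^sub>R y) - u * q y)"
      if "0 \<le> t" "0 \<le> u" for t u
      using le[of "t + u" "x1 + x2"] tri[of "x1 + t *\<^sub>R y" "x2 + u *\<^sub>R y"] that by (simp add: algebra_simps)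
    have "sublinear_shift q y (x1 + x2) - (q (x2 + u *\<^sub>R y) - u * q y) \<le> sublinear_shift q y x1"
      if "0 \<le> u" for u
      using *[OF _ that] by (intro ge) (simp add: algebra_simps)
    then have "sublinear_shift q y (x1 + x2) - sublinear_shift q y x1 \<le> sublinear_shift q y x2"
      by (intro ge) (simp add: algebra_simps)
    then show ?thesis by simp
  qed
  moreover have "sublinear_shift q y (c *\<^sub>R x) \<le> c * sublinear_shift q y x" if "0 < c" for c x
  proof -
    have "sublinear_shift q y (c *\<^sub>R x) / c \<le> sublinear_shift q y x"
    proof (rule ge)
      fix t :: real assume "0 \<le> t"
      then have "sublinear_shift q y (c *\<^sub>R x) \<le> q (c *\<^sub>R (x + t *\<^sub>R y)) - (c * t) * q y"
        using le[of "c * t" "c *\<^sub>R x"] that by (simp add: algebra_simps)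
      also have "q (c *\<^sub>R (x + t *\<^sub>R y)) = c * q (x + t *\<^sub>R y)" using that by (intro sublinear_scaleR q) simp
      finally show "sublinear_shift q y (c *\<^sub>R x) / c \<le> q (x + t *\<^sub>R y) - t * q y"
        using that by (simp add: field_simps)
    qed
    then show ?thesis using that by (simp add: field_simps)
  qed
  moreover have "sublinear_shift q y 0 = 0"
  proof (rule antisym)
    show "sublinear_shift q y 0 \<le> 0" using le0[of 0] q by (simp add: sublinear_def)
    show "0 \<le> sublinear_shift q y 0"
      using sublinear_scaleR[OF q] by (intro ge) simp
  qed
  ultimately show "sublinear (sublinear_shift q y)" by (simp add: sublinear_def)
qed

text \<open>Every member of the chain is bounded below at \<open>x\<close> by -p(-x), so the infimum
  is finite. Comparability is what allows the smaller of two members to be used for both summands in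
  subadditivity.\<close>

lemma sublinear_chain_bound:
  assumes C: "C \<noteq> {}" "\<And>q. q \<in> C \<Longrightarrow> sublinear q \<and> (\<forall>x. q x \<le> p x)"
    and tot: "\<And>q r. q \<in> C \<Longrightarrow> r \<in> C \<Longrightarrow> (\<forall>x. q x \<le> r x) \<or> (\<forall>x. r x \<le> q x)"
  shows "sublinear (\<lambda>x. INF q\<in>C. q x) \<and> (\<forall>q\<in>C. \<forall>x. (INF q\<in>C. q x) \<le> q x)"
proof -
  define u where "u = (\<lambda>x. INF q\<in>C. q x)"
  have lb: "- p (- x) \<le> q x" if "q \<in> C" for q x
    using sublinear_minus[of q x] C(2)[OF that] by (meson neg_le_iff_le order_trans)
  have le: "u x \<le> q x" if "q \<in> C" for q x
    unfolding u_def using lb that by (intro cINF_lower bdd_belowI2) auto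
  have ge: "r \<le> u x" if "\<And>q. q \<in> C \<Longrightarrow> r \<le> q x" for r x
    unfolding u_def using C(1) that by (intro cINF_greatest)
  have "u (x + y) \<le> u x + u y" for x y
  proof -
    have *: "u (x + y) \<le> q x + r y" if "q \<in> C" "r \<in> C" for q r
    proof -
      have a: "u (x + y) \<le> q x + q y" "u (x + y) \<le> r x + r y"
        using le[OF that(1)] le[OF that(2)] C(2)[OF that(1)] C(2)[OF that(2)]
        unfolding sublinear_def by (meson order_trans)+
      show ?thesis using tot[OF that] a by (meson add_le_cancel_left add_le_cancel_right order_trans)
    qed
    have "u (x + y) - r y \<le> u x" if "r \<in> C" for r
      using *[OF _ that] by (intro ge) (simp add: algebra_simps)
    then have "u (x + y) - u x \<le> u y" by (intro ge) (simp add: algebra_simps)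
    then show ?thesis by simp
  qed
  moreover have "u (c *\<^sub>R x) \<le> c * u x" if "0 < c" for c x
  proof -
    have "u (c *\<^sub>R x) / c \<le> u x"
    proof (rule ge)
      fix q assume "q \<in> C"
      then have "u (c *\<^sub>R x) \<le> c * q x" using le[of q "c *\<^sub>R x"] C(2)[of q] that sublinear_scaleR[of q c x] by simp
      then show "u (c *\<^sub>R x) / c \<le> q x" using that by (simp add: field_simps)
    qed
    then show ?thesis using that by (simp add: field_simps)
  qed
  moreover have "u 0 = 0"
  proof -
    have "(\<lambda>q. q 0) ` C = {0}" using C by (auto simp: sublinear_def image_iff)
    then show ?thesis unfolding u_def by simp
  qed
  ultimately show ?thesis using le by (simp add: sublinear_def u_def)
qed

text \<open>A form of Hahn-Banach: a minimal sublinear functional is linear. The search for it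
  begins below the shift of \<open>p\<close> along \<open>h\<close> instead of below
  \<open>p\<close> itself, which forces f(-h) <= -p(h) and with it equality at
  \<open>h\<close>.\<close>

theorem dominated_linear_functional:
  fixes p :: "'b::real_vector \<Rightarrow> real"
  assumes p: "sublinear p"
  obtains f where "linear f" "\<And>x. f x \<le> p x" "f h = p h"
proof -
  define S where "S = {q. sublinear q \<and> (\<forall>x. q x \<le> sublinear_shift p h x)}"
  define R where "R = (\<lambda>q r :: 'b \<Rightarrow> real. \<forall>x. r x \<le> q x)"
  have "partial_order_on S (relation_of R S)"
    by (rule partial_order_on_relation_ofI) (auto simp: R_def intro: order_trans intro!: ext antisym)
  moreover have "\<exists>u\<in>S. \<forall>q\<in>C. R q u" if C: "C \<in> Chains (relation_of R S)" for C
  proof (cases "C = {}")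
    case True
    then show ?thesis using sublinear_sublinear_shift[OF p] by (auto simp: S_def)
  next
    case False
    have CS: "q \<in> S" if "q \<in> C" for q using C that by (auto simp: Chains_def relation_of_def)
    have "sublinear (\<lambda>x. INF q\<in>C. q x) \<and> (\<forall>q\<in>C. \<forall>x. (INF q\<in>C. q x) \<le> q x)"
      using CS C by (intro sublinear_chain_bound[OF False, where p = "sublinear_shift p h"])
        (auto simp: S_def Chains_def relation_of_def R_def)
    moreover obtain q where q: "q \<in> C" using False by blast
    ultimately show ?thesis using CS[OF q]
      by (intro bexI[of _ "\<lambda>x. INF q\<in>C. q x"]) (auto simp: S_def R_def intro: order_trans)
  qed
  ultimately obtain f where f: "f \<in> S" "\<And>q. q \<in> S \<Longrightarrow> R f q \<Longrightarrow> q = f"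
    using predicate_Zorn[of S R] by blast
  have sf: "sublinear f" and fp: "f x \<le> sublinear_shift p h x" for x using f(1) by (auto simp: S_def)
  have "sublinear_shift f y = f" for y
    using sublinear_sublinear_shift[OF sf] sublinear_shift_le[OF sf] order_trans[OF sublinear_shift_le[OF sf] fp]
    by (intro f(2)) (auto simp: S_def R_def)
  then have neg: "f (- y) = - f y" for y
    using sublinear_shift_minus[OF sf, of y] sublinear_minus[OF sf, of "- y"] by (simp add: antisym)
  have add: "f (x + y) = f x + f y" for x y
  proof (rule antisym)
    show "f (x + y) \<le> f x + f y" using sf by (simp add: sublinear_def)
    have "f (x + y + - y) \<le> f (x + y) + f (- y)" using sf unfolding sublinear_def by blast
    then show "f x + f y \<le> f (x + y)" by (simp add: neg)
  qed
  have "f (c *\<^sub>R x) = c * f x" for c x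
  proof (cases "0 \<le> c")
    case False
    then have "f (- c *\<^sub>R x) = - c * f x" by (intro sublinear_scaleR sf) simp
    then show ?thesis by (simp add: neg)
  qed (rule sublinear_scaleR[OF sf])
  then have "linear f" using add by (intro linearI) simp_all
  moreover have le: "f x \<le> p x" for x using fp sublinear_shift_le[OF p] order_trans by blast
  moreover have "f h = p h"
  proof (rule antisym)
    have "f (- h) \<le> - p h" using fp sublinear_shift_minus[OF p] order_trans by blast
    then show "p h \<le> f h" by (simp add: neg)
  qed (rule le)
  ultimately show ?thesis using that by blast
qed

text \<open>The distance from \<open>Re x\<close> to the negative cone, measured along the unit.\<close>

definition positive_gauge :: "'a::{cstar_algebra, monoid_mult} \<Rightarrow> real" where
  "positive_gauge x = Inf {t. 0 \<le> t \<and> psd (t *\<^sub>R 1 - (1/2) *\<^sub>R (x + star x))}"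

lemma
  fixes x :: "'a::{cstar_algebra, monoid_mult}"
  shows positive_gauge_le: "0 \<le> t \<Longrightarrow> psd (t *\<^sub>R 1 - (1/2) *\<^sub>R (x + star x)) \<Longrightarrow> positive_gauge x \<le> t"
    and positive_gauge_less: "positive_gauge x < t \<Longrightarrow> psd (t *\<^sub>R 1 - (1/2) *\<^sub>R (x + star x))"
    and positive_gauge_le_norm: "positive_gauge x \<le> norm x"
    and positive_gauge_nonneg: "0 \<le> positive_gauge x"
proof -
  let ?S = "{t. 0 \<le> t \<and> psd (t *\<^sub>R 1 - (1/2) *\<^sub>R (x + star x))}"
  have bdd: "bdd_below ?S" by (rule bdd_belowI[of _ 0]) simp
  show le: "positive_gauge x \<le> t" if "0 \<le> t" "psd (t *\<^sub>R 1 - (1/2) *\<^sub>R (x + star x))" for t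
    unfolding positive_gauge_def using bdd that by (intro cInf_lower) auto
  have "norm ((1/2) *\<^sub>R (x + star x)) \<le> norm x"
    using norm_triangle_ineq[of x "star x"] by (simp add: norm_star)
  then have n: "norm x \<in> ?S" unfolding mem_Collect_eq by (auto intro!: psd_norm_minus simp: star_scaleR star_add star_star add.commute)
  then show "positive_gauge x \<le> norm x" using le by blast
  show "0 \<le> positive_gauge x" unfolding positive_gauge_def
  proof (rule cInf_greatest)
    show "?S \<noteq> {}" using n by blast
  qed simp
  assume "positive_gauge x < t"
  then obtain u where "u \<in> ?S" "u < t"
    unfolding positive_gauge_def using n cInf_lessD[of ?S t] by blast
  then have "psd ((u *\<^sub>R 1 - (1/2) *\<^sub>R (x + star x)) + (t - u) *\<^sub>R 1)"
    by (intro psd_add psd_nonneg_one) auto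
  then show "psd (t *\<^sub>R 1 - (1/2) *\<^sub>R (x + star x))" by (simp add: algebra_simps)
qed

lemma sublinear_positive_gauge: "sublinear (positive_gauge :: 'a::{cstar_algebra, monoid_mult} \<Rightarrow> real)"
proof -
  let ?g = "positive_gauge :: 'a \<Rightarrow> real"
  have "?g (x + y) \<le> ?g x + ?g y" for x y
  proof (rule field_le_epsilon)
    fix e :: real assume "0 < e"
    then have "psd ((?g x + e/2) *\<^sub>R 1 - (1/2) *\<^sub>R (x + star x) + ((?g y + e/2) *\<^sub>R 1 - (1/2) *\<^sub>R (y + star y)))"
      by (intro psd_add positive_gauge_less) simp_all
    then show "?g (x + y) \<le> ?g x + ?g y + e"
      using \<open>0 < e\<close> positive_gauge_nonneg[of x] positive_gauge_nonneg[of y] scaleR_half_double[of "e *\<^sub>R (1::'a)"]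
      by (intro positive_gauge_le) (simp_all add: algebra_simps star_add)
  qed
  moreover have "?g (c *\<^sub>R x) \<le> c * ?g x" if "0 < c" for c x
  proof (rule field_le_epsilon)
    fix e :: real assume "0 < e"
    then have "psd (c *\<^sub>R ((?g x + e/c) *\<^sub>R 1 - (1/2) *\<^sub>R (x + star x)))"
      using that by (intro psd_scaleR positive_gauge_less) simp_all
    then have "?g (c *\<^sub>R x) \<le> c * (?g x + e/c)"
      using \<open>0 < e\<close> that positive_gauge_nonneg[of x]
      by (intro positive_gauge_le) (simp_all add: scaleR_diff_right star_scaleR scaleR_add_right mult.commute)
    then show "?g (c *\<^sub>R x) \<le> c * ?g x + e" using that by (simp add: algebra_simps)
  qed
  moreover have "?g 0 = 0"
    using positive_gauge_le_norm[of "0::'a"] positive_gauge_nonneg[of "0::'a"] by simp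
  ultimately show ?thesis by (simp add: sublinear_def)
qed

text \<open>If both gauges vanish, -h and h are limits of positive elements, so both are positive
  and h = 0.\<close>

lemma positive_gauge_pos:
  fixes h :: "'a::{cstar_algebra, monoid_mult}"
  assumes "star h = h" "h \<noteq> 0"
  shows "0 < positive_gauge h \<or> 0 < positive_gauge (- h)"
proof (rule ccontr)
  assume "\<not> ?thesis"
  moreover have "psd (- k)" if "\<not> 0 < positive_gauge k" "star k = k" for k :: 'a
  proof (rule psd_limit)
    have "positive_gauge k < 1 / real (Suc n)" for n using that(1) by (smt (verit) of_nat_0_less_iff zero_less_Suc divide_pos_pos)
    from positive_gauge_less[OF this] that(2)
    show "psd ((1 / real (Suc n)) *\<^sub>R 1 - k)" for n using scaleR_half_double[of k] by (metis)
    have "(\<lambda>n. (1 / real (Suc n)) *\<^sub>R 1 - k) \<longlonglongrightarrow> 0 *\<^sub>R 1 - k"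
      by (intro tendsto_intros) (use LIMSEQ_inverse_real_of_nat in \<open>simp add: inverse_eq_divide\<close>)
    then show "(\<lambda>n. (1 / real (Suc n)) *\<^sub>R 1 - k) \<longlonglongrightarrow> - k" by simp
  qed
  ultimately have "psd (- h)" "psd (- (- h))" using assms(1) star_minus[of h] by force+
  then show False using psd_antisym[of h] assms(2) by simp
qed

text \<open>A real linear functional below the gauge is nonnegative on positive elements and
  vanishes on antiselfadjoint ones, because the gauge is 0 at -x in the one case and at both x and
  -x in the other. The usual complexification is then real on selfadjoint elements and equal to
  \<open>f\<close> there.\<close>

lemma exists_positive_functional_selfadj:
  fixes h :: "'a::{cstar_algebra, monoid_mult}"
  assumes "star h = h" "h \<noteq> 0"
  obtains \<tau> where "positive_functional \<tau>" "\<tau> h \<noteq> 0" "\<And>k. star k = k \<Longrightarrow> \<tau> k \<in> \<real>"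
proof -
  obtain k where k: "0 < positive_gauge k" "k = h \<or> k = - h" using positive_gauge_pos[OF assms] by blast
  obtain f where f: "linear f" "\<And>x::'a. f x \<le> positive_gauge x" "f k = positive_gauge k"
    using dominated_linear_functional[OF sublinear_positive_gauge] by blast
  have neg: "f (- x) = - f x" for x using f(1) by (rule linear_neg)
  have fadd: "f (x + y) = f x + f y" for x y using f(1) by (rule linear_add)
  have fsc: "f (c *\<^sub>R x) = c * f x" for x c using linear_scale[OF f(1)] by simp
  have pos: "0 \<le> f x" if "psd x" for x
  proof -
    have "positive_gauge (- x) \<le> 0"
      using that psd_star[OF that] scaleR_half_double[of "- x"] by (intro positive_gauge_le) (simp_all add: star_minus)
    then show ?thesis using f(2)[of "- x"] by (simp add: neg)
  qed
  have anti: "f x = 0" if "star x = - x" for x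
  proof -
    have "positive_gauge x \<le> 0" "positive_gauge (- x) \<le> 0"
      using that by (auto intro!: positive_gauge_le simp: star_minus)
    then show ?thesis using f(2)[of x] f(2)[of "- x"] by (simp add: neg)
  qed
  have bd: "\<bar>f x\<bar> \<le> norm x" for x
    using f(2)[of x] f(2)[of "- x"] positive_gauge_le_norm[of x] positive_gauge_le_norm[of "- x"] by (simp add: neg)
  define \<tau> where "\<tau> x = complex_of_real (f x) - \<i> * complex_of_real (f (\<i> *\<^sub>C x))" for x
  have tadd: "\<tau> (x + y) = \<tau> x + \<tau> y" for x y
    by (simp add: \<tau>_def fadd scaleC_add_right algebra_simps)
  have tr: "\<tau> (r *\<^sub>R x) = r * \<tau> x" for r x
  proof -
    have "\<i> *\<^sub>C (r *\<^sub>R x) = r *\<^sub>R (\<i> *\<^sub>C x)" by (simp add: scaleR_scaleC scaleC_scaleC mult.commute)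
    then show ?thesis by (simp add: \<tau>_def fsc algebra_simps)
  qed
  have ti: "\<tau> (\<i> *\<^sub>C x) = \<i> * \<tau> x" for x
    by (simp add: \<tau>_def scaleC_scaleC complex_vs.scale_minus_left scaleC_one neg algebra_simps)
  have tc: "\<tau> (c *\<^sub>C x) = c * \<tau> x" for c x
  proof -
    have "c *\<^sub>C x = Re c *\<^sub>R x + Im c *\<^sub>R (\<i> *\<^sub>C x)"
      unfolding scaleR_scaleC scaleC_scaleC scaleC_add_left[symmetric]
      by (metis complex_eq mult.commute)
    then have "\<tau> (c *\<^sub>C x) = Re c * \<tau> x + Im c * (\<i> * \<tau> x)" by (simp only: tadd tr ti)
    also have "\<dots> = (Re c + \<i> * Im c) * \<tau> x" by (simp add: algebra_simps)
    finally show ?thesis by (simp only: complex_eq[symmetric])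
  qed
  have sa: "\<tau> x = f x" if "star x = x" for x
    using anti[of "\<i> *\<^sub>C x"] that by (simp add: \<tau>_def star_scaleC complex_vs.scale_minus_left)
  have "bounded_linear \<tau>"
  proof (rule bounded_linear_intro[where K = 2])
    show "norm (\<tau> x) \<le> norm x * 2" for x
    proof -
      have "norm (\<tau> x) \<le> \<bar>f x\<bar> + \<bar>f (\<i> *\<^sub>C x)\<bar>"
        unfolding \<tau>_def by (rule order_trans[OF norm_triangle_ineq4]) (simp add: norm_mult)
      then show ?thesis using bd[of x] bd[of "\<i> *\<^sub>C x"] by (simp add: norm_scaleC)
    qed
  qed (simp_all add: tadd tr scaleR_conv_of_real)
  moreover have "Vector_Spaces.linear scaleC (*) \<tau>"
    unfolding Vector_Spaces.linear_iff using tadd tc complex_vs.vector_space_axioms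
    by (auto intro!: vector_space.intro simp: algebra_simps)
  moreover have "\<tau> (star a * a) \<in> \<real>\<^sub>\<ge>\<^sub>0" for a
    using pos[OF psd_star_mult_self[of a]] sa[of "star a * a"] by (simp add: star_mult star_star nonneg_Reals_of_real_iff)
  ultimately have "positive_functional \<tau>" by (simp add: positive_functional_def dual_def)
  moreover have "\<tau> h \<noteq> 0" using k f(3) sa[OF assms(1)] by (auto simp: neg)
  moreover have "\<tau> k \<in> \<real>" if "star k = k" for k using sa[OF that] by simp
  ultimately show ?thesis using that by blast
qed

theorem exists_positive_functional:
  fixes x :: "'a::{cstar_algebra, monoid_mult}"
  assumes "x \<noteq> 0"
  obtains \<tau> where "positive_functional \<tau>" "\<tau> x \<noteq> 0"
proof -
  obtain h k where hk: "star h = h" "star k = k" "x = h + \<i> *\<^sub>C k" using selfadj_parts[of x] by metis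
  define g where "g = (if h = 0 then k else h)"
  have "star g = g" "g \<noteq> 0" using hk assms by (auto simp: g_def)
  then obtain \<tau> where t: "positive_functional \<tau>" "\<tau> g \<noteq> 0" "\<And>k. star k = k \<Longrightarrow> \<tau> k \<in> \<real>"
    using exists_positive_functional_selfadj by metis
  have "\<tau> x = \<tau> h + \<i> * \<tau> k" using t(1) hk(3)
    by (simp add: positive_functional_def dual_def Vector_Spaces.linear_iff)
  moreover obtain a b where "\<tau> h = complex_of_real a" "\<tau> k = complex_of_real b"
    using t(3)[OF hk(1)] t(3)[OF hk(2)] by (auto simp: Reals_def)
  ultimately have "\<tau> x \<noteq> 0" using t(2) by (auto simp: g_def complex_eq_iff split: if_splits)
  then show ?thesis using that t(1) by blast
qed

section \<open>Strictly continuous extension of positive functionals\<close>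

lemma complex_linear_iff:
  "Vector_Spaces.linear scaleC (*) (F :: 'a::cstar_algebra \<Rightarrow> complex) \<longleftrightarrow>
     (\<forall>x y. F (x + y) = F x + F y) \<and> (\<forall>c x. F (c *\<^sub>C x) = c * F x)"
  unfolding Vector_Spaces.linear_iff using complex_vs.vector_space_axioms
  by (auto intro!: vector_space.intro simp: algebra_simps)

lemma
  assumes "Vector_Spaces.linear scaleC (*) (F :: 'a::cstar_algebra \<Rightarrow> complex)"
  shows complex_linear_add: "F (x + y) = F x + F y"
    and complex_linear_scaleC: "F (c *\<^sub>C x) = c * F x"
    and complex_linear_scaleR: "F (r *\<^sub>R x) = r * F x"
    and complex_linear_zero: "F 0 = 0"
    and complex_linear_diff: "F (x - y) = F x - F y"
proof -
  have a: "F (x + y) = F x + F y" and s: "F (c *\<^sub>C x) = c * F x" for c x y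
    using assms by (auto simp: complex_linear_iff)
  show "F (x + y) = F x + F y" "F (c *\<^sub>C x) = c * F x" "F (r *\<^sub>R x) = r * F x"
    by (simp_all add: a s scaleR_scaleC)
  show "F 0 = 0" using s[of 0 0] by (simp add: complex_vs.scale_zero_right)
  show "F (x - y) = F x - F y" using a[of "x - y" y] by simp
qed

lemma complex_linear_sum:
  "Vector_Spaces.linear scaleC (*) (F :: 'a::cstar_algebra \<Rightarrow> complex) \<Longrightarrow> F (\<Sum>i\<in>I. f i) = (\<Sum>i\<in>I. F (f i))"
  by (induction I rule: infinite_finite_induct) (simp_all add: complex_linear_add complex_linear_zero)

text \<open>The values s = -t cnj(z) with real t reduce the claim to a real quadratic in t,
  evaluated at its minimum t = 1/C.\<close>

lemma quadratic_nonneg_imp: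
  fixes z :: complex and A C :: real
  assumes "\<And>s::complex. 0 \<le> A + 2 * Re (s * z) + (cmod s)\<^sup>2 * C" "0 \<le> C"
  shows "(cmod z)\<^sup>2 \<le> A * C"
proof -
  have *: "0 \<le> A - 2 * t * (cmod z)\<^sup>2 + t\<^sup>2 * (cmod z)\<^sup>2 * C" for t :: real
  proof -
    have 1: "Re ((- t * cnj z) * z) = - t * (cmod z)\<^sup>2"
      by (simp only: cmod_power2) (simp add: power2_eq_square algebra_simps)
    have 2: "(cmod (- t * cnj z))\<^sup>2 = t\<^sup>2 * (cmod z)\<^sup>2"
      by (simp add: norm_mult power_mult_distrib)
    show ?thesis using assms(1)[of "- t * cnj z"] unfolding 1 2 by (simp add: algebra_simps)
  qed
  show ?thesis
  proof (cases "C = 0")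
    case True
    have "cmod z = 0"
    proof (rule ccontr)
      assume "cmod z \<noteq> 0"
      then have p: "0 < (cmod z)\<^sup>2" by simp
      \<comment> \<open>For C = 0 the expression is affine in t, and this t makes it equal to
        -1.\<close>
      have "0 \<le> A - 2 * ((A + 1) / (2 * (cmod z)\<^sup>2)) * (cmod z)\<^sup>2" using *[of "(A + 1) / (2 * (cmod z)\<^sup>2)"] True by simp
      then show False using p by simp
    qed
    then show ?thesis using True by simp
  next
    case False
    then have C: "0 < C" using assms(2) by simp
    have "0 \<le> A - 2 * (1 / C) * (cmod z)\<^sup>2 + (1/C)\<^sup>2 * (cmod z)\<^sup>2 * C" by (rule *)
    also have "\<dots> = A - (cmod z)\<^sup>2 / C" using C by (simp add: power2_eq_square field_simps)
    finally show ?thesis using C by (simp add: field_simps)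
  qed
qed

text \<open>Boundedness is left out so that Cauchy-Schwarz and its consequences serve both for
  functionals on A and for their extensions to M(A).\<close>

definition positive_form :: "('a::cstar_algebra \<Rightarrow> complex) \<Rightarrow> bool" where
  "positive_form F \<longleftrightarrow> Vector_Spaces.linear scaleC (*) F \<and> (\<forall>x. F (star x * x) \<in> \<real>\<^sub>\<ge>\<^sub>0)"

lemma positive_functional_form: "positive_functional \<omega> \<Longrightarrow> positive_form \<omega>"
  by (simp add: positive_functional_def dual_def positive_form_def)

definition form_sq :: "('a::cstar_algebra \<Rightarrow> complex) \<Rightarrow> 'a \<Rightarrow> real" where
  "form_sq F x = Re (F (star x * x))"

lemma
  assumes "positive_form F"
  shows positive_form_linear: "Vector_Spaces.linear scaleC (*) F"
    and form_sq_of_real: "F (star x * x) = of_real (form_sq F x)"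
    and form_sq_nonneg: "0 \<le> form_sq F x"
    and positive_form_cnj: "F (star y * x) = cnj (F (star x * y))"
    and form_sq_add_scaleC: "form_sq F (x + s *\<^sub>C y) = form_sq F x + 2 * Re (s * F (star x * y)) + (cmod s)\<^sup>2 * form_sq F y"
proof -
  show lin: "Vector_Spaces.linear scaleC (*) F" using assms by (simp add: positive_form_def)
  have nn: "F (star x * x) \<in> \<real>\<^sub>\<ge>\<^sub>0" for x using assms by (simp add: positive_form_def)
  have im: "Im (F (star x * x)) = 0" and ge: "0 \<le> form_sq F x" for x
    using nn[of x] by (auto simp: complex_nonneg_Reals_iff form_sq_def)
  show eq: "F (star x * x) = of_real (form_sq F x)" for x using im[of x] by (simp add: complex_eq_iff form_sq_def)
  show "0 \<le> form_sq F x" by (rule ge)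
  have ex: "F (star (x + s *\<^sub>C y) * (x + s *\<^sub>C y)) = F (star x * x) + s * F (star x * y) + cnj s * F (star y * x) + (s * cnj s) * F (star y * y)"
    for s x y
    by (simp add: star_add star_scaleC algebra_simps mult_scaleC_left mult_scaleC_right scaleC_scaleC
       complex_linear_add[OF lin] complex_linear_scaleC[OF lin])
  have "Im (F (star x * y) + F (star y * x)) = 0"
    using im[of "x + 1 *\<^sub>C y"] unfolding ex using im[of x] im[of y] by simp
  moreover have "Im (\<i> * F (star x * y) - \<i> * F (star y * x)) = 0"
    using im[of "x + \<i> *\<^sub>C y"] unfolding ex using im[of x] im[of y] by simp
  ultimately show c: "F (star y * x) = cnj (F (star x * y))" by (simp add: complex_eq_iff)
  have "s * cnj s = of_real ((cmod s)\<^sup>2)" by (simp only: complex_norm_square)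
  moreover have "Re (z + w + cnj w + of_real r * of_real t) = Re z + 2 * Re w + r * t" for z w r t by simp
  ultimately show "form_sq F (x + s *\<^sub>C y) = form_sq F x + 2 * Re (s * F (star x * y)) + (cmod s)\<^sup>2 * form_sq F y"
    unfolding form_sq_def[of F "x + s *\<^sub>C y"] ex c eq[of y] complex_cnj_mult[symmetric]
    by (simp only:) (simp only: form_sq_def)
qed

lemma form_Cauchy_Schwarz:
  assumes "positive_form F"
  shows "(cmod (F (star x * y)))\<^sup>2 \<le> form_sq F x * form_sq F y"
  using form_sq_nonneg[OF assms] form_sq_add_scaleC[OF assms, of x _ y]
  by (intro quadratic_nonneg_imp) metis+

lemma form_Cauchy_Schwarz_sqrt:
  assumes "positive_form F"
  shows "cmod (F (star x * y)) \<le> sqrt (form_sq F x) * sqrt (form_sq F y)"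
  using real_le_rsqrt[OF form_Cauchy_Schwarz[OF assms, of x y]] by (simp add: real_sqrt_mult)

lemma form_sq_parallelogram:
  assumes "positive_form F"
  shows "form_sq F (x + y) + form_sq F (x - y) = 2 * form_sq F x + 2 * form_sq F y"
  using form_sq_add_scaleC[OF assms, of x 1 y] form_sq_add_scaleC[OF assms, of x "-1" y]
  by (simp add: scaleC_one complex_vs.scale_minus_left)

lemma form_sq_scaleR:
  assumes "positive_form F" shows "form_sq F (r *\<^sub>R x) = r\<^sup>2 * form_sq F x"
  using complex_linear_scaleR[OF positive_form_linear[OF assms]]
  by (simp add: form_sq_def star_scaleR power2_eq_square)

lemma positive_functional_bound:
  assumes "positive_functional \<omega>"
  obtains K where "0 < K" "\<And>x. cmod (\<omega> x) \<le> K * norm x" "\<And>x. form_sq \<omega> x \<le> K * (norm x)\<^sup>2"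
proof -
  obtain K where K: "0 < K" "\<And>x. cmod (\<omega> x) \<le> K * norm x"
    using assms bounded_linear.pos_bounded[of \<omega>] by (auto simp: positive_functional_def dual_def mult.commute)
  moreover have "form_sq \<omega> x \<le> K * (norm x)\<^sup>2" for x
    using K(2)[of "star x * x"] complex_Re_le_cmod[of "\<omega> (star x * x)"] by (simp add: form_sq_def cstar_identity)
  ultimately show ?thesis using that by blast
qed

lemma approximate_unit_at:
  fixes a :: "'a::cstar_algebra"
  assumes "0 < e"
  obtains u where "norm u \<le> 1" "star u = u" "norm (u * a - a) < e" "norm (a * u - a) < e"
proof -
  have "finite {a}" by simp
  from approximate_unit[OF this assms] that show ?thesis by (metis singletonI)
qed

text \<open>With a unit this would be symmetry of the form at the pair (1, a). Here an approximate
  unit \<open>u\<close> at \<open>a\<close> stands in for 1, and continuity controls the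
  error.\<close>

lemma positive_functional_star:
  assumes "positive_functional \<omega>"
  shows "\<omega> (star a) = cnj (\<omega> a)"
proof -
  obtain K where K: "0 < K" "\<And>x. cmod (\<omega> x) \<le> K * norm x" using positive_functional_bound[OF assms] by metis
  note F = positive_functional_form[OF assms]
  note lin = positive_form_linear[OF F]
  have "cmod (\<omega> (star a) - cnj (\<omega> a)) \<le> 0 + e" if "0 < e" for e :: real
  proof -
    have "0 < e / (2 * K)" using that K(1) by simp
    then obtain u where u: "norm u \<le> 1" "star u = u" and n: "norm (u * a - a) < e / (2 * K)"
      by (rule approximate_unit_at)
    have 1: "cmod (\<omega> (u * a) - \<omega> a) \<le> e / 2"
      using K(2)[of "u * a - a"] mult_left_mono[OF less_imp_le[OF n], of K] K(1)
      by (simp add: complex_linear_diff[OF lin])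
    have "norm (star (u * a - a)) < e / (2 * K)" using n by (simp only: norm_star)
    then have n': "norm (star a * u - star a) < e / (2 * K)" by (simp add: star_diff star_mult u(2))
    have 2: "cmod (\<omega> (star a * u) - \<omega> (star a)) \<le> e / 2"
      using K(2)[of "star a * u - star a"] mult_left_mono[OF less_imp_le[OF n'], of K] K(1)
      by (simp add: complex_linear_diff[OF lin])
    have "\<omega> (star a * u) = cnj (\<omega> (u * a))" using positive_form_cnj[OF F, of a u] u(2) by simp
    then have "\<omega> (star a) - cnj (\<omega> a) = cnj (\<omega> (u * a) - \<omega> a) - (\<omega> (star a * u) - \<omega> (star a))" by simp
    then show ?thesis using 1 2 norm_triangle_ineq4[of "cnj (\<omega> (u * a) - \<omega> a)" "\<omega> (star a * u) - \<omega> (star a)"]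
      unfolding complex_mod_cnj by simp
  qed
  then have "cmod (\<omega> (star a) - cnj (\<omega> a)) \<le> 0" by (rule field_le_epsilon)
  then show ?thesis by simp
qed

text \<open>The norm of a positive functional, which takes the role of its value at the missing
  unit.\<close>

definition form_norm :: "('a::cstar_algebra \<Rightarrow> complex) \<Rightarrow> real" where
  "form_norm \<omega> = (SUP b\<in>{b. norm b \<le> 1}. Re (\<omega> b))"

text \<open>Cauchy-Schwarz is available for pairs (u, a) with \<open>u\<close> in the unit ball,
  where the form of \<open>u\<close> is at most \<open>form_norm\<close>. Letting \<open>u\<close>
  be an approximate unit at \<open>a\<close> gives the inequality for the pair (1, a).\<close>

lemma
  assumes "positive_functional \<omega>"
  shows form_norm_approx: "0 < e \<Longrightarrow> \<exists>b. norm b \<le> 1 \<and> form_norm \<omega> - e < Re (\<omega> b)"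
    and form_norm_Cauchy_Schwarz: "(cmod (\<omega> a))\<^sup>2 \<le> form_norm \<omega> * form_sq \<omega> a"
    and form_norm_sq: "norm b \<le> 1 \<Longrightarrow> form_sq \<omega> b \<le> form_norm \<omega>"
    and form_norm_nonneg: "0 \<le> form_norm \<omega>"
proof -
  obtain K where K: "0 < K" "\<And>x. cmod (\<omega> x) \<le> K * norm x" using positive_functional_bound[OF assms] by metis
  note F = positive_functional_form[OF assms]
  note lin = positive_form_linear[OF F]
  have bdd: "bdd_above ((\<lambda>b. Re (\<omega> b)) ` {b. norm b \<le> 1})"
  proof (rule bdd_aboveI2)
    show "Re (\<omega> b) \<le> K" if "b \<in> {b. norm b \<le> 1}" for b
    proof -
      have "K * norm b \<le> K" using that K(1) by (simp add: mult_left_le)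
      then show ?thesis using K(2)[of b] complex_Re_le_cmod[of "\<omega> b"] by linarith
    qed
  qed
  have up: "Re (\<omega> b) \<le> form_norm \<omega>" if "norm b \<le> 1" for b
    unfolding form_norm_def using bdd that by (intro cSUP_upper) auto
  show "\<exists>b. norm b \<le> 1 \<and> form_norm \<omega> - e < Re (\<omega> b)" if "0 < e"
  proof -
    have "form_norm \<omega> - e < (SUP b\<in>{b. norm b \<le> 1}. Re (\<omega> b))" using that by (simp add: form_norm_def)
    then show ?thesis by (subst (asm) less_cSUP_iff[OF _ bdd]) (auto intro: exI[of _ 0])
  qed
  show sq: "form_sq \<omega> b \<le> form_norm \<omega>" if "norm b \<le> 1" for b
    unfolding form_sq_def using that by (intro up) (simp add: cstar_identity power_le_one)
  show nn: "0 \<le> form_norm \<omega>" using up[of 0] complex_linear_zero[OF lin] by simp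
  show "(cmod (\<omega> a))\<^sup>2 \<le> form_norm \<omega> * form_sq \<omega> a"
  proof -
    have "cmod (\<omega> a) \<le> sqrt (form_norm \<omega> * form_sq \<omega> a) + e" if "0 < e" for e
    proof -
      have "0 < e / K" using that K(1) by simp
      then obtain u where u: "norm u \<le> 1" "star u = u" and n: "norm (u * a - a) < e / K"
        by (rule approximate_unit_at)
      have 1: "cmod (\<omega> (u * a) - \<omega> a) \<le> e"
        using K(2)[of "u * a - a"] mult_left_mono[OF less_imp_le[OF n], of K] K(1)
        by (simp add: complex_linear_diff[OF lin])
      have "(cmod (\<omega> (u * a)))\<^sup>2 \<le> form_sq \<omega> u * form_sq \<omega> a" using form_Cauchy_Schwarz[OF F, of u a] u(2) by simp
      also have "\<dots> \<le> form_norm \<omega> * form_sq \<omega> a" by (intro mult_right_mono sq u(1) form_sq_nonneg F)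
      finally have "cmod (\<omega> (u * a)) \<le> sqrt (form_norm \<omega> * form_sq \<omega> a)" by (rule real_le_rsqrt)
      then show ?thesis using 1 norm_triangle_ineq2[of "\<omega> a" "\<omega> (u * a)"] by (simp add: norm_minus_commute)
    qed
    then have "cmod (\<omega> a) \<le> sqrt (form_norm \<omega> * form_sq \<omega> a)" by (rule field_le_epsilon)
    then have "(cmod (\<omega> a))\<^sup>2 \<le> (sqrt (form_norm \<omega> * form_sq \<omega> a))\<^sup>2" by (intro power_mono) simp_all
    then show ?thesis using nn form_sq_nonneg[OF F] by simp
  qed
qed

text \<open>\<open>form_defect \<omega> b\<close> is the value at \<open>(1 - b)\<^sup>* (1 - b)\<close> of the extension of \<open>\<omega>\<close> to the unitization.\<close>

definition form_defect :: "('a::cstar_algebra \<Rightarrow> complex) \<Rightarrow> 'a \<Rightarrow> real" where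
  "form_defect \<omega> b = form_sq \<omega> b - 2 * Re (\<omega> b) + form_norm \<omega>"

text \<open>The defect is nonnegative and quadratic. At the midpoint of \<open>b\<close> and
  \<open>c\<close> the parallelogram law turns this into the first claim, so near-maximizers of the
  functional are close in the seminorm of the form; along the line through \<open>b\<close> in
  direction \<open>a\<close> it gives a Cauchy-Schwarz inequality.\<close>

lemma
  assumes "positive_functional \<omega>"
  shows form_defect_diff: "form_sq \<omega> (b - c) \<le> 2 * form_defect \<omega> b + 2 * form_defect \<omega> c"
    and form_defect_mult: "(cmod (\<omega> (star b * a) - \<omega> a))\<^sup>2 \<le> form_defect \<omega> b * form_sq \<omega> a"
proof -
  note F = positive_functional_form[OF assms]
  note lin = positive_form_linear[OF F]
  have nn: "0 \<le> form_defect \<omega> b" for b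
  proof -
    have "Re (\<omega> b) \<le> cmod (\<omega> b)" by (rule complex_Re_le_cmod)
    also have "cmod (\<omega> b) \<le> sqrt (form_norm \<omega>) * sqrt (form_sq \<omega> b)"
      using real_le_rsqrt[OF form_norm_Cauchy_Schwarz[OF assms, of b]] by (simp add: real_sqrt_mult)
    finally have "form_defect \<omega> b \<ge> (sqrt (form_sq \<omega> b) - sqrt (form_norm \<omega>))\<^sup>2"
      using form_norm_nonneg[OF assms] form_sq_nonneg[OF F, of b]
      by (simp add: form_defect_def power2_diff algebra_simps)
    then show ?thesis by (rule order_trans[rotated]) simp
  qed
  show "form_sq \<omega> (b - c) \<le> 2 * form_defect \<omega> b + 2 * form_defect \<omega> c"
  proof -
    have "form_defect \<omega> ((1/2) *\<^sub>R (b + c)) = (1/4) * form_sq \<omega> (b + c) - (Re (\<omega> b) + Re (\<omega> c)) + form_norm \<omega>"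
      unfolding form_defect_def form_sq_scaleR[OF F] complex_linear_scaleR[OF lin] complex_linear_add[OF lin]
      by (simp add: power2_eq_square field_simps)
    then have "0 \<le> (1/4) * form_sq \<omega> (b + c) - (Re (\<omega> b) + Re (\<omega> c)) + form_norm \<omega>"
      using nn[of "(1/2) *\<^sub>R (b + c)"] by simp
    then show ?thesis using form_sq_parallelogram[OF F, of b c]
      unfolding form_defect_def by simp
  qed
  show "(cmod (\<omega> (star b * a) - \<omega> a))\<^sup>2 \<le> form_defect \<omega> b * form_sq \<omega> a"
  proof (rule quadratic_nonneg_imp)
    fix s
    have "form_defect \<omega> (b + s *\<^sub>C a) = form_defect \<omega> b + 2 * Re (s * (\<omega> (star b * a) - \<omega> a)) + (cmod s)\<^sup>2 * form_sq \<omega> a"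
      unfolding form_defect_def form_sq_add_scaleC[OF F] complex_linear_add[OF lin] complex_linear_scaleC[OF lin]
      by (simp add: algebra_simps)
    then show "0 \<le> form_defect \<omega> b + 2 * Re (s * (\<omega> (star b * a) - \<omega> a)) + (cmod s)\<^sup>2 * form_sq \<omega> a"
      using nn[of "b + s *\<^sub>C a"] by simp
  qed (rule form_sq_nonneg[OF F])
qed

section \<open>Existence of the strictly continuous extension\<close>

text \<open>The square of the norm of m b is the norm of m b b* m*, and conjugation by
  \<open>m\<close> is monotone.\<close>

lemma lmult_factor:
  assumes "psd (c *\<^sub>R of_alg (v * star v) - of_alg (b * star b))" "0 \<le> c"
  shows "norm (m \<rhd> b) \<le> sqrt c * norm (m \<rhd> v)"
proof -
  have e: "m * of_alg (x * star x) * star m = of_alg (m \<rhd> x) * star (of_alg (m \<rhd> x))" for x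
    by (simp only: of_alg_mult of_alg_star of_alg_lmult[symmetric] star_mult mult.assoc)
  have n: "norm (m * of_alg (x * star x) * star m) = (norm (m \<rhd> x))\<^sup>2" for x
    using cstar_identity[of "star (of_alg (m \<rhd> x))"] unfolding e star_star norm_star norm_of_alg .
  have "norm (m * of_alg (b * star b) * star m) \<le> norm (m * (c *\<^sub>R of_alg (v * star v)) * star m)"
    by (rule norm_conj_mono[OF psd_of_alg_mult_star assms(1)])
  also have "\<dots> = c * norm (m * of_alg (v * star v) * star m)" using assms(2) by simp
  finally have "(norm (m \<rhd> b))\<^sup>2 \<le> c * (norm (m \<rhd> v))\<^sup>2" by (simp only: n)
  then have "norm (m \<rhd> b) \<le> sqrt (c * (norm (m \<rhd> v))\<^sup>2)" by (rule real_le_rsqrt)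
  then show ?thesis by (simp add: real_sqrt_mult)
qed

text \<open>One factor dominating a whole sequence; this replaces the Cohen factorization.\<close>

lemma common_right_factor:
  fixes b :: "nat \<Rightarrow> 'a::cstar_algebra"
  assumes "\<And>n. norm (b n) \<le> 1"
  obtains v where "star v = v" "\<And>n m. norm (m \<rhd> b n) \<le> 2 ^ n * norm (m \<rhd> v)"
proof -
  \<comment> \<open>The weights make the series summable; the price is a factor growing with n in
    the estimate, which the use of the lemma has to absorb.\<close>
  define g where "g n = (1/2) ^ n *\<^sub>R (b n * star (b n))" for n
  have "norm (g n) \<le> (1/2) ^ n" for n
  proof -
    have "norm (b n * star (b n)) \<le> 1 * 1"
      by (rule order_trans[OF norm_mult_ineq mult_mono]) (use assms in \<open>simp_all add: norm_star\<close>)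
    then show ?thesis by (simp add: g_def mult_left_le)
  qed
  then have sg: "summable g" by (intro summable_comparison_test'[OF summable_geometric[of "1/2::real"]]) auto
  define h where "h = suminf g"
  have pg: "psd (of_alg (g n))" for n
    unfolding g_def of_alg_scaleR by (intro psd_scaleR psd_of_alg_mult_star) simp
  have lim: "(\<lambda>N. of_alg (\<Sum>i<N. g i)) \<longlonglongrightarrow> of_alg h"
  proof -
    have d: "dist (of_alg x) (of_alg y) = dist x y" for x y :: 'a
      by (simp only: dist_norm of_alg_diff[symmetric] norm_of_alg)
    have "(\<lambda>N. \<Sum>i<N. g i) \<longlonglongrightarrow> h" using summable_LIMSEQ[OF sg] by (simp add: h_def)
    then show ?thesis by (subst (asm) tendsto_dist_iff, subst tendsto_dist_iff) (simp only: d)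
  qed
  have pd: "psd (of_alg h - of_alg (g n))" for n
  proof (rule psd_limit)
    show "(\<lambda>N. of_alg (\<Sum>i<N + Suc n. g i) - of_alg (g n)) \<longlonglongrightarrow> of_alg h - of_alg (g n)"
      by (intro tendsto_intros LIMSEQ_ignore_initial_segment lim)
    show "psd (of_alg (\<Sum>i<N + Suc n. g i) - of_alg (g n))" for N
    proof -
      have "of_alg (\<Sum>i<N + Suc n. g i) = of_alg (g n) + (\<Sum>i\<in>{..<N + Suc n} - {n}. of_alg (g i))"
        unfolding of_alg_sum by (intro sum.remove) auto
      then show ?thesis using psd_sum[of "{..<N + Suc n} - {n}" "\<lambda>i. of_alg (g i)"] pg by simp
    qed
  qed
  have "psd (of_alg h)" using psd_add[OF pd[of 0] pg[of 0]] by simp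
  then obtain v where v: "star v = v" "v * v = h" using sqrt_in_algebra by metis
  have "norm (m \<rhd> b n) \<le> 2 ^ n * norm (m \<rhd> v)" for m n
  proof -
    have "psd (2 ^ n *\<^sub>R (of_alg h - of_alg (g n)))" by (intro psd_scaleR pd) simp
    moreover have "2 ^ n *\<^sub>R of_alg (g n) = of_alg (b n * star (b n))"
      by (simp add: g_def of_alg_scaleR power_one_over)
    ultimately have "norm (m \<rhd> b n) \<le> sqrt (2 ^ n) * norm (m \<rhd> v)"
      using v by (intro lmult_factor) (simp_all add: scaleR_diff_right)
    moreover have "sqrt (2 ^ n) \<le> 2 ^ n"
      by (rule real_le_lsqrt) (simp_all add: self_le_power)
    ultimately show ?thesis by (meson mult_right_mono norm_ge_zero order_trans)
  qed
  then show ?thesis using that v(1) by blast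
qed

lemma tendsto_zero_bound:
  fixes f :: "nat \<Rightarrow> 'a::real_normed_vector"
  assumes "\<And>n. (norm (f n - l))\<^sup>2 \<le> g n" "g \<longlonglongrightarrow> 0"
  shows "f \<longlonglongrightarrow> l"
proof -
  have "(\<lambda>n. (norm (f n - l))\<^sup>2) \<longlonglongrightarrow> 0"
    by (rule tendsto_sandwich[OF _ _ tendsto_const assms(2)]) (use assms(1) in auto)
  then have "(\<lambda>n. sqrt ((norm (f n - l))\<^sup>2)) \<longlonglongrightarrow> sqrt 0" by (rule tendsto_real_sqrt)
  then show ?thesis by (simp add: tendsto_norm_zero_iff LIM_zero_iff)
qed

text \<open>The extension is the limit of \<omega>(b_n* m b_n), with b_n in the unit ball nearly
  attaining the norm of \<omega>. The differences b_(n+1) - b_n are at most 4^(-n) in the seminorm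
  of the form, while the common factor \<open>v\<close> costs 2^n. The increments are thus geometric
  and bounded through the two norms of m v and v m, which is strict continuity.\<close>

lemma strictly_continuous_extension:
  fixes \<omega> :: "'a::cstar_algebra \<Rightarrow> complex"
  assumes "positive_functional \<omega>"
  obtains \<Omega> C v where "positive_form \<Omega>" "\<And>a. \<Omega> (of_alg a) = \<omega> a" "0 \<le> C"
    "\<And>m. cmod (\<Omega> m) \<le> C * (norm (m \<rhd> v) + norm (v \<lhd> m))"
proof -
  note F = positive_functional_form[OF assms]
  note lin = positive_form_linear[OF F]
  obtain K where K: "0 < K" "\<And>x. cmod (\<omega> x) \<le> K * norm x" "\<And>x. form_sq \<omega> x \<le> K * (norm x)\<^sup>2"
    using positive_functional_bound[OF assms] by blast
  \<comment> \<open>Doubling this gap bounds the defect by a quarter of 16^(-n), and two consecutive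
    defects, each doubled, stay below 16^(-n).\<close>
  have "\<exists>b. norm b \<le> 1 \<and> form_norm \<omega> - (1/8) * (1/16) ^ n < Re (\<omega> b)" for n :: nat
    by (rule form_norm_approx[OF assms]) simp
  then have "\<forall>n. \<exists>b. norm b \<le> 1 \<and> form_norm \<omega> - (1/8) * (1/16) ^ n < Re (\<omega> b)" ..
  then obtain b where "\<forall>n. norm (b n) \<le> 1 \<and> form_norm \<omega> - (1/8) * (1/16) ^ n < Re (\<omega> (b n))" by (rule choice[THEN exE])
  then have b: "\<And>n. norm (b n) \<le> 1" "\<And>n. form_norm \<omega> - (1/8) * (1/16) ^ n < Re (\<omega> (b n))" by blast+
  have def: "form_defect \<omega> (b n) \<le> (1/4) * (1/16) ^ n" for n
    using b(2)[of n] form_norm_sq[OF assms b(1)[of n]] by (simp add: form_defect_def)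
  have sq: "sqrt (form_sq \<omega> (b (Suc n) - b n)) \<le> (1/4) ^ n" for n
  proof (rule real_le_lsqrt)
    have "form_sq \<omega> (b (Suc n) - b n) \<le> 2 * ((1/4) * (1/16) ^ Suc n) + 2 * ((1/4) * (1/16) ^ n)"
      by (rule order_trans[OF form_defect_diff[OF assms]]) (intro add_mono mult_left_mono def; simp)
    also have "\<dots> \<le> (1/16) ^ n" by simp
    also have "(1/16 :: real) ^ n = ((1/4) ^ n)\<^sup>2"
      by (simp add: power2_eq_square flip: power_mult_distrib)
    finally show "form_sq \<omega> (b (Suc n) - b n) \<le> ((1/4) ^ n)\<^sup>2" .
  qed simp
  obtain v where v: "star v = v" "\<And>n m. norm (m \<rhd> b n) \<le> 2 ^ n * norm (m \<rhd> v)"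
    using common_right_factor[of b, OF b(1)] by blast
  have v': "norm (star (star (b n) \<lhd> m)) \<le> 2 ^ n * norm (v \<lhd> m)" for n m
  proof -
    have "norm (star m \<rhd> v) = norm (v \<lhd> m)" by (simp add: norm_star v(1))
    then show ?thesis using v(2)[of "star m" n] by (simp add: star_star)
  qed
  define R where "R m = norm (m \<rhd> v) + norm (v \<lhd> m)" for m
  define T where "T n m = \<omega> (star (b n) * (m \<rhd> b n))" for n m
  have sK: "sqrt (form_sq \<omega> x) \<le> sqrt K * norm x" for x
    using real_sqrt_le_mono[OF K(3)[of x]] by (simp add: real_sqrt_mult)
  have step: "cmod (T (Suc n) m - T n m) \<le> 2 * sqrt K * R m * (1/2) ^ n" for n m
  proof -
    define d where "d = b (Suc n) - b n"
    have "T (Suc n) m - T n m = \<omega> (star d * (m \<rhd> b (Suc n))) + \<omega> (star (star (star (b n) \<lhd> m)) * d)"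
      unfolding T_def d_def complex_linear_diff[OF lin, symmetric] complex_linear_add[OF lin, symmetric]
      by (rule arg_cong[where f = \<omega>]) (simp add: star_diff star_star algebra_simps mult_lmult rmult_linear_simps lmult_linear_simps)
    also have "cmod \<dots> \<le> sqrt (form_sq \<omega> d) * sqrt (form_sq \<omega> (m \<rhd> b (Suc n)))
        + sqrt (form_sq \<omega> (star (star (b n) \<lhd> m))) * sqrt (form_sq \<omega> d)"
      by (rule norm_triangle_mono) (rule form_Cauchy_Schwarz_sqrt[OF F])+
    also have "\<dots> \<le> (1/4) ^ n * (sqrt K * (2 ^ Suc n * norm (m \<rhd> v))) + (sqrt K * (2 ^ n * norm (v \<lhd> m))) * (1/4) ^ n"
      using K(1) form_sq_nonneg[OF F]
      by (intro add_mono mult_mono sq[of n, folded d_def] order_trans[OF sK] mult_left_mono v(2) v') simp_all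
    also have "\<dots> = sqrt K * (2 * norm (m \<rhd> v) + norm (v \<lhd> m)) * (2 ^ n * (1/4) ^ n)" by (simp add: algebra_simps)
    also have "(2::real) ^ n * (1/4) ^ n = (1/2) ^ n" by (simp flip: power_mult_distrib)
    also have "sqrt K * (2 * norm (m \<rhd> v) + norm (v \<lhd> m)) * (1/2) ^ n \<le> sqrt K * (2 * R m) * (1/2) ^ n"
      using K(1) by (intro mult_right_mono mult_left_mono) (simp_all add: R_def)
    finally show ?thesis by (simp add: mult_ac)
  qed
  have R0: "0 \<le> R m" for m by (simp add: R_def)
  have Tsum: "T n m = T 0 m + (\<Sum>i<n. T (Suc i) m - T i m)" for n m
    using sum_lessThan_telescope[of "\<lambda>i. T i m" n] by simp
  have smb: "summable (\<lambda>i. 2 * sqrt K * R m * (1/2) ^ i)" for m by (intro summable_mult summable_geometric) simp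
  have conv: "convergent (\<lambda>n. T n m)" for m
  proof -
    have "summable (\<lambda>i. T (Suc i) m - T i m)"
      by (rule summable_comparison_test'[OF smb, where N = 0]) (use step in auto)
    then have "convergent (\<lambda>n. \<Sum>i<n. T (Suc i) m - T i m)" by (simp add: summable_iff_convergent)
    then have "convergent (\<lambda>n. T 0 m + (\<Sum>i<n. T (Suc i) m - T i m))" by (rule convergent_add[OF convergent_const])
    then show ?thesis by (simp only: Tsum[symmetric])
  qed
  define \<Omega> where "\<Omega> m = lim (\<lambda>n. T n m)" for m
  have \<Omega>: "(\<lambda>n. T n m) \<longlonglongrightarrow> \<Omega> m" for m unfolding \<Omega>_def using conv convergent_LIMSEQ_iff by blast
  \<comment> \<open>\<open>K\<close> bounds the initial term, and the increments add up to at most 4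
    sqrt K times \<open>R m\<close>.\<close>
  define C where "C = K + 4 * sqrt K"
  have T0: "cmod (T 0 m) \<le> K * R m" for m
  proof -
    have "norm (star (b 0) * (m \<rhd> b 0)) \<le> 1 * (2 ^ 0 * norm (m \<rhd> v))"
      by (rule order_trans[OF norm_mult_ineq mult_mono[OF _ v(2)]]) (simp_all add: norm_star b(1))
    then have "norm (star (b 0) * (m \<rhd> b 0)) \<le> R m" by (simp add: R_def add_increasing2)
    then show ?thesis unfolding T_def using K(1) by (intro order_trans[OF K(2)] mult_left_mono) auto
  qed
  have bd: "cmod (\<Omega> m) \<le> C * R m" for m
  proof (rule LIMSEQ_le_const2[OF tendsto_norm[OF \<Omega>]], intro exI allI impI)
    fix n
    have "cmod (T n m) \<le> cmod (T 0 m) + (\<Sum>i<n. cmod (T (Suc i) m - T i m))"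
      unfolding Tsum[of n] by (rule norm_triangle_mono[OF order_refl norm_sum])
    also have "(\<Sum>i<n. cmod (T (Suc i) m - T i m)) \<le> (\<Sum>i<n. 2 * sqrt K * R m * (1/2) ^ i)"
      by (intro sum_mono step)
    also have "\<dots> \<le> (\<Sum>i. 2 * sqrt K * R m * (1/2) ^ i)"
      using R0 K(1) by (intro sum_le_suminf smb) auto
    also have "\<dots> = 2 * sqrt K * R m * 2"
      by (subst suminf_mult[OF summable_geometric]) (simp_all add: suminf_geometric)
    finally show "cmod (T n m) \<le> C * R m" using T0[of m] by (simp add: C_def algebra_simps)
  qed
  have add: "\<Omega> (m + m') = \<Omega> m + \<Omega> m'" for m m'
  proof (rule LIMSEQ_unique[OF \<Omega>])
    have "T n (m + m') = T n m + T n m'" for n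
      by (simp add: T_def distrib_left complex_linear_add[OF lin])
    then show "(\<lambda>n. T n (m + m')) \<longlonglongrightarrow> \<Omega> m + \<Omega> m'" by (simp only:) (intro tendsto_add \<Omega>)
  qed
  have act_scaleC: "(c *\<^sub>C m) \<rhd> (x::'a) = c *\<^sub>C (m \<rhd> x)" for c m x
  proof (rule cstar_right_cancel)
    fix y
    have "((c *\<^sub>C m) \<rhd> x) * y = (c *\<^sub>C m * of_alg x) \<rhd> y" by (simp add: lmult_mult)
    also have "c *\<^sub>C m * of_alg x = of_alg (c *\<^sub>C (m \<rhd> x))" by (simp add: mult_scaleC_left of_alg_lmult of_alg_scaleC)
    finally show "((c *\<^sub>C m) \<rhd> x) * y = (c *\<^sub>C (m \<rhd> x)) * y" by simp
  qed
  have sc: "\<Omega> (c *\<^sub>C m) = c * \<Omega> m" for c m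
  proof (rule LIMSEQ_unique[OF \<Omega>])
    have "T n (c *\<^sub>C m) = c * T n m" for n
      by (simp add: T_def act_scaleC mult_scaleC_right complex_linear_scaleC[OF lin])
    then show "(\<lambda>n. T n (c *\<^sub>C m)) \<longlonglongrightarrow> c * \<Omega> m" by (simp only:) (intro tendsto_mult_left \<Omega>)
  qed
  have pos: "\<Omega> (star m * m) \<in> \<real>\<^sub>\<ge>\<^sub>0" for m
  proof (rule closed_sequentially[OF closed_nonneg_Reals_complex _ \<Omega>])
    fix n
    have "star (b n) * (star m \<rhd> (m \<rhd> b n)) = star (m \<rhd> b n) * (m \<rhd> b n)"
      unfolding mult_lmult[of "star (b n)"] by (simp add: star_star)
    then have "T n (star m * m) = \<omega> (star (m \<rhd> b n) * (m \<rhd> b n))" by (simp add: T_def)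
    then show "T n (star m * m) \<in> \<real>\<^sub>\<ge>\<^sub>0" using F by (simp add: positive_form_def)
  qed
  have ext: "\<Omega> (of_alg a) = \<omega> a" for a
  proof (rule LIMSEQ_unique[OF \<Omega>])
    have z: "(\<lambda>n. (1/4) * (1/16::real) ^ n * M) \<longlonglongrightarrow> 0" for M
      by (intro tendsto_mult_left_zero tendsto_mult_right_zero LIMSEQ_power_zero) simp
    have "(\<lambda>n. \<omega> (star (b n) * star a)) \<longlonglongrightarrow> \<omega> (star a)"
    proof (rule tendsto_zero_bound[OF _ z])
      fix n
      show "(cmod (\<omega> (star (b n) * star a) - \<omega> (star a)))\<^sup>2 \<le> 1 / 4 * (1 / 16) ^ n * form_sq \<omega> (star a)"
        by (rule order_trans[OF form_defect_mult[OF assms] mult_right_mono[OF def form_sq_nonneg[OF F]]])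
    qed
    then have "(\<lambda>n. cnj (\<omega> (star (b n) * star a))) \<longlonglongrightarrow> cnj (\<omega> (star a))" by (rule tendsto_cnj)
    moreover have "cnj (\<omega> (star (b n) * star a)) = \<omega> (a * b n)" for n
      using positive_form_cnj[OF F, of "star a" "b n"] by (simp add: star_star)
    ultimately have 1: "(\<lambda>n. \<omega> (a * b n)) \<longlonglongrightarrow> \<omega> a"
      using positive_functional_star[OF assms, of a] by simp
    have "(\<lambda>n. \<omega> (star (b n) * (a * b n)) - \<omega> (a * b n)) \<longlonglongrightarrow> 0"
    proof (rule tendsto_zero_bound[OF _ z])
      fix n
      have "norm (a * b n) \<le> norm a * 1" by (rule order_trans[OF norm_mult_ineq mult_left_mono[OF b(1)]]) simp
      then have "(norm (a * b n))\<^sup>2 \<le> (norm a)\<^sup>2" by (intro power_mono) simp_all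
      then have "form_sq \<omega> (a * b n) \<le> K * (norm a)\<^sup>2"
        using K(1) by (intro order_trans[OF K(3)] mult_left_mono) simp_all
      then show "(cmod (\<omega> (star (b n) * (a * b n)) - \<omega> (a * b n) - 0))\<^sup>2 \<le> 1 / 4 * (1 / 16) ^ n * (K * (norm a)\<^sup>2)"
        using form_sq_nonneg[OF F] unfolding diff_0_right
        by (intro order_trans[OF form_defect_mult[OF assms]] mult_mono def) simp_all
    qed
    from tendsto_add[OF this 1] show "(\<lambda>n. T n (of_alg a)) \<longlonglongrightarrow> \<omega> a" by (simp add: T_def)
  qed
  have "positive_form \<Omega>" using add sc pos by (simp add: positive_form_def complex_linear_iff)
  then show ?thesis using that[of \<Omega> C v] ext bd K(1) by (simp add: R_def C_def)
qed

lemma strictly_continuousI: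
  fixes \<Omega> :: "'a::cstar_algebra multiplier \<Rightarrow> complex"
  assumes lin: "Vector_Spaces.linear scaleC (*) \<Omega>"
    and bd: "\<And>m. cmod (\<Omega> m) \<le> C * (norm (m \<rhd> v) + norm (v \<lhd> m))"
  shows "continuous_map strict_topology euclidean \<Omega>"
proof -
  have ts: "topspace strict_topology = (UNIV :: 'a multiplier set)"
    by (simp add: strict_topology_def topspace_pullback_topology)
  have "openin strict_topology {m. \<Omega> m \<in> U}" if U: "open U" for U
  proof (subst openin_subopen, intro ballI)
    fix m0 assume "m0 \<in> {m. \<Omega> m \<in> U}"
    then have "\<Omega> m0 \<in> U" by simp
    then obtain e where e: "0 < e" "ball (\<Omega> m0) e \<subseteq> U" by (rule openE[OF U])
    define V where "V = {p :: ('a \<Rightarrow> 'a) \<times> ('a \<Rightarrow> 'a). C * (norm (fst p v - m0 \<rhd> v) + norm (snd p v - v \<lhd> m0)) < e}"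
    have c: "continuous_on UNIV (\<lambda>p :: ('a \<Rightarrow> 'a) \<times> ('a \<Rightarrow> 'a). fst p v)" "continuous_on UNIV (\<lambda>p :: ('a \<Rightarrow> 'a) \<times> ('a \<Rightarrow> 'a). snd p v)"
      by (rule continuous_on_compose2[OF continuous_on_product_coordinates[of v] continuous_on_fst[OF continuous_on_id]], simp)
        (rule continuous_on_compose2[OF continuous_on_product_coordinates[of v] continuous_on_snd[OF continuous_on_id]], simp)
    have "open V" unfolding V_def by (intro open_Collect_less continuous_intros c)
    define S where "S = (\<lambda>m. ((\<lambda>a. m \<rhd> a), (\<lambda>a. a \<lhd> m))) -` V"
    have "openin strict_topology S"
      unfolding strict_topology_def openin_pullback_topology S_def using \<open>open V\<close> by auto
    moreover have "m0 \<in> S" using e(1) by (simp add: S_def V_def)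
    moreover have "S \<subseteq> {m. \<Omega> m \<in> U}"
    proof
      fix m assume "m \<in> S"
      then have "C * (norm ((m - m0) \<rhd> v) + norm (v \<lhd> (m - m0))) < e" by (simp add: S_def V_def)
      with bd[of "m - m0"] have "cmod (\<Omega> m - \<Omega> m0) < e" by (simp add: complex_linear_diff[OF lin])
      then show "m \<in> {m. \<Omega> m \<in> U}" using e(2) by (auto simp: dist_norm norm_minus_commute)
    qed
    ultimately show "\<exists>T. openin strict_topology T \<and> m0 \<in> T \<and> T \<subseteq> {m. \<Omega> m \<in> U}" by blast
  qed
  then show ?thesis by (simp add: continuous_map_def ts)
qed

section \<open>Strict density of A in M(A) and uniqueness of the extension\<close>

lemma open_fun_contains_finite:
  fixes V :: "('a \<Rightarrow> 'b::real_normed_vector) set"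
  assumes "open V" "f \<in> V"
  obtains S e where "finite S" "0 < e" "\<And>g. (\<And>a. a \<in> S \<Longrightarrow> norm (g a - f a) < e) \<Longrightarrow> g \<in> V"
proof -
  obtain X where X: "f \<in> (\<Pi>\<^sub>E i\<in>UNIV. X i)" "\<And>i. open (X i)" "finite {i. X i \<noteq> UNIV}" "(\<Pi>\<^sub>E i\<in>UNIV. X i) \<subseteq> V"
    using product_topology_open_contains_basis[OF _ assms(2), of "\<lambda>i. euclidean" UNIV] assms(1)
    by (auto simp: open_fun_def)
  define S where "S = {i. X i \<noteq> UNIV}"
  have "\<exists>e>0. ball (f i) e \<subseteq> X i" for i using X(1,2) open_contains_ball[of "X i"] by (auto simp: PiE_iff)
  then obtain e where e: "\<And>i. 0 < e i" "\<And>i. ball (f i) (e i) \<subseteq> X i" by metis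
  define r where "r = Min (insert 1 (e ` S))"
  have fS: "finite S" using X(3) by (simp add: S_def)
  have r: "0 < r" "\<And>i. i \<in> S \<Longrightarrow> r \<le> e i" using fS e(1) by (auto simp: r_def)
  have "g \<in> V" if "\<And>a. a \<in> S \<Longrightarrow> norm (g a - f a) < r" for g
  proof -
    have "g i \<in> X i" for i
    proof (cases "i \<in> S")
      case True
      then have "g i \<in> ball (f i) (e i)" using that[OF True] r(2)[OF True] by (simp add: dist_norm norm_minus_commute)
      then show ?thesis using e(2) by blast
    qed (simp add: S_def)
    then show ?thesis using X(4) by (auto simp: PiE_iff)
  qed
  then show ?thesis using that fS r(1) by blast
qed

text \<open>A is strictly dense in M(A): a strict neighbourhood of \<open>m\<close> tests finitely
  many elements, and for an approximate unit \<open>u\<close> at these the element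
  \<open>m \<rhd> u\<close> of A lies in the neighbourhood.\<close>

lemma strictly_continuous_eqI:
  fixes \<Omega> \<Omega>' :: "'a::cstar_algebra multiplier \<Rightarrow> complex"
  assumes "continuous_map strict_topology euclidean \<Omega>" "continuous_map strict_topology euclidean \<Omega>'"
    and eq: "\<And>a. \<Omega> (of_alg a) = \<Omega>' (of_alg a)"
  shows "\<Omega> = \<Omega>'"
proof (rule ext, rule ccontr)
  fix m assume ne: "\<Omega> m \<noteq> \<Omega>' m"
  have "continuous_map strict_topology euclidean (\<lambda>m. \<Omega> m - \<Omega>' m)"
    using assms(1,2) by (rule continuous_map_diff)
  then have "openin strict_topology {m \<in> topspace strict_topology. \<Omega> m - \<Omega>' m \<in> - {0}}"
    by (rule openin_continuous_map_preimage) (simp add: open_Compl)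
  then obtain V where V: "open V" "{m. \<Omega> m \<noteq> \<Omega>' m} = (\<lambda>m. ((\<lambda>a. m \<rhd> a), (\<lambda>a. a \<lhd> m))) -` V"
    unfolding strict_topology_def openin_pullback_topology topspace_pullback_topology by auto
  then have "((\<lambda>a. m \<rhd> a), (\<lambda>a. a \<lhd> m)) \<in> V" using ne by blast
  then obtain V1 V2 where V12: "open V1" "open V2" "(\<lambda>a. m \<rhd> a) \<in> V1" "(\<lambda>a. a \<lhd> m) \<in> V2" "V1 \<times> V2 \<subseteq> V"
    using V(1) by (metis open_prod_elim mem_Times_iff fst_conv snd_conv)
  obtain S1 e1 where S1: "finite S1" "0 < e1" "\<And>g. (\<And>a. a \<in> S1 \<Longrightarrow> norm (g a - m \<rhd> a) < e1) \<Longrightarrow> g \<in> V1"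
    using open_fun_contains_finite[OF V12(1,3)] by blast
  obtain S2 e2 where S2: "finite S2" "0 < e2" "\<And>g. (\<And>a. a \<in> S2 \<Longrightarrow> norm (g a - a \<lhd> m) < e2) \<Longrightarrow> g \<in> V2"
    using open_fun_contains_finite[OF V12(2,4)] by blast
  \<comment> \<open>Left tests lose a factor of the norm of \<open>m\<close>, right tests lose none;
    the extra 1 gives strictness and covers m = 0.\<close>
  define e where "e = min e1 e2 / (norm m + 1)"
  have nm: "0 < norm m + 1" by (simp add: add_nonneg_pos)
  have e: "0 < e" using S1(2) S2(2) nm by (simp add: e_def)
  have em: "norm m * e < e1" "e \<le> e2"
  proof -
    have "(norm m + 1) * e = min e1 e2" using nm by (simp add: e_def)
    moreover have "(norm m + 1) * e = norm m * e + e" by (simp add: algebra_simps)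
    moreover have "0 \<le> norm m * e" using e by simp
    ultimately show "norm m * e < e1" "e \<le> e2" using e by linarith+
  qed
  \<comment> \<open>On the right \<open>m \<rhd> u\<close> sends \<open>a\<close> to (a m) u, so the
    unit has to be good at a m and not at a.\<close>
  obtain u where u: "\<And>a. a \<in> S1 \<union> (\<lambda>a. a \<lhd> m) ` S2 \<Longrightarrow> norm (u * a - a) < e"
     "\<And>a. a \<in> S1 \<union> (\<lambda>a. a \<lhd> m) ` S2 \<Longrightarrow> norm (a * u - a) < e"
    using approximate_unit[of "S1 \<union> (\<lambda>a. a \<lhd> m) ` S2" e] S1(1) S2(1) e by (metis finite_UnI finite_imageI)
  have "(\<lambda>a. of_alg (m \<rhd> u) \<rhd> a) \<in> V1"
  proof (rule S1(3))
    fix a assume a: "a \<in> S1"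
    have "of_alg (m \<rhd> u) \<rhd> a - m \<rhd> a = m \<rhd> (u * a - a)" by (simp add: lmult_mult lmult_linear_simps)
    also have "norm \<dots> \<le> norm m * e" using u(1)[of a] a by (intro order_trans[OF norm_lmult] mult_left_mono) auto
    finally show "norm (of_alg (m \<rhd> u) \<rhd> a - m \<rhd> a) < e1" using em(1) by linarith
  qed
  moreover have "(\<lambda>a. a \<lhd> of_alg (m \<rhd> u)) \<in> V2"
  proof (rule S2(3))
    fix a assume a: "a \<in> S2"
    have "a \<lhd> of_alg (m \<rhd> u) - a \<lhd> m = (a \<lhd> m) * u - (a \<lhd> m)" by (simp add: mult_lmult)
    then show "norm (a \<lhd> of_alg (m \<rhd> u) - a \<lhd> m) < e2" using u(2)[of "a \<lhd> m"] a em(2) by fastforce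
  qed
  ultimately have "((\<lambda>a. of_alg (m \<rhd> u) \<rhd> a), (\<lambda>a. a \<lhd> of_alg (m \<rhd> u))) \<in> V" using V12(5) by blast
  then have "of_alg (m \<rhd> u) \<in> {m. \<Omega> m \<noteq> \<Omega>' m}" unfolding V(2) by (rule vimageI2)
  then show False using eq by simp
qed

text \<open>Existence and strict density turn the definite description into a usable function. A
  functional on M(A) is recognized as the extension from its values on A and a bound through one
  element \<open>v'\<close>.\<close>

lemma
  fixes \<omega> :: "'a::cstar_algebra \<Rightarrow> complex"
  assumes "positive_functional \<omega>"
  shows positive_form_functional_ext: "positive_form (functional_ext \<omega>)"
    and functional_ext_of_alg: "functional_ext \<omega> (of_alg a) = \<omega> a"
    and functional_ext_bound: "\<exists>C v. 0 \<le> C \<and> (\<forall>m. cmod (functional_ext \<omega> m) \<le> C * (norm (m \<rhd> v) + norm (v \<lhd> m)))"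
    and functional_ext_eqI: "Vector_Spaces.linear scaleC (*) \<Omega>' \<Longrightarrow>
      (\<And>m. cmod (\<Omega>' m) \<le> C' * (norm (m \<rhd> v') + norm (v' \<lhd> m))) \<Longrightarrow>
      (\<And>a. \<Omega>' (of_alg a) = \<omega> a) \<Longrightarrow> functional_ext \<omega> = \<Omega>'"
proof -
  obtain \<Omega> C v where \<Omega>: "positive_form \<Omega>" "\<And>a. \<Omega> (of_alg a) = \<omega> a" "0 \<le> C"
    "\<And>m. cmod (\<Omega> m) \<le> C * (norm (m \<rhd> v) + norm (v \<lhd> m))"
    using strictly_continuous_extension[OF assms] by blast
  have c: "continuous_map strict_topology euclidean \<Omega>"
    using strictly_continuousI[OF positive_form_linear[OF \<Omega>(1)] \<Omega>(4)] .
  have e: "functional_ext \<omega> = \<Omega>"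
    unfolding functional_ext_def
  proof (rule the_equality, intro conjI allI)
    fix \<Omega>' assume "Vector_Spaces.linear scaleC (*) \<Omega>' \<and> continuous_map strict_topology euclidean \<Omega>' \<and> (\<forall>a. \<Omega>' (of_alg a) = \<omega> a)"
    then show "\<Omega>' = \<Omega>" using \<Omega>(2) by (intro strictly_continuous_eqI c) auto
  qed (use \<Omega> c positive_form_linear in auto)
  show "positive_form (functional_ext \<omega>)" "functional_ext \<omega> (of_alg a) = \<omega> a"
    "\<exists>C v. 0 \<le> C \<and> (\<forall>m. cmod (functional_ext \<omega> m) \<le> C * (norm (m \<rhd> v) + norm (v \<lhd> m)))"
    unfolding e by (rule \<Omega>(1), rule \<Omega>(2), intro exI conjI allI, rule \<Omega>(3), rule \<Omega>(4))
  show "functional_ext \<omega> = \<Omega>'" if "Vector_Spaces.linear scaleC (*) \<Omega>'"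
      "\<And>m. cmod (\<Omega>' m) \<le> C' * (norm (m \<rhd> v') + norm (v' \<lhd> m))"
      "\<And>a. \<Omega>' (of_alg a) = \<omega> a"
    unfolding e by (rule strictly_continuous_eqI[OF c strictly_continuousI[OF that(1,2)]]) (simp add: \<Omega>(2) that(3))
qed

text \<open>Compressing by \<open>c \<in> A\<close> turns a functional on \<open>M(A)\<close> into one on \<open>A\<close> whose extension is explicit.\<close>

theorem functional_ext_separates:
  fixes m :: "'a::cstar_algebra multiplier"
  assumes "m \<noteq> 0"
  obtains \<omega> where "positive_functional \<omega>" "functional_ext \<omega> m \<noteq> 0"
proof -
  have "\<exists>c. star c * (m \<rhd> c) \<noteq> 0"
  proof (rule ccontr)
    assume a: "\<not> ?thesis"
    have "star c * (m \<rhd> d) = 0" for c d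
    proof -
      have p: "star c * (m \<rhd> d) + star d * (m \<rhd> c) = 0" for c d
      proof -
        have "star (c + d) * (m \<rhd> (c + d)) = star c * (m \<rhd> c) + star d * (m \<rhd> d) + (star c * (m \<rhd> d) + star d * (m \<rhd> c))"
          by (simp add: star_add lmult_linear_simps algebra_simps)
        then show ?thesis using a by simp
      qed
      \<comment> \<open>Replacing \<open>d\<close> by i d changes the sign of one of the two mixed
        terms, so the terms are both equal and opposite.\<close>
      have "\<i> *\<^sub>C (star c * (m \<rhd> d)) = \<i> *\<^sub>C (star d * (m \<rhd> c))"
        using p[of c "\<i> *\<^sub>C d"] by (simp add: star_scaleC lmult_scaleC mult_scaleC_left mult_scaleC_right complex_vs.scale_minus_left)
      then have "star c * (m \<rhd> d) = star d * (m \<rhd> c)" by (simp add: complex_vs.scale_cancel_left)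
      then have "star c * (m \<rhd> d) + star c * (m \<rhd> d) = 0" using p[of c d] by simp
      then show ?thesis using scaleR_half_double[of "star c * (m \<rhd> d)"] by simp
    qed
    then have "m \<rhd> d = 0" for d using cstar_identity[of "m \<rhd> d"] by (metis norm_zero zero_eq_power2 norm_eq_zero)
    then have "m = 0" by (intro multiplier_eqI) simp
    then show False using assms by simp
  qed
  then obtain c where c: "star c * (m \<rhd> c) \<noteq> 0" by blast
  then have "of_alg (star c * (m \<rhd> c)) \<noteq> 0" by (metis of_alg_eq_iff of_alg_zero)
  then obtain \<tau> where \<tau>: "positive_functional \<tau>" "\<tau> (of_alg (star c * (m \<rhd> c))) \<noteq> 0"
    using exists_positive_functional by blast
  note F = positive_functional_form[OF \<tau>(1)]
  note lin = positive_form_linear[OF F]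
  obtain K where K: "0 < K" "\<And>x. cmod (\<tau> x) \<le> K * norm x" using positive_functional_bound[OF \<tau>(1)] by metis
  define \<Omega> where "\<Omega> n = \<tau> (of_alg (star c * (n \<rhd> c)))" for n
  define \<omega> where "\<omega> a = \<Omega> (of_alg a)" for a
  have "(c' *\<^sub>C n) \<rhd> c = c' *\<^sub>C (n \<rhd> c)" for c' n
  proof -
    have "of_alg ((c' *\<^sub>C n) \<rhd> c) = of_alg (c' *\<^sub>C (n \<rhd> c))"
      by (simp only: of_alg_lmult[symmetric] of_alg_scaleC mult_scaleC_left)
    then show ?thesis by simp
  qed
  then have lin\<Omega>: "Vector_Spaces.linear scaleC (*) \<Omega>"
    unfolding complex_linear_iff
    by (simp add: \<Omega>_def distrib_left of_alg_add of_alg_scaleC mult_scaleC_right complex_linear_add[OF lin] complex_linear_scaleC[OF lin])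
  have bd: "cmod (\<Omega> n) \<le> K * norm c * (norm (n \<rhd> c) + norm (c \<lhd> n))" for n
  proof -
    have "cmod (\<Omega> n) \<le> K * (norm c * norm (n \<rhd> c))"
      unfolding \<Omega>_def using K(1) norm_mult_ineq[of "star c" "n \<rhd> c"]
      by (intro order_trans[OF K(2)] mult_left_mono) (simp_all add: norm_of_alg norm_star)
    also have "\<dots> \<le> K * (norm c * (norm (n \<rhd> c) + norm (c \<lhd> n)))"
      using K(1) by (intro mult_left_mono) auto
    finally show ?thesis by (simp add: mult.assoc)
  qed
  have lin\<omega>: "Vector_Spaces.linear scaleC (*) \<omega>" unfolding complex_linear_iff \<omega>_def
    by (simp add: of_alg_add of_alg_scaleC complex_linear_add[OF lin\<Omega>] complex_linear_scaleC[OF lin\<Omega>])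
  have "bounded_linear \<omega>"
  proof (rule bounded_linear_intro)
    fix a
    have "norm (a * c) + norm (c * a) \<le> 2 * norm c * norm a"
      using norm_mult_ineq[of a c] norm_mult_ineq[of c a] by (simp add: algebra_simps)
    then have "K * norm c * (norm (a * c) + norm (c * a)) \<le> K * norm c * (2 * norm c * norm a)"
      using K(1) by (intro mult_left_mono) auto
    then show "norm (\<omega> a) \<le> norm a * (K * norm c * (2 * norm c))"
      using bd[of "of_alg a"] by (simp add: \<omega>_def mult_ac)
  qed (simp_all add: complex_linear_add[OF lin\<omega>] complex_linear_scaleR[OF lin\<omega>] scaleR_conv_of_real)
  moreover have "\<omega> (star a * a) \<in> \<real>\<^sub>\<ge>\<^sub>0" for a
  proof -
    have "star c * (star a * a * c) = star (a * c) * (a * c)" by (simp add: star_mult mult.assoc)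
    then have "\<omega> (star a * a) = \<tau> (of_alg (star (a * c) * (a * c)))"
      by (simp only: \<omega>_def \<Omega>_def act_of_alg)
    then have "\<omega> (star a * a) = \<tau> (star (of_alg (a * c)) * of_alg (a * c))"
      by (simp only: of_alg_star[symmetric] of_alg_mult[symmetric])
    then show ?thesis using F by (simp add: positive_form_def)
  qed
  ultimately have pf: "positive_functional \<omega>" using lin\<omega> by (simp add: positive_functional_def dual_def)
  have "functional_ext \<omega> = \<Omega>" by (rule functional_ext_eqI[OF pf lin\<Omega> bd]) (simp add: \<omega>_def)
  then show ?thesis using that[OF pf] \<tau>(2) by (simp add: \<Omega>_def)
qed

section \<open>Actions on multipliers\<close>

lemma
  assumes "continuous_action \<alpha>"
  shows action_star_hom: "star_hom (\<alpha> s)"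
    and action_add: "\<alpha> (s + t) a = \<alpha> s (\<alpha> t a)"
    and action_continuous: "continuous_on UNIV (\<lambda>s. \<alpha> s a)"
    and action_minus: "\<alpha> s (\<alpha> (- s) a) = a" "\<alpha> (- s) (\<alpha> s a) = a"
proof -
  have z: "\<alpha> 0 a = a"
    using assms by (simp add: continuous_action_def)
  show "star_hom (\<alpha> s)" and add: "\<alpha> (s + t) a = \<alpha> s (\<alpha> t a)"
    and "continuous_on UNIV (\<lambda>s. \<alpha> s a)" for s t a
    using assms by (auto simp: continuous_action_def)
  show "\<alpha> s (\<alpha> (- s) a) = a" "\<alpha> (- s) (\<alpha> s a) = a"
    using add[of s "- s" a] add[of "- s" s a] z by simp_all
qed

lemma action_norm_le: "continuous_action \<alpha> \<Longrightarrow> norm (\<alpha> s a) \<le> norm a"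
  using star_hom_norm_le[OF star_hom_of_alg[OF action_star_hom], of \<alpha> s a] by (simp add: norm_of_alg)

lemma action_bounded_linear: "continuous_action \<alpha> \<Longrightarrow> bounded_linear (\<alpha> s)"
  by (rule bounded_linear_intro[where K = 1])
    (simp_all add: star_hom_add[OF action_star_hom] star_hom_scaleR[OF action_star_hom] action_norm_le)

text \<open>The explicit candidate is conjugation, m -> \<alpha>_s m \<alpha>_(-s). Any other unital
  extension agrees with it after multiplication by elements of A, and that determines a
  multiplier.\<close>

lemma
  fixes \<alpha> :: "'g::{topological_group_add, t2_space} \<Rightarrow> 'a::cstar_algebra \<Rightarrow> 'a"
  assumes "continuous_action \<alpha>"
  shows mact_lmult: "mact \<alpha> s m \<rhd> a = \<alpha> s (m \<rhd> \<alpha> (- s) a)"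
    and mact_rmult: "a \<lhd> mact \<alpha> s m = \<alpha> s (\<alpha> (- s) a \<lhd> m)"
    and mact_of_alg: "mact \<alpha> s (of_alg a) = of_alg (\<alpha> s a)"
    and mact_star_hom: "star_hom (mact \<alpha> s)"
proof -
  note h = action_star_hom[OF assms] and inv = action_minus[OF assms]
  note simps = star_hom_add[OF h] star_hom_scaleC[OF h] star_hom_mult[OF h] star_hom_star[OF h]
  define M where "M m = mk_multiplier (\<lambda>a. \<alpha> s (m \<rhd> \<alpha> (- s) a)) (\<lambda>a. \<alpha> s (\<alpha> (- s) a \<lhd> m))" for m
  have bl: "bounded_linear (\<lambda>a. \<alpha> s (m \<rhd> \<alpha> (- s) a))" "bounded_linear (\<lambda>a. \<alpha> s (\<alpha> (- s) a \<lhd> m))" for m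
    by (intro bounded_linear_compose[OF action_bounded_linear[OF assms]]
        bounded_linear_compose[OF bounded_linear_lmult action_bounded_linear[OF assms]]
        bounded_linear_compose[OF bounded_linear_rmult action_bounded_linear[OF assms]])+
  have c: "a * \<alpha> s (m \<rhd> \<alpha> (- s) b) = \<alpha> s (\<alpha> (- s) a \<lhd> m) * b" for a b m
  proof -
    have "a * \<alpha> s (m \<rhd> \<alpha> (- s) b) = \<alpha> s (\<alpha> (- s) a * (m \<rhd> \<alpha> (- s) b))" by (simp only: simps inv)
    also have "\<dots> = \<alpha> s ((\<alpha> (- s) a \<lhd> m) * \<alpha> (- s) b)" by (simp only: mult_lmult)
    finally show ?thesis by (simp only: simps inv)
  qed
  have e: "\<alpha> s (m \<rhd> \<alpha> (- s) (a * b)) = \<alpha> s (m \<rhd> \<alpha> (- s) a) * b"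
    "\<alpha> s (\<alpha> (- s) (a * b) \<lhd> m) = a * \<alpha> s (\<alpha> (- s) b \<lhd> m)" for a b m
    by (simp_all only: simps lmult_mult rmult_mult inv)
  have lm: "M m \<rhd> a = \<alpha> s (m \<rhd> \<alpha> (- s) a)" and rm: "a \<lhd> M m = \<alpha> s (\<alpha> (- s) a \<lhd> m)" for m a
    unfolding M_def by (rule lmult_mk_multiplier rmult_mk_multiplier;
       (rule bl e c)?; simp add: simps lmult_scaleC rmult_scaleC)+
  have ma: "M (of_alg a) = of_alg (\<alpha> s a)" for a
    by (rule multiplier_eqI) (simp add: lm simps inv)
  have mh: "star_hom M"
    by (rule star_homI; rule multiplier_eqI; simp add: lm rm simps inv)
  have "mact \<alpha> s = M"
    unfolding mact_def morphism_ext_def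
  proof (rule the_equality, intro conjI allI)
    show "star_hom M" "M (of_alg a) = of_alg (\<alpha> s a)" for a by fact+
    show "M 1 = 1" by (rule multiplier_eqI) (simp add: lm inv)
    fix \<Phi> assume \<Phi>: "star_hom \<Phi> \<and> \<Phi> 1 = 1 \<and> (\<forall>a. \<Phi> (of_alg a) = of_alg (\<alpha> s a))"
    show "\<Phi> = M"
    proof (rule ext, rule multiplier_eqI)
      fix m a
      have "of_alg (\<Phi> m \<rhd> a) = \<Phi> m * \<Phi> (of_alg (\<alpha> (- s) a))" using \<Phi> by (simp add: of_alg_lmult inv)
      also have "\<dots> = \<Phi> (m * of_alg (\<alpha> (- s) a))" using \<Phi> by (simp add: star_hom_mult)
      also have "\<dots> = of_alg (M m \<rhd> a)" using \<Phi> by (simp add: of_alg_lmult lm)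
      finally show "\<Phi> m \<rhd> a = M m \<rhd> a" by simp
    qed
  qed
  then show "mact \<alpha> s m \<rhd> a = \<alpha> s (m \<rhd> \<alpha> (- s) a)" "a \<lhd> mact \<alpha> s m = \<alpha> s (\<alpha> (- s) a \<lhd> m)"
     "mact \<alpha> s (of_alg a) = of_alg (\<alpha> s a)" "star_hom (mact \<alpha> s)"
    using lm rm ma mh by simp_all
qed

section \<open>Well-definedness of the averaging map\<close>

lemma functional_ext_eqD:
  fixes e :: "'a::cstar_algebra multiplier"
  assumes "\<And>\<omega>. positive_functional \<omega> \<Longrightarrow> functional_ext \<omega> e = functional_ext \<omega> e'"
  shows "e = e'"
proof (rule ccontr)
  assume "e \<noteq> e'"
  then obtain \<omega> where w: "positive_functional \<omega>" "functional_ext \<omega> (e - e') \<noteq> 0"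
    using functional_ext_separates[of "e - e'"] by auto
  then show False
    using assms[OF w(1)] complex_linear_diff[OF positive_form_linear[OF positive_form_functional_ext[OF w(1)]]] by simp
qed

lemma average_pos_eq: "is_average \<mu> \<alpha> a e \<Longrightarrow> average_pos \<mu> \<alpha> a = e"
  unfolding average_pos_def by (rule the_equality) (auto simp: is_average_def intro!: functional_ext_eqD)

text \<open>Under a positive functional every expansion of \<open>a\<close> yields the integral of
  \<omega>(\<alpha>_s(a)), so two expansions give values that no functional distinguishes.\<close>

lemma average_eqI:
  fixes \<alpha> :: "'g::{topological_group_add, t2_space} \<Rightarrow> 'a::cstar_algebra \<Rightarrow> 'a" and n :: nat
  assumes \<alpha>: "continuous_action \<alpha>" and dom: "a \<in> \<mm> \<mu> \<alpha>"
    and p: "\<And>i. i < n \<Longrightarrow> p i \<in> \<pp> \<mu> \<alpha>" "\<And>i. i < n \<Longrightarrow> is_average \<mu> \<alpha> (p i) (e i)"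
    and a: "a = (\<Sum>i<n. c i *\<^sub>C p i)"
  shows "average \<mu> \<alpha> a = (\<Sum>i<n. c i *\<^sub>C e i)"
proof -
  have *: "functional_ext \<omega> (\<Sum>i<k. d i *\<^sub>C f i) = (LINT s|\<mu>. functional_ext \<omega> (mact \<alpha> s (\<Sum>i<k. d i *\<^sub>C q i)))"
    if "\<And>i. i < k \<Longrightarrow> is_average \<mu> \<alpha> (q i) (f i)" "positive_functional \<omega>" for \<omega> and k :: nat and d q f
  proof -
    note lin = positive_form_linear[OF positive_form_functional_ext[OF that(2)]]
    note h = mact_star_hom[OF \<alpha>]
    have i: "integrable \<mu> (\<lambda>s. functional_ext \<omega> (mact \<alpha> s (q i)))"
       "functional_ext \<omega> (f i) = (LINT s|\<mu>. functional_ext \<omega> (mact \<alpha> s (q i)))" if "i < k" for i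
      using that \<open>\<And>i. i < k \<Longrightarrow> is_average \<mu> \<alpha> (q i) (f i)\<close> \<open>positive_functional \<omega>\<close> by (auto simp: is_average_def)
    have "(LINT s|\<mu>. functional_ext \<omega> (mact \<alpha> s (\<Sum>i<k. d i *\<^sub>C q i)))
        = (LINT s|\<mu>. (\<Sum>i<k. d i * functional_ext \<omega> (mact \<alpha> s (q i))))"
      by (simp add: star_hom_sum[OF h] star_hom_scaleC[OF h] complex_linear_sum[OF lin] complex_linear_scaleC[OF lin])
    also have "\<dots> = (\<Sum>i<k. d i * (LINT s|\<mu>. functional_ext \<omega> (mact \<alpha> s (q i))))"
      using i(1) by (subst Bochner_Integration.integral_sum) auto
    also have "\<dots> = functional_ext \<omega> (\<Sum>i<k. d i *\<^sub>C f i)"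
      using i(2) by (simp add: complex_linear_sum[OF lin] complex_linear_scaleC[OF lin])
    finally show ?thesis by simp
  qed
  have ap: "is_average \<mu> \<alpha> q (average_pos \<mu> \<alpha> q)" if "q \<in> \<pp> \<mu> \<alpha>" for q
    using that average_pos_eq by (auto simp: avg_pos_def)
  show ?thesis
    unfolding average_def
  proof (rule the_equality)
    show "a \<in> \<mm> \<mu> \<alpha> \<and> (\<exists>(k::nat) ca pa. (\<forall>i<k. pa i \<in> \<pp> \<mu> \<alpha>) \<and> a = (\<Sum>i<k. ca i *\<^sub>C pa i) \<and>
        (\<Sum>i<n. c i *\<^sub>C e i) = (\<Sum>i<k. ca i *\<^sub>C average_pos \<mu> \<alpha> (pa i)))"
      using dom p average_pos_eq[OF p(2)] a
      by (intro conjI exI[of _ n] exI[of _ c] exI[of _ p]) auto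
  next
    fix e' assume "a \<in> \<mm> \<mu> \<alpha> \<and> (\<exists>(n::nat) c p. (\<forall>i<n. p i \<in> \<pp> \<mu> \<alpha>) \<and> a = (\<Sum>i<n. c i *\<^sub>C p i) \<and>
        e' = (\<Sum>i<n. c i *\<^sub>C average_pos \<mu> \<alpha> (p i)))"
    then obtain k :: nat and d q where q: "\<And>i. i < k \<Longrightarrow> q i \<in> \<pp> \<mu> \<alpha>" "a = (\<Sum>i<k. d i *\<^sub>C q i)"
       "e' = (\<Sum>i<k. d i *\<^sub>C average_pos \<mu> \<alpha> (q i))" by blast
    show "e' = (\<Sum>i<n. c i *\<^sub>C e i)"
    proof (rule functional_ext_eqD)
      fix \<omega> :: "'a \<Rightarrow> complex" assume w: "positive_functional \<omega>"
      show "functional_ext \<omega> e' = functional_ext \<omega> (\<Sum>i<n. c i *\<^sub>C e i)"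
        using *[where k = k and q = q and f = "\<lambda>i. average_pos \<mu> \<alpha> (q i)" and d = d, OF ap[OF q(1)] w]
          *[where k = n and q = p and f = e and d = c, OF p(2) w] a q by simp
    qed
  qed
qed

section \<open>Integration of compactly supported continuous functions\<close>

text \<open>Differences of measurable functions are delicate when the space is not separable. A
  simple function has finitely many values, so the sublevel set is a finite union over these
  values.\<close>

lemma borel_measurable_norm_diff_simple:
  fixes f S :: "'s \<Rightarrow> 'a::real_normed_vector"
  assumes f: "f \<in> borel_measurable M" and S: "simple_function M S"
  shows "(\<lambda>s. norm (f s - S s)) \<in> borel_measurable M"
proof (rule borel_measurableI_less)
  fix r :: real
  have fc: "(\<lambda>s. norm (f s - c)) \<in> borel_measurable M" for c
    by (rule measurable_compose[OF f borel_measurable_continuous_onI]) (intro continuous_intros)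
  have "{s \<in> space M. norm (f s - S s) < r} = (\<Union>c\<in>S ` space M. (S -` {c} \<inter> space M) \<inter> {s \<in> space M. norm (f s - c) < r})"
    by auto
  also have "\<dots> \<in> sets M"
  proof (intro sets.finite_UN)
    show "finite (S ` space M)" using S by (simp add: simple_function_def)
    fix c
    have "S -` {c} \<inter> space M \<in> sets M" using S simple_functionD(2) by blast
    moreover have "{s \<in> space M. norm (f s - c) < r} \<in> sets M" using fc[of c] by (simp add: borel_measurable_iff_less)
    ultimately show "(S -` {c} \<inter> space M) \<inter> {s \<in> space M. norm (f s - c) < r} \<in> sets M" by (rule sets.Int)
  qed
  finally show "{s \<in> space M. norm (f s - S s) < r} \<in> sets M" .
qed

lemma simple_bochner_integral_diff_le:
  fixes f S T :: "'s \<Rightarrow> 'a::real_normed_vector"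
  assumes f: "f \<in> borel_measurable M"
    and S: "Bochner_Integration.simple_bochner_integrable M S" and T: "Bochner_Integration.simple_bochner_integrable M T"
  shows "ennreal (norm (Bochner_Integration.simple_bochner_integral M S - Bochner_Integration.simple_bochner_integral M T))
     \<le> (\<integral>\<^sup>+s. norm (f s - S s) \<partial>M) + (\<integral>\<^sup>+s. norm (f s - T s) \<partial>M)"
proof -
  have ST: "Bochner_Integration.simple_bochner_integrable M (\<lambda>s. S s - T s)"
    by (rule simple_bochner_integrable_compose2[OF _ S T]) simp
  have nST: "Bochner_Integration.simple_bochner_integrable M (\<lambda>s. norm (S s - T s))"
    by (rule simple_bochner_integrable_compose2[where p = "\<lambda>x y. norm x", OF _ ST ST]) simp
  have "ennreal (norm (Bochner_Integration.simple_bochner_integral M S - Bochner_Integration.simple_bochner_integral M T))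
     \<le> ennreal (Bochner_Integration.simple_bochner_integral M (\<lambda>s. norm (S s - T s)))"
    unfolding simple_bochner_integral_diff[OF S T, symmetric]
    by (intro ennreal_leI simple_bochner_integral_norm_bound ST)
  also have "\<dots> = (\<integral>\<^sup>+s. norm (S s - T s) \<partial>M)"
    by (rule simple_bochner_integral_eq_nn_integral[OF nST]) simp
  also have "\<dots> \<le> (\<integral>\<^sup>+s. ennreal (norm (f s - S s)) + ennreal (norm (f s - T s)) \<partial>M)"
  proof (intro nn_integral_mono)
    fix s
    have "norm (S s - T s) \<le> norm (f s - S s) + norm (f s - T s)"
      using norm_triangle_ineq4[of "f s - T s" "f s - S s"] by simp
    then show "ennreal (norm (S s - T s)) \<le> ennreal (norm (f s - S s)) + ennreal (norm (f s - T s))"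
      by (simp flip: ennreal_plus)
  qed
  also have "\<dots> = (\<integral>\<^sup>+s. norm (f s - S s) \<partial>M) + (\<integral>\<^sup>+s. norm (f s - T s) \<partial>M)"
    using borel_measurable_norm_diff_simple[OF f] S T
    by (intro nn_integral_add measurable_compose[OF _ measurable_ennreal]) (auto simp: simple_bochner_integrable.simps)
  finally show ?thesis .
qed

text \<open>Comparing \<open>T\<close> with the simple functions from the definition and passing to
  the limit makes the L1 distance of \<open>T\<close> an error bound. Uniqueness and all Riemann sum
  estimates rest on it.\<close>

lemma has_vector_integral_approx:
  fixes f T :: "'s \<Rightarrow> 'a::real_normed_vector"
  assumes v: "has_vector_integral M f v" and T: "Bochner_Integration.simple_bochner_integrable M T"
  shows "ennreal (norm (v - Bochner_Integration.simple_bochner_integral M T)) \<le> (\<integral>\<^sup>+s. norm (f s - T s) \<partial>M)"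
proof -
  obtain S where f: "f \<in> borel_measurable M" and S: "\<And>i. Bochner_Integration.simple_bochner_integrable M (S i)"
    "(\<lambda>i::nat. \<integral>\<^sup>+s. norm (f s - S i s) \<partial>M) \<longlonglongrightarrow> 0"
    "(\<lambda>i. Bochner_Integration.simple_bochner_integral M (S i)) \<longlonglongrightarrow> v"
    using v unfolding has_vector_integral_def by blast
  let ?I = "Bochner_Integration.simple_bochner_integral M"
  show ?thesis
  proof (rule LIMSEQ_le)
    show "(\<lambda>i. ennreal (norm (?I (S i) - ?I T))) \<longlonglongrightarrow> ennreal (norm (v - ?I T))"
      by (intro tendsto_ennrealI tendsto_intros S)
    have "(\<lambda>i. (\<integral>\<^sup>+s. norm (f s - S i s) \<partial>M) + (\<integral>\<^sup>+s. norm (f s - T s) \<partial>M)) \<longlonglongrightarrow> 0 + (\<integral>\<^sup>+s. norm (f s - T s) \<partial>M)"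
      by (intro tendsto_add S tendsto_const)
    then show "(\<lambda>i. (\<integral>\<^sup>+s. norm (f s - S i s) \<partial>M) + (\<integral>\<^sup>+s. norm (f s - T s) \<partial>M)) \<longlonglongrightarrow> (\<integral>\<^sup>+s. norm (f s - T s) \<partial>M)"
      by simp
    show "\<exists>N. \<forall>i\<ge>N. ennreal (norm (?I (S i) - ?I T)) \<le> (\<integral>\<^sup>+s. norm (f s - S i s) \<partial>M) + (\<integral>\<^sup>+s. norm (f s - T s) \<partial>M)"
      using simple_bochner_integral_diff_le[OF f S(1) T] by blast
  qed
qed

lemma has_vector_integral_unique:
  fixes f :: "'s \<Rightarrow> 'a::real_normed_vector"
  assumes "has_vector_integral M f v" "has_vector_integral M f w"
  shows "v = w"
proof -
  obtain S where S: "\<And>i. Bochner_Integration.simple_bochner_integrable M (S i)"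
    "(\<lambda>i::nat. \<integral>\<^sup>+s. norm (f s - S i s) \<partial>M) \<longlonglongrightarrow> 0"
    "(\<lambda>i. Bochner_Integration.simple_bochner_integral M (S i)) \<longlonglongrightarrow> w"
    using assms(2) unfolding has_vector_integral_def by blast
  have "(\<lambda>i. ennreal (norm (v - Bochner_Integration.simple_bochner_integral M (S i)))) \<longlonglongrightarrow> 0"
    by (rule tendsto_sandwich[OF _ _ tendsto_const S(2)])
      (use has_vector_integral_approx[OF assms(1) S(1)] in auto)
  then have "(\<lambda>i. norm (v - Bochner_Integration.simple_bochner_integral M (S i))) \<longlonglongrightarrow> 0"
    by (simp add: ennreal_tendsto_0_iff)
  then have "(\<lambda>i. v - Bochner_Integration.simple_bochner_integral M (S i)) \<longlonglongrightarrow> 0"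
    by (rule tendsto_norm_zero_cancel)
  moreover have "(\<lambda>i. v - Bochner_Integration.simple_bochner_integral M (S i)) \<longlonglongrightarrow> v - w"
    by (intro tendsto_intros S(3))
  ultimately show ?thesis using LIMSEQ_unique by fastforce
qed

text \<open>Measurability of the sum is a separate hypothesis, since it is not automatic without
  separability. In the applications it comes from continuity.\<close>

lemma has_vector_integral_add:
  fixes f g :: "'s \<Rightarrow> 'a::real_normed_vector"
  assumes f: "has_vector_integral M f v" and g: "has_vector_integral M g w"
    and m: "(\<lambda>s. f s + g s) \<in> borel_measurable M"
  shows "has_vector_integral M (\<lambda>s. f s + g s) (v + w)"
proof -
  obtain S where fm: "f \<in> borel_measurable M" and S: "\<And>i. Bochner_Integration.simple_bochner_integrable M (S i)"
    "(\<lambda>i::nat. \<integral>\<^sup>+s. norm (f s - S i s) \<partial>M) \<longlonglongrightarrow> 0"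
    "(\<lambda>i. Bochner_Integration.simple_bochner_integral M (S i)) \<longlonglongrightarrow> v"
    using f unfolding has_vector_integral_def by blast
  obtain T where gm: "g \<in> borel_measurable M" and T: "\<And>i. Bochner_Integration.simple_bochner_integrable M (T i)"
    "(\<lambda>i::nat. \<integral>\<^sup>+s. norm (g s - T i s) \<partial>M) \<longlonglongrightarrow> 0"
    "(\<lambda>i. Bochner_Integration.simple_bochner_integral M (T i)) \<longlonglongrightarrow> w"
    using g unfolding has_vector_integral_def by blast
  have *: "(\<integral>\<^sup>+s. norm (f s + g s - (S i s + T i s)) \<partial>M) \<le> (\<integral>\<^sup>+s. norm (f s - S i s) \<partial>M) + (\<integral>\<^sup>+s. norm (g s - T i s) \<partial>M)" for i
  proof -
    have "(\<integral>\<^sup>+s. norm (f s + g s - (S i s + T i s)) \<partial>M) \<le> (\<integral>\<^sup>+s. ennreal (norm (f s - S i s)) + ennreal (norm (g s - T i s)) \<partial>M)"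
    proof (intro nn_integral_mono)
      fix s
      show "ennreal (norm (f s + g s - (S i s + T i s))) \<le> ennreal (norm (f s - S i s)) + ennreal (norm (g s - T i s))"
        using norm_triangle_ineq[of "f s - S i s" "g s - T i s"] by (simp add: algebra_simps flip: ennreal_plus)
    qed
    also have "\<dots> = (\<integral>\<^sup>+s. norm (f s - S i s) \<partial>M) + (\<integral>\<^sup>+s. norm (g s - T i s) \<partial>M)"
      using borel_measurable_norm_diff_simple[OF fm] borel_measurable_norm_diff_simple[OF gm] S(1)[of i] T(1)[of i]
      by (intro nn_integral_add measurable_compose[OF _ measurable_ennreal]) (auto simp: simple_bochner_integrable.simps)
    finally show ?thesis .
  qed
  show ?thesis
    unfolding has_vector_integral_def
  proof (intro conjI m exI[of _ "\<lambda>i s. S i s + T i s"] allI)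
    show "Bochner_Integration.simple_bochner_integrable M (\<lambda>s. S i s + T i s)" for i
      by (rule simple_bochner_integrable_compose2[OF _ S(1) T(1)]) simp
    show "(\<lambda>i. Bochner_Integration.simple_bochner_integral M (\<lambda>s. S i s + T i s)) \<longlonglongrightarrow> v + w"
      unfolding simple_bochner_integral_add[OF S(1) T(1)] by (intro tendsto_add S T)
    have lim: "(\<lambda>i. (\<integral>\<^sup>+s. norm (f s - S i s) \<partial>M) + (\<integral>\<^sup>+s. norm (g s - T i s) \<partial>M)) \<longlonglongrightarrow> 0"
      using tendsto_add[OF S(2) T(2)] by simp
    show "(\<lambda>i. \<integral>\<^sup>+s. norm (f s + g s - (S i s + T i s)) \<partial>M) \<longlonglongrightarrow> 0"
      by (rule tendsto_sandwich[OF _ _ tendsto_const lim]) (simp_all add: *)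
  qed
qed

lemma has_vector_integral_bounded_linear:
  fixes f :: "'s \<Rightarrow> 'a::real_normed_vector" and L :: "'a \<Rightarrow> 'b::real_normed_vector"
  assumes f: "has_vector_integral M f v" and L: "bounded_linear L"
  shows "has_vector_integral M (\<lambda>s. L (f s)) (L v)"
proof -
  obtain S where fm: "f \<in> borel_measurable M" and S: "\<And>i. Bochner_Integration.simple_bochner_integrable M (S i)"
    "(\<lambda>i::nat. \<integral>\<^sup>+s. norm (f s - S i s) \<partial>M) \<longlonglongrightarrow> 0"
    "(\<lambda>i. Bochner_Integration.simple_bochner_integral M (S i)) \<longlonglongrightarrow> v"
    using f unfolding has_vector_integral_def by blast
  obtain K where K: "0 < K" "\<And>x. norm (L x) \<le> norm x * K" using bounded_linear.pos_bounded[OF L] by blast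
  have lin: "linear L" using L by (rule bounded_linear.linear)
  have fSm: "(\<lambda>s. ennreal (norm (f s - S i s))) \<in> borel_measurable M" for i
    using borel_measurable_norm_diff_simple[OF fm, of "S i"] S(1)[of i]
    by (intro measurable_compose[OF _ measurable_ennreal]) (auto simp: simple_bochner_integrable.simps)
  show ?thesis
    unfolding has_vector_integral_def
  proof (intro conjI exI[of _ "\<lambda>i s. L (S i s)"] allI)
    show "(\<lambda>s. L (f s)) \<in> borel_measurable M"
      by (rule measurable_compose[OF fm borel_measurable_continuous_onI]) (rule linear_continuous_on[OF L])
    show "Bochner_Integration.simple_bochner_integrable M (\<lambda>s. L (S i s))" for i
      by (rule simple_bochner_integrable_compose2[where p = "\<lambda>x y. L x", OF _ S(1) S(1)]) (simp add: linear_0[OF lin])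
    show "(\<lambda>i. Bochner_Integration.simple_bochner_integral M (\<lambda>s. L (S i s))) \<longlonglongrightarrow> L v"
      unfolding simple_bochner_integral_linear[OF lin S(1)] by (rule bounded_linear.tendsto[OF L S(3)])
    have "(\<integral>\<^sup>+s. norm (L (f s) - L (S i s)) \<partial>M) \<le> K * (\<integral>\<^sup>+s. norm (f s - S i s) \<partial>M)" for i
    proof -
      have "(\<integral>\<^sup>+s. norm (L (f s) - L (S i s)) \<partial>M) \<le> (\<integral>\<^sup>+s. ennreal K * ennreal (norm (f s - S i s)) \<partial>M)"
        using K by (intro nn_integral_mono)
          (simp add: linear_diff[OF lin, symmetric] mult.commute flip: ennreal_mult)
      also have "\<dots> = K * (\<integral>\<^sup>+s. norm (f s - S i s) \<partial>M)" by (rule nn_integral_cmult[OF fSm])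
      finally show ?thesis .
    qed
    note * = this
    have "(\<lambda>i. K * (\<integral>\<^sup>+s. norm (f s - S i s) \<partial>M)) \<longlonglongrightarrow> ennreal K * 0"
      by (intro ennreal_tendsto_cmult S) simp
    then have lim: "(\<lambda>i. K * (\<integral>\<^sup>+s. norm (f s - S i s) \<partial>M)) \<longlonglongrightarrow> 0" by simp
    show "(\<lambda>i. \<integral>\<^sup>+s. norm (L (f s) - L (S i s)) \<partial>M) \<longlonglongrightarrow> 0"
      by (rule tendsto_sandwich[OF _ _ tendsto_const lim]) (simp_all add: *)
  qed
qed

lemma has_vector_integral_imp_has_bochner_integral:
  fixes f :: "'s \<Rightarrow> 'a::{real_normed_vector, second_countable_topology}"
  assumes "has_vector_integral M f v" shows "has_bochner_integral M f v"
  using assms unfolding has_vector_integral_def by (auto intro: has_bochner_integral.intros)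

section \<open>Riemann sums over compact sets\<close>

lemma finite_disjoint_refinement:
  assumes "finite I" "\<And>i. i \<in> I \<Longrightarrow> W i \<in> sets M"
  obtains B where "\<And>i. i \<in> I \<Longrightarrow> B i \<in> sets M" "\<And>i. i \<in> I \<Longrightarrow> B i \<subseteq> W i" "disjoint_family_on B I" "(\<Union>i\<in>I. B i) = (\<Union>i\<in>I. W i)"
  using assms
proof (induction I arbitrary: thesis rule: finite_induct)
  case empty
  show ?case by (rule empty(1)[of "\<lambda>i. {}"]) (auto simp: disjoint_family_on_def)
next
  case (insert x I)
  obtain B where B: "\<And>i. i \<in> I \<Longrightarrow> B i \<in> sets M" "\<And>i. i \<in> I \<Longrightarrow> B i \<subseteq> W i" "disjoint_family_on B I" "(\<Union>i\<in>I. B i) = (\<Union>i\<in>I. W i)"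
    using insert.IH insert.prems(2) by blast
  define B' where "B' = B(x := W x - (\<Union>i\<in>I. B i))"
  have e: "B' i = B i" if "i \<in> I" for i using that insert.hyps(2) by (auto simp: B'_def)
  show ?case
  proof (rule insert.prems(1)[of B'])
    show "B' i \<in> sets M" "B' i \<subseteq> W i" if "i \<in> insert x I" for i
      using that B insert.prems(2) insert.hyps by (auto simp: B'_def intro!: sets.Diff sets.finite_UN)
    show "disjoint_family_on B' (insert x I)"
      using B(3) e insert.hyps unfolding disjoint_family_on_def by (auto simp: B'_def)
    show "(\<Union>i\<in>insert x I. B' i) = (\<Union>i\<in>insert x I. W i)"
      using B(4) insert.hyps by (auto simp: B'_def)
  qed
qed

text \<open>A tagged partition of \<open>K\<close> that is fine in two ways. Besides the oscillation
  of \<open>f\<close>, the offset of a cell from its tag is confined to \<open>V\<close>; this keeps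
  the cells with tags in a given set inside an enlargement of that set independent of the
  partition.\<close>

definition riemann_data :: "'g::topological_group_add set \<Rightarrow> 'g set \<Rightarrow> ('g \<Rightarrow> 'a::metric_space) \<Rightarrow> real \<Rightarrow> 'g set \<Rightarrow> ('g \<Rightarrow> 'g set) \<Rightarrow> bool" where
  "riemann_data K V f e I B \<longleftrightarrow> finite I \<and> I \<subseteq> K \<and> (\<forall>i\<in>I. B i \<in> sets borel) \<and> disjoint_family_on B I \<and>
     (\<Union>i\<in>I. B i) = K \<and> (\<forall>i\<in>I. \<forall>s\<in>B i. - s + i \<in> V \<and> dist (f s) (f i) < e)"

lemma continuous_on_left_translation: "continuous_on UNIV (\<lambda>t. s + t :: 'g::topological_group_add)"
  unfolding continuous_on_def by (auto intro!: tendsto_intros)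

lemma riemann_data_exists:
  fixes f :: "'g::{topological_group_add, t2_space} \<Rightarrow> 'a::metric_space"
  assumes "compact K" "continuous_on UNIV f" "open V" "0 \<in> V" "0 < e"
  obtains I B where "riemann_data K V f e I B"
proof -
  define W where "W i = {s. - s + i \<in> V} \<inter> {s. dist (f s) (f i) < e}" for i
  have W: "open (W i)" "i \<in> W i" for i
  proof -
    have "continuous_on UNIV (\<lambda>s. - s + i)" unfolding continuous_on_def by (auto intro!: tendsto_intros)
    then have "open ((\<lambda>s. - s + i) -` V)" using assms(3) by (rule open_vimage[rotated])
    moreover have "open {s. dist (f s) (f i) < e}"
      by (intro open_Collect_less continuous_intros assms(2))
    ultimately show "open (W i)" by (auto simp: W_def vimage_def)
    show "i \<in> W i" using assms by (simp add: W_def)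
  qed
  obtain I where I: "I \<subseteq> K" "finite I" "K \<subseteq> (\<Union>i\<in>I. W i)"
    using compactE_image[OF assms(1), of K W] W by (metis UN_I subsetI)
  have "W i \<inter> K \<in> sets borel" for i
    using W(1) compact_imp_closed[OF assms(1)] by auto
  then obtain B where B: "\<And>i. i \<in> I \<Longrightarrow> B i \<in> sets borel" "\<And>i. i \<in> I \<Longrightarrow> B i \<subseteq> W i \<inter> K" "disjoint_family_on B I"
     "(\<Union>i\<in>I. B i) = (\<Union>i\<in>I. W i \<inter> K)"
    using finite_disjoint_refinement[OF I(2), of "\<lambda>i. W i \<inter> K" borel] by blast
  have "riemann_data K V f e I B"
    unfolding riemann_data_def using I B by (auto simp: W_def subset_iff)
  then show ?thesis using that by blast
qed

lemma simple_bochner_indicator_scaleR: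
  fixes c :: "'a::real_normed_vector"
  assumes "B \<in> sets M" "emeasure M B \<noteq> \<infinity>"
  shows "Bochner_Integration.simple_bochner_integrable M (\<lambda>s. indicator B s *\<^sub>R c)"
    and "Bochner_Integration.simple_bochner_integral M (\<lambda>s. indicator B s *\<^sub>R c) = measure M B *\<^sub>R c"
proof -
  have e: "{y \<in> space M. indicator B y \<noteq> (0::real)} = B" using sets.sets_into_space[OF assms(1)] by (auto simp: indicator_def)
  have i: "Bochner_Integration.simple_bochner_integrable M (indicator B :: _ \<Rightarrow> real)"
    using assms e by (intro simple_bochner_integrable.intros simple_function_indicator) auto
  show "Bochner_Integration.simple_bochner_integrable M (\<lambda>s. indicator B s *\<^sub>R c)"
    by (rule simple_bochner_integrable_compose2[where p = "\<lambda>x y. x *\<^sub>R c", OF _ i i]) simp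
  have "ennreal (Bochner_Integration.simple_bochner_integral M (indicator B)) = (\<integral>\<^sup>+s. ennreal (indicator B s) \<partial>M)"
    by (rule simple_bochner_integral_eq_nn_integral[OF i]) simp
  also have "\<dots> = ennreal (measure M B)" using assms by (simp add: ennreal_indicator emeasure_eq_ennreal_measure)
  finally have "Bochner_Integration.simple_bochner_integral M (indicator B) = measure M B"
    by (simp add: simple_bochner_integral_nonneg)
  moreover have "linear (\<lambda>r. r *\<^sub>R c)" by (rule bounded_linear.linear[OF bounded_linear_scaleR_left])
  note simple_bochner_integral_linear[OF this i]
  ultimately show "Bochner_Integration.simple_bochner_integral M (\<lambda>s. indicator B s *\<^sub>R c) = measure M B *\<^sub>R c"
    by simp
qed

lemma simple_bochner_sum:
  fixes c :: "'i \<Rightarrow> 'a::real_normed_vector"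
  assumes "finite I" "\<And>i. i \<in> I \<Longrightarrow> B i \<in> sets M" "\<And>i. i \<in> I \<Longrightarrow> emeasure M (B i) \<noteq> \<infinity>"
  shows "Bochner_Integration.simple_bochner_integrable M (\<lambda>s. \<Sum>i\<in>I. indicator (B i) s *\<^sub>R c i) \<and>
    Bochner_Integration.simple_bochner_integral M (\<lambda>s. \<Sum>i\<in>I. indicator (B i) s *\<^sub>R c i) = (\<Sum>i\<in>I. measure M (B i) *\<^sub>R c i)"
  using assms
proof (induction I rule: finite_induct)
  case empty
  then show ?case by (auto intro!: simple_bochner_integrable.intros sum.neutral simp: simple_bochner_integral_def)
next
  case (insert x I)
  note ih = insert.IH[OF insert.prems] and x = simple_bochner_indicator_scaleR[of "B x" M "c x"]
  have i: "Bochner_Integration.simple_bochner_integrable M (\<lambda>s. \<Sum>i\<in>I. indicator (B i) s *\<^sub>R c i)"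
    "Bochner_Integration.simple_bochner_integral M (\<lambda>s. \<Sum>i\<in>I. indicator (B i) s *\<^sub>R c i) = (\<Sum>i\<in>I. measure M (B i) *\<^sub>R c i)"
    using ih by auto
  have j: "Bochner_Integration.simple_bochner_integrable M (\<lambda>s. indicator (B x) s *\<^sub>R c x)"
    "Bochner_Integration.simple_bochner_integral M (\<lambda>s. indicator (B x) s *\<^sub>R c x) = measure M (B x) *\<^sub>R c x"
    using x insert.prems by auto
  show ?case
    unfolding sum.insert[OF insert.hyps] simple_bochner_integral_add[OF j(1) i(1)] i(2) j(2)
    by (intro conjI refl simple_bochner_integrable_compose2[of "(+)", OF _ j(1) i(1)]) simp
qed

section \<open>Haar measure\<close>

lemma
  assumes "left_haar_measure \<mu>"
  shows haar_sets: "sets \<mu> = sets borel"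
    and haar_compact: "compact K \<Longrightarrow> emeasure \<mu> K < \<infinity>"
    and haar_translate: "B \<in> sets borel \<Longrightarrow> emeasure \<mu> ((\<lambda>t. s + t) ` B) = emeasure \<mu> B"
proof -
  show "sets \<mu> = sets borel" using assms by (simp add: left_haar_measure_def)
  show "compact K \<Longrightarrow> emeasure \<mu> K < \<infinity>" "B \<in> sets borel \<Longrightarrow> emeasure \<mu> ((\<lambda>t. s + t) ` B) = emeasure \<mu> B"
    using assms by (simp_all add: left_haar_measure_def)
qed

lemma haar_measurable_continuous:
  "left_haar_measure \<mu> \<Longrightarrow> continuous_on UNIV f \<Longrightarrow> f \<in> borel_measurable \<mu>"
  by (subst measurable_cong_sets[OF haar_sets refl]) (auto intro: borel_measurable_continuous_onI)

lemma riemann_sum_bound: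
  fixes f :: "'g::{topological_group_add, t2_space} \<Rightarrow> 'a::real_normed_vector"
  assumes \<mu>: "left_haar_measure \<mu>" and K: "compact K" "\<And>s. s \<notin> K \<Longrightarrow> f s = 0"
    and IB: "finite I" "\<And>i. i \<in> I \<Longrightarrow> B i \<in> sets borel" "disjoint_family_on B I" "(\<Union>i\<in>I. B i) = K"
    and c: "\<And>i s. i \<in> I \<Longrightarrow> s \<in> B i \<Longrightarrow> norm (f s - c i) \<le> e" and "0 \<le> e"
  shows "Bochner_Integration.simple_bochner_integrable \<mu> (\<lambda>s. \<Sum>i\<in>I. indicator (B i) s *\<^sub>R c i)"
    "Bochner_Integration.simple_bochner_integral \<mu> (\<lambda>s. \<Sum>i\<in>I. indicator (B i) s *\<^sub>R c i) = (\<Sum>i\<in>I. measure \<mu> (B i) *\<^sub>R c i)"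
    "(\<integral>\<^sup>+s. norm (f s - (\<Sum>i\<in>I. indicator (B i) s *\<^sub>R c i)) \<partial>\<mu>) \<le> ennreal (e * measure \<mu> K)"
proof -
  have Ks: "K \<in> sets \<mu>" using compact_imp_closed[OF K(1)] haar_sets[OF \<mu>] by auto
  have "emeasure \<mu> (B i) \<noteq> \<infinity>" if "i \<in> I" for i
  proof -
    have "B i \<subseteq> K" using that IB(4) by blast
    then have "emeasure \<mu> (B i) \<le> emeasure \<mu> K" using Ks by (rule emeasure_mono)
    then show ?thesis using haar_compact[OF \<mu> K(1)] by (auto simp: top_unique)
  qed
  then have "Bochner_Integration.simple_bochner_integrable \<mu> (\<lambda>s. \<Sum>i\<in>I. indicator (B i) s *\<^sub>R c i) \<and>
    Bochner_Integration.simple_bochner_integral \<mu> (\<lambda>s. \<Sum>i\<in>I. indicator (B i) s *\<^sub>R c i) = (\<Sum>i\<in>I. measure \<mu> (B i) *\<^sub>R c i)"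
    using IB haar_sets[OF \<mu>] by (intro simple_bochner_sum) auto
  then show "Bochner_Integration.simple_bochner_integrable \<mu> (\<lambda>s. \<Sum>i\<in>I. indicator (B i) s *\<^sub>R c i)"
    "Bochner_Integration.simple_bochner_integral \<mu> (\<lambda>s. \<Sum>i\<in>I. indicator (B i) s *\<^sub>R c i) = (\<Sum>i\<in>I. measure \<mu> (B i) *\<^sub>R c i)"
    by blast+
  have pt: "norm (f s - (\<Sum>i\<in>I. indicator (B i) s *\<^sub>R c i)) \<le> e * indicator K s" for s
  proof (cases "s \<in> K")
    case True
    then obtain j where j: "j \<in> I" "s \<in> B j" using IB(4) by blast
    have "indicator (B i) s *\<^sub>R c i = 0" if "i \<in> I - {j}" for i
      using that j IB(3) by (auto simp: disjoint_family_on_def indicator_def)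
    then have "(\<Sum>i\<in>I. indicator (B i) s *\<^sub>R c i) = c j"
      using j by (subst sum.remove[OF IB(1) j(1)]) (simp add: sum.neutral)
    then show ?thesis using c[OF j] True by simp
  next
    case False
    then have "indicator (B i) s *\<^sub>R c i = 0" if "i \<in> I" for i using that IB(4) by (auto simp: indicator_def)
    then show ?thesis using False K(2)[OF False] by (simp add: sum.neutral)
  qed
  have "(\<integral>\<^sup>+s. norm (f s - (\<Sum>i\<in>I. indicator (B i) s *\<^sub>R c i)) \<partial>\<mu>) \<le> (\<integral>\<^sup>+s. ennreal e * indicator K s \<partial>\<mu>)"
    using pt \<open>0 \<le> e\<close> by (intro nn_integral_mono)
      (metis ennreal_indicator ennreal_leI ennreal_mult'' indicator_pos_le)
  also have "\<dots> = ennreal e * emeasure \<mu> K" by (rule nn_integral_cmult_indicator[OF Ks])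
  also have "\<dots> = ennreal (e * measure \<mu> K)"
    using haar_compact[OF \<mu> K(1)] \<open>0 \<le> e\<close> by (simp add: ennreal_mult emeasure_eq_ennreal_measure)
  finally show "(\<integral>\<^sup>+s. norm (f s - (\<Sum>i\<in>I. indicator (B i) s *\<^sub>R c i)) \<partial>\<mu>) \<le> ennreal (e * measure \<mu> K)" .
qed

lemma riemann_sum_approx:
  fixes f :: "'g::{topological_group_add, t2_space} \<Rightarrow> 'a::real_normed_vector"
  assumes \<mu>: "left_haar_measure \<mu>" and K: "compact K" "\<And>s. s \<notin> K \<Longrightarrow> f s = 0"
    and v: "has_vector_integral \<mu> f v"
    and IB: "finite I" "\<And>i. i \<in> I \<Longrightarrow> B i \<in> sets borel" "disjoint_family_on B I" "(\<Union>i\<in>I. B i) = K"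
    and c: "\<And>i s. i \<in> I \<Longrightarrow> s \<in> B i \<Longrightarrow> norm (f s - c i) \<le> e" and "0 \<le> e"
  shows "norm (v - (\<Sum>i\<in>I. measure \<mu> (B i) *\<^sub>R c i)) \<le> e * measure \<mu> K"
proof -
  have r: "Bochner_Integration.simple_bochner_integrable \<mu> (\<lambda>s. \<Sum>i\<in>I. indicator (B i) s *\<^sub>R c i)"
    "Bochner_Integration.simple_bochner_integral \<mu> (\<lambda>s. \<Sum>i\<in>I. indicator (B i) s *\<^sub>R c i) = (\<Sum>i\<in>I. measure \<mu> (B i) *\<^sub>R c i)"
    "(\<integral>\<^sup>+s. norm (f s - (\<Sum>i\<in>I. indicator (B i) s *\<^sub>R c i)) \<partial>\<mu>) \<le> ennreal (e * measure \<mu> K)"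
    using riemann_sum_bound[where f = f and K = K and B = B and I = I and c = c and e = e, OF \<mu> K IB c \<open>0 \<le> e\<close>]
    by blast+
  have "ennreal (norm (v - (\<Sum>i\<in>I. measure \<mu> (B i) *\<^sub>R c i))) \<le> ennreal (e * measure \<mu> K)"
    using order_trans[OF has_vector_integral_approx[OF v r(1)] r(3)] unfolding r(2) .
  then show ?thesis using \<open>0 \<le> e\<close> by (simp add: ennreal_le_iff)
qed

text \<open>Compactness takes the place of separability: finitely many tags approximate
  \<open>f\<close> uniformly on \<open>K\<close>, so the step functions converge in L1 and their
  integrals are Cauchy.\<close>

lemma has_vector_integral_compact_support:
  fixes f :: "'g::{topological_group_add, t2_space} \<Rightarrow> 'a::banach"
  assumes \<mu>: "left_haar_measure \<mu>" and K: "compact K" "\<And>s. s \<notin> K \<Longrightarrow> f s = 0"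
    and f: "continuous_on UNIV f"
  obtains v where "has_vector_integral \<mu> f v"
proof -
  define e where "e n = 1 / real (Suc n)" for n
  have e: "0 < e n" for n by (simp add: e_def)
  have e0: "e \<longlonglongrightarrow> 0" unfolding e_def using LIMSEQ_inverse_real_of_nat by (simp add: inverse_eq_divide)
  have "\<exists>p. riemann_data K UNIV f (e n) (fst p) (snd p)" for n
    using riemann_data_exists[OF K(1) f open_UNIV _ e[of n]] by (metis UNIV_I fst_conv snd_conv)
  then obtain p where p: "\<And>n. riemann_data K UNIV f (e n) (fst (p n)) (snd (p n))" by metis
  define I B where "I n = fst (p n)" and "B n = snd (p n)" for n
  have IB: "finite (I n)" "\<And>i. i \<in> I n \<Longrightarrow> B n i \<in> sets borel" "disjoint_family_on (B n) (I n)" "(\<Union>i\<in>I n. B n i) = K"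
    and d: "\<And>i s. i \<in> I n \<Longrightarrow> s \<in> B n i \<Longrightarrow> norm (f s - f i) \<le> e n" for n
    using p[of n] unfolding riemann_data_def I_def B_def dist_norm by (auto intro: less_imp_le)
  define S where "S n s = (\<Sum>i\<in>I n. indicator (B n i) s *\<^sub>R f i)" for n s
  have r: "Bochner_Integration.simple_bochner_integrable \<mu> (S n)"
    "(\<integral>\<^sup>+s. norm (f s - S n s) \<partial>\<mu>) \<le> ennreal (e n * measure \<mu> K)" for n
    using riemann_sum_bound(1,3)[where f = f and K = K and B = "B n" and I = "I n" and c = f and e = "e n", OF \<mu> K IB d less_imp_le[OF e]]
    unfolding S_def by blast+
  have fm: "f \<in> borel_measurable \<mu>" by (rule haar_measurable_continuous[OF \<mu> f])
  let ?J = "\<lambda>n. Bochner_Integration.simple_bochner_integral \<mu> (S n)"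
  have c: "norm (?J n - ?J m) \<le> (e n + e m) * measure \<mu> K" for n m
  proof -
    have "ennreal (norm (?J n - ?J m)) \<le> ennreal (e n * measure \<mu> K) + ennreal (e m * measure \<mu> K)"
      by (rule order_trans[OF simple_bochner_integral_diff_le[OF fm r(1) r(1)] add_mono[OF r(2) r(2)]])
    also have "\<dots> = ennreal ((e n + e m) * measure \<mu> K)"
      using e[of n] e[of m] by (simp add: ring_distribs flip: ennreal_plus)
    finally show ?thesis using e[of n] e[of m] by (subst (asm) ennreal_le_iff) auto
  qed
  have ek: "(\<lambda>n. e n * measure \<mu> K) \<longlonglongrightarrow> 0" using tendsto_mult_left_zero[OF e0] .
  have "Cauchy ?J"
  proof (rule metric_CauchyI)
    fix r :: real assume "0 < r"
    then obtain N where N: "\<And>n. n \<ge> N \<Longrightarrow> norm (e n * measure \<mu> K - 0) < r / 2" using LIMSEQ_D[OF ek, of "r / 2"] by auto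
    have "dist (?J m) (?J n) < r" if "m \<ge> N" "n \<ge> N" for m n
    proof -
      have "e m * measure \<mu> K < r / 2" "e n * measure \<mu> K < r / 2"
        using N[OF that(1)] N[OF that(2)] e[of m] e[of n] by simp_all
      then show ?thesis using c[of m n] by (simp add: dist_norm algebra_simps)
    qed
    then show "\<exists>M. \<forall>m\<ge>M. \<forall>n\<ge>M. dist (?J m) (?J n) < r" by blast
  qed
  then obtain v where v: "?J \<longlonglongrightarrow> v" using Cauchy_convergent convergentD by blast
  have "(\<lambda>n. \<integral>\<^sup>+s. norm (f s - S n s) \<partial>\<mu>) \<longlonglongrightarrow> 0"
  proof (rule tendsto_sandwich[OF _ _ tendsto_const])
    show "(\<lambda>n. ennreal (e n * measure \<mu> K)) \<longlonglongrightarrow> 0" using tendsto_ennrealI[OF ek] by simp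
  qed (use r(2) in auto)
  then have "has_vector_integral \<mu> f v"
    unfolding has_vector_integral_def using fm r(1) v by blast
  then show ?thesis using that by blast
qed

lemma compact_translate: "compact K \<Longrightarrow> compact ((\<lambda>t. s + t) ` (K :: 'g::topological_group_add set))"
  by (rule compact_continuous_image[OF continuous_on_subset[OF continuous_on_left_translation]]) auto

lemma borel_translate:
  fixes B :: "'g::{topological_group_add, t2_space} set"
  assumes "B \<in> sets borel" shows "(\<lambda>t. s + t) ` B \<in> sets borel"
proof -
  have "(\<lambda>t. - s + t) \<in> borel \<rightarrow>\<^sub>M borel" by (rule borel_measurable_continuous_onI[OF continuous_on_left_translation])
  then have "(\<lambda>t. - s + t) -` B \<inter> space borel \<in> sets borel" using assms by (rule measurable_sets)
  moreover have "(\<lambda>t. - s + t) -` B \<inter> space borel = (\<lambda>t. s + t) ` B"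
  proof (intro set_eqI iffI)
    fix x assume "x \<in> (\<lambda>t. - s + t) -` B \<inter> space borel"
    then have "- s + x \<in> B" "x = s + (- s + x)" by (simp_all add: add.assoc[symmetric])
    then show "x \<in> (\<lambda>t. s + t) ` B" by blast
  qed (auto simp: add.assoc[symmetric])
  ultimately show ?thesis by simp
qed

text \<open>Translating the cells of a partition preserves their measure, so one and the same
  Riemann sum approximates both integrals.\<close>

lemma has_vector_integral_translate:
  fixes f :: "'g::{topological_group_add, t2_space} \<Rightarrow> 'a::banach"
  assumes \<mu>: "left_haar_measure \<mu>" and K: "compact K" "\<And>s. s \<notin> K \<Longrightarrow> f s = 0"
    and f: "continuous_on UNIV f" and v: "has_vector_integral \<mu> f v"
  shows "has_vector_integral \<mu> (\<lambda>t. f (s + t)) v"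
proof -
  define K' where "K' = (\<lambda>t. - s + t) ` K"
  have K': "compact K'" unfolding K'_def by (rule compact_translate[OF K(1)])
  have van: "f (s + t) = 0" if "t \<notin> K'" for t
  proof -
    have "t = - s + (s + t)" by (simp add: add.assoc[symmetric])
    then have "s + t \<notin> K" using that unfolding K'_def by blast
    then show ?thesis by (rule K(2))
  qed
  have fc: "continuous_on UNIV (\<lambda>t. f (s + t))"
    by (rule continuous_on_compose2[OF f continuous_on_left_translation]) auto
  obtain w where w: "has_vector_integral \<mu> (\<lambda>t. f (s + t)) w"
    using has_vector_integral_compact_support[OF \<mu> K' van fc] by blast
  have mK: "measure \<mu> ((\<lambda>t. - s + t) ` B) = measure \<mu> B" if "B \<in> sets borel" for B
    using haar_translate[OF \<mu> that] by (simp add: measure_def)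
  have Kb: "K \<in> sets borel" using compact_imp_closed[OF K(1)] by auto
  have "norm (v - w) \<le> 0 + r" if "0 < r" for r :: real
  proof -
    define e where "e = r / (2 * (measure \<mu> K + 1))"
    have m0: "0 < measure \<mu> K + 1" by (simp add: add_nonneg_pos)
    then have e: "0 < e" using that by (simp add: e_def)
    obtain I B where "riemann_data K UNIV f e I B" using riemann_data_exists[OF K(1) f open_UNIV _ e] by blast
    then have IB: "finite I" "\<And>i. i \<in> I \<Longrightarrow> B i \<in> sets borel" "disjoint_family_on B I" "(\<Union>i\<in>I. B i) = K"
      and d: "\<And>i s. i \<in> I \<Longrightarrow> s \<in> B i \<Longrightarrow> norm (f s - f i) \<le> e"
      unfolding riemann_data_def dist_norm by (auto intro: less_imp_le)
    have 1: "norm (v - (\<Sum>i\<in>I. measure \<mu> (B i) *\<^sub>R f i)) \<le> e * measure \<mu> K"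
      by (rule riemann_sum_approx[where f = f and K = K and B = B and I = I and c = f, OF \<mu> K v IB d less_imp_le[OF e]])
    define B' where "B' i = (\<lambda>t. - s + t) ` B i" for i
    have "norm (w - (\<Sum>i\<in>I. measure \<mu> (B' i) *\<^sub>R f i)) \<le> e * measure \<mu> K'"
    proof (rule riemann_sum_approx[OF \<mu> K' van w IB(1)])
      show "B' i \<in> sets borel" if "i \<in> I" for i unfolding B'_def by (rule borel_translate[OF IB(2)[OF that]])
      show "disjoint_family_on B' I" using IB(3) unfolding disjoint_family_on_def B'_def by (auto; blast)
      show "(\<Union>i\<in>I. B' i) = K'" unfolding B'_def K'_def IB(4)[symmetric] by blast
      show "norm (f (s + t) - f i) \<le> e" if i: "i \<in> I" and t: "t \<in> B' i" for i t
      proof -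
        obtain x where "x \<in> B i" "t = - s + x" using t by (auto simp: B'_def)
        then show ?thesis using d[OF i] by (simp add: add.assoc[symmetric])
      qed
    qed (use less_imp_le[OF e] in auto)
    then have 2: "norm (w - (\<Sum>i\<in>I. measure \<mu> (B i) *\<^sub>R f i)) \<le> e * measure \<mu> K"
      using mK[OF Kb] mK[OF IB(2)] unfolding B'_def K'_def by simp
    have "norm (v - w) \<le> 2 * (e * measure \<mu> K)"
      using 1 2 norm_triangle_ineq4[of "v - (\<Sum>i\<in>I. measure \<mu> (B i) *\<^sub>R f i)" "w - (\<Sum>i\<in>I. measure \<mu> (B i) *\<^sub>R f i)"] by simp
    also have "\<dots> \<le> 2 * (e * (measure \<mu> K + 1))" using e by simp
    also have "\<dots> = r"
    proof -
      have "2 * (r / (2 * x) * x) = r" if "0 < x" for x :: real using that by simp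
      from this[OF m0] show ?thesis unfolding e_def .
    qed
    finally show ?thesis by simp
  qed
  then have "norm (v - w) \<le> 0" by (rule field_le_epsilon)
  then show ?thesis using w by simp
qed

text \<open>By outer regularity \<open>K\<close> has an open neighbourhood of barely larger measure,
  and the tube lemma keeps K + v inside it for small v, so the modular function is at most 1 + e
  near 0. Multiplicativity with v and -v gives the lower bound, and a translation moves the
  statement to other points.\<close>

lemma modular_function_continuous:
  fixes \<mu> :: "'g::{topological_group_add, t2_space} measure"
  assumes \<mu>: "left_haar_measure \<mu>" and \<Delta>: "modular_function \<mu> \<Delta>"
  shows "continuous_on UNIV \<Delta>"
proof -
  have pos: "0 < \<Delta> s" and tr: "B \<in> sets borel \<Longrightarrow> emeasure \<mu> ((\<lambda>t. t + s) ` B) = ennreal (\<Delta> s) * emeasure \<mu> B" for s B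
    using \<Delta> by (auto simp: modular_function_def)
  have "emeasure \<mu> UNIV = (SUP K\<in>{K. compact K \<and> K \<subseteq> UNIV}. emeasure \<mu> K)" "emeasure \<mu> UNIV \<noteq> 0"
    using \<mu> open_UNIV unfolding left_haar_measure_def by blast+
  \<comment> \<open>If all compact sets were null, inner regularity on the open set
    \<open>UNIV\<close> would make the measure zero.\<close>
  then obtain K where K: "compact K" "emeasure \<mu> K \<noteq> 0"
    by (metis (mono_tags, lifting) SUP_eq_const SUP_bot bot_ennreal mem_Collect_eq SUP_least le_zero_eq)
  have fin: "emeasure \<mu> K < \<infinity>" by (rule haar_compact[OF \<mu> K(1)])
  define k where "k = measure \<mu> K"
  have k: "emeasure \<mu> K = ennreal k" "0 < k"
  proof -
    show "emeasure \<mu> K = ennreal k" using fin by (simp add: k_def emeasure_eq_ennreal_measure)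
    then show "0 < k" using K(2) by (metis ennreal_eq_zero_iff ennreal_neg k_def linorder_not_le measure_nonneg order_less_le)
  qed
  have cr: "continuous_on UNIV (\<lambda>t::'g. t + s)" for s
    unfolding continuous_on_def by (auto intro!: tendsto_intros)
  have Kb: "K \<in> sets borel" using compact_imp_closed[OF K(1)] by auto
  have Ksb: "(\<lambda>t. t + s) ` K \<in> sets borel" for s
    using compact_imp_closed[OF compact_continuous_image[OF continuous_on_subset[OF cr] K(1)], of s] by auto
  have hom: "\<Delta> (s + v) = \<Delta> s * \<Delta> v" for s v
  proof -
    have "(\<lambda>t. t + v) ` (\<lambda>t. t + s) ` K = (\<lambda>t. t + (s + v)) ` K" by (auto simp: image_image add.assoc)
    then have "ennreal (\<Delta> (s + v)) * ennreal k = ennreal (\<Delta> v) * (ennreal (\<Delta> s) * ennreal k)"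
      using tr[OF Ksb, of v s] tr[OF Kb, of s] tr[OF Kb, of "s + v"] k(1) by simp
    then have "ennreal (\<Delta> (s + v) * k) = ennreal (\<Delta> v * (\<Delta> s * k))"
      using pos[of v] pos[of s] pos[of "s + v"] k(2) by (simp add: ennreal_mult less_imp_le)
    then have "\<Delta> (s + v) * k = \<Delta> v * (\<Delta> s * k)"
      using pos[of v] pos[of s] pos[of "s + v"] k(2) by (subst (asm) ennreal_inj) (auto intro: less_imp_le)
    then show ?thesis using k(2) by simp
  qed
  have \<Delta>0: "\<Delta> 0 = 1" using hom[of 0 0] pos[of 0] by simp
  have up: "\<exists>W. open W \<and> 0 \<in> W \<and> (\<forall>v\<in>W. \<Delta> v \<le> 1 + e)" if e: "0 < e" for e :: real
  proof -
    have "(INF U\<in>{U. open U \<and> K \<subseteq> U}. emeasure \<mu> U) = emeasure \<mu> K"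
      using \<mu> Kb unfolding left_haar_measure_def by metis
    also have "\<dots> < ennreal (k * (1 + e))" using k e by (simp add: ennreal_lessI)
    finally obtain U where U: "open U" "K \<subseteq> U" "emeasure \<mu> U < ennreal (k * (1 + e))"
      unfolding INF_less_iff by blast
    have "continuous_on UNIV (\<lambda>p::'g \<times> 'g. snd p + fst p)"
      by (intro continuous_on_add continuous_on_snd continuous_on_fst continuous_on_id)
    then have "open ((\<lambda>p::'g \<times> 'g. snd p + fst p) -` U)" using U(1) by (rule open_vimage[rotated])
    from Elementary_Topology.tube_lemma[OF K(1) this, of 0] have "{0} \<times> K \<subseteq> (\<lambda>p. snd p + fst p) -` U \<Longrightarrow>
        \<exists>W. 0 \<in> W \<and> open W \<and> W \<times> K \<subseteq> (\<lambda>p. snd p + fst p) -` U" .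
    moreover have "{0} \<times> K \<subseteq> (\<lambda>p. snd p + fst p) -` U" using U(2) by auto
    ultimately obtain W where W: "0 \<in> W" "open W" "W \<times> K \<subseteq> (\<lambda>p. snd p + fst p) -` U" by blast
    have "\<Delta> v \<le> 1 + e" if "v \<in> W" for v
    proof -
      have "(\<lambda>t. t + v) ` K \<subseteq> U" using W(3) that by auto
      then have "emeasure \<mu> ((\<lambda>t. t + v) ` K) \<le> emeasure \<mu> U"
        using U(1) haar_sets[OF \<mu>] by (intro emeasure_mono) auto
      then have "ennreal (\<Delta> v) * ennreal k < ennreal (k * (1 + e))"
        using U(3) tr[OF Kb, of v] k(1) by simp
      then have "ennreal (\<Delta> v * k) < ennreal (k * (1 + e))"
        using pos[of v] k(2) by (simp add: ennreal_mult less_imp_le)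
      then have "\<Delta> v * k < k * (1 + e)" using pos[of v] k(2) by (simp add: ennreal_less_iff)
      then show ?thesis using k(2) by (simp add: mult.commute)
    qed
    then show ?thesis using W by blast
  qed
  have "isCont \<Delta> 0"
    unfolding continuous_at tendsto_def
  proof (intro allI impI)
    fix S assume S: "open S" "\<Delta> 0 \<in> S"
    then obtain r where r: "0 < r" "ball 1 r \<subseteq> S" using \<Delta>0 openE by metis
    \<comment> \<open>The lower bound loses e + e^2; with e at most 1/2 and at most r/2 this is at
      most 3r/4.\<close>
    define e where "e = min (r / 2) (1/2)"
    have e: "0 < e" "e < r" "e < 1" using r(1) by (auto simp: e_def)
    obtain W where W: "open W" "0 \<in> W" "\<And>v. v \<in> W \<Longrightarrow> \<Delta> v \<le> 1 + e" using up[OF e(1)] by blast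
    have "continuous_on UNIV (\<lambda>v::'g. - v)" unfolding continuous_on_def by (auto intro!: tendsto_intros)
    then have "open (uminus -` W)" using W(1) by (rule open_vimage[rotated])
    then have o: "open (W \<inter> uminus -` W)" using W(1) by blast
    have "\<Delta> v \<in> S" if "v \<in> W \<inter> uminus -` W" for v
    proof -
      have a: "\<Delta> v \<le> 1 + e" "\<Delta> (- v) \<le> 1 + e" using W(3) that by auto
      have "1 = \<Delta> v * \<Delta> (- v)" using hom[of v "- v"] \<Delta>0 by simp
      also have "\<dots> \<le> \<Delta> v * (1 + e)" using a(2) pos[of v] by simp
      finally have "1 \<le> \<Delta> v + \<Delta> v * e" by (simp add: algebra_simps)
      moreover have "\<Delta> v * e \<le> (1 + e) * e" using a(1) e(1) by (intro mult_right_mono) simp_all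
      moreover have "(1 + e) * e = e + e * e" by (simp add: algebra_simps)
      moreover have "e * e \<le> e * (1/2)" using e(1) by (intro mult_left_mono) (simp_all add: e_def)
      moreover have "e \<le> r / 2" by (simp add: e_def)
      ultimately have "1 - r < \<Delta> v" "\<Delta> v < 1 + r" using a(1) e r(1) by linarith+
      then have "\<bar>\<Delta> v - 1\<bar> < r" by simp
      then show ?thesis using r(2) by (auto simp: dist_real_def abs_minus_commute)
    qed
    then show "\<forall>\<^sub>F v in at 0. \<Delta> v \<in> S"
      unfolding eventually_at_topological using o W(2) by (intro exI[of _ "W \<inter> uminus -` W"]) auto
  qed
  then have l0: "(\<Delta> \<longlongrightarrow> 1) (nhds 0)" using \<Delta>0 tendsto_at_iff_tendsto_nhds[of \<Delta> 0] by (simp add: continuous_at)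
  show ?thesis
    unfolding continuous_on_def
  proof
    fix s0 :: 'g assume "s0 \<in> UNIV"
    have "((\<lambda>s. - s0 + s) \<longlongrightarrow> - s0 + s0) (at s0)" by (intro tendsto_intros)
    then have "filterlim (\<lambda>s. - s0 + s) (nhds 0) (at s0)" by simp
    then have "((\<lambda>s. \<Delta> (- s0 + s)) \<longlongrightarrow> 1) (at s0)" by (rule filterlim_compose[OF l0])
    then have "((\<lambda>s. \<Delta> s0 * \<Delta> (- s0 + s)) \<longlongrightarrow> \<Delta> s0 * 1) (at s0)" by (intro tendsto_intros)
    moreover have "\<Delta> s0 * \<Delta> (- s0 + s) = \<Delta> s" for s using hom[of s0 "- s0 + s"] by (simp add: add.assoc[symmetric])
    ultimately show "(\<Delta> \<longlongrightarrow> \<Delta> s0) (at s0 within UNIV)" by simp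
  qed
qed

section \<open>Compactly supported functions and proper actions\<close>

lemma CcI:
  fixes f :: "'x::t2_space c0"
  assumes "compact K" "\<And>x. x \<notin> K \<Longrightarrow> c0_apply f x = 0"
  shows "f \<in> Cc"
proof -
  have "closure {x. c0_apply f x \<noteq> 0} \<subseteq> K"
    using assms by (intro closure_minimal compact_imp_closed) auto
  then have "compact (closure {x. c0_apply f x \<noteq> 0})"
    using compact_Int_closed[OF assms(1) closed_closure] by (metis inf.absorb2)
  then show ?thesis by (simp add: Cc_def)
qed

lemma CcE:
  assumes "f \<in> Cc"
  obtains K where "compact K" "\<And>x. x \<notin> K \<Longrightarrow> c0_apply f x = 0"
proof (rule that)
  show "compact (closure {x. c0_apply f x \<noteq> 0})" using assms by (simp add: Cc_def)
  show "c0_apply f x = 0" if "x \<notin> closure {x. c0_apply f x \<noteq> 0}" for x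
    using that closure_subset[of "{x. c0_apply f x \<noteq> 0}"] by blast
qed

lemma mk_c0_Cc:
  fixes f :: "'x::t2_space \<Rightarrow> complex"
  assumes "continuous_on UNIV f" "compact K" "\<And>x. x \<notin> K \<Longrightarrow> f x = 0"
  shows "c0_apply (mk_c0 f) = f" "mk_c0 f \<in> Cc"
proof -
  show e: "c0_apply (mk_c0 f) = f"
  proof (rule ext, rule apply_mk_c0[OF assms(1)])
    fix e :: real assume "0 < e"
    then have "{x. e \<le> cmod (f x)} \<subseteq> K" using assms(3) by fastforce
    then show "compact {x. e \<le> cmod (f x)}" by (rule compact_level_subset[OF assms(1,2)])
  qed
  show "mk_c0 f \<in> Cc" by (rule CcI[OF assms(2)]) (simp add: e assms(3))
qed

lemma Cc_star: "f \<in> Cc \<Longrightarrow> star f \<in> (Cc :: 'x::t2_space c0 set)"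
  by (erule CcE, erule CcI) simp

lemma Cc_dense:
  fixes f :: "'x::t2_space c0"
  assumes "0 < e"
  obtains g where "g \<in> Cc" "norm (f - g) \<le> e"
proof -
  \<comment> \<open>Multiplication by \<open>r\<close> lowers the modulus by \<open>e\<close> and
    cuts it off at 0. The maximum in the denominator avoids division by zero and keeps
    \<open>r\<close> continuous.\<close>
  define r where "r x = max 0 (cmod (c0_apply f x) - e) / max (cmod (c0_apply f x)) e" for x
  have c: "continuous_on UNIV (\<lambda>x. c0_apply f x * of_real (r x))"
    unfolding r_def using assms by (intro continuous_intros continuous_on_c0) auto
  have K: "compact {x. e \<le> cmod (c0_apply f x)}" by (rule compact_c0[OF assms])
  have z: "c0_apply f x * of_real (r x) = 0" if "x \<notin> {x. e \<le> cmod (c0_apply f x)}" for x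
    using that by (simp add: r_def)
  define g where "g = mk_c0 (\<lambda>x. c0_apply f x * of_real (r x))"
  have g: "c0_apply g = (\<lambda>x. c0_apply f x * of_real (r x))" "g \<in> Cc"
    unfolding g_def by (rule mk_c0_Cc[OF c K]; fact z)+
  have "cmod (c0_apply (f - g) x) \<le> e" for x
  proof (cases "e \<le> cmod (c0_apply f x)")
    case True
    then have p: "0 < cmod (c0_apply f x)" using assms by linarith
    have r: "1 - r x = e / cmod (c0_apply f x)" using True p by (simp add: r_def max_def field_simps)
    have "c0_apply (f - g) x = c0_apply f x * of_real (1 - r x)"
      using fun_cong[OF g(1), of x] by (simp add: algebra_simps)
    then have "cmod (c0_apply (f - g) x) = cmod (c0_apply f x) * \<bar>1 - r x\<bar>"
      by (simp only: norm_mult norm_of_real)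
    also have "\<dots> = e" unfolding r using p assms by simp
    finally show ?thesis by simp
  next
    case False
    have "c0_apply g x = c0_apply f x * complex_of_real (r x)" by (rule fun_cong[OF g(1)])
    also have "\<dots> = 0" by (rule z) (use False in simp)
    finally have "c0_apply g x = 0" .
    then have "c0_apply (f - g) x = c0_apply f x" by simp
    then show ?thesis using False by (metis linear)
  qed
  then have "norm (f - g) \<le> e" by (rule norm_c0_bound)
  then show ?thesis by (rule that[OF g(2)])
qed

lemma Cc_Urysohn:
  fixes K :: "'x::t2_space set"
  assumes lc: "locally_compact_space (euclidean :: 'x topology)" and K: "compact K"
  obtains h where "h \<in> Cc" "star h = h" "\<And>x. cmod (c0_apply h x) \<le> 1" "\<And>x. x \<in> K \<Longrightarrow> c0_apply h x = 1"
proof -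
  have H: "Hausdorff_space (euclidean :: 'x topology)"
    unfolding Hausdorff_space_def disjnt_def using hausdorff by auto
  have cr: "completely_regular_space (euclidean :: 'x topology)"
    using lc H by (intro locally_compact_regular_imp_completely_regular_space) auto
  obtain U L where UL: "open U" "compact L" "K \<subseteq> U" "U \<subseteq> L"
    using lc K H locally_compact_space_compact_closed_compact[of "euclidean :: 'x topology"] by auto
  have "disjnt K (- U)" using UL(3) by (auto simp: disjnt_def)
  moreover have "closedin euclidean (- U)" using UL(1) by (simp add: closed_Compl)
  moreover have "compactin euclidean K" using K by simp
  ultimately obtain f :: "'x \<Rightarrow> real" where f: "continuous_map euclidean (subtopology euclidean {0..1}) f" "f ` (- U) \<subseteq> {0}" "f ` K \<subseteq> {1}"
    using Urysohn_completely_regular_compact_closed[of 0 1 "euclidean :: 'x topology" K "- U"] cr by (metis zero_le_one)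
  have fc: "continuous_on UNIV f" and f01: "0 \<le> f x" "f x \<le> 1" for x
    using f(1) by (auto simp: continuous_map_in_subtopology Pi_iff)
  have z: "complex_of_real (f x) = 0" if "x \<notin> L" for x using that UL(4) f(2) by auto
  have c: "continuous_on UNIV (\<lambda>x. complex_of_real (f x))" by (intro continuous_intros fc)
  have h: "c0_apply (mk_c0 (\<lambda>x. complex_of_real (f x))) = (\<lambda>x. complex_of_real (f x))"
    "mk_c0 (\<lambda>x. complex_of_real (f x)) \<in> Cc"
    by (rule mk_c0_Cc[OF c UL(2)]; fact z)+
  show ?thesis
  proof (rule that[OF h(2)])
    show "star (mk_c0 (\<lambda>x. complex_of_real (f x))) = mk_c0 (\<lambda>x. complex_of_real (f x))"
      by (rule c0_eqI) (simp add: h(1))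
    show "cmod (c0_apply (mk_c0 (\<lambda>x. complex_of_real (f x))) x) \<le> 1" for x using f01[of x] by (simp add: h(1))
    show "c0_apply (mk_c0 (\<lambda>x. complex_of_real (f x))) x = 1" if "x \<in> K" for x using f(3) that by (auto simp: h(1))
  qed
qed

text \<open>The set of group elements carrying a point of \<open>K\<close> into \<open>L\<close> is
  the projection of the preimage of K x L under the proper map (x, s) -> (x, x s).\<close>

lemma
  fixes act :: "'x::t2_space \<Rightarrow> 'g::{topological_group_add, t2_space} \<Rightarrow> 'x"
  assumes "proper_right_action act"
  shows right_action_zero: "act x 0 = x"
    and right_action_add: "act (act x s) t = act x (s + t)"
    and right_action_continuous: "continuous_on UNIV (\<lambda>(x, t). act x t)"
    and proper_action_compact: "compact K \<Longrightarrow> compact L \<Longrightarrow> compact {s. \<exists>x\<in>K. act x s \<in> L}"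
    and action_image_compact: "compact K \<Longrightarrow> compact S \<Longrightarrow> compact {act x s | x s. x \<in> K \<and> s \<in> S}"
proof -
  show z: "act x 0 = x" and add: "act (act x s) t = act x (s + t)" and c: "continuous_on UNIV (\<lambda>(x, t). act x t)" for x s t
    using assms by (auto simp: proper_right_action_def)
  show "compact {s. \<exists>x\<in>K. act x s \<in> L}" if "compact K" "compact L"
  proof -
    have "compactin euclidean {p \<in> topspace euclidean. (\<lambda>(x, t). (x, act x t)) p \<in> K \<times> L}"
      using assms that by (intro compactin_proper_map_preimage[where Y = euclidean]) (auto simp: proper_right_action_def compact_Times)
    then have "compact {p. (\<lambda>(x, t). (x, act x t)) p \<in> K \<times> L}" by simp
    then have "compact (snd ` {p. (\<lambda>(x, t). (x, act x t)) p \<in> K \<times> L})"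
      by (rule compact_continuous_image[rotated]) (intro continuous_on_snd continuous_on_id)
    moreover have "snd ` {p. (\<lambda>(x, t). (x, act x t)) p \<in> K \<times> L} = {s. \<exists>x\<in>K. act x s \<in> L}"
      by (auto simp: image_def)
    ultimately show ?thesis by simp
  qed
  show "compact {act x s | x s. x \<in> K \<and> s \<in> S}" if "compact K" "compact S"
  proof -
    have "compact ((\<lambda>(x, t). act x t) ` (K \<times> S))"
      using c that by (intro compact_continuous_image compact_Times) (auto intro: continuous_on_subset)
    moreover have "(\<lambda>(x, t). act x t) ` (K \<times> S) = {act x s | x s. x \<in> K \<and> s \<in> S}" by force
    ultimately show ?thesis by simp
  qed
qed

lemma right_action_continuous_orbit:
  fixes act :: "'x::t2_space \<Rightarrow> 'g::{topological_group_add, t2_space} \<Rightarrow> 'x"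
  assumes "proper_right_action act"
  shows "continuous_on UNIV (\<lambda>s. act x s)" "continuous_on UNIV (\<lambda>x. act x s)"
proof -
  show "continuous_on UNIV (\<lambda>s. act x s)"
    using continuous_on_compose2[OF right_action_continuous[OF assms], of UNIV "\<lambda>s. (x, s)"]
    by (simp add: continuous_on_Pair)
  show "continuous_on UNIV (\<lambda>x. act x s)"
    using continuous_on_compose2[OF right_action_continuous[OF assms], of UNIV "\<lambda>x. (x, s)"]
    by (simp add: continuous_on_Pair)
qed

text \<open>Left invariance moves the set of \<open>s\<close> with \<open>x \<cdot> s \<in> L\<close> into a fixed compact set, independently of \<open>x\<close>.\<close>

lemma orbit_measure_bound:
  fixes act :: "'x::t2_space \<Rightarrow> 'g::{topological_group_add, t2_space} \<Rightarrow> 'x"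
  assumes act: "proper_right_action act" and \<mu>: "left_haar_measure \<mu>" and L: "compact L"
  obtains C where "0 \<le> C" "\<And>x S. S \<in> sets borel \<Longrightarrow> S \<subseteq> {s. act x s \<in> L} \<Longrightarrow> emeasure \<mu> S \<le> ennreal C"
proof -
  define Q where "Q = {s. \<exists>x\<in>L. act x s \<in> L}"
  have Q: "compact Q" unfolding Q_def by (rule proper_action_compact[OF act L L])
  have Qb: "Q \<in> sets borel" using compact_imp_closed[OF Q] by auto
  have eQ: "emeasure \<mu> Q = ennreal (measure \<mu> Q)"
    using haar_compact[OF \<mu> Q] by (simp add: emeasure_eq_ennreal_measure)
  have "emeasure \<mu> S \<le> ennreal (measure \<mu> Q)" if S: "S \<in> sets borel" "S \<subseteq> {s. act x s \<in> L}" for S x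
  proof (cases "S = {}")
    case False
    then obtain s0 where s0: "s0 \<in> S" by blast
    have "S \<subseteq> (\<lambda>t. s0 + t) ` Q"
    proof
      fix s assume "s \<in> S"
      then have "act (act x s0) (- s0 + s) \<in> L" "act x s0 \<in> L"
        using S(2) s0 by (auto simp: right_action_add[OF act] add.assoc[symmetric])
      then have "- s0 + s \<in> Q" unfolding Q_def by blast
      moreover have "s = s0 + (- s0 + s)" by (simp add: add.assoc[symmetric])
      ultimately show "s \<in> (\<lambda>t. s0 + t) ` Q" by blast
    qed
    then have "emeasure \<mu> S \<le> emeasure \<mu> ((\<lambda>t. s0 + t) ` Q)"
      using borel_translate[OF Qb] haar_sets[OF \<mu>] by (intro emeasure_mono) auto
    then show ?thesis using haar_translate[OF \<mu> Qb] eQ by simp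
  qed simp
  then show ?thesis using that[of "measure \<mu> Q"] by simp
qed

lemma translation_Cc:
  fixes act :: "'x::t2_space \<Rightarrow> 'g::{topological_group_add, t2_space} \<Rightarrow> 'x"
  assumes act: "proper_right_action act" and f: "f \<in> Cc"
  shows "translation act s f \<in> Cc"
proof -
  obtain K where K: "compact K" "\<And>x. x \<notin> K \<Longrightarrow> c0_apply f x = 0" using CcE[OF f] by blast
  have "compact ((\<lambda>x. act x (- s)) ` K)"
    by (rule compact_continuous_image[OF continuous_on_subset[OF right_action_continuous_orbit(2)[OF act]] K(1)]) simp
  moreover have "c0_apply (translation act s f) x = 0" if "x \<notin> (\<lambda>x. act x (- s)) ` K" for x
  proof -
    have "x = act (act x s) (- s)" by (simp add: right_action_add[OF act] right_action_zero[OF act])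
    then have "act x s \<notin> K" using that by blast
    then show ?thesis by (simp add: c0_apply_translation[OF act] K(2))
  qed
  ultimately show ?thesis by (rule CcI)
qed

lemma translation_mult:
  "proper_right_action act \<Longrightarrow> translation act s (f * g) = translation act s f * translation act s g"
  by (rule c0_eqI) (simp add: c0_apply_translation)

lemma translation_star:
  "proper_right_action act \<Longrightarrow> translation act s (star f) = star (translation act s f)"
  by (rule c0_eqI) (simp add: c0_apply_translation)

section \<open>The corner \<open>C\<^sub>c(X) A C\<^sub>c(X)\<close>\<close>

lemma lmult_rmult: "(m \<rhd> a) \<lhd> n = m \<rhd> (a \<lhd> n)"
proof -
  have "of_alg ((m \<rhd> a) \<lhd> n) = of_alg (m \<rhd> (a \<lhd> n))"
    by (simp only: of_alg_rmult[symmetric] of_alg_lmult[symmetric] mult.assoc)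
  then show ?thesis by simp
qed

text \<open>Having a local unit characterizes membership in A_0 without reference to sums of
  generators, and the unit carries the support information that the estimates need.\<close>

definition local_unit :: "('x::topological_space c0 \<Rightarrow> 'a::cstar_algebra multiplier) \<Rightarrow> 'x c0 \<Rightarrow> 'a \<Rightarrow> bool" where
  "local_unit \<phi> g y \<longleftrightarrow> g \<in> Cc \<and> star g = g \<and> \<phi> g \<rhd> y = y \<and> y \<lhd> \<phi> g = y"

locale proper_comma =
  fixes act :: "'x::t2_space \<Rightarrow> 'g::{topological_group_add, t2_space} \<Rightarrow> 'x"
    and \<mu> :: "'g measure"
    and \<alpha> :: "'g \<Rightarrow> 'a::cstar_algebra \<Rightarrow> 'a"
    and \<phi> :: "'x c0 \<Rightarrow> 'a multiplier"
  assumes G: "locally_compact_space (euclidean :: 'g topology)"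
    and X: "locally_compact_space (euclidean :: 'x topology)"
    and \<mu>: "left_haar_measure \<mu>"
    and act: "proper_right_action act"
    and comma: "comma_object (translation act) \<alpha> \<phi>"
begin

lemma \<alpha>: "continuous_action \<alpha>"
  and \<phi>: "star_hom \<phi>"
  and nondegenerate: "closure (cspan {\<phi> f \<rhd> b | f b. True}) = UNIV"
  and equivariant: "mact \<alpha> s (\<phi> f) = \<phi> (translation act s f)"
  using comma by (auto simp: comma_object_def equivariant_morphism_def cstar_morphism_def)

lemmas \<alpha>_hom = action_star_hom[OF \<alpha>]

lemma \<phi>_mult_lmult: "\<phi> f \<rhd> (\<phi> g \<rhd> a) = \<phi> (f * g) \<rhd> a"
  by (simp add: star_hom_mult[OF \<phi>])

lemma \<phi>_mult_rmult: "(a \<lhd> \<phi> f) \<lhd> \<phi> g = a \<lhd> \<phi> (f * g)"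
  by (simp add: star_hom_mult[OF \<phi>])

lemma star_\<phi>_lmult: "star (\<phi> f \<rhd> a) = star a \<lhd> \<phi> (star f)"
  by (simp add: star_hom_star[OF \<phi>] star_star)

lemma star_\<phi>_rmult: "star (a \<lhd> \<phi> f) = \<phi> (star f) \<rhd> star a"
  by (simp add: star_hom_star[OF \<phi>] star_star)

lemma \<alpha>_\<phi>_lmult: "\<alpha> s (\<phi> f \<rhd> a) = \<phi> (translation act s f) \<rhd> \<alpha> s a"
  by (simp add: equivariant[symmetric] mact_lmult[OF \<alpha>] action_minus[OF \<alpha>])

lemma \<alpha>_\<phi>_rmult: "\<alpha> s (a \<lhd> \<phi> f) = \<alpha> s a \<lhd> \<phi> (translation act s f)"
  by (simp add: equivariant[symmetric] mact_rmult[OF \<alpha>] action_minus[OF \<alpha>])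

lemma corner_generator: "f \<in> Cc \<Longrightarrow> g \<in> Cc \<Longrightarrow> \<phi> f \<rhd> a \<lhd> \<phi> g \<in> corner \<phi>"
  unfolding corner_def by (rule complex_vs.span_base) blast

lemma local_unit_corner: "local_unit \<phi> g y \<Longrightarrow> y \<in> corner \<phi>"
  using corner_generator[of g g y] by (simp add: local_unit_def)

lemma local_unit_pair:
  fixes f g :: "'x c0"
  assumes "f \<in> Cc" "g \<in> Cc"
  obtains h where "h \<in> Cc" "star h = h" "h * f = f" "h * g = g" "\<And>x. cmod (c0_apply h x) \<le> 1"
proof -
  obtain K where K: "compact K" "\<And>x. x \<notin> K \<Longrightarrow> c0_apply f x = 0" using CcE[OF assms(1)] by blast
  obtain L where L: "compact L" "\<And>x. x \<notin> L \<Longrightarrow> c0_apply g x = 0" using CcE[OF assms(2)] by blast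
  obtain h where h: "h \<in> Cc" "star h = h" "\<And>x. cmod (c0_apply h x) \<le> 1" "\<And>x. x \<in> K \<union> L \<Longrightarrow> c0_apply h x = 1"
    using Cc_Urysohn[OF X compact_Un[OF K(1) L(1)]] by blast
  have "h * f = f" "h * g = g"
    using K(2) L(2) h(4) by (auto intro!: c0_eqI simp: mult_eq_self_implies_10) metis+
  then show ?thesis using that h by blast
qed

lemma c0_mult_commute: "f * g = g * (f :: 'x c0)"
  by (rule c0_eqI) simp

lemma local_unit_absorb:
  assumes "local_unit \<phi> g y" "h * g = g" "h \<in> Cc" "star h = h"
  shows "local_unit \<phi> h y"
proof -
  have "\<phi> h \<rhd> y = \<phi> (h * g) \<rhd> y" using assms(1) \<phi>_mult_lmult[of h g y] by (simp add: local_unit_def)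
  moreover have "y \<lhd> \<phi> h = y \<lhd> \<phi> (g * h)" using assms(1) \<phi>_mult_rmult[of y g h] by (simp add: local_unit_def)
  ultimately show ?thesis using assms c0_mult_commute[of g h] by (simp add: local_unit_def)
qed

lemma local_unit_add:
  assumes "local_unit \<phi> f x" "local_unit \<phi> g y"
  obtains h where "local_unit \<phi> h x" "local_unit \<phi> h y" "\<And>x. cmod (c0_apply h x) \<le> 1"
proof -
  have "f \<in> Cc" "g \<in> Cc" using assms by (auto simp: local_unit_def)
  then obtain h where h: "h \<in> Cc" "star h = h" "h * f = f" "h * g = g" "\<And>x. cmod (c0_apply h x) \<le> 1"
    using local_unit_pair by metis
  then show ?thesis using that[of h] local_unit_absorb[OF assms(1), of h] local_unit_absorb[OF assms(2), of h] by blast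
qed

lemma local_unit_linear:
  assumes "local_unit \<phi> h x" "local_unit \<phi> h y"
  shows "local_unit \<phi> h (x + y)" "local_unit \<phi> h (c *\<^sub>C x)" "local_unit \<phi> h (star x)" "local_unit \<phi> h (x * y)"
proof -
  have h: "h \<in> Cc" "star h = h" and x: "\<phi> h \<rhd> x = x" "x \<lhd> \<phi> h = x" and y: "\<phi> h \<rhd> y = y" "y \<lhd> \<phi> h = y"
    using assms by (auto simp: local_unit_def)
  show "local_unit \<phi> h (x + y)" unfolding local_unit_def
    by (intro conjI h) (simp_all only: x y lmult_linear_simps rmult_linear_simps)
  show "local_unit \<phi> h (c *\<^sub>C x)" unfolding local_unit_def
    by (intro conjI h) (simp_all only: x lmult_scaleC rmult_scaleC)
  show "local_unit \<phi> h (x * y)" unfolding local_unit_def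
    by (intro conjI h) (simp_all only: x y lmult_mult rmult_mult)
  have "\<phi> h \<rhd> star x = star x" using star_\<phi>_rmult[of x h] unfolding x h by (rule sym)
  moreover have "star x \<lhd> \<phi> h = star x" using star_\<phi>_lmult[of h x] unfolding x h by (rule sym)
  ultimately show "local_unit \<phi> h (star x)" unfolding local_unit_def by (intro conjI h)
qed

text \<open>For a generator a Urysohn function equal to 1 on both supports works, and two local
  units are absorbed by a third. The bound by 1 keeps later constants from depending on the size of
  the unit.\<close>

lemma corner_local_unit:
  assumes "y \<in> corner \<phi>"
  obtains g where "local_unit \<phi> g y" "\<And>x. cmod (c0_apply g x) \<le> 1"
proof -
  have "\<exists>g. local_unit \<phi> g y \<and> (\<forall>x. cmod (c0_apply g x) \<le> 1)"
    using assms unfolding corner_def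
  proof (induction rule: complex_vs.span_induct_alt)
    case base
    obtain h :: "'x c0" where h: "h \<in> Cc" "star h = h" "\<And>x. cmod (c0_apply h x) \<le> 1"
      "\<And>x. x \<in> {} \<Longrightarrow> c0_apply h x = 1"
      by (rule Cc_Urysohn[OF X compact_empty]) blast
    have "local_unit \<phi> h 0" unfolding local_unit_def
      by (intro conjI h(1,2)) (simp_all only: lmult_linear_simps rmult_linear_simps)
    then show ?case using h(3) by blast
  next
    case (step c x y)
    then obtain f a g where x: "x = \<phi> f \<rhd> a \<lhd> \<phi> g" "f \<in> Cc" "g \<in> Cc" by blast
    obtain h where h: "h \<in> Cc" "star h = h" "h * f = f" "h * g = g" "\<And>x. cmod (c0_apply h x) \<le> 1"
      by (rule local_unit_pair[OF x(2,3)]) blast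
    have "\<phi> h \<rhd> x = x" unfolding x(1) lmult_rmult[symmetric] \<phi>_mult_lmult h(3) ..
    moreover have "x \<lhd> \<phi> h = x" unfolding x(1) lmult_rmult \<phi>_mult_rmult c0_mult_commute[of g h] h(4) ..
    ultimately have "local_unit \<phi> h x" unfolding local_unit_def using h(1,2) by blast
    moreover obtain k where "local_unit \<phi> k y" using step by blast
    ultimately obtain l where l: "local_unit \<phi> l x" "local_unit \<phi> l y" "\<And>x. cmod (c0_apply l x) \<le> 1"
      by (rule local_unit_add) blast
    have "local_unit \<phi> l (c *\<^sub>C x + y)"
      by (rule local_unit_linear(1)[OF local_unit_linear(2)[OF l(1,1)] l(2)])
    then show ?case using l(3) by blast
  qed
  then show ?thesis using that by blast
qed

lemma corner_subspace: "module.subspace scaleC (corner \<phi>)"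
  unfolding corner_def by (rule complex_vs.subspace_span)

lemma local_unit_action:
  assumes "local_unit \<phi> g y"
  shows "local_unit \<phi> (translation act s g) (\<alpha> s y)"
  using assms translation_Cc[OF act] translation_star[OF act, of s g]
  unfolding local_unit_def by (metis \<alpha>_\<phi>_lmult \<alpha>_\<phi>_rmult)

lemma
  assumes "x \<in> corner \<phi>"
  shows corner_scaleC: "c *\<^sub>C x \<in> corner \<phi>"
    and corner_star: "star x \<in> corner \<phi>"
    and corner_action: "\<alpha> s x \<in> corner \<phi>"
    and corner_add: "y \<in> corner \<phi> \<Longrightarrow> x + y \<in> corner \<phi>"
    and corner_diff: "y \<in> corner \<phi> \<Longrightarrow> x - y \<in> corner \<phi>"
    and corner_mult: "y \<in> corner \<phi> \<Longrightarrow> x * y \<in> corner \<phi>"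
proof -
  obtain g where g: "local_unit \<phi> g x" using corner_local_unit[OF assms] by blast
  show "c *\<^sub>C x \<in> corner \<phi>" using corner_subspace assms by (rule complex_vs.subspace_scale)
  show "star x \<in> corner \<phi>" by (rule local_unit_corner[OF local_unit_linear(3)[OF g g]])
  show "\<alpha> s x \<in> corner \<phi>" by (rule local_unit_corner[OF local_unit_action[OF g]])
  assume y: "y \<in> corner \<phi>"
  show "x + y \<in> corner \<phi>" using corner_subspace assms y by (rule complex_vs.subspace_add)
  show "x - y \<in> corner \<phi>" using corner_subspace assms y by (rule complex_vs.subspace_diff)
  obtain f where "local_unit \<phi> f y" using corner_local_unit[OF y] by blast
  then obtain h where "local_unit \<phi> h x" "local_unit \<phi> h y" using local_unit_add[OF g] by metis
  then show "x * y \<in> corner \<phi>" using local_unit_corner[OF local_unit_linear(4)] by blast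
qed

lemma corner_zero: "0 \<in> corner \<phi>"
  using corner_subspace by (rule complex_vs.subspace_0)

lemma corner_star_subalgebra: "star_subalgebra (corner \<phi>)"
  by (simp add: star_subalgebra_def corner_subspace corner_mult corner_star)

text \<open>Nondegeneracy speaks of all of C_0(X); since \<phi> is contractive and C_c(X) is dense,
  each function in a finite sum can be replaced by one of compact support.\<close>

lemma \<phi>_Cc_approx:
  assumes "0 < e"
  obtains y where "y \<in> cspan {\<phi> f \<rhd> b | f b. f \<in> Cc}" "norm (a - y) < e"
proof -
  have "a \<in> closure (cspan {\<phi> f \<rhd> b | f b. True})" using nondegenerate by simp
  then obtain z where z: "z \<in> cspan {\<phi> f \<rhd> b | f b. True}" "dist z a < e / 2"
    unfolding closure_approachable using assms by (metis half_gt_zero)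
  have *: "\<exists>y\<in>cspan {\<phi> f \<rhd> b | f b. f \<in> Cc}. norm (z - y) \<le> d" if "0 < d" for d
    using z(1) that
  proof (induction arbitrary: d rule: complex_vs.span_induct_alt)
    case base
    then show ?case by (intro bexI[of _ 0]) (auto intro: complex_vs.span_zero)
  next
    case (step c x y)
    then obtain f b where x: "x = \<phi> f \<rhd> b" by blast
    define M where "M = cmod c * (norm b) + 1"
    have M: "0 < M" by (simp add: M_def add_nonneg_pos)
    obtain g where g: "g \<in> Cc" "norm (f - g) \<le> d / 2 / M" using Cc_dense[of "d / 2 / M" f] step.prems M by auto
    obtain y' where y': "y' \<in> cspan {\<phi> f \<rhd> b | f b. f \<in> Cc}" "norm (y - y') \<le> d / 2"
      using step.IH[of "d / 2"] step.prems by auto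
    have "c *\<^sub>C (\<phi> g \<rhd> b) + y' \<in> cspan {\<phi> f \<rhd> b | f b. f \<in> Cc}"
      by (rule complex_vs.span_add[OF complex_vs.span_scale[OF complex_vs.span_base] y'(1)]) (use g(1) in blast)
    moreover have "norm (c *\<^sub>C x + y - (c *\<^sub>C (\<phi> g \<rhd> b) + y')) \<le> d"
    proof -
      have "c *\<^sub>C x + y - (c *\<^sub>C (\<phi> g \<rhd> b) + y') = c *\<^sub>C (\<phi> (f - g) \<rhd> b) + (y - y')"
        by (simp add: x star_hom_diff[OF \<phi>] complex_vs.scale_right_diff_distrib)
      also have "norm \<dots> \<le> cmod c * (norm (f - g) * norm b) + d / 2"
        using y'(2) order_trans[OF norm_lmult mult_right_mono[OF star_hom_norm_le[OF \<phi>] norm_ge_zero], of "f - g" b]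
        by (intro norm_triangle_mono) (auto simp: norm_scaleC intro!: mult_left_mono)
      also have "cmod c * (norm (f - g) * norm b) \<le> M * (d / 2 / M)"
      proof -
        have "cmod c * (norm (f - g) * norm b) = (cmod c * norm b) * norm (f - g)" by simp
        also have "\<dots> \<le> M * (d / 2 / M)" using g(2) by (intro mult_mono) (auto simp: M_def)
        finally show ?thesis .
      qed
      finally show ?thesis using M by simp
    qed
    ultimately show ?case by blast
  qed
  obtain y where y: "y \<in> cspan {\<phi> f \<rhd> b | f b. f \<in> Cc}" "norm (z - y) \<le> e / 3" using *[of "e / 3"] assms by auto
  have "norm (a - y) \<le> norm (a - z) + norm (z - y)" using norm_triangle_ineq[of "a - z" "z - y"] by simp
  then have "norm (a - y) < e" using y(2) z(2) assms by (simp add: dist_norm norm_minus_commute)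
  then show ?thesis using that y(1) by blast
qed

text \<open>One-sided density is used twice: for the given element, and for the adjoints of the
  second factors in the approximating sum. The adjoint in the second use moves C_c(X) to the
  right-hand side.\<close>

lemma corner_dense: "closure (corner \<phi>) = UNIV"
proof -
  let ?S = "cspan {\<phi> f \<rhd> b | f b. f \<in> Cc}"
  have r: "\<phi> f \<rhd> star y \<in> corner \<phi>" if "f \<in> Cc" "y \<in> ?S" for f y
    using that(2)
  proof (induction rule: complex_vs.span_induct_alt)
    case base
    then show ?case by (simp add: star_zero lmult_linear_simps corner_zero)
  next
    case (step c x y)
    then obtain g b where x: "x = \<phi> g \<rhd> b" "g \<in> Cc" by blast
    have "\<phi> f \<rhd> star (c *\<^sub>C x + y) = cnj c *\<^sub>C (\<phi> f \<rhd> star b \<lhd> \<phi> (star g)) + \<phi> f \<rhd> star y"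
      unfolding x(1) star_add star_scaleC star_\<phi>_lmult by (simp add: lmult_linear_simps lmult_rmult)
    then show ?case using step.IH that(1) Cc_star[OF x(2)] by (simp add: corner_add corner_scaleC corner_generator)
  qed
  have "\<exists>y\<in>corner \<phi>. dist y a < e" if e: "0 < e" for a e
  proof -
    obtain y where y: "y \<in> ?S" "norm (a - y) < e / 2" using \<phi>_Cc_approx[of "e / 2"] e by auto
    have "\<exists>z\<in>corner \<phi>. norm (y - z) \<le> d" if "0 < d" for d
      using y(1) that
    proof (induction arbitrary: d rule: complex_vs.span_induct_alt)
      case base
      then show ?case using corner_zero by (intro bexI[of _ 0]) auto
    next
      case (step c x y)
      then obtain f b where x: "x = \<phi> f \<rhd> b" "f \<in> Cc" by blast
      define M where "M = cmod c * norm (\<phi> f) + 1"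
      have M: "0 < M" by (simp add: M_def add_nonneg_pos)
      obtain w where w: "w \<in> ?S" "norm (star b - w) < d / 2 / M" using \<phi>_Cc_approx[of "d / 2 / M" "star b"] step.prems M by auto
      obtain z where z: "z \<in> corner \<phi>" "norm (y - z) \<le> d / 2" using step.IH[of "d / 2"] step.prems by auto
      have n: "norm (b - star w) = norm (star b - w)" using norm_star[of "star b - w"] by (simp add: star_diff star_star)
      have "norm (c *\<^sub>C x + y - (c *\<^sub>C (\<phi> f \<rhd> star w) + z)) \<le> d"
      proof -
        have "c *\<^sub>C x + y - (c *\<^sub>C (\<phi> f \<rhd> star w) + z) = c *\<^sub>C (\<phi> f \<rhd> (b - star w)) + (y - z)"
          by (simp add: x(1) lmult_linear_simps complex_vs.scale_right_diff_distrib)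
        also have "norm \<dots> \<le> cmod c * (norm (\<phi> f) * norm (b - star w)) + d / 2"
          using z(2) norm_lmult[of "\<phi> f" "b - star w"]
          by (intro norm_triangle_mono) (auto simp: norm_scaleC intro!: mult_left_mono)
        also have "cmod c * (norm (\<phi> f) * norm (b - star w)) \<le> M * (d / 2 / M)"
        proof -
          have "cmod c * (norm (\<phi> f) * norm (b - star w)) = (cmod c * norm (\<phi> f)) * norm (b - star w)" by simp
          also have "\<dots> \<le> M * (d / 2 / M)" using w(2) n by (intro mult_mono) (auto simp: M_def)
          finally show ?thesis .
        qed
        finally show ?thesis using M by simp
      qed
      moreover have "c *\<^sub>C (\<phi> f \<rhd> star w) + z \<in> corner \<phi>" using r[OF x(2) w(1)] z(1) by (intro corner_add corner_scaleC)
      ultimately show ?case by blast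
    qed
    from this[of "e / 3"] obtain z where z: "z \<in> corner \<phi>" "norm (y - z) \<le> e / 3" using e by auto
    have "norm (z - a) \<le> norm (y - a) + norm (y - z)" using norm_triangle_ineq4[of "y - a" "y - z"] by simp
    then have "dist z a < e" using y(2) z(2) e by (simp add: dist_norm norm_minus_commute)
    then show ?thesis using z(1) by blast
  qed
  then show ?thesis using closure_approachable[of _ "corner \<phi>"] by auto
qed

lemma corner_dense_approx:
  assumes "0 < e" obtains y where "y \<in> corner \<phi>" "norm (y - a) < e"
proof -
  have "a \<in> closure (corner \<phi>)" using corner_dense by simp
  then show ?thesis using that assms unfolding closure_approachable dist_norm by blast
qed

text \<open>Compact support in \<open>s\<close> comes from properness: \<open>f \<cdot> \<gamma>\<^sub>s(g)\<close> vanishes unless \<open>supp f \<cdot> s\<close> meets \<open>supp g\<close>.\<close>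

lemma corner_product_support:
  assumes "c \<in> corner \<phi>" "y \<in> corner \<phi>"
  obtains K where "compact K" "\<And>s. s \<notin> K \<Longrightarrow> c * \<alpha> s y = 0" "\<And>s. s \<notin> K \<Longrightarrow> \<alpha> s y * c = 0"
proof -
  obtain f where f: "local_unit \<phi> f c" using corner_local_unit[OF assms(1)] by metis
  obtain g where g: "local_unit \<phi> g y" using corner_local_unit[OF assms(2)] by metis
  have "f \<in> Cc" "g \<in> Cc" using f g by (auto simp: local_unit_def)
  then obtain P Q where P: "compact P" "\<And>x. x \<notin> P \<Longrightarrow> c0_apply f x = 0" and Q: "compact Q" "\<And>x. x \<notin> Q \<Longrightarrow> c0_apply g x = 0"
    using CcE by metis
  define K where "K = {s. \<exists>x\<in>P. act x s \<in> Q}"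
  have K: "compact K" unfolding K_def by (rule proper_action_compact[OF act P(1) Q(1)])
  have z: "f * translation act s g = 0" if "s \<notin> K" for s
  proof (rule c0_eqI)
    fix x
    show "c0_apply (f * translation act s g) x = c0_apply 0 x"
      using that P(2)[of x] Q(2)[of "act x s"] unfolding K_def by (auto simp: c0_apply_translation[OF act])
  qed
  have y: "\<alpha> s y = \<phi> (translation act s g) \<rhd> \<alpha> s y" "\<alpha> s y = \<alpha> s y \<lhd> \<phi> (translation act s g)" for s
    using g \<alpha>_\<phi>_lmult[of s g y] \<alpha>_\<phi>_rmult[of s y g] by (simp_all add: local_unit_def)
  have "c * \<alpha> s y = 0" if "s \<notin> K" for s
  proof -
    have "c * \<alpha> s y = (c \<lhd> \<phi> f) * (\<phi> (translation act s g) \<rhd> \<alpha> s y)" using f y(1)[of s] by (simp add: local_unit_def)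
    also have "\<dots> = (c \<lhd> \<phi> (f * translation act s g)) * \<alpha> s y" by (simp only: mult_lmult \<phi>_mult_rmult)
    finally show ?thesis using z[OF that] by (simp add: star_hom_zero[OF \<phi>])
  qed
  moreover have "\<alpha> s y * c = 0" if "s \<notin> K" for s
  proof -
    have "\<alpha> s y * c = (\<alpha> s y \<lhd> \<phi> (translation act s g)) * (\<phi> f \<rhd> c)" using f y(2)[of s] by (simp add: local_unit_def)
    also have "\<dots> = (\<alpha> s y \<lhd> \<phi> (f * translation act s g)) * c"
      by (simp only: mult_lmult \<phi>_mult_rmult c0_mult_commute[of f])
    finally show ?thesis using z[OF that] by (simp add: star_hom_zero[OF \<phi>])
  qed
  ultimately show ?thesis using that K by blast
qed

end

section \<open>Multipliers from densely defined double centralizers\<close>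

lemma cstar_left_cancel:
  fixes x y :: "'a::cstar_algebra"
  assumes "\<And>a. a * x = a * y"
  shows "x = y"
proof -
  have "star (x - y) * (x - y) = 0"
    using assms[of "star (x - y)"] by (simp add: right_diff_distrib)
  then show ?thesis using cstar_identity[of "x - y"] by simp
qed

lemma dense_closed_induct:
  assumes "closure S = UNIV" "closed {x. P x}" "\<And>x. x \<in> S \<Longrightarrow> P x"
  shows "P x"
  using closure_minimal[of S "{x. P x}"] assms by auto

lemma multiplier_norm_dense:
  assumes "closure S = UNIV" "0 \<le> K" "\<And>a. a \<in> S \<Longrightarrow> norm (m \<rhd> a) \<le> K * norm a"
  shows "norm m \<le> K"
proof (rule norm_multiplier_bound[OF assms(2)])
  have "closed {a. norm (m \<rhd> a) \<le> K * norm a}"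
    by (intro closed_Collect_le continuous_intros linear_continuous_on bounded_linear_lmult)
  then show "norm (m \<rhd> a) \<le> K * norm a" for a
    by (rule dense_closed_induct[OF assms(1) _ assms(3)])
qed

lemma multiplier_eqI_dense:
  assumes "closure S = UNIV" "\<And>a. a \<in> S \<Longrightarrow> m \<rhd> a = n \<rhd> a"
  shows "m = n"
proof -
  have "norm (m - n) \<le> 0"
    by (rule multiplier_norm_dense[OF assms(1)]) (simp_all add: assms(2))
  then show ?thesis by simp
qed

lemma dense_Lipschitz_extension:
  fixes f :: "'a::real_normed_vector \<Rightarrow> 'b::banach"
  assumes S: "closure S = UNIV" and K: "0 \<le> K"
    and f: "\<And>x y. x \<in> S \<Longrightarrow> y \<in> S \<Longrightarrow> norm (f x - f y) \<le> K * norm (x - y)"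
  obtains F where "continuous_on UNIV F" "\<And>x. x \<in> S \<Longrightarrow> F x = f x"
proof -
  have "K-lipschitz_on S f" by (rule lipschitz_onI) (simp_all add: f K dist_norm)
  then obtain F where "uniformly_continuous_on (closure S) F" "\<And>x. x \<in> S \<Longrightarrow> f x = F x"
    using uniformly_continuous_on_extension_on_closure[OF lipschitz_on_uniformly_continuous] by metis
  then show ?thesis using that uniformly_continuous_imp_continuous S by metis
qed

text \<open>All algebraic clauses of a double centralizer follow from \<open>a L b = R a b\<close> by cancellation.\<close>

lemma double_centralizer_extension:
  fixes l r :: "'a::cstar_algebra \<Rightarrow> 'a"
  assumes S: "closure S = UNIV" "0 \<in> S" and K: "0 \<le> K"
    and l: "\<And>x y. x \<in> S \<Longrightarrow> y \<in> S \<Longrightarrow> norm (l x - l y) \<le> K * norm (x - y)"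
    and r: "\<And>x y. x \<in> S \<Longrightarrow> y \<in> S \<Longrightarrow> norm (r x - r y) \<le> K * norm (x - y)"
    and lr: "\<And>a b. a \<in> S \<Longrightarrow> b \<in> S \<Longrightarrow> a * l b = r a * b"
  obtains m where "\<And>b. b \<in> S \<Longrightarrow> m \<rhd> b = l b" "\<And>a. a \<in> S \<Longrightarrow> a \<lhd> m = r a"
proof -
  obtain L where L: "continuous_on UNIV L" "\<And>x. x \<in> S \<Longrightarrow> L x = l x"
    using dense_Lipschitz_extension[OF S(1) K l] by metis
  obtain R where R: "continuous_on UNIV R" "\<And>x. x \<in> S \<Longrightarrow> R x = r x"
    using dense_Lipschitz_extension[OF S(1) K r] by metis
  have LRS: "a * L b = R a * b" if b: "b \<in> S" for a b
  proof (rule dense_closed_induct[OF S(1), where P = "\<lambda>a. a * L b = R a * b"])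
    show "closed {a. a * L b = R a * b}" by (intro closed_Collect_eq continuous_intros R)
  qed (simp only: lr[OF _ b] L(2)[OF b] R(2))
  have LR: "a * L b = R a * b" for a b
  proof (rule dense_closed_induct[OF S(1), where P = "\<lambda>b. a * L b = R a * b"])
    show "closed {b. a * L b = R a * b}" by (intro closed_Collect_eq continuous_intros L)
  qed (rule LRS)
  have L0: "L 0 = 0" by (rule cstar_left_cancel) (simp add: LR)
  have R0: "R 0 = 0" by (rule cstar_right_cancel) (simp add: LR[symmetric])
  have Ln: "norm (L x) \<le> K * norm x" for x
  proof (rule dense_closed_induct[OF S(1), where P = "\<lambda>x. norm (L x) \<le> K * norm x"])
    show "closed {x. norm (L x) \<le> K * norm x}" by (intro closed_Collect_le continuous_intros L)
    show "norm (L x) \<le> K * norm x" if "x \<in> S" for x using l[OF that S(2)] L(2) L0 S(2) that by simp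
  qed
  have Rn: "norm (R x) \<le> K * norm x" for x
  proof (rule dense_closed_induct[OF S(1), where P = "\<lambda>x. norm (R x) \<le> K * norm x"])
    show "closed {x. norm (R x) \<le> K * norm x}" by (intro closed_Collect_le continuous_intros R)
    show "norm (R x) \<le> K * norm x" if "x \<in> S" for x using r[OF that S(2)] R(2) R0 S(2) that by simp
  qed
  have Ladd: "L (x + y) = L x + L y" for x y by (rule cstar_left_cancel) (simp add: LR distrib_left)
  have Radd: "R (x + y) = R x + R y" for x y by (rule cstar_right_cancel) (simp add: LR[symmetric] distrib_right)
  have LC: "L (c *\<^sub>C x) = c *\<^sub>C L x" for c x by (rule cstar_left_cancel) (simp add: LR mult_scaleC_right)
  have RC: "R (c *\<^sub>C x) = c *\<^sub>C R x" for c x by (rule cstar_right_cancel) (simp add: LR[symmetric] mult_scaleC_left)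
  have Lm: "L (x * y) = L x * y" for x y by (rule cstar_left_cancel) (simp add: LR mult.assoc[symmetric])
  have Rm: "R (x * y) = x * R y" for x y by (rule cstar_right_cancel) (simp add: LR[symmetric] mult.assoc)
  have bL: "bounded_linear L"
    by (rule bounded_linear_intro[where K = K]) (simp_all add: Ladd LC scaleR_scaleC Ln mult.commute)
  have bR: "bounded_linear R"
    by (rule bounded_linear_intro[where K = K]) (simp_all add: Radd RC scaleR_scaleC Rn mult.commute)
  note * = bL bR LC RC Lm Rm LR
  show ?thesis
    using that[of "mk_multiplier L R"] lmult_mk_multiplier[of L R, OF *] rmult_mk_multiplier[of L R, OF *] L(2) R(2) by simp
qed

lemma sum_lmult: "(\<Sum>i\<in>I. f i) \<rhd> c = (\<Sum>i\<in>I. f i \<rhd> c)"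
  by (induction I rule: infinite_finite_induct) simp_all

lemma c0_apply_sum: "c0_apply (\<Sum>i\<in>I. f i) x = (\<Sum>i\<in>I. c0_apply (f i) x)"
  by (induction I rule: infinite_finite_induct) simp_all

section \<open>Averages of elements of the corner\<close>

context proper_comma
begin

text \<open>Compressing y <= t 1 by \<phi>(g) leaves \<open>y\<close> unchanged and turns t 1 into a
  multiple of \<phi>(g^2).\<close>

lemma local_unit_psd_bound:
  assumes "local_unit \<phi> g y" "psd (of_alg y)" "norm y \<le> t"
  shows "psd (t *\<^sub>R \<phi> (g * g) - of_alg y)"
proof -
  have g: "star (\<phi> g) = \<phi> g" using assms(1) star_hom_star[OF \<phi>, of g] by (simp add: local_unit_def)
  have "psd (star (\<phi> g) * (t *\<^sub>R 1 - of_alg y) * \<phi> g)"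
    by (intro psd_conj psd_norm_minus psd_star assms) (simp add: norm_of_alg assms)
  moreover have "star (\<phi> g) * (t *\<^sub>R 1 - of_alg y) * \<phi> g = t *\<^sub>R \<phi> (g * g) - of_alg y"
    using assms(1) by (simp add: g algebra_simps of_alg_lmult of_alg_rmult star_hom_mult[OF \<phi>] local_unit_def)
  ultimately show ?thesis by simp
qed

lemma action_psd: "psd (of_alg y) \<Longrightarrow> psd (of_alg (\<alpha> s y))"
  by (rule star_hom_psd[OF star_hom_of_alg[OF \<alpha>_hom]])

text \<open>The Riemann sums \<open>T\<close> are dominated by \<open>\<parallel>y\<parallel> \<phi>(F)\<close>, where \<open>F\<close> is a Riemann sum of the orbit integral
  of \<open>g\<^sup>2\<close>, and the orbit integrals of \<open>g\<^sup>2\<close> are bounded uniformly in the orbit.\<close>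

lemma average_riemann_sums:
  assumes g: "g \<in> Cc" "\<And>x. cmod (c0_apply g x) \<le> 1"
  obtains C where "0 \<le> C"
    "\<And>y c v e. local_unit \<phi> g y \<Longrightarrow> psd (of_alg y) \<Longrightarrow> c \<in> corner \<phi> \<Longrightarrow>
       has_vector_integral \<mu> (\<lambda>s. \<alpha> s y * c) v \<Longrightarrow> 0 < e \<Longrightarrow>
       \<exists>T. psd T \<and> norm T \<le> C * norm y \<and> norm (v - T \<rhd> c) \<le> e"
proof -
  obtain P where P: "compact P" "\<And>x. x \<notin> P \<Longrightarrow> c0_apply g x = 0" using CcE[OF g(1)] by blast
  \<comment> \<open>A relatively compact neighbourhood bounds the offset between tag and cell, so
    the compact set of the next lines can be fixed before any partition is chosen.\<close>
  obtain V W where VW: "open V" "compact W" "(0::'g) \<in> V" "V \<subseteq> W"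
    using G unfolding locally_compact_space_def by simp metis
  have "compact (uminus ` W)"
    by (rule compact_continuous_image[OF _ VW(2)]) (intro continuous_intros)
  then have L: "compact {act x s | x s. x \<in> P \<and> s \<in> uminus ` W}"
    by (rule action_image_compact[OF act P(1)])
  obtain C where C: "0 \<le> C"
    "\<And>x S. S \<in> sets borel \<Longrightarrow> S \<subseteq> {s. act x s \<in> {act x s | x s. x \<in> P \<and> s \<in> uminus ` W}} \<Longrightarrow> emeasure \<mu> S \<le> ennreal C"
    using orbit_measure_bound[OF act \<mu> L] by blast
  have "\<exists>T. psd T \<and> norm T \<le> C * norm y \<and> norm (v - T \<rhd> c) \<le> e"
    if y: "local_unit \<phi> g y" "psd (of_alg y)" and c: "c \<in> corner \<phi>"
      and v: "has_vector_integral \<mu> (\<lambda>s. \<alpha> s y * c) v" and e: "0 < e" for y c v e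
  proof -
    obtain K where K: "compact K" "\<And>s. s \<notin> K \<Longrightarrow> \<alpha> s y * c = 0"
      using corner_product_support[OF c local_unit_corner[OF y(1)]] by metis
    define d where "d = e / (measure \<mu> K + 1)"
    have p: "0 < measure \<mu> K + 1" by (simp add: add_nonneg_pos)
    then have d: "0 < d" using e by (simp add: d_def)
    have ct: "continuous_on UNIV (\<lambda>s. \<alpha> s y * c)" by (intro continuous_intros action_continuous[OF \<alpha>])
    obtain I B where "riemann_data K V (\<lambda>s. \<alpha> s y * c) d I B"
      by (rule riemann_data_exists[OF K(1) ct VW(1,3) d])
    then have I: "finite I" "I \<subseteq> K" and B: "\<And>i. i \<in> I \<Longrightarrow> B i \<in> sets borel" "disjoint_family_on B I" "(\<Union>i\<in>I. B i) = K"
      and BV: "\<And>i s. i \<in> I \<Longrightarrow> s \<in> B i \<Longrightarrow> - s + i \<in> V"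
      and Bd: "\<And>i s. i \<in> I \<Longrightarrow> s \<in> B i \<Longrightarrow> dist (\<alpha> s y * c) (\<alpha> i y * c) < d"
      unfolding riemann_data_def by auto
    have fin: "emeasure \<mu> (B i) \<noteq> \<infinity>" if "i \<in> I" for i
    proof -
      have "emeasure \<mu> (B i) \<le> emeasure \<mu> K"
        using that B compact_imp_closed[OF K(1)] haar_sets[OF \<mu>] by (intro emeasure_mono) auto
      then show ?thesis using haar_compact[OF \<mu> K(1)] by (auto simp: top_unique)
    qed
    define T where "T = (\<Sum>i\<in>I. measure \<mu> (B i) *\<^sub>R of_alg (\<alpha> i y))"
    define F where "F = (\<Sum>i\<in>I. measure \<mu> (B i) *\<^sub>R translation act i (g * g))"
    have T: "psd T" unfolding T_def by (intro psd_sum psd_scaleR action_psd y) simp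
    have "norm F \<le> C"
    proof (rule norm_c0_bound)
      fix x
      \<comment> \<open>Only tags that move \<open>x\<close> into the support of \<open>g\<close>
        contribute. Their disjoint cells move \<open>x\<close> into the enlarged compact set, so
        their total measure is at most the orbit constant.\<close>
      define J where "J = {i \<in> I. act x i \<in> P}"
      have J: "finite J" "J \<subseteq> I" using I by (auto simp: J_def)
      have "cmod (c0_apply F x) \<le> (\<Sum>i\<in>I. measure \<mu> (B i) * (cmod (c0_apply g (act x i)))\<^sup>2)"
        unfolding F_def c0_apply_sum
        by (rule order_trans[OF norm_sum]) (simp add: c0_apply_translation[OF act] norm_mult power2_eq_square)
      also have "\<dots> = (\<Sum>i\<in>J. measure \<mu> (B i) * (cmod (c0_apply g (act x i)))\<^sup>2)"
        using I P(2) by (intro sum.mono_neutral_right) (auto simp: J_def)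
      also have "\<dots> \<le> (\<Sum>i\<in>J. measure \<mu> (B i) * 1)"
        using g(2) by (intro sum_mono mult_left_mono) (auto intro: power_le_one)
      also have "\<dots> = measure \<mu> (\<Union>i\<in>J. B i)"
        using J B fin haar_sets[OF \<mu>] by (subst measure_finite_Union) (auto intro: disjoint_family_on_mono)
      also have "\<dots> \<le> C"
      proof -
        have "(\<Union>i\<in>J. B i) \<subseteq> {s. act x s \<in> {act x s | x s. x \<in> P \<and> s \<in> uminus ` W}}"
        proof
          fix s assume "s \<in> (\<Union>i\<in>J. B i)"
          then obtain i where i: "i \<in> I" "act x i \<in> P" "s \<in> B i" by (auto simp: J_def)
          have "- s + i \<in> W" using BV[OF i(1,3)] VW(4) by blast
          moreover have "act x s = act (act x i) (- (- s + i))"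
            by (simp add: right_action_add[OF act] minus_add add.assoc[symmetric])
          ultimately show "s \<in> {s. act x s \<in> {act x s | x s. x \<in> P \<and> s \<in> uminus ` W}}" using i(2) by blast
        qed
        moreover have "(\<Union>i\<in>J. B i) \<in> sets borel" using J B(1) by (intro sets.finite_UN) auto
        ultimately have "emeasure \<mu> (\<Union>i\<in>J. B i) \<le> ennreal C" using C(2) by blast
        then show ?thesis using C(1) by (simp add: measure_def enn2real_leI)
      qed
      finally show "cmod (c0_apply F x) \<le> C" .
    qed
    then have F: "norm (\<phi> F) \<le> C" using star_hom_norm_le[OF \<phi>, of F] by linarith
    have "norm y *\<^sub>R \<phi> F - T = (\<Sum>i\<in>I. measure \<mu> (B i) *\<^sub>R (norm y *\<^sub>R \<phi> (translation act i g * translation act i g) - of_alg (\<alpha> i y)))"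
      by (simp add: F_def T_def star_hom_sum[OF \<phi>] star_hom_scaleR[OF \<phi>] scaleR_sum_right sum_subtractf[symmetric]
          scaleR_diff_right translation_mult[OF act] mult.commute)
    also have "psd \<dots>"
      by (intro psd_sum psd_scaleR local_unit_psd_bound local_unit_action y action_psd action_norm_le[OF \<alpha>]) simp
    finally have "norm T \<le> norm (norm y *\<^sub>R \<phi> F)" by (rule psd_mono_norm[OF T])
    also have "\<dots> \<le> C * norm y" using F by (simp add: mult.commute[of C] mult_left_mono)
    finally have nT: "norm T \<le> C * norm y" .
    have "norm (v - (\<Sum>i\<in>I. measure \<mu> (B i) *\<^sub>R (\<alpha> i y * c))) \<le> d * measure \<mu> K"
      using Bd d by (intro riemann_sum_approx[OF \<mu> K v I(1) B]) (auto simp: dist_norm intro: less_imp_le)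
    also have "(\<Sum>i\<in>I. measure \<mu> (B i) *\<^sub>R (\<alpha> i y * c)) = T \<rhd> c" by (simp add: T_def sum_lmult)
    also have "d * measure \<mu> K \<le> e" using p e by (simp add: d_def field_simps)
    finally show ?thesis using T nT by blast
  qed
  then show ?thesis using that C(1) by blast
qed

end

section \<open>Strict averages as multipliers\<close>

lemma has_vector_integral_minus:
  assumes "has_vector_integral M f v"
  shows "has_vector_integral M (\<lambda>s. - f s) (- v :: 'a::real_normed_vector)"
  by (rule has_vector_integral_bounded_linear[OF assms bounded_linear_minus[OF bounded_linear_ident]])

lemma has_vector_integral_star:
  assumes "has_vector_integral M f v"
  shows "has_vector_integral M (\<lambda>s. star (f s)) (star v)"
  by (rule has_vector_integral_bounded_linear[OF assms bounded_linear_star])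

context proper_comma
begin

lemma action_corner_continuous:
  "continuous_on UNIV (\<lambda>s. \<alpha> s y * c)" "continuous_on UNIV (\<lambda>s. c * \<alpha> s y)"
  by (intro continuous_intros action_continuous[OF \<alpha>])+

lemma
  assumes "y \<in> corner \<phi>" "c \<in> corner \<phi>"
  shows corner_integrable_left: "\<exists>v. has_vector_integral \<mu> (\<lambda>s. \<alpha> s y * c) v"
    and corner_integrable_right: "\<exists>v. has_vector_integral \<mu> (\<lambda>s. c * \<alpha> s y) v"
proof -
  obtain K where K: "compact K" "\<And>s. s \<notin> K \<Longrightarrow> c * \<alpha> s y = 0" "\<And>s. s \<notin> K \<Longrightarrow> \<alpha> s y * c = 0"
    using corner_product_support[OF assms(2,1)] by metis
  show "\<exists>v. has_vector_integral \<mu> (\<lambda>s. \<alpha> s y * c) v"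
    by (rule has_vector_integral_compact_support[OF \<mu> K(1,3) action_corner_continuous(1)]) blast+
  show "\<exists>v. has_vector_integral \<mu> (\<lambda>s. c * \<alpha> s y) v"
    by (rule has_vector_integral_compact_support[OF \<mu> K(1,2) action_corner_continuous(2)]) blast+
qed

text \<open>Tests run over A_0 only, where the integrand has compact support; density of A_0 still
  makes the multiplier unique.\<close>

definition strict_average :: "'a \<Rightarrow> 'a multiplier \<Rightarrow> bool" where
  "strict_average y m \<longleftrightarrow> (\<forall>c\<in>corner \<phi>. has_vector_integral \<mu> (\<lambda>s. \<alpha> s y * c) (m \<rhd> c) \<and>
     has_vector_integral \<mu> (\<lambda>s. c * \<alpha> s y) (c \<lhd> m))"

lemma strict_average_unique:
  assumes "strict_average y m" "strict_average y n"
  shows "m = n"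
  by (rule multiplier_eqI_dense[OF corner_dense])
     (use assms has_vector_integral_unique in \<open>unfold strict_average_def, blast\<close>)

lemma strict_average_add:
  assumes "strict_average y m" "strict_average z n"
  shows "strict_average (y + z) (m + n)"
  unfolding strict_average_def
proof (intro ballI conjI)
  fix c assume c: "c \<in> corner \<phi>"
  have "has_vector_integral \<mu> (\<lambda>s. \<alpha> s y * c + \<alpha> s z * c) (m \<rhd> c + n \<rhd> c)"
    by (rule has_vector_integral_add)
       (use assms c in \<open>auto simp: strict_average_def intro!: haar_measurable_continuous[OF \<mu>] continuous_intros action_continuous[OF \<alpha>]\<close>)
  then show "has_vector_integral \<mu> (\<lambda>s. \<alpha> s (y + z) * c) ((m + n) \<rhd> c)"
    by (simp add: star_hom_add[OF \<alpha>_hom] distrib_right)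
  have "has_vector_integral \<mu> (\<lambda>s. c * \<alpha> s y + c * \<alpha> s z) (c \<lhd> m + c \<lhd> n)"
    by (rule has_vector_integral_add)
       (use assms c in \<open>auto simp: strict_average_def intro!: haar_measurable_continuous[OF \<mu>] continuous_intros action_continuous[OF \<alpha>]\<close>)
  then show "has_vector_integral \<mu> (\<lambda>s. c * \<alpha> s (y + z)) (c \<lhd> (m + n))"
    by (simp add: star_hom_add[OF \<alpha>_hom] distrib_left)
qed

lemma strict_average_scaleC:
  assumes "strict_average y m"
  shows "strict_average (k *\<^sub>C y) (k *\<^sub>C m)"
  unfolding strict_average_def
proof (intro ballI conjI)
  fix c assume c: "c \<in> corner \<phi>"
  have "has_vector_integral \<mu> (\<lambda>s. k *\<^sub>C (\<alpha> s y * c)) (k *\<^sub>C (m \<rhd> c))"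
    by (rule has_vector_integral_bounded_linear[OF _ bounded_linear_scaleC])
       (use assms c in \<open>auto simp: strict_average_def\<close>)
  then show "has_vector_integral \<mu> (\<lambda>s. \<alpha> s (k *\<^sub>C y) * c) ((k *\<^sub>C m) \<rhd> c)"
    by (simp add: star_hom_scaleC[OF \<alpha>_hom] mult_scaleC_left)
  have "has_vector_integral \<mu> (\<lambda>s. k *\<^sub>C (c * \<alpha> s y)) (k *\<^sub>C (c \<lhd> m))"
    by (rule has_vector_integral_bounded_linear[OF _ bounded_linear_scaleC])
       (use assms c in \<open>auto simp: strict_average_def\<close>)
  then show "has_vector_integral \<mu> (\<lambda>s. c * \<alpha> s (k *\<^sub>C y)) (c \<lhd> (k *\<^sub>C m))"
    by (simp add: star_hom_scaleC[OF \<alpha>_hom] mult_scaleC_right)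
qed

text \<open>For each \<open>c\<close> the integral is approximated by \<open>T \<rhd> c\<close> with
  positive \<open>T\<close> of norm at most C norm y, where \<open>T\<close> depends on
  \<open>c\<close> but the bound does not. This makes c -> l(c) Lipschitz, hence a multiplier. The
  right action is obtained through adjoints, as \<alpha>_s(y) is selfadjoint.\<close>

lemma strict_average_psd_exists:
  assumes g: "g \<in> Cc" "\<And>x. cmod (c0_apply g x) \<le> 1"
  obtains C where "0 \<le> C"
    "\<And>y. local_unit \<phi> g y \<Longrightarrow> psd (of_alg y) \<Longrightarrow> \<exists>m. strict_average y m \<and> psd m \<and> norm m \<le> C * norm y"
proof -
  obtain C where C: "0 \<le> C"
    "\<And>y c v e. local_unit \<phi> g y \<Longrightarrow> psd (of_alg y) \<Longrightarrow> c \<in> corner \<phi> \<Longrightarrow>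
       has_vector_integral \<mu> (\<lambda>s. \<alpha> s y * c) v \<Longrightarrow> 0 < e \<Longrightarrow>
       \<exists>T. psd T \<and> norm T \<le> C * norm y \<and> norm (v - T \<rhd> c) \<le> e"
    using average_riemann_sums[OF g] by blast
  have "\<exists>m. strict_average y m \<and> psd m \<and> norm m \<le> C * norm y"
    if y: "local_unit \<phi> g y" "psd (of_alg y)" for y
  proof -
    let ?t = "C * norm y"
    have yc: "y \<in> corner \<phi>" by (rule local_unit_corner[OF y(1)])
    have sy: "star (\<alpha> s y) = \<alpha> s y" for s
      using psd_star[OF action_psd[OF y(2)], of s] by (simp add: of_alg_star[symmetric])
    have t: "0 \<le> ?t" using C(1) by simp
    define l where "l c = (SOME v. has_vector_integral \<mu> (\<lambda>s. \<alpha> s y * c) v)" for c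
    have l: "has_vector_integral \<mu> (\<lambda>s. \<alpha> s y * c) (l c)" if "c \<in> corner \<phi>" for c
      unfolding l_def using corner_integrable_left[OF yc that] by (rule someI_ex)
    have r: "has_vector_integral \<mu> (\<lambda>s. c * \<alpha> s y) (star (l (star c)))" if "c \<in> corner \<phi>" for c
      using has_vector_integral_star[OF l[OF corner_star[OF that]]] by (simp add: star_mult star_star sy)
    have app: "\<exists>T. psd T \<and> norm T \<le> ?t \<and> norm (l c - T \<rhd> c) \<le> e" if "c \<in> corner \<phi>" "0 < e" for c e
      using C(2)[OF y that(1) l[OF that(1)] that(2)] .
    have ln: "norm (l c) \<le> ?t * norm c" if c: "c \<in> corner \<phi>" for c
    proof (rule field_le_epsilon)
      fix e :: real assume e: "0 < e"
      obtain T where T: "norm T \<le> ?t" "norm (l c - T \<rhd> c) \<le> e" using app[OF c e] by blast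
      have "norm (l c) \<le> norm (l c - T \<rhd> c) + norm (T \<rhd> c)" by (metis diff_add_cancel norm_triangle_ineq)
      also have "norm (T \<rhd> c) \<le> ?t * norm c"
        using order_trans[OF norm_lmult mult_right_mono[OF T(1) norm_ge_zero]] .
      finally show "norm (l c) \<le> ?t * norm c + e" using T(2) by simp
    qed
    have ld: "l a - l b = l (a - b)" if "a \<in> corner \<phi>" "b \<in> corner \<phi>" for a b
    proof (rule has_vector_integral_unique[OF _ l[OF corner_diff[OF that]]])
      have "has_vector_integral \<mu> (\<lambda>s. \<alpha> s y * a + - (\<alpha> s y * b)) (l a + - l b)"
        by (intro has_vector_integral_add has_vector_integral_minus l that
            haar_measurable_continuous[OF \<mu>] continuous_intros action_continuous[OF \<alpha>])
      then show "has_vector_integral \<mu> (\<lambda>s. \<alpha> s y * (a - b)) (l a - l b)" by (simp add: right_diff_distrib)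
    qed
    have lL: "norm (l a - l b) \<le> ?t * norm (a - b)" if "a \<in> corner \<phi>" "b \<in> corner \<phi>" for a b
      using ln[OF corner_diff[OF that]] ld[OF that] by simp
    have rL: "norm (star (l (star a)) - star (l (star b))) \<le> ?t * norm (a - b)" if "a \<in> corner \<phi>" "b \<in> corner \<phi>" for a b
      using lL[OF corner_star[OF that(1)] corner_star[OF that(2)]] by (simp add: star_diff[symmetric] norm_star)
    have lr: "a * l b = star (l (star a)) * b" if "a \<in> corner \<phi>" "b \<in> corner \<phi>" for a b
    proof (rule has_vector_integral_unique)
      show "has_vector_integral \<mu> (\<lambda>s. a * (\<alpha> s y * b)) (a * l b)"
        by (rule has_vector_integral_bounded_linear[OF l[OF that(2)] bounded_linear_mult_right])
      have "has_vector_integral \<mu> (\<lambda>s. a * \<alpha> s y * b) (star (l (star a)) * b)"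
        by (rule has_vector_integral_bounded_linear[OF r[OF that(1)] bounded_linear_mult_left])
      then show "has_vector_integral \<mu> (\<lambda>s. a * (\<alpha> s y * b)) (star (l (star a)) * b)" by (simp add: mult.assoc)
    qed
    obtain m where m: "\<And>b. b \<in> corner \<phi> \<Longrightarrow> m \<rhd> b = l b" "\<And>a. a \<in> corner \<phi> \<Longrightarrow> a \<lhd> m = star (l (star a))"
      using double_centralizer_extension[OF corner_dense corner_zero t lL rL lr] by blast
    have "strict_average y m" using l r m by (simp add: strict_average_def)
    moreover have "star m = m"
      by (rule multiplier_eqI_dense[OF corner_dense]) (simp add: m corner_star star_star)
    moreover have "norm m \<le> ?t" by (rule multiplier_norm_dense[OF corner_dense t]) (simp add: m ln)
    \<comment> \<open>Positivity is a norm inequality, so it is inherited from the Riemann sums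
      \<open>T\<close> even though a different \<open>T\<close> serves each
      \<open>c\<close>.\<close>
    moreover have "norm (?t *\<^sub>R 1 - m) \<le> ?t"
    proof (rule multiplier_norm_dense[OF corner_dense t])
      fix c assume c: "c \<in> corner \<phi>"
      show "norm ((?t *\<^sub>R 1 - m) \<rhd> c) \<le> ?t * norm c"
      proof (rule field_le_epsilon)
        fix e :: real assume e: "0 < e"
        obtain T where T: "psd T" "norm T \<le> ?t" "norm (l c - T \<rhd> c) \<le> e" using app[OF c e] by blast
        have "(?t *\<^sub>R 1 - m) \<rhd> c = (?t *\<^sub>R 1 - T) \<rhd> c - (l c - T \<rhd> c)" by (simp add: m c)
        then have "norm ((?t *\<^sub>R 1 - m) \<rhd> c) \<le> norm ((?t *\<^sub>R 1 - T) \<rhd> c) + norm (l c - T \<rhd> c)"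
          by (metis norm_triangle_ineq4)
        also have "norm ((?t *\<^sub>R 1 - T) \<rhd> c) \<le> ?t * norm c"
          by (rule order_trans[OF norm_lmult mult_right_mono[OF psd_norm_diff[OF T(1,2)] norm_ge_zero]])
        finally show "norm ((?t *\<^sub>R 1 - m) \<rhd> c) \<le> ?t * norm c + e" using T(3) by simp
      qed
    qed
    ultimately show ?thesis unfolding psd_def by blast
  qed
  then show ?thesis using that C(1) by blast
qed

text \<open>On the compact set \<open>K\<close> of relevant s the translates of the local unit of
  \<open>y\<close> have supports in one compact set. A function \<open>h\<close> equal to 1 there
  and on the support for \<open>c\<close> is a local unit of every value of the integrand, and
  therefore of the integral.\<close>

lemma strict_average_corner:
  assumes m: "strict_average y m" and y: "y \<in> corner \<phi>" and c: "c \<in> corner \<phi>"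
  shows "m \<rhd> c \<in> corner \<phi>" "c \<lhd> m \<in> corner \<phi>"
proof -
  obtain K where K: "compact K" "\<And>s. s \<notin> K \<Longrightarrow> c * \<alpha> s y = 0" "\<And>s. s \<notin> K \<Longrightarrow> \<alpha> s y * c = 0"
    using corner_product_support[OF c y] by metis
  obtain f g where f: "local_unit \<phi> f c" and g: "local_unit \<phi> g y"
    using corner_local_unit y c by metis
  then obtain P Q where P: "compact P" "\<And>x. x \<notin> P \<Longrightarrow> c0_apply f x = 0" and Q: "compact Q" "\<And>x. x \<notin> Q \<Longrightarrow> c0_apply g x = 0"
    using CcE unfolding local_unit_def by metis
  have "compact (uminus ` K)"
    by (rule compact_continuous_image[OF _ K(1)]) (intro continuous_intros)
  then have PQ: "compact (P \<union> {act x s | x s. x \<in> Q \<and> s \<in> uminus ` K})"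
    by (intro compact_Un P(1) action_image_compact[OF act Q(1)])
  obtain h where h: "h \<in> Cc" "star h = h"
    "\<And>x. x \<in> P \<union> {act x s | x s. x \<in> Q \<and> s \<in> uminus ` K} \<Longrightarrow> c0_apply h x = 1"
    by (rule Cc_Urysohn[OF X PQ]) blast
  have "h * f = f" by (rule c0_eqI) (use h(3) P(2) in force)
  then have c': "local_unit \<phi> h c" using local_unit_absorb[OF f] h(1,2) by blast
  have y': "local_unit \<phi> h (\<alpha> s y)" if "s \<in> K" for s
  proof (rule local_unit_absorb[OF local_unit_action[OF g] _ h(1,2)])
    show "h * translation act s g = translation act s g"
    proof (rule c0_eqI)
      fix x
      have "x = act (act x s) (- s)" by (simp add: right_action_add[OF act] right_action_zero[OF act])
      then have "act x s \<in> Q \<Longrightarrow> c0_apply h x = 1" using that by (intro h(3)) blast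
      then show "c0_apply (h * translation act s g) x = c0_apply (translation act s g) x"
        using Q(2)[of "act x s"] by (auto simp: c0_apply_translation[OF act])
    qed
  qed
  have z: "local_unit \<phi> h 0" using h(1,2) by (simp add: local_unit_def lmult_linear_simps rmult_linear_simps)
  have 1: "local_unit \<phi> h (\<alpha> s y * c)" for s
    using local_unit_linear(4)[OF y' c', of s] K(3)[of s] z by metis
  have 2: "local_unit \<phi> h (c * \<alpha> s y)" for s
    using local_unit_linear(4)[OF c' y', of s] K(2)[of s] z by metis
  have *: "v \<in> corner \<phi>" if v: "has_vector_integral \<mu> w v" and w: "\<And>s. local_unit \<phi> h (w s)" for w v
  proof -
    have "has_vector_integral \<mu> (\<lambda>s. \<phi> h \<rhd> w s) (\<phi> h \<rhd> v)"
      by (rule has_vector_integral_bounded_linear[OF v bounded_linear_lmult])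
    moreover have "has_vector_integral \<mu> (\<lambda>s. w s \<lhd> \<phi> h) (v \<lhd> \<phi> h)"
      by (rule has_vector_integral_bounded_linear[OF v bounded_linear_rmult])
    moreover have "(\<lambda>s. \<phi> h \<rhd> w s) = w" "(\<lambda>s. w s \<lhd> \<phi> h) = w"
      using w by (simp_all add: local_unit_def)
    ultimately have "\<phi> h \<rhd> v = v" "v \<lhd> \<phi> h = v"
      using has_vector_integral_unique[OF _ v] by metis+
    then show ?thesis using h(1,2) by (intro local_unit_corner[of h]) (simp add: local_unit_def)
  qed
  show "m \<rhd> c \<in> corner \<phi>"
    by (rule *[where w = "\<lambda>s. \<alpha> s y * c", OF _ 1]) (use m c in \<open>simp add: strict_average_def\<close>)
  show "c \<lhd> m \<in> corner \<phi>"
    by (rule *[where w = "\<lambda>s. c * \<alpha> s y", OF _ 2]) (use m c in \<open>simp add: strict_average_def\<close>)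
qed

text \<open>\<alpha>_s passes under the integral and shifts the variable from t to s + t, which left
  invariance of Haar measure undoes.\<close>

lemma strict_average_invariant:
  assumes m: "strict_average y m" and y: "y \<in> corner \<phi>"
  shows "mact \<alpha> s m = m"
proof (rule multiplier_eqI_dense[OF corner_dense])
  fix c assume c: "c \<in> corner \<phi>"
  obtain K where K: "compact K" "\<And>s. s \<notin> K \<Longrightarrow> \<alpha> s y * c = 0"
    using corner_product_support[OF c y] by metis
  have "has_vector_integral \<mu> (\<lambda>t. \<alpha> s (\<alpha> t y * \<alpha> (- s) c)) (\<alpha> s (m \<rhd> \<alpha> (- s) c))"
    using m corner_action[OF c, of "- s"]
    by (intro has_vector_integral_bounded_linear[OF _ action_bounded_linear[OF \<alpha>]]) (simp add: strict_average_def)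
  then have "has_vector_integral \<mu> (\<lambda>t. \<alpha> (s + t) y * c) (mact \<alpha> s m \<rhd> c)"
    by (simp add: star_hom_mult[OF \<alpha>_hom] action_minus[OF \<alpha>] action_add[OF \<alpha>] mact_lmult[OF \<alpha>])
  moreover have "has_vector_integral \<mu> (\<lambda>t. \<alpha> (s + t) y * c) (m \<rhd> c)"
    using has_vector_integral_translate[OF \<mu> K action_corner_continuous(1)] m c by (simp add: strict_average_def)
  ultimately show "mact \<alpha> s m \<rhd> c = m \<rhd> c" by (rule has_vector_integral_unique)
qed

end

section \<open>Averages in the sense of positive functionals\<close>

lemma positive_form_psd:
  assumes F: "positive_form F" and h: "psd (h :: 'a::{cstar_algebra, monoid_mult})"
  shows "0 \<le> Re (F h)"
proof -
  obtain s where "star s = s" "s * s = h" using psd_sqrt[OF h] by metis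
  then have "Re (F h) = form_sq F s" by (simp add: form_sq_def)
  then show ?thesis using form_sq_nonneg[OF F] by simp
qed

lemma form_sq_mult_le:
  fixes k z :: "'a::{cstar_algebra, monoid_mult}"
  assumes F: "positive_form F"
  shows "form_sq F (k * z) \<le> (norm k)\<^sup>2 * form_sq F z"
proof -
  have "psd ((norm k)\<^sup>2 *\<^sub>R 1 - star k * k)"
    by (intro psd_norm_minus) (simp_all add: cstar_identity star_mult star_star)
  then have "psd (star z * ((norm k)\<^sup>2 *\<^sub>R 1 - star k * k) * z)" by (rule psd_conj)
  then have "0 \<le> Re (F (star z * ((norm k)\<^sup>2 *\<^sub>R 1 - star k * k) * z))" by (rule positive_form_psd[OF F])
  also have "star z * ((norm k)\<^sup>2 *\<^sub>R 1 - star k * k) * z = (norm k)\<^sup>2 *\<^sub>R (star z * z) - star (k * z) * (k * z)"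
    by (simp add: algebra_simps star_mult)
  finally show ?thesis
    using positive_form_linear[OF F] by (simp add: form_sq_def complex_linear_diff complex_linear_scaleR)
qed

text \<open>Expansion of the form at x - y/t. The free parameter lets the coefficient of
  \<open>x\<close> come arbitrarily near 1.\<close>

lemma form_sq_add_le:
  assumes F: "positive_form F" and t: "0 < t"
  shows "form_sq F (x + y) \<le> (1 + t) * form_sq F x + (1 + 1 / t) * form_sq F y"
proof -
  have "0 \<le> form_sq F (x + complex_of_real (- (1 / t)) *\<^sub>C y)" by (rule form_sq_nonneg[OF F])
  also have "\<dots> = form_sq F x + 2 * (- (1 / t) * Re (F (star x * y))) + (1 / t)\<^sup>2 * form_sq F y"
    unfolding form_sq_add_scaleC[OF F] by (simp add: power_divide norm_divide)
  finally have "0 \<le> t * (form_sq F x + 2 * (- (1 / t) * Re (F (star x * y))) + (1 / t)\<^sup>2 * form_sq F y)"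
    using t by simp
  also have "\<dots> = t * form_sq F x - 2 * Re (F (star x * y)) + (1 / t) * form_sq F y"
    using t by (simp add: field_simps power2_eq_square)
  finally have "2 * Re (F (star x * y)) \<le> t * form_sq F x + (1 / t) * form_sq F y" by linarith
  then show ?thesis using form_sq_add_scaleC[OF F, of x 1 y] by (simp add: scaleC_one algebra_simps)
qed

lemma form_sq_tendsto:
  assumes F: "positive_form F" and "(\<lambda>n. form_sq F (z n - w)) \<longlonglongrightarrow> 0"
  shows "(\<lambda>n. form_sq F (z n)) \<longlonglongrightarrow> form_sq F w"
proof -
  have "(\<lambda>n. 2 * (sqrt (form_sq F w) * sqrt (form_sq F (z n - w))) + form_sq F (z n - w))
      \<longlonglongrightarrow> 2 * (sqrt (form_sq F w) * sqrt 0) + 0"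
    by (intro tendsto_intros assms)
  then have *: "(\<lambda>n. 2 * (sqrt (form_sq F w) * sqrt (form_sq F (z n - w))) + form_sq F (z n - w)) \<longlonglongrightarrow> 0" by simp
  have "\<bar>form_sq F (z n) - form_sq F w\<bar> \<le> 2 * (sqrt (form_sq F w) * sqrt (form_sq F (z n - w))) + form_sq F (z n - w)" for n
  proof -
    have "form_sq F (z n) = form_sq F w + 2 * Re (F (star w * (z n - w))) + form_sq F (z n - w)"
      using form_sq_add_scaleC[OF F, of w 1 "z n - w"] by (simp add: scaleC_one)
    moreover have "\<bar>Re (F (star w * (z n - w)))\<bar> \<le> sqrt (form_sq F w) * sqrt (form_sq F (z n - w))"
      using abs_Re_le_cmod form_Cauchy_Schwarz_sqrt[OF F] order_trans by blast
    ultimately show ?thesis using form_sq_nonneg[OF F, of "z n - w"] by linarith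
  qed
  then have "(\<lambda>n. form_sq F (z n) - form_sq F w) \<longlonglongrightarrow> 0"
    by (intro Lim_null_comparison[OF _ *]) simp
  then show ?thesis by (simp add: LIM_zero_iff)
qed

lemma form_sq_functional_ext: "positive_functional \<omega> \<Longrightarrow> form_sq (functional_ext \<omega>) (of_alg z) = form_sq \<omega> z"
  by (simp add: form_sq_def of_alg_mult[symmetric] of_alg_star[symmetric] functional_ext_of_alg)

lemma Fatou_tendsto:
  fixes u :: "nat \<Rightarrow> 's \<Rightarrow> real"
  assumes u: "\<And>i. has_bochner_integral M (u i) (c i)" "\<And>i s. 0 \<le> u i s"
    and lim: "\<And>s. (\<lambda>i. u i s) \<longlonglongrightarrow> w s" "c \<longlonglongrightarrow> d" and w: "w \<in> borel_measurable M"
  shows "integrable M w" "(LINT s|M. w s) \<le> d"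
proof -
  have w0: "0 \<le> w s" for s using LIMSEQ_le_const[OF lim(1)] u(2) by blast
  have d0: "0 \<le> d"
  proof (rule LIMSEQ_le_const[OF lim(2)])
    have "0 \<le> c n" for n
    proof -
      have "0 \<le> integral\<^sup>L M (u n)" using u(2) by simp
      then show ?thesis using u(1)[of n] by (simp add: has_bochner_integral_iff)
    qed
    then show "\<exists>N. \<forall>n\<ge>N. 0 \<le> c n" by blast
  qed
  have "(\<integral>\<^sup>+s. ennreal (w s) \<partial>M) = (\<integral>\<^sup>+s. liminf (\<lambda>i. ennreal (u i s)) \<partial>M)"
    by (intro nn_integral_cong sym[OF lim_imp_Liminf] tendsto_ennrealI lim) simp
  also have "\<dots> \<le> liminf (\<lambda>i. \<integral>\<^sup>+s. ennreal (u i s) \<partial>M)"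
    using u(1) by (intro nn_integral_liminf) (auto dest: borel_measurable_has_bochner_integral)
  also have "(\<lambda>i. \<integral>\<^sup>+s. ennreal (u i s) \<partial>M) = (\<lambda>i. ennreal (c i))"
    using u by (auto simp: nn_integral_eq_integral has_bochner_integral_iff)
  also have "liminf (\<lambda>i. ennreal (c i)) = ennreal d"
    by (intro lim_imp_Liminf tendsto_ennrealI lim) simp
  finally have *: "(\<integral>\<^sup>+s. ennreal (w s) \<partial>M) \<le> ennreal d" .
  then show 1: "integrable M w"
    using w w0 by (intro integrableI_bounded) (auto intro: le_less_trans)
  show "(LINT s|M. w s) \<le> d"
    using * nn_integral_eq_integral[OF 1] w0 d0 by simp
qed

context proper_comma
begin

text \<open>The extension of \<omega> is controlled by one element \<open>v\<close>, so an
  approximate unit at \<open>v\<close> is near 1 in its form; density then replaces it by an element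
  of A_0.\<close>

lemma corner_approximates_unit:
  assumes \<omega>: "positive_functional \<omega>" and e: "0 < e"
  obtains b where "b \<in> corner \<phi>" "form_sq (functional_ext \<omega>) (of_alg b - 1) < e"
proof -
  let ?F = "functional_ext \<omega>"
  note F = positive_form_functional_ext[OF \<omega>]
  obtain C v where C: "0 \<le> C" "\<And>m. cmod (?F m) \<le> C * (norm (m \<rhd> v) + norm (v \<lhd> m))"
    using functional_ext_bound[OF \<omega>] by blast
  \<comment> \<open>\<open>k\<close> has norm at most 2, so each of the two norms is at most 2 d and
    the bound becomes 4 C d.\<close>
  define d where "d = e / (16 * (C + 1))"
  have d: "0 < d" "C * (4 * d) \<le> e / 4" using e C(1) by (simp_all add: d_def field_simps)
  obtain u where u: "norm u \<le> 1" "star u = u" "norm (u * v - v) < d" "norm (v * u - v) < d"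
    using approximate_unit_at[OF d(1)] by metis
  define k where "k = of_alg u - 1"
  have k: "star k = k" "norm k \<le> 2"
    using norm_triangle_ineq4[of "of_alg u" 1] u(1) norm_one_le[where 'a = "'a multiplier"]
    by (simp_all add: k_def star_diff of_alg_star[symmetric] u(2) norm_of_alg)
  have "norm ((star k * k) \<rhd> v) \<le> 2 * d"
    using order_trans[OF norm_lmult mult_mono[OF k(2) less_imp_le[OF u(3)]]] by (simp add: k(1)) (simp add: k_def)
  moreover have "norm (v \<lhd> (star k * k)) \<le> 2 * d"
    using order_trans[OF norm_rmult mult_mono[OF k(2) less_imp_le[OF u(4)]]] by (simp add: k(1)) (simp add: k_def)
  ultimately have "C * (norm ((star k * k) \<rhd> v) + norm (v \<lhd> (star k * k))) \<le> C * (4 * d)"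
    by (intro mult_left_mono C) simp
  then have "cmod (?F (star k * k)) \<le> e / 4" using C(2)[of "star k * k"] d(2) by linarith
  then have 1: "form_sq ?F k \<le> e / 4" unfolding form_sq_def using abs_Re_le_cmod[of "?F (star k * k)"] by linarith
  obtain K where K: "0 < K" "\<And>x. form_sq \<omega> x \<le> K * (norm x)\<^sup>2" using positive_functional_bound[OF \<omega>] by metis
  define c where "c = min 1 (e / (8 * K))"
  have c: "0 < c" using e K by (simp add: c_def)
  obtain b where b: "b \<in> corner \<phi>" "norm (b - u) < c" using corner_dense_approx[OF c] by metis
  have "K * (norm (b - u))\<^sup>2 \<le> K * (c * c)"
    unfolding power2_eq_square using b(2) K(1) c by (intro mult_left_mono mult_mono) auto
  also have "\<dots> \<le> K * (c * 1)" using K(1) c by (intro mult_left_mono) (auto simp: c_def)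
  also have "\<dots> \<le> e / 8" using K(1) by (simp add: c_def min_def field_simps)
  finally have 2: "form_sq ?F (of_alg b - of_alg u) \<le> e / 8"
    using K(2)[of "b - u"] by (simp add: of_alg_diff[symmetric] form_sq_functional_ext[OF \<omega>])
  have "form_sq ?F (of_alg b - 1) \<le> 2 * form_sq ?F k + 2 * form_sq ?F (of_alg b - of_alg u)"
    using form_sq_add_le[OF F, of 1 k "of_alg b - of_alg u"] by (simp add: k_def)
  then have "form_sq ?F (of_alg b - 1) < e" using 1 2 e by linarith
  then show ?thesis using that b(1) by blast
qed

text \<open>With \<open>x\<^sup>2 = y\<close> and \<open>r\<^sup>2 = m\<close>, both sides are limits of their compressions by elements \<open>b\<close> of the corner
  tending to \<open>1\<close> in the form of \<open>\<omega>\<close>, where the strict integral applies. Fatou's lemma also bounds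
  the integral of the error \<open>\<omega>((b - 1)\<^sup>* \<alpha>\<^sub>s(y) (b - 1))\<close>, which gives the converse inequality.\<close>

lemma strict_average_is_average:
  assumes y: "y \<in> corner \<phi>" "psd (of_alg y)" and m: "strict_average y m" "psd m"
  shows "is_average \<mu> \<alpha> (of_alg y) m"
proof -
  obtain x where x: "star x = x" "x * x = y" using sqrt_in_algebra[OF y(2)] by metis
  obtain r where r: "star r = r" "r * r = m" using psd_sqrt[OF m(2)] by metis
  have main: "has_bochner_integral \<mu> (\<lambda>s. functional_ext \<omega> (mact \<alpha> s (of_alg y))) (functional_ext \<omega> m)"
    if \<omega>: "positive_functional \<omega>" for \<omega>
  proof -
    let ?q = "form_sq (functional_ext \<omega>)"
    \<comment> \<open>As \<open>x\<close> is a root of \<open>y\<close>, the form at \<xi>(s) is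
      \<omega>(\<alpha>_s(y)). Integrands thus become squares of seminorms, to which triangle
      inequalities apply.\<close>
    define \<xi> where "\<xi> s = of_alg (\<alpha> s x)" for s
    note F = positive_form_functional_ext[OF \<omega>]
    have bl: "bounded_linear \<omega>" using \<omega> by (simp add: positive_functional_def dual_def)
    have \<xi>: "star (\<xi> s) * \<xi> s = of_alg (\<alpha> s y)" for s
      by (simp add: \<xi>_def of_alg_star[symmetric] of_alg_mult[symmetric] star_hom_star[OF \<alpha>_hom, symmetric]
          star_hom_mult[OF \<alpha>_hom, symmetric] x)
    have q\<xi>: "?q (\<xi> s * of_alg b) = Re (\<omega> (star b * (\<alpha> s y * b)))" for s b
    proof -
      have "star (\<xi> s * of_alg b) * (\<xi> s * of_alg b) = of_alg (star b) * (star (\<xi> s) * \<xi> s) * of_alg b"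
        by (simp add: star_mult of_alg_star mult.assoc)
      also have "\<dots> = of_alg (star b * (\<alpha> s y * b))" by (simp only: \<xi> of_alg_mult mult.assoc)
      finally show ?thesis by (simp add: form_sq_def functional_ext_of_alg[OF \<omega>])
    qed
    have qr: "?q (r * of_alg b) = Re (\<omega> (star b * (m \<rhd> b)))" for b
    proof -
      have "star (r * of_alg b) * (r * of_alg b) = of_alg (star b) * ((r * r) * of_alg b)"
        by (simp add: star_mult of_alg_star r(1) mult.assoc)
      also have "\<dots> = of_alg (star b * (m \<rhd> b))" by (simp only: r(2) of_alg_mult of_alg_lmult)
      finally show ?thesis by (simp add: form_sq_def functional_ext_of_alg[OF \<omega>])
    qed
    have int: "has_bochner_integral \<mu> (\<lambda>s. ?q (\<xi> s * of_alg b)) (?q (r * of_alg b))" if b: "b \<in> corner \<phi>" for b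
    proof -
      have "has_vector_integral \<mu> (\<lambda>s. \<alpha> s y * b) (m \<rhd> b)" using m(1) b by (simp add: strict_average_def)
      then have "has_vector_integral \<mu> (\<lambda>s. Re (\<omega> (star b * (\<alpha> s y * b)))) (Re (\<omega> (star b * (m \<rhd> b))))"
        by (rule has_vector_integral_bounded_linear[OF _ bounded_linear_compose[OF bounded_linear_Re
              bounded_linear_compose[OF bl bounded_linear_mult_right]]])
      then show ?thesis unfolding q\<xi> qr by (rule has_vector_integral_imp_has_bochner_integral)
    qed
    have "\<exists>b. b \<in> corner \<phi> \<and> ?q (of_alg b - 1) < 1 / Suc n" for n
      using corner_approximates_unit[OF \<omega>, of "1 / Suc n"] by auto
    then obtain b where b: "\<And>n. b n \<in> corner \<phi>" "\<And>n. ?q (of_alg (b n) - 1) < 1 / Suc n" by metis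
    have "(\<lambda>n. 1 / real (Suc n)) \<longlonglongrightarrow> 0" by (rule lim_1_over_n[THEN LIMSEQ_Suc])
    then have b0: "(\<lambda>n. ?q (of_alg (b n) - 1)) \<longlonglongrightarrow> 0"
      by (rule Lim_null_comparison[rotated]) (use b(2) form_sq_nonneg[OF F] in \<open>auto intro!: always_eventually less_imp_le\<close>)
    have k0: "(\<lambda>n. ?q (k * (of_alg (b n) - 1))) \<longlonglongrightarrow> 0" for k
    proof (rule Lim_null_comparison)
      show "\<forall>\<^sub>F n in sequentially. norm (?q (k * (of_alg (b n) - 1))) \<le> (norm k)\<^sup>2 * ?q (of_alg (b n) - 1)"
        using form_sq_mult_le[OF F] form_sq_nonneg[OF F] by (auto intro!: always_eventually)
      show "(\<lambda>n. (norm k)\<^sup>2 * ?q (of_alg (b n) - 1)) \<longlonglongrightarrow> 0" using tendsto_mult_left[OF b0, of "(norm k)\<^sup>2"] by simp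
    qed
    have k1: "(\<lambda>n. ?q (k * of_alg (b n))) \<longlonglongrightarrow> ?q k" for k
      by (rule form_sq_tendsto[OF F]) (use k0[of k] in \<open>simp add: right_diff_distrib\<close>)
    have k2: "(\<lambda>j. ?q (k * of_alg (b n - b j))) \<longlonglongrightarrow> ?q (k * (of_alg (b n) - 1))" for k n
    proof (rule form_sq_tendsto[OF F])
      have "k * of_alg (b n - b j) - k * (of_alg (b n) - 1) = (- k) * (of_alg (b j) - 1)" for j
        by (simp add: of_alg_diff algebra_simps)
      then show "(\<lambda>j. ?q (k * of_alg (b n - b j) - k * (of_alg (b n) - 1))) \<longlonglongrightarrow> 0" using k0[of "- k"] by simp
    qed
    have c\<xi>: "(\<lambda>s. ?q (\<xi> s)) \<in> borel_measurable \<mu>"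
    proof -
      have "?q (\<xi> s) = Re (\<omega> (\<alpha> s y))" for s by (simp add: form_sq_def \<xi> functional_ext_of_alg[OF \<omega>])
      then show ?thesis
        by (auto intro!: haar_measurable_continuous[OF \<mu>] continuous_intros action_continuous[OF \<alpha>]
              bounded_linear.continuous_on[OF bl])
    qed
    have i1: "integrable \<mu> (\<lambda>s. ?q (\<xi> s))" "(LINT s|\<mu>. ?q (\<xi> s)) \<le> ?q r"
      by (rule Fatou_tendsto[OF int[OF b(1)] form_sq_nonneg[OF F] k1 k1 c\<xi>])+
    have m2: "(\<lambda>s. ?q (\<xi> s * (of_alg (b n) - 1))) \<in> borel_measurable \<mu>" for n
    proof (rule borel_measurable_LIMSEQ_real[OF k2])
      show "(\<lambda>s. ?q (\<xi> s * of_alg (b n - b j))) \<in> borel_measurable \<mu>" for j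
        using int[OF corner_diff[OF b(1) b(1)]] by (rule borel_measurable_has_bochner_integral)
    qed
    \<comment> \<open>With n fixed, Fatou runs over j in b_n - b_j, which lies in A_0 and tends to
      b_n - 1 in the form.\<close>
    have i2: "integrable \<mu> (\<lambda>s. ?q (\<xi> s * (of_alg (b n) - 1)))"
      "(LINT s|\<mu>. ?q (\<xi> s * (of_alg (b n) - 1))) \<le> ?q (r * (of_alg (b n) - 1))" for n
      by (rule Fatou_tendsto[OF int[OF corner_diff[OF b(1) b(1)]] form_sq_nonneg[OF F] k2 k2 m2])+
    have *: "?q r \<le> (1 + t) * (LINT s|\<mu>. ?q (\<xi> s))" if t: "0 < t" for t
    proof (rule LIMSEQ_le)
      show "(\<lambda>n. ?q (r * of_alg (b n))) \<longlonglongrightarrow> ?q r" by (rule k1)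
      have "(\<lambda>n. (1 + t) * (LINT s|\<mu>. ?q (\<xi> s)) + (1 + 1 / t) * ?q (r * (of_alg (b n) - 1)))
          \<longlonglongrightarrow> (1 + t) * (LINT s|\<mu>. ?q (\<xi> s)) + (1 + 1 / t) * 0"
        by (intro tendsto_intros k0)
      then show "(\<lambda>n. (1 + t) * (LINT s|\<mu>. ?q (\<xi> s)) + (1 + 1 / t) * ?q (r * (of_alg (b n) - 1)))
          \<longlonglongrightarrow> (1 + t) * (LINT s|\<mu>. ?q (\<xi> s))" by simp
      have "?q (r * of_alg (b n)) \<le> (1 + t) * (LINT s|\<mu>. ?q (\<xi> s)) + (1 + 1 / t) * ?q (r * (of_alg (b n) - 1))" for n
      proof -
        have "?q (r * of_alg (b n)) = (LINT s|\<mu>. ?q (\<xi> s * of_alg (b n)))"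
          using int[OF b(1)] by (simp add: has_bochner_integral_iff)
        also have "\<dots> \<le> (LINT s|\<mu>. (1 + t) * ?q (\<xi> s) + (1 + 1 / t) * ?q (\<xi> s * (of_alg (b n) - 1)))"
        proof (rule integral_mono)
          show "integrable \<mu> (\<lambda>s. ?q (\<xi> s * of_alg (b n)))" using int[OF b(1)] by (simp add: has_bochner_integral_iff)
          show "integrable \<mu> (\<lambda>s. (1 + t) * ?q (\<xi> s) + (1 + 1 / t) * ?q (\<xi> s * (of_alg (b n) - 1)))"
            by (intro Bochner_Integration.integrable_add integrable_mult_right i1 i2)
          show "?q (\<xi> s * of_alg (b n)) \<le> (1 + t) * ?q (\<xi> s) + (1 + 1 / t) * ?q (\<xi> s * (of_alg (b n) - 1))" for s
            using form_sq_add_le[OF F t, of "\<xi> s" "\<xi> s * (of_alg (b n) - 1)"] by (simp add: right_diff_distrib)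
        qed
        also have "\<dots> = (1 + t) * (LINT s|\<mu>. ?q (\<xi> s)) + (1 + 1 / t) * (LINT s|\<mu>. ?q (\<xi> s * (of_alg (b n) - 1)))"
          by (subst Bochner_Integration.integral_add) (simp_all add: i1(1) i2(1))
        also have "\<dots> \<le> (1 + t) * (LINT s|\<mu>. ?q (\<xi> s)) + (1 + 1 / t) * ?q (r * (of_alg (b n) - 1))"
          using t by (intro add_left_mono mult_left_mono i2) simp
        finally show ?thesis .
      qed
      then show "\<exists>N. \<forall>n\<ge>N. ?q (r * of_alg (b n)) \<le> (1 + t) * (LINT s|\<mu>. ?q (\<xi> s)) + (1 + 1 / t) * ?q (r * (of_alg (b n) - 1))"
        by blast
    qed
    have I0: "0 \<le> (LINT s|\<mu>. ?q (\<xi> s))" by (intro Bochner_Integration.integral_nonneg form_sq_nonneg[OF F])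
    have "?q r \<le> (LINT s|\<mu>. ?q (\<xi> s))"
    proof (rule field_le_epsilon)
      fix e :: real assume e: "0 < e"
      let ?I = "LINT s|\<mu>. ?q (\<xi> s)"
      \<comment> \<open>The parameter is t = e / (I + 1), where the added 1 avoids division by zero
        and t I stays at most e.\<close>
      have "e * ?I \<le> e * (?I + 1)" using e by simp
      then have "e / (?I + 1) * ?I \<le> e" using I0 by (simp add: divide_le_eq)
      then show "?q r \<le> ?I + e" using *[of "e / (?I + 1)"] e I0 by (simp add: distrib_right)
    qed
    then have "has_bochner_integral \<mu> (\<lambda>s. ?q (\<xi> s)) (?q r)" using i1 by (simp add: has_bochner_integral_iff)
    then have "has_bochner_integral \<mu> (\<lambda>s. complex_of_real (?q (\<xi> s))) (complex_of_real (?q r))"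
      by (rule has_bochner_integral_of_real)
    moreover have "complex_of_real (?q (\<xi> s)) = functional_ext \<omega> (mact \<alpha> s (of_alg y))" for s
      using form_sq_of_real[OF F, of "\<xi> s"] by (simp add: \<xi> mact_of_alg[OF \<alpha>])
    moreover have "complex_of_real (?q r) = functional_ext \<omega> m"
      using form_sq_of_real[OF F, of r] by (simp add: r)
    ultimately show ?thesis by simp
  qed
  show ?thesis unfolding is_average_def
    using main m(2) by (auto simp: positive_iff_psd has_bochner_integral_iff)
qed

end

section \<open>The averaging map on the corner\<close>

lemma sum_lessThan_four: "(\<Sum>i<4. f i) = f 0 + (f 1 + (f 2 + f 3))" for f :: "nat \<Rightarrow> 'b::ab_group_add"
  by (simp add: eval_nat_numeral lessThan_Suc algebra_simps)

context proper_comma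
begin

text \<open>The usual four positive parts come without information on supports. Compression by
  \<phi>(g) gives all of them the local unit \<open>h\<close>, keeps them positive and within the
  norm of \<open>y\<close>, and preserves their sum because \<open>y\<close> is fixed by it.\<close>

lemma compression_psd_decomposition:
  assumes g: "local_unit \<phi> g y" "\<And>x. cmod (c0_apply g x) \<le> 1" and h: "h \<in> Cc" "star h = h" "h * g = g"
  obtains p where "y = (\<Sum>i<4. \<i> ^ i *\<^sub>C p i)" "\<And>i. psd (of_alg (p i))" "\<And>i. local_unit \<phi> h (p i)"
    "\<And>i. norm (p i) \<le> norm y"
proof -
  have sg: "star (\<phi> g) = \<phi> g" using g(1) star_hom_star[OF \<phi>, of g] by (simp add: local_unit_def)
  have "norm g \<le> 1" using g(2) by (rule norm_c0_bound)
  then have ng: "norm (\<phi> g) \<le> 1" using star_hom_norm_le[OF \<phi>, of g] by linarith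
  obtain a b where ab: "star a = a" "star b = b" "y = a + \<i> *\<^sub>C b" "norm a \<le> norm y" "norm b \<le> norm y"
    using selfadj_parts[of y] by metis
  obtain a1 a2 where a: "a = a1 - a2" "psd (of_alg a1)" "psd (of_alg a2)" "norm a1 \<le> norm a" "norm a2 \<le> norm a"
    using selfadj_decomposition[OF ab(1)] by metis
  obtain b1 b2 where b: "b = b1 - b2" "psd (of_alg b1)" "psd (of_alg b2)" "norm b1 \<le> norm b" "norm b2 \<le> norm b"
    using selfadj_decomposition[OF ab(2)] by metis
  \<comment> \<open>The order follows the powers 1, i, -1, -i.\<close>
  define q where "q i = (if i = 0 then a1 else if i = 1 then b1 else if i = 2 then a2 else b2)" for i :: nat
  have q: "psd (of_alg (q i))" "norm (q i) \<le> norm y" for i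
    using a b ab(4,5) unfolding q_def by (auto intro: order_trans)
  have yq: "y = (\<Sum>i<4. \<i> ^ i *\<^sub>C q i)"
    by (simp add: eval_nat_numeral lessThan_Suc q_def ab(3) a(1) b(1) scaleC_one complex_vs.scale_right_diff_distrib
        complex_vs.scale_minus_left algebra_simps)
  define p where "p i = \<phi> g \<rhd> q i \<lhd> \<phi> g" for i
  have sl: "m \<rhd> (\<Sum>i\<in>I. f i) = (\<Sum>i\<in>I. m \<rhd> f i)" "(\<Sum>i\<in>I. f i) \<lhd> m = (\<Sum>i\<in>I. f i \<lhd> m)"
    for m :: "'a multiplier" and f :: "nat \<Rightarrow> 'a" and I
    by (induction I rule: infinite_finite_induct) (simp_all add: lmult_linear_simps rmult_linear_simps)
  have "y = \<phi> g \<rhd> y \<lhd> \<phi> g" using g(1) by (simp add: local_unit_def)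
  also have "\<dots> = (\<Sum>i<4. \<i> ^ i *\<^sub>C p i)" unfolding p_def
    by (subst yq) (simp only: sl lmult_scaleC rmult_scaleC)
  finally have 1: "y = (\<Sum>i<4. \<i> ^ i *\<^sub>C p i)" .
  have "of_alg (p i) = star (\<phi> g) * of_alg (q i) * \<phi> g" for i
    by (simp add: p_def sg of_alg_lmult of_alg_rmult)
  then have 2: "psd (of_alg (p i))" for i by (simp add: psd_conj q)
  have "\<phi> h \<rhd> p i = p i" "p i \<lhd> \<phi> h = p i" for i
    by (simp_all add: p_def lmult_rmult[symmetric] \<phi>_mult_lmult h(3))
       (simp add: lmult_rmult \<phi>_mult_rmult c0_mult_commute[of g h] h(3))
  then have 3: "local_unit \<phi> h (p i)" for i using h by (simp add: local_unit_def)
  have "norm (p i) \<le> norm y" for i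
  proof -
    have "norm (p i) \<le> norm (\<phi> g) * norm (\<phi> g \<rhd> q i)" unfolding p_def by (rule norm_rmult)
    also have "\<dots> \<le> 1 * norm (\<phi> g \<rhd> q i)" by (rule mult_right_mono[OF ng]) simp
    also have "norm (\<phi> g \<rhd> q i) \<le> norm (\<phi> g) * norm (q i)" by (rule norm_lmult)
    also have "\<dots> \<le> 1 * norm (q i)" by (rule mult_right_mono[OF ng]) simp
    finally show ?thesis using q(2)[of i] by simp
  qed
  then show ?thesis using that 1 2 3 by blast
qed

text \<open>The square root of \<open>p\<close> inside A lies in
  \<open>\<nn> \<mu> \<alpha>\<close>, so \<open>p\<close> is itself one of the products that span
  \<open>\<mm> \<mu> \<alpha>\<close>.\<close>

lemma of_alg_psd_dom:
  assumes "psd (of_alg p)" "is_average \<mu> \<alpha> (of_alg p) m"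
  shows "of_alg p \<in> \<pp> \<mu> \<alpha>" "of_alg p \<in> \<mm> \<mu> \<alpha>"
proof -
  show p: "of_alg p \<in> \<pp> \<mu> \<alpha>" using assms by (auto simp: avg_pos_def positive_iff_psd)
  obtain x where x: "star x = x" "x * x = p" using sqrt_in_algebra[OF assms(1)] by metis
  then have e: "star (of_alg x) * of_alg x = of_alg p" by (simp add: of_alg_star[symmetric] of_alg_mult[symmetric])
  then have "of_alg x \<in> \<nn> \<mu> \<alpha>" using p by (simp add: avg_sq_def)
  then show "of_alg p \<in> \<mm> \<mu> \<alpha>" unfolding avg_dom_def e[symmetric] by (intro complex_vs.span_base) blast
qed

text \<open>The four positive parts share the local unit \<open>h\<close>, which is chosen from
  \<open>g\<close> alone, so one constant bounds each of their averages and four times it bounds the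
  total.\<close>

lemma average_bounded:
  assumes g: "g \<in> Cc" "\<And>x. cmod (c0_apply g x) \<le> 1"
  obtains C where "0 \<le> C"
    "\<And>y. local_unit \<phi> g y \<Longrightarrow> strict_average y (average \<mu> \<alpha> (of_alg y)) \<and> norm (average \<mu> \<alpha> (of_alg y)) \<le> C * norm y"
proof -
  obtain h where h: "h \<in> Cc" "star h = h" "h * g = g" "\<And>x. cmod (c0_apply h x) \<le> 1"
    by (rule local_unit_pair[OF g(1) g(1)]) blast
  obtain C where C: "0 \<le> C"
    "\<And>y. local_unit \<phi> h y \<Longrightarrow> psd (of_alg y) \<Longrightarrow> \<exists>m. strict_average y m \<and> psd m \<and> norm m \<le> C * norm y"
    using strict_average_psd_exists[OF h(1,4)] by blast
  have "strict_average y (average \<mu> \<alpha> (of_alg y)) \<and> norm (average \<mu> \<alpha> (of_alg y)) \<le> 4 * C * norm y"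
    if y: "local_unit \<phi> g y" for y
  proof -
    obtain p where p: "y = (\<Sum>i<4. \<i> ^ i *\<^sub>C p i)" "\<And>i. psd (of_alg (p i))" "\<And>i. local_unit \<phi> h (p i)"
      "\<And>i. norm (p i) \<le> norm y"
      using compression_psd_decomposition[OF y g(2) h(1-3)] by blast
    have "\<forall>i. \<exists>m. strict_average (p i) m \<and> psd m \<and> norm m \<le> C * norm (p i)" using C(2) p(2,3) by blast
    then obtain m where m: "\<And>i. strict_average (p i) (m i)" "\<And>i. psd (m i)" "\<And>i. norm (m i) \<le> C * norm (p i)"
      by metis
    have av: "is_average \<mu> \<alpha> (of_alg (p i)) (m i)" for i
      by (rule strict_average_is_average[OF local_unit_corner[OF p(3)] p(2) m(1,2)])
    have oy: "of_alg y = (\<Sum>i<4. \<i> ^ i *\<^sub>C of_alg (p i))"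
      by (subst p(1)) (simp only: of_alg_sum of_alg_scaleC)
    have "of_alg y \<in> \<mm> \<mu> \<alpha>"
      unfolding oy avg_dom_def
      by (intro complex_vs.span_sum complex_vs.span_scale)
         (use of_alg_psd_dom(2)[OF p(2) av] in \<open>simp add: avg_dom_def\<close>)
    then have e: "average \<mu> \<alpha> (of_alg y) = (\<Sum>i<4. \<i> ^ i *\<^sub>C m i)"
      by (rule average_eqI[OF \<alpha> _ of_alg_psd_dom(1)[OF p(2) av] av oy])
    have "norm (average \<mu> \<alpha> (of_alg y)) \<le> (\<Sum>i<4::nat. C * norm y)"
      unfolding e
    proof (rule sum_norm_le)
      fix i
      have "norm (\<i> ^ i *\<^sub>C m i) = norm (m i)" by (simp add: norm_scaleC norm_power)
      also have "\<dots> \<le> C * norm y" using m(3)[of i] mult_left_mono[OF p(4)[of i] C(1)] by linarith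
      finally show "norm (\<i> ^ i *\<^sub>C m i) \<le> C * norm y" .
    qed
    moreover have "strict_average y (average \<mu> \<alpha> (of_alg y))"
    proof -
      have "strict_average (\<i> ^ 0 *\<^sub>C p 0 + (\<i> ^ 1 *\<^sub>C p 1 + (\<i> ^ 2 *\<^sub>C p 2 + \<i> ^ 3 *\<^sub>C p 3)))
        (\<i> ^ 0 *\<^sub>C m 0 + (\<i> ^ 1 *\<^sub>C m 1 + (\<i> ^ 2 *\<^sub>C m 2 + \<i> ^ 3 *\<^sub>C m 3)))"
        by (intro strict_average_add strict_average_scaleC m)
      then show ?thesis unfolding e by (subst p(1)) (simp only: sum_lessThan_four)
    qed
    ultimately show ?thesis by simp
  qed
  then show ?thesis using that[of "4 * C"] C(1) by simp
qed

lemma strict_average_average: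
  assumes "y \<in> corner \<phi>"
  shows "strict_average y (average \<mu> \<alpha> (of_alg y))"
proof -
  obtain g where g: "local_unit \<phi> g y" "\<And>x. cmod (c0_apply g x) \<le> 1" using corner_local_unit[OF assms] by blast
  then have "g \<in> Cc" by (simp add: local_unit_def)
  then show ?thesis using average_bounded[OF _ g(2)] g(1) by metis
qed

text \<open>Linearity of E on A_0 is read off from strict averages, which are visibly linear and
  unique.\<close>

lemma
  assumes "x \<in> corner \<phi>"
  shows average_corner_scaleC: "average \<mu> \<alpha> (of_alg (c *\<^sub>C x)) = c *\<^sub>C average \<mu> \<alpha> (of_alg x)"
    and average_corner_add: "y \<in> corner \<phi> \<Longrightarrow>
      average \<mu> \<alpha> (of_alg (x + y)) = average \<mu> \<alpha> (of_alg x) + average \<mu> \<alpha> (of_alg y)"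
    and average_corner_diff: "y \<in> corner \<phi> \<Longrightarrow>
      average \<mu> \<alpha> (of_alg (x - y)) = average \<mu> \<alpha> (of_alg x) - average \<mu> \<alpha> (of_alg y)"
proof -
  have 1: "average \<mu> \<alpha> (of_alg (c *\<^sub>C x)) = c *\<^sub>C average \<mu> \<alpha> (of_alg x)" if "x \<in> corner \<phi>" for x c
    by (rule strict_average_unique[OF strict_average_average[OF corner_scaleC[OF that]]
          strict_average_scaleC[OF strict_average_average[OF that]]])
  have 2: "average \<mu> \<alpha> (of_alg (x + y)) = average \<mu> \<alpha> (of_alg x) + average \<mu> \<alpha> (of_alg y)"
    if "y \<in> corner \<phi>" for y
    by (rule strict_average_unique[OF strict_average_average[OF corner_add[OF assms that]]
          strict_average_add[OF strict_average_average[OF assms] strict_average_average[OF that]]])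
  show "average \<mu> \<alpha> (of_alg (c *\<^sub>C x)) = c *\<^sub>C average \<mu> \<alpha> (of_alg x)" by (rule 1[OF assms])
  assume y: "y \<in> corner \<phi>"
  show "average \<mu> \<alpha> (of_alg (x + y)) = average \<mu> \<alpha> (of_alg x) + average \<mu> \<alpha> (of_alg y)" by (rule 2[OF y])
  show "average \<mu> \<alpha> (of_alg (x - y)) = average \<mu> \<alpha> (of_alg x) - average \<mu> \<alpha> (of_alg y)"
    using 1[OF y, of "- 1"] 2[OF corner_scaleC[OF y, of "- 1"]]
    by (simp add: complex_vs.scale_minus_left scaleC_one)
qed

lemma average_is_rieffel_inner:
  assumes "a \<in> corner \<phi>" "b \<in> corner \<phi>"
  shows "is_rieffel_inner \<mu> \<alpha> (corner \<phi>) a b (average \<mu> \<alpha> (of_alg (star a * b)))"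
proof -
  have y: "star a * b \<in> corner \<phi>" by (intro corner_mult corner_star assms)
  note m = strict_average_average[OF y]
  show ?thesis unfolding is_rieffel_inner_def
    using strict_average_invariant[OF m y] strict_average_corner[OF m y] m
    by (simp add: strict_average_def)
qed

lemma rieffel_inner_eq_average:
  assumes "a \<in> corner \<phi>" "b \<in> corner \<phi>"
  shows "rieffel_inner \<mu> \<alpha> (corner \<phi>) a b = average \<mu> \<alpha> (of_alg (star a * b))"
  unfolding rieffel_inner_def
proof (rule the_equality)
  show E: "is_rieffel_inner \<mu> \<alpha> (corner \<phi>) a b (average \<mu> \<alpha> (of_alg (star a * b)))"
    by (rule average_is_rieffel_inner[OF assms])
  fix m assume m: "is_rieffel_inner \<mu> \<alpha> (corner \<phi>) a b m"
  have eq: "c \<lhd> m = c \<lhd> average \<mu> \<alpha> (of_alg (star a * b))" if "c \<in> corner \<phi>" for c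
    by (rule has_vector_integral_unique) (use m E that in \<open>unfold is_rieffel_inner_def, blast\<close>)+
  \<comment> \<open>The defining property constrains only products c m, while the density criterion
    compares left products; adjoints convert one into the other.\<close>
  have "star m = star (average \<mu> \<alpha> (of_alg (star a * b)))"
    by (rule multiplier_eqI_dense[OF corner_dense]) (simp add: eq corner_star)
  then show "m = average \<mu> \<alpha> (of_alg (star a * b))" by (metis star_star)
qed

text \<open>If \<open>h\<close> is a local unit of \<open>y\<close>, then \<open>y\<close> is a limit of products \<open>(h u h) y\<close> with \<open>u \<in> A\<close>, and \<open>E\<close> is bounded
  along them because their local unit does not depend on \<open>u\<close>.\<close>

lemma average_product_approx:
  assumes y: "y \<in> corner \<phi>" and e: "0 < e"
  obtains a b where "a \<in> corner \<phi>" "b \<in> corner \<phi>"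
    "norm (average \<mu> \<alpha> (of_alg (star a * b)) - average \<mu> \<alpha> (of_alg y)) < e"
proof -
  obtain h where h: "local_unit \<phi> h y" "\<And>x. cmod (c0_apply h x) \<le> 1" using corner_local_unit[OF y] by blast
  then have hC: "h \<in> Cc" by (simp add: local_unit_def)
  have "norm h \<le> 1" using h(2) by (rule norm_c0_bound)
  then have nh: "norm (\<phi> h) \<le> 1" using star_hom_norm_le[OF \<phi>, of h] by linarith
  obtain k where k: "k \<in> Cc" "star k = k" "k * h = h" "\<And>x. cmod (c0_apply k x) \<le> 1"
    by (rule local_unit_pair[OF hC hC]) blast
  obtain C where C: "0 \<le> C"
    "\<And>y. local_unit \<phi> k y \<Longrightarrow> strict_average y (average \<mu> \<alpha> (of_alg y)) \<and> norm (average \<mu> \<alpha> (of_alg y)) \<le> C * norm y"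
    using average_bounded[OF k(1,4)] by blast
  define d where "d = e / (C + 1)"
  have d: "0 < d" "C * d < e" using e C(1) by (simp_all add: d_def field_simps)
  obtain u where u: "norm (u * y - y) < d" using approximate_unit_at[OF d(1)] by metis
  define a where "a = \<phi> h \<rhd> u \<lhd> \<phi> h"
  have ky: "local_unit \<phi> k y" by (rule local_unit_absorb[OF h(1) k(3,1,2)])
  have "\<phi> k \<rhd> a = a" "a \<lhd> \<phi> k = a"
    by (simp_all add: a_def lmult_rmult[symmetric] \<phi>_mult_lmult k(3))
       (simp add: lmult_rmult \<phi>_mult_rmult c0_mult_commute[of h k] k(3))
  then have ka: "local_unit \<phi> k a" using k by (simp add: local_unit_def)
  have "a * y = \<phi> h \<rhd> (u * y)"
    using h(1) by (simp only: a_def lmult_rmult lmult_mult[symmetric] mult_lmult[symmetric] local_unit_def)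
  then have "a * y - y = \<phi> h \<rhd> (u * y - y)"
    using h(1) by (simp add: lmult_linear_simps local_unit_def)
  then have "norm (a * y - y) \<le> norm (\<phi> h) * norm (u * y - y)" using norm_lmult by metis
  also have "\<dots> \<le> 1 * norm (u * y - y)" by (rule mult_right_mono[OF nh]) simp
  finally have n: "norm (a * y - y) \<le> d" using u by simp
  have "local_unit \<phi> k (a * y + (- 1) *\<^sub>C y)"
    by (rule local_unit_linear(1)[OF local_unit_linear(4)[OF ka ky] local_unit_linear(2)[OF ky ky]])
  then have kd: "local_unit \<phi> k (a * y - y)" by (simp add: complex_vs.scale_minus_left scaleC_one)
  have ac: "a \<in> corner \<phi>" "a * y \<in> corner \<phi>" using local_unit_corner[OF ka] corner_mult[OF _ y] by auto
  have "norm (average \<mu> \<alpha> (of_alg (a * y)) - average \<mu> \<alpha> (of_alg y)) \<le> C * norm (a * y - y)"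
    using C(2)[OF kd] average_corner_diff[OF ac(2) y] by simp
  also have "\<dots> \<le> C * d" using n C(1) by (rule mult_left_mono)
  finally have "norm (average \<mu> \<alpha> (of_alg (star (star a) * y)) - average \<mu> \<alpha> (of_alg y)) < e"
    using d(2) by (simp add: star_star)
  then show ?thesis using that[OF corner_star[OF ac(1)] y] by blast
qed

text \<open>E(A_0) is a subspace containing all inner products, hence their span. Conversely each
  E(y) is a norm limit of single inner products, so the closures agree.\<close>

lemma generalized_fixed_point_algebra_eq_Fix:
  "generalized_fixed_point_algebra \<mu> \<alpha> (corner \<phi>) = Fix \<mu> \<alpha> \<phi>"
proof -
  let ?E = "\<lambda>y. average \<mu> \<alpha> (of_alg y)"
  let ?I = "{rieffel_inner \<mu> \<alpha> (corner \<phi>) a b | a b. a \<in> corner \<phi> \<and> b \<in> corner \<phi>}"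
  have Fix: "Fix \<mu> \<alpha> \<phi> = closure (?E ` corner \<phi>)" by (simp add: Fix_def image_image)
  have "cspan ?I \<subseteq> ?E ` corner \<phi>"
  proof (rule complex_vs.span_minimal)
    show "?I \<subseteq> ?E ` corner \<phi>"
      by (auto simp: rieffel_inner_eq_average intro!: imageI corner_mult corner_star)
    show "module.subspace scaleC (?E ` corner \<phi>)"
    proof (rule complex_vs.subspaceI)
      have "?E 0 = 0" using average_corner_scaleC[OF corner_zero, of 0] by simp
      then show "0 \<in> ?E ` corner \<phi>" using corner_zero by force
      show "x + y \<in> ?E ` corner \<phi>" if "x \<in> ?E ` corner \<phi>" "y \<in> ?E ` corner \<phi>" for x y
        using that by (auto simp: average_corner_add[symmetric] corner_add)
      show "c *\<^sub>C x \<in> ?E ` corner \<phi>" if "x \<in> ?E ` corner \<phi>" for c x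
        using that by (auto simp: average_corner_scaleC[symmetric] corner_scaleC)
    qed
  qed
  then have "closure (cspan ?I) \<subseteq> closure (?E ` corner \<phi>)" by (rule closure_mono)
  moreover have "?E ` corner \<phi> \<subseteq> closure (cspan ?I)"
  proof
    fix m assume "m \<in> ?E ` corner \<phi>"
    then obtain y where y: "y \<in> corner \<phi>" "m = ?E y" by blast
    have "\<exists>n\<in>cspan ?I. dist n m < e" if e: "0 < e" for e
    proof -
      obtain a b where ab: "a \<in> corner \<phi>" "b \<in> corner \<phi>" "norm (?E (star a * b) - ?E y) < e"
        using average_product_approx[OF y(1) e] by blast
      have "?E (star a * b) \<in> cspan ?I"
        unfolding rieffel_inner_eq_average[OF ab(1,2), symmetric] using ab(1,2) by (intro complex_vs.span_base) blast
      then show ?thesis using ab(3) y(2) unfolding dist_norm by blast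
    qed
    then show "m \<in> closure (cspan ?I)" unfolding closure_approachable by blast
  qed
  ultimately show ?thesis
    unfolding generalized_fixed_point_algebra_def Fix by (simp add: closure_minimal subset_antisym)
qed

text \<open>The weight is a continuous function of s because the modular function is continuous and
  positive, so the weighted integrand remains continuous with compact support.\<close>

lemma corner_rieffel_proper:
  assumes \<Delta>: "modular_function \<mu> \<Delta>"
  shows "rieffel_proper \<mu> \<Delta> \<alpha> (corner \<phi>)"
proof -
  have "(\<lambda>s. (\<Delta> s powr (- 1 / 2)) *\<^sub>R (a * \<alpha> s (star b))) \<in> L1 \<mu>" if a: "a \<in> corner \<phi>" and b: "b \<in> corner \<phi>" for a b
  proof -
    obtain K where K: "compact K" "\<And>s. s \<notin> K \<Longrightarrow> a * \<alpha> s (star b) = 0"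
      using corner_product_support[OF a corner_star[OF b]] by metis
    have "\<Delta> s \<noteq> 0" for s using \<Delta> by (simp add: modular_function_def less_imp_neq[THEN not_sym])
    then have "continuous_on UNIV (\<lambda>s. (\<Delta> s powr (- 1 / 2)) *\<^sub>R (a * \<alpha> s (star b)))"
      by (intro continuous_intros modular_function_continuous[OF \<mu> \<Delta>] action_continuous[OF \<alpha>]) simp
    then obtain v where "has_vector_integral \<mu> (\<lambda>s. (\<Delta> s powr (- 1 / 2)) *\<^sub>R (a * \<alpha> s (star b))) v"
      by (rule has_vector_integral_compact_support[OF \<mu> K(1), rotated]) (simp_all add: K(2))
    then show ?thesis by (auto simp: L1_def)
  qed
  then show ?thesis
    unfolding rieffel_proper_def
    using corner_star_subalgebra corner_dense corner_action corner_integrable_right[OF corner_star]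
    by (auto simp: L1_def intro: average_is_rieffel_inner)
qed

end

theorem proposition3p1:
  fixes act :: "'x::t2_space \<Rightarrow> 'g::{topological_group_add, t2_space} \<Rightarrow> 'x"
    and \<mu> :: "'g measure"
    and \<Delta> :: "'g \<Rightarrow> real"
    and \<alpha> :: "'g \<Rightarrow> 'a::cstar_algebra \<Rightarrow> 'a"
    and \<phi> :: "'x c0 \<Rightarrow> 'a multiplier"
  assumes "locally_compact_space (euclidean :: 'g topology)"
    and "locally_compact_space (euclidean :: 'x topology)"
    and "left_haar_measure \<mu>"
    and "modular_function \<mu> \<Delta>"
    and "proper_right_action act"
    and "comma_object (translation act) \<alpha> \<phi>"
  shows "rieffel_proper \<mu> \<Delta> \<alpha> (corner \<phi>) \<and>
         generalized_fixed_point_algebra \<mu> \<alpha> (corner \<phi>) = Fix \<mu> \<alpha> \<phi> \<and>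
         (\<forall>a\<in>corner \<phi>. \<forall>b\<in>corner \<phi>.
            rieffel_inner \<mu> \<alpha> (corner \<phi>) a b = average \<mu> \<alpha> (of_alg (star a * b)))"
proof -
  interpret proper_comma act \<mu> \<alpha> \<phi> using assms by unfold_locales
  show ?thesis
    using corner_rieffel_proper[OF assms(4)] generalized_fixed_point_algebra_eq_Fix rieffel_inner_eq_average by blast
qed

end
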